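(* Let the input sequence $\{x_i\}_{i\ge 0}$ satisfy Assumption 1, 2 or 3 (stated in the context). (i) For every $\theta\in(0,\infty)$ the limiting spectral distribution $F_\theta$ of $A_n^\theta$ exists. Moreover, with $\beta_h^{(\theta)}=\int x^h\,dF_\theta(x)$, for all $k\ge 1$, $$\beta_{2k-1}^{(\theta)}=0\quad\text{and}\quad \beta_{2k}^{(\theta)}=\sum_{w\in\mathcal{W}_{2k}^{(p)}}p_\theta(w).$$ (ii) If $\theta_m\to\theta$ with $\theta_m,\theta\in(0,\infty)$, then $F_{\theta_m}$ converges weakly to $F_\theta$.
   Context: For $\theta\in(0,\infty)$ and $n$ large enough that $\lfloor n/\theta\rfloor\ge1$, let $L_\theta(i,j)=(i+j)\bmod\lfloor n/\theta\rfloor$ for $1\le i,j\le n$. Given a sequence of real random variables $\{x_i\}_{i\ge0}$ (input sequence), $A_n^\theta=n^{-1/2}((x_{L_\theta(i,j)}))_{1\le i,j\le n}$, a real symmetric random matrix. The empirical spectral distribution (ESD) of an $n\times n$ real symmetric matrix is the distribution function of $\frac1n\sum_{i=1}^n\delta_{\lambda_i}$, where $\lambda_1,\dots,\lambda_n$ are its eigenvalues. The limiting spectral distribution (LSD) of a sequence of random matrices exists and equals the non-random distribution function $F$ if, outside a null set, the ESDs converge to $F$ at all continuity points of $F$ as $n\to\infty$. Assumption 1: $\{x_i\}$ are independent and uniformly bounded with mean $0$ and variance $1$. Assumption 2: $\{x_i\}$ are i.i.d. with mean $0$ and variance $1$. Assumption 3: $\{x_i\}$ are independent with mean $0$ and variance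 $1$, and with uniformly bounded moments of all orders. Words and the numbers $p_\theta(w)$: A word of length $2k$ is a sequence of $2k$ letters whose first occurrences are in alphabetical order; $w[i]$ is its $i$-th letter; it is pair-matched if every letter appears exactly twice; $\mathcal{W}_{2k}^{(p)}$ is the set of pair-matched words of length $2k$. A circuit of length $2k$ is a function $\pi:\{0,\dots,2k\}\to\{1,\dots,n\}$ with $\pi(0)=\pi(2k)$. $\Pi_\theta^*(w)$ is the set of such circuits for which $w[i]=w[j]$ implies $L_\theta(\pi(i-1),\pi(i))=L_\theta(\pi(j-1),\pi(j))$. Then $p_\theta(w)=\lim_{n\to\infty}n^{-(k+1)}\#\Pi_\theta^*(w)$; this limit exists and is given by $$p_\theta(w)=\theta^{-k-1}\sum_{\gamma\in\mathcal{A}_\theta^k}\int_{(0,\theta)^{k+1}}\mathbb{I}\big(L_i^H(\nu_{S(w)})+a_i^{(\gamma)}\in(0,\theta),\ i\notin S(w)\cup\{2k\}\big)\,\mathbb{I}\big(\nu_0=L_{2k}^H(\nu_{S(w)})+a_{2k}^{(\gamma)}\big)\,d\nu_{S(w)}.$$ Here $\mathcal{A}_\theta=\{0,\pm1,\dots,\pm\lfloor2\theta\rfloor\}$; $S(w)=\{0\}\cup\{i\ge1:w[i]\text{ is the first occurrence of its letter}\}$ and $\nu_{S(w)}=\{\nu_i:i\in S(w)\}$; and, writing $(i_s,j_s)$, $i_s<j_s$, $1\le s\le k$, for the pairs of positions with $w[i_s]=w[j_s]$, the equations $(\nu_{i_s-1}+\nu_{i_s})-(\nu_{j_s-1}+\nu_{j_s})=\gamma_s$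 solved successively from left to right express each $\nu_i$ with $i\in\{0,\dots,2k\}\setminus S(w)$ uniquely as $L_i^H(\nu_{S(w)})+a_i^{(\gamma)}$, with $L_i^H$ linear and not depending on $\gamma$, and $a_i^{(\gamma)}$ an integer constant depending on $\gamma$ and $w$. *)

theory Defs
  imports "HOL-Probability.Probability" "Jordan_Normal_Form.Char_Poly"
begin

definition link :: "real \<Rightarrow> nat \<Rightarrow> nat \<Rightarrow> nat \<Rightarrow> nat" where
  "link \<theta> n i j = (i + j) mod nat \<lfloor>real n / \<theta>\<rfloor>"

(* JNF matrices are indexed from 0, while the link function is applied to
   indices in {1..n}; hence the shifts by Suc.  For the finitely many n with
   floor (n / theta) = 0 the value is irrelevant (Isabelle: m mod 0 = m). *)
definition link_matrix :: "real \<Rightarrow> (nat \<Rightarrow> 'a \<Rightarrow> real) \<Rightarrow> nat \<Rightarrow> 'a \<Rightarrow> real mat" where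
  "link_matrix \<theta> x n \<omega> =
     Matrix.mat n n (\<lambda>(i, j). x (link \<theta> n (Suc i) (Suc j)) \<omega> / sqrt (real n))"

(* For a real symmetric matrix all n eigenvalues are real, and proots lists
   them with their multiplicities. *)
definition ESD :: "real mat \<Rightarrow> real \<Rightarrow> real" where
  "ESD A t = real (size {#l \<in># proots (char_poly A). l \<le> t#}) / real (dim_row A)"

(* The non-random distribution function is given as the cdf of a Borel
   probability measure on the real line. *)
definition is_LSD :: "'a measure \<Rightarrow> (nat \<Rightarrow> 'a \<Rightarrow> real mat) \<Rightarrow> real measure \<Rightarrow> bool" where
  "is_LSD M A \<mu> \<longleftrightarrow>
     real_distribution \<mu> \<and> (AE \<omega> in M. weak_conv (\<lambda>n. ESD (A n \<omega>)) (cdf \<mu>))"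

definition mean0_var1 :: "'a measure \<Rightarrow> ('a \<Rightarrow> real) \<Rightarrow> bool" where
  "mean0_var1 M X \<longleftrightarrow> integrable M X \<and> integrable M (\<lambda>\<omega>. (X \<omega>)\<^sup>2) \<and>
     prob_space.expectation M X = 0 \<and> prob_space.variance M X = 1"

definition indep_mean0_var1 :: "'a measure \<Rightarrow> (nat \<Rightarrow> 'a \<Rightarrow> real) \<Rightarrow> bool" where
  "indep_mean0_var1 M x \<longleftrightarrow>
     prob_space.indep_vars M (\<lambda>_. borel) x UNIV \<and> (\<forall>i. mean0_var1 M (x i))"

definition assumption1 :: "'a measure \<Rightarrow> (nat \<Rightarrow> 'a \<Rightarrow> real) \<Rightarrow> bool" where
  "assumption1 M x \<longleftrightarrow> indep_mean0_var1 M x \<and>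
     (\<exists>C. \<forall>i. AE \<omega> in M. \<bar>x i \<omega>\<bar> \<le> C)"

definition assumption2 :: "'a measure \<Rightarrow> (nat \<Rightarrow> 'a \<Rightarrow> real) \<Rightarrow> bool" where
  "assumption2 M x \<longleftrightarrow> indep_mean0_var1 M x \<and>
     (\<forall>i j. distr M borel (x i) = distr M borel (x j))"

definition assumption3 :: "'a measure \<Rightarrow> (nat \<Rightarrow> 'a \<Rightarrow> real) \<Rightarrow> bool" where
  "assumption3 M x \<longleftrightarrow> indep_mean0_var1 M x \<and>
     (\<forall>h::nat. \<exists>C. \<forall>i. integrable M (\<lambda>\<omega>. \<bar>x i \<omega>\<bar> ^ h) \<and>
        prob_space.expectation M (\<lambda>\<omega>. \<bar>x i \<omega>\<bar> ^ h) \<le> C)"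

(* The letters a, b, c, ... are coded as 0, 1, 2, ...  In a word each new letter
   is the first letter of the alphabet not used so far, and the letters used
   before it are then exactly those with smaller codes. *)
definition is_word :: "nat list \<Rightarrow> bool" where
  "is_word w \<longleftrightarrow>
     (\<forall>i < length w. w ! i \<in> set (take i w) \<or> w ! i = card (set (take i w)))"

definition pair_matched_words :: "nat \<Rightarrow> nat list set" where
  "pair_matched_words k =
     {w. length w = 2 * k \<and> is_word w \<and> (\<forall>a \<in> set w. count_list w a = 2)}"

(* Circuits are extensional functions on {0..length w}, so that they can be
   counted.  The i-th letter w[i], i = 1, 2, ..., is w ! (i - 1). *)
definition circuits :: "real \<Rightarrow> nat list \<Rightarrow> nat \<Rightarrow> (nat \<Rightarrow> nat) set" where
  "circuits \<theta> w n =
     {\<pi> \<in> {0..length w} \<rightarrow>\<^sub>E {1..n}. \<pi> 0 = \<pi> (length w) \<and>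
        (\<forall>i \<in> {1..length w}. \<forall>j \<in> {1..length w}. w ! (i - 1) = w ! (j - 1) \<longrightarrow>
           link \<theta> n (\<pi> (i - 1)) (\<pi> i) = link \<theta> n (\<pi> (j - 1)) (\<pi> j))}"

definition word_limit :: "real \<Rightarrow> nat list \<Rightarrow> real" where
  "word_limit \<theta> w =
     lim (\<lambda>n. real (card (circuits \<theta> w n)) / real n ^ (length w div 2 + 1))"

(* Sums over pair-matched words are genuine finite sums. *)
lemma finite_pair_matched_words: "finite (pair_matched_words k)"
proof -
  have "set w \<subseteq> {..2 * k}" if "w \<in> pair_matched_words k" for w
  proof -
    have len: "length w = 2 * k" and word: "is_word w"
      using that by (auto simp: pair_matched_words_def)
    have "w ! i \<le> 2 * k" if "i < length w" for i
      using that
    proof (induction i rule: less_induct)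
      case (less i)
      from word less.prems
      consider "w ! i \<in> set (take i w)" | "w ! i = card (set (take i w))"
        by (auto simp: is_word_def)
      then show ?case
      proof cases
        case 1
        then obtain j where "j < i" "w ! i = w ! j"
          using less.prems by (auto simp: in_set_conv_nth)
        then show ?thesis using less by simp
      next
        case 2
        have "card (set (take i w)) \<le> length (take i w)" by (rule card_length)
        then show ?thesis using 2 less.prems len by simp
      qed
    qed
    then show ?thesis by (auto simp: in_set_conv_nth)
  qed
  then have "pair_matched_words k \<subseteq> {w. set w \<subseteq> {..2 * k} \<and> length w = 2 * k}"
    by (auto simp: pair_matched_words_def)
  then show ?thesis
    using finite_lists_length_eq[of "{..2 * k}" "2 * k"] finite_subset by blast
qed

end

theory Submission
  imports Defs "Jordan_Normal_Form.Schur_Decomposition" "HOL-Number_Theory.Cong" "HOL-Real_Asymp.Real_Asymp"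
begin

text \<open>
  By the method of moments it suffices to find the almost sure limits of the normalised traces of
  powers of the matrix, which are sums over circuits.  Given its link values, a circuit is
  determined modulo the period by its starting point, since \<open>\<pi> (i + 1) = l i - \<pi> i\<close>.  Going once
  around imposes a congruence on the link values.  For a pair-matched word this congruence is void
  when each letter occurs at positions of opposite parity, and it makes the number of circuits of
  smaller order otherwise.  In the former case, rescaling the link values and the starting point by
  the period turns the count into the integral over the unit cube of a product of functions
  \<open>rho \<theta>\<close>.  This integral is continuous in \<open>\<theta>\<close>, which gives part (ii).

  Traces concentrate because the fourth central moment counts quadruples of circuits in which each
  circuit shares a link value with another one; Borel-Cantelli applies.  For i.i.d. inputs
  with two moments, truncated and standardised variables satisfy Assumption 1.  Every link
  value occurs boundedly often in a row, so the squared Frobenius distance between the two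
  matrices, and with it the difference of the characteristic functions of the spectral
  distributions, is controlled by an average of \<open>(x i - y i)\<^sup>2\<close>.
\<close>

section \<open>Spectral decomposition of real symmetric matrices\<close>

text \<open>The period need not be prime, so coefficients of congruences cannot be inverted. A
  congruence only saves a factor of the period up to the modulus of a coefficient that is nonzero as
  an integer. For quadruples of circuits such coefficients are found by parity, since signs may
  cancel but an odd number of signs cannot. Pairs of circuits would save one factor of n only, and
  1/n is not summable; four circuits save two. Odd lengths need no centring: the congruence obtained
  by going around fixes twice the starting point, so at most two starting residues fit given link
  values. The limiting moments of order 2k grow at most like C^k k!. Hence characteristic functions
  are limits of Taylor polynomials in the moments, the moments determine the measure, and
  convergence of moments gives weak convergence in both parts of the theorem. The weight
  \<open>rho\<close> jumps, but the walk contains its starting point with coefficient 1 or -1, so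
  the jumps form a null set. The parity condition on a word does not involve \<theta>, which is why
  continuity in \<theta> concerns the integrals only.\<close>

lemma orthonormal_rows_imp_cols:
  fixes u :: "nat \<Rightarrow> nat \<Rightarrow> real"
  assumes "\<And>i j. i < n \<Longrightarrow> j < n \<Longrightarrow> (\<Sum>k<n. u i k * u j k) = (if i = j then 1 else 0)"
    and "k < n" "l < n"
  shows "(\<Sum>i<n. u i k * u i l) = (if k = l then 1 else 0)"
proof -
  define A where "A = Matrix.mat n n (\<lambda>(i,k). u i k)"
  define B where "B = Matrix.mat n n (\<lambda>(k,i). u i k)"
  have A: "A \<in> carrier_mat n n" and B: "B \<in> carrier_mat n n" by (auto simp: A_def B_def)
  have "A * B = 1\<^sub>m n"
    by (rule eq_matI) (auto simp: A_def B_def scalar_prod_def lessThan_atLeast0[symmetric] assms(1))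
  then have "B * A = 1\<^sub>m n" by (rule mat_mult_left_right_inverse[OF A B])
  then have "(B * A) $$ (k,l) = 1\<^sub>m n $$ (k,l)" by simp
  then show ?thesis using assms(2,3)
    by (auto simp: A_def B_def scalar_prod_def lessThan_atLeast0[symmetric])
qed

text \<open>Gram-Schmidt keeps the head of its input list, so a basis completed from
  \<open>v\<close> is orthogonalised with \<open>v\<close> still in front; dividing by the norms
  \<open>s i\<close> does not change a unit vector. Serves the deflation in
  \<open>symmetric_eigenbasis\<close>.\<close>

lemma orthonormal_completion:
  fixes v :: "nat \<Rightarrow> real"
  assumes n: "n > 0" and v: "(\<Sum>k<n. (v k)\<^sup>2) = 1"
  shows "\<exists>W. (\<forall>k<n. W 0 k = v k) \<and>
    (\<forall>i<n. \<forall>j<n. (\<Sum>k<n. W i k * W j k) = (if i = j then 1 else (0::real)))"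
proof -
  define b where "b = vec n v"
  have b: "b \<in> carrier_vec n" by (simp add: b_def)
  have bb: "b \<bullet> b = 1"
    using v by (simp add: b_def scalar_prod_def lessThan_atLeast0[symmetric] power2_eq_square)
  have b0: "b \<noteq> 0\<^sub>v n" using bb by auto
  interpret cof_vec_space n "TYPE(real)" .
  define c where "c = basis_completion b"
  note bc = basis_completion[OF b b0, folded c_def]
  define ws where "ws = gram_schmidt n c"
  have ws: "set ws \<subseteq> carrier_vec n" "corthogonal ws" "length ws = n"
    using gram_schmidt_result[OF bc(2) bc(4) bc(5) ws_def] bc(6) by auto
  obtain cs where c: "c = b # cs" using bc(6,7) n by (cases c) auto
  have "hd ws = b" unfolding ws_def c by (rule gram_schmidt_hd[OF b])
  then have ws0: "ws ! 0 = b" using ws(3) n by (cases ws) auto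
  have wc: "ws ! i \<in> carrier_vec n" if "i < n" for i using that ws by auto
  have conj: "conjugate w = w" for w :: "real vec" by (intro eq_vecI) auto
  have orth: "(ws ! i \<bullet> ws ! j = 0) = (i \<noteq> j)" if "i < n" "j < n" for i j
    using corthogonalD[OF ws(2), of i j] that ws(3) by (simp add: conj)
  define s where "s i = sqrt (ws ! i \<bullet> ws ! i)" for i
  have pos: "ws ! i \<bullet> ws ! i > 0" if "i < n" for i
  proof -
    have "ws ! i \<bullet> ws ! i = (\<Sum>k<n. (ws ! i $ k)\<^sup>2)"
      using wc[OF that] by (auto simp: scalar_prod_def lessThan_atLeast0[symmetric] power2_eq_square)
    then have "ws ! i \<bullet> ws ! i \<ge> 0" by (simp add: sum_nonneg)
    then show ?thesis using orth[OF that that] by simp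
  qed
  define W where "W i k = ws ! i $ k / s i" for i k
  have "(\<Sum>k<n. W i k * W j k) = (if i = j then 1 else 0)" if "i < n" "j < n" for i j
  proof -
    have "(\<Sum>k<n. W i k * W j k) = (ws ! i \<bullet> ws ! j) / (s i * s j)"
      using wc[OF that(1)] wc[OF that(2)]
      by (auto simp: scalar_prod_def lessThan_atLeast0[symmetric] W_def sum_divide_distrib intro!: sum.cong)
    then show ?thesis using orth[OF that] pos[OF that(1)]
      by (auto simp: s_def)
  qed
  moreover have "W 0 k = v k" if "k < n" for k
    using that ws0 bb by (simp add: W_def s_def b_def)
  ultimately show ?thesis by blast
qed

text \<open>A complex eigenvalue exists by the fundamental theorem of algebra. It is real because
  symmetry makes the Hermitian form at its eigenvector real, and then the real characteristic
  polynomial has this root, which yields a real eigenvector.\<close>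

lemma symmetric_real_eigenvector:
  fixes a :: "nat \<Rightarrow> nat \<Rightarrow> real"
  assumes n: "n > 0" and sym: "\<And>i j. i < n \<Longrightarrow> j < n \<Longrightarrow> a i j = a j i"
  shows "\<exists>v e. (\<Sum>k<n. (v k)\<^sup>2) = 1 \<and> (\<forall>k<n. (\<Sum>l<n. a k l * v l) = e * v k)"
proof -
  define A where "A = Matrix.mat n n (\<lambda>(i,k). a i k)"
  have A: "A \<in> carrier_mat n n" by (simp add: A_def)
  define A' where "A' = map_mat complex_of_real A"
  have A': "A' \<in> carrier_mat n n" using A by (simp add: A'_def)
  have cp: "char_poly A' = map_poly complex_of_real (char_poly A)"
    unfolding A'_def by (rule of_real_hom.char_poly_hom[OF A])
  have "\<not> constant (poly (char_poly A'))"
    using degree_monic_char_poly[OF A'] n by (simp add: constant_degree)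
  then obtain z where z: "poly (char_poly A') z = 0" using fundamental_theorem_of_algebra by blast
  then have "eigenvalue A' z" using eigenvalue_root_char_poly[OF A'] by simp
  then obtain w where w: "w \<in> carrier_vec n" "w \<noteq> 0\<^sub>v n" "A' *\<^sub>v w = z \<cdot>\<^sub>v w"
    using A' unfolding eigenvalue_def eigenvector_def by auto
  define f where "f i = w $ i" for i
  have ev: "(\<Sum>j<n. of_real (a i j) * f j) = z * f i" if "i < n" for i
  proof -
    have "(A' *\<^sub>v w) $ i = (z \<cdot>\<^sub>v w) $ i" using w by simp
    then show ?thesis using that w(1) by (auto simp: f_def A'_def A_def scalar_prod_def
      lessThan_atLeast0[symmetric])
  qed
  define S where "S = (\<Sum>i<n. f i * cnj (f i))"
  have Sr: "S = of_real (\<Sum>i<n. (cmod (f i))\<^sup>2)"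
    unfolding S_def by (simp only: complex_norm_square of_real_sum)
  obtain i0 where i0: "i0 < n" "f i0 \<noteq> 0"
    using w(1,2) unfolding f_def by (metis eq_vecI carrier_vecD index_zero_vec)
  have "(\<Sum>i<n. (cmod (f i))\<^sup>2) > 0" using i0 by (intro sum_pos2[of _ i0]) auto
  then have S0: "S \<noteq> 0" unfolding Sr by (metis of_real_eq_0_iff less_irrefl)
  \<comment> \<open>\<open>z * S\<close> is the Hermitian form of the matrix at the eigenvector;
    conjugating it and exchanging the two sums gives it back.\<close>
  have zS: "z * S = (\<Sum>i<n. \<Sum>j<n. of_real (a i j) * f j * cnj (f i))"
    unfolding S_def sum_distrib_left
    by (intro sum.cong refl) (simp add: sum_distrib_right[symmetric] ev mult.assoc[symmetric])
  have "cnj (z * S) = (\<Sum>i<n. \<Sum>j<n. of_real (a i j) * cnj (f j) * f i)" by (simp add: zS)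
  also have "\<dots> = (\<Sum>j<n. \<Sum>i<n. of_real (a i j) * cnj (f j) * f i)" by (rule sum.swap)
  also have "\<dots> = z * S" unfolding zS by (intro sum.cong refl) (auto simp: sym)
  finally have "cnj z = z" using S0 Sr by simp
  then have zr: "z = of_real (Re z)" by (simp add: complex_eq_iff)
  have "poly (char_poly A) (Re z) = 0"
    using z unfolding cp by (subst (asm) zr) simp
  then have "eigenvalue A (Re z)" using eigenvalue_root_char_poly[OF A] by simp
  then obtain x where x: "x \<in> carrier_vec n" "x \<noteq> 0\<^sub>v n" "A *\<^sub>v x = Re z \<cdot>\<^sub>v x"
    using A unfolding eigenvalue_def eigenvector_def by auto
  define T where "T = sqrt (\<Sum>k<n. (x $ k)\<^sup>2)"
  obtain i1 where i1: "i1 < n" "x $ i1 \<noteq> 0"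
    using x(1,2) by (metis eq_vecI carrier_vecD index_zero_vec)
  have Tp: "(\<Sum>k<n. (x $ k)\<^sup>2) > 0" using i1 by (intro sum_pos2[of _ i1]) auto
  have "(\<Sum>k<n. (x $ k / T)\<^sup>2) = 1"
    using Tp by (simp add: power_divide sum_divide_distrib[symmetric] T_def)
  moreover have "(\<Sum>l<n. a k l * (x $ l / T)) = Re z * (x $ k / T)" if "k < n" for k
  proof -
    have "(A *\<^sub>v x) $ k = (Re z \<cdot>\<^sub>v x) $ k" using x by simp
    then have "(\<Sum>l<n. a k l * x $ l) = Re z * x $ k" using that x(1)
      by (auto simp: A_def scalar_prod_def lessThan_atLeast0[symmetric])
    then have "(\<Sum>l<n. a k l * x $ l) / T = Re z * x $ k / T" by simp
    then show ?thesis by (simp add: sum_divide_distrib)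
  qed
  ultimately show ?thesis by (intro exI[of _ "\<lambda>k. x $ k / T"] exI[of _ "Re z"]) auto
qed

text \<open>Deflation: in an orthonormal basis starting with a unit eigenvector the matrix splits
  into a block of size 1 and a symmetric block of size \<open>n\<close>, to which the induction
  hypothesis applies.\<close>

lemma symmetric_eigenbasis:
  fixes a :: "nat \<Rightarrow> nat \<Rightarrow> real"
  assumes "\<And>i j. i < n \<Longrightarrow> j < n \<Longrightarrow> a i j = a j i"
  shows "\<exists>u e. (\<forall>i<n. \<forall>j<n. (\<Sum>k<n. u i k * u j k) = (if i = j then 1 else (0::real))) \<and>
    (\<forall>i<n. \<forall>k<n. (\<Sum>l<n. a k l * u i l) = e i * u i k)"
  using assms
proof (induction n arbitrary: a)
  case 0
  then show ?case by simp
next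
  case (Suc n a)
  obtain v e0 where v: "(\<Sum>k<Suc n. (v k)\<^sup>2) = 1" and e0: "\<forall>k<Suc n. (\<Sum>l<Suc n. a k l * v l) = e0 * v k"
    using symmetric_real_eigenvector[of "Suc n" a] Suc.prems by blast
  obtain W where W0: "\<forall>k<Suc n. W 0 k = v k" and
    W: "\<forall>i<Suc n. \<forall>j<Suc n. (\<Sum>k<Suc n. W i k * W j k) = (if i = j then 1 else (0::real))"
    using orthonormal_completion[OF _ v] by blast
  have W': "(\<Sum>i<Suc n. W i k * W i l) = (if k = l then 1 else 0)" if "k < Suc n" "l < Suc n" for k l
    using orthonormal_rows_imp_cols[of "Suc n" W k l] W that by blast
  define c where "c p q = (\<Sum>k<Suc n. \<Sum>l<Suc n. W p k * a k l * W q l)" for p q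
  have csym: "c p q = c q p" for p q
    unfolding c_def by (subst sum.swap) (intro sum.cong refl, auto simp: Suc.prems mult_ac)
  \<comment> \<open>The first column of the transformed matrix vanishes below the diagonal:
    \<open>v\<close> is an eigenvector, and the other rows of \<open>W\<close> are orthogonal to
    it.\<close>
  have cS0: "c (Suc p) 0 = 0" if "p < n" for p
  proof -
    have "c (Suc p) 0 = (\<Sum>k<Suc n. W (Suc p) k * (\<Sum>l<Suc n. a k l * v l))"
      unfolding c_def sum_distrib_left using W0 by (intro sum.cong refl) (auto simp: mult_ac)
    also have "\<dots> = (\<Sum>k<Suc n. W (Suc p) k * (e0 * W 0 k))"
      using W0 e0 by (intro sum.cong refl) (simp del: sum.lessThan_Suc)
    also have "\<dots> = e0 * (\<Sum>k<Suc n. W (Suc p) k * W 0 k)"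
      unfolding sum_distrib_left by (simp only: mult_ac)
    also have "(\<Sum>k<Suc n. W (Suc p) k * W 0 k) = 0" using W that
      by (metis Suc_less_eq nat.distinct(1) zero_less_Suc)
    finally show ?thesis by simp
  qed
  have AW: "(\<Sum>l<Suc n. a k l * W q l) = (\<Sum>p<Suc n. W p k * c p q)" if k: "k < Suc n" for k q
  proof -
    have "(\<Sum>p<Suc n. W p k * c p q) = (\<Sum>p<Suc n. \<Sum>m<Suc n. W p k * W p m * (\<Sum>l<Suc n. a m l * W q l))"
      unfolding c_def sum_distrib_left by (intro sum.cong refl) (auto simp: mult_ac)
    also have "\<dots> = (\<Sum>m<Suc n. (\<Sum>p<Suc n. W p k * W p m) * (\<Sum>l<Suc n. a m l * W q l))"
      unfolding sum_distrib_right by (rule sum.swap)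
    also have "\<dots> = (\<Sum>m<Suc n. (if k = m then (\<Sum>l<Suc n. a m l * W q l) else 0))"
      using W' k by (intro sum.cong refl) auto
    also have "\<dots> = (\<Sum>l<Suc n. a k l * W q l)" using k by (subst sum.delta') auto
    finally show ?thesis by simp
  qed
  define a' where "a' p q = c (Suc p) (Suc q)" for p q
  obtain u e where u: "\<forall>i<n. \<forall>j<n. (\<Sum>k<n. u i k * u j k) = (if i = j then 1 else (0::real))"
    and e: "\<forall>i<n. \<forall>k<n. (\<Sum>l<n. a' k l * u i l) = e i * u i k"
    using Suc.IH[of a'] csym by (auto simp: a'_def)
  \<comment> \<open>The eigenvectors of the small block are carried back along the rows of
    \<open>W\<close> after the first.\<close>
  define U where "U i k = (case i of 0 \<Rightarrow> v k | Suc i \<Rightarrow> (\<Sum>m<n. u i m * W (Suc m) k))" for i k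
  define E where "E i = (case i of 0 \<Rightarrow> e0 | Suc i \<Rightarrow> e i)" for i
  have UU: "(\<Sum>k<Suc n. U i k * U j k) = (if i = j then 1 else 0)" if i: "i < Suc n" and j: "j < Suc n" for i j
  proof -
    have 1: "(\<Sum>k<Suc n. U (Suc i) k * W p k) = (if p = 0 then 0 else u i (p - 1))"
      if "i < n" "p < Suc n" for i p
    proof -
      have "(\<Sum>k<Suc n. U (Suc i) k * W p k) = (\<Sum>k<Suc n. \<Sum>m<n. u i m * (W (Suc m) k * W p k))"
        unfolding U_def by (simp only: sum_distrib_right mult.assoc nat.case)
      also have "\<dots> = (\<Sum>m<n. u i m * (\<Sum>k<Suc n. W (Suc m) k * W p k))"
        unfolding sum_distrib_left by (rule sum.swap)
      also have "\<dots> = (\<Sum>m<n. (if m = p - 1 then (if p = 0 then 0 else u i m) else 0))"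
        using W that by (intro sum.cong refl) (auto simp del: sum.lessThan_Suc)
      also have "\<dots> = (if p = 0 then 0 else u i (p - 1))" using that by (subst sum.delta) auto
      finally show ?thesis .
    qed
    have S0: "(\<Sum>k<Suc n. U (Suc i) k * U 0 k) = 0" if "i < n" for i
    proof -
      have "(\<Sum>k<Suc n. U (Suc i) k * U 0 k) = (\<Sum>k<Suc n. U (Suc i) k * W 0 k)"
        using W0 by (intro sum.cong refl) (auto simp: U_def)
      then show ?thesis using 1[OF that, of 0] by simp
    qed
    have SS: "(\<Sum>k<Suc n. U (Suc i) k * U (Suc j) k) = (if i = j then 1 else 0)" if "i < n" "j < n" for i j
    proof -
      have "(\<Sum>k<Suc n. U (Suc i) k * U (Suc j) k) = (\<Sum>k<Suc n. \<Sum>m<n. u j m * (U (Suc i) k * W (Suc m) k))"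
        by (subst (2) U_def) (simp only: sum_distrib_left nat.case mult_ac)
      also have "\<dots> = (\<Sum>m<n. u j m * (\<Sum>k<Suc n. U (Suc i) k * W (Suc m) k))"
        unfolding sum_distrib_left by (rule sum.swap)
      also have "\<dots> = (\<Sum>m<n. u i m * u j m)" using 1 that
        by (intro sum.cong refl) (auto simp del: sum.lessThan_Suc)
      finally show ?thesis using u that by simp
    qed
    have "(\<Sum>k<Suc n. U 0 k * U 0 k) = 1" using v by (simp add: U_def power2_eq_square)
    moreover have "(\<Sum>k<Suc n. U 0 k * U (Suc j) k) = 0" if "j < n" for j
      using S0[OF that] by (simp only: mult.commute)
    ultimately show ?thesis using i j S0 SS by (cases i; cases j) (simp_all del: sum.lessThan_Suc)
  qed
  have UE: "(\<Sum>l<Suc n. a k l * U i l) = E i * U i k" if i: "i < Suc n" and k: "k < Suc n" for i k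
  proof (cases i)
    case 0 then show ?thesis using e0 k by (simp add: U_def E_def)
  next
    case (Suc j)
    have j: "j < n" using i Suc by simp
    have "(\<Sum>l<Suc n. a k l * U i l) = (\<Sum>l<Suc n. \<Sum>m<n. u j m * (a k l * W (Suc m) l))"
      unfolding Suc U_def by (simp only: sum_distrib_left nat.case mult_ac)
    also have "\<dots> = (\<Sum>m<n. u j m * (\<Sum>l<Suc n. a k l * W (Suc m) l))"
      unfolding sum_distrib_left by (rule sum.swap)
    also have "\<dots> = (\<Sum>m<n. u j m * (\<Sum>p<n. W (Suc p) k * a' p m))"
      using AW[OF k] cS0 csym by (intro sum.cong refl) (simp add: sum.lessThan_Suc_shift a'_def del:
        sum.lessThan_Suc)
    also have "\<dots> = (\<Sum>p<n. W (Suc p) k * (\<Sum>m<n. a' p m * u j m))"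
      unfolding sum_distrib_left by (subst sum.swap) (simp only: mult_ac)
    also have "\<dots> = (\<Sum>p<n. W (Suc p) k * (e j * u j p))"
      using e j by (intro sum.cong refl) simp
    also have "\<dots> = e j * (\<Sum>p<n. u j p * W (Suc p) k)"
      unfolding sum_distrib_left by (simp only: mult_ac)
    finally show ?thesis by (simp add: Suc U_def E_def)
  qed
  show ?case using UU UE by blast
qed


text \<open>Plain sums of numbers instead of matrix products, so that traces can be expanded over
  paths. Both orthonormality relations are recorded: the one summed over \<open>k\<close> contracts
  products of eigenvectors, the one summed over \<open>i\<close> gives Parseval's identity.\<close>

definition eigen_decomp :: "nat \<Rightarrow> (nat \<Rightarrow> nat \<Rightarrow> real) \<Rightarrow> (nat \<Rightarrow> nat \<Rightarrow> real) \<Rightarrow> (nat \<Rightarrow> real) \<Rightarrow> bool" where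
  "eigen_decomp n a u e \<longleftrightarrow>
    (\<forall>i<n. \<forall>j<n. (\<Sum>k<n. u i k * u j k) = (if i = j then 1 else 0)) \<and>
    (\<forall>k<n. \<forall>l<n. (\<Sum>i<n. u i k * u i l) = (if k = l then 1 else 0)) \<and>
    (\<forall>k<n. \<forall>l<n. a k l = (\<Sum>i<n. e i * u i k * u i l))"

lemma eigen_decomp_exists:
  assumes "\<And>i j. i < n \<Longrightarrow> j < n \<Longrightarrow> a i j = a j i"
  shows "\<exists>u e. eigen_decomp n a u e"
proof -
  obtain u e where u: "\<forall>i<n. \<forall>j<n. (\<Sum>k<n. u i k * u j k) = (if i = j then 1 else (0::real))"
    and e: "\<forall>i<n. \<forall>k<n. (\<Sum>l<n. a k l * u i l) = e i * u i k"
    using symmetric_eigenbasis[of n a] assms by blast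
  have u': "(\<Sum>i<n. u i k * u i l) = (if k = l then 1 else 0)" if "k < n" "l < n" for k l
    using orthonormal_rows_imp_cols[of n u k l] u that by blast
  have "a k l = (\<Sum>i<n. e i * u i k * u i l)" if kl: "k < n" "l < n" for k l
  proof -
    have "(\<Sum>i<n. e i * u i k * u i l) = (\<Sum>i<n. \<Sum>m<n. a k m * (u i m * u i l))"
      using e kl by (intro sum.cong refl) (simp only: sum_distrib_right[symmetric] mult.assoc[symmetric]
        lessThan_iff)
    also have "\<dots> = (\<Sum>m<n. a k m * (\<Sum>i<n. u i m * u i l))"
      unfolding sum_distrib_left by (rule sum.swap)
    also have "\<dots> = (\<Sum>m<n. if m = l then a k m else 0)"
      using u' kl by (intro sum.cong refl) auto
    finally show ?thesis using kl by simp
  qed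
  then show ?thesis using u u' unfolding eigen_decomp_def by blast
qed

text \<open>The matrix is orthogonally similar to the diagonal matrix of the \<open>e i\<close>;
  this ties these numbers to the roots that \<open>ESD\<close> counts, with multiplicities.\<close>

lemma eigen_decomp_char_poly:
  assumes "eigen_decomp n a u e"
  shows "proots (char_poly (Matrix.mat n n (\<lambda>(i,j). a i j))) = image_mset e (mset_set {..<n})"
proof -
  define A where "A = Matrix.mat n n (\<lambda>(i,k). a i k)"
  define P where "P = Matrix.mat n n (\<lambda>(k,i). u i k)"
  define Q where "Q = Matrix.mat n n (\<lambda>(i,k). u i k)"
  define D where "D = Matrix.mat n n (\<lambda>(i,j). if i = j then e i else 0)"
  have A: "A \<in> carrier_mat n n" and P: "P \<in> carrier_mat n n" and Q: "Q \<in> carrier_mat n n"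
    and D: "D \<in> carrier_mat n n" by (auto simp: A_def P_def Q_def D_def)
  note d = assms[unfolded eigen_decomp_def]
  have QP: "Q * P = 1\<^sub>m n" using d
    by (intro eq_matI) (auto simp: P_def Q_def scalar_prod_def lessThan_atLeast0[symmetric])
  have PQ: "P * Q = 1\<^sub>m n" using d
    by (intro eq_matI) (auto simp: P_def Q_def scalar_prod_def lessThan_atLeast0[symmetric])
  have DQ: "D * Q = Matrix.mat n n (\<lambda>(i,k). e i * u i k)"
    by (intro eq_matI) (auto simp: D_def Q_def scalar_prod_def lessThan_atLeast0[symmetric] if_distrib[of
      "\<lambda>x. x * _"] cong: if_cong)
  have "A = P * (D * Q)" unfolding DQ using d
    by (intro eq_matI) (auto simp: A_def P_def scalar_prod_def lessThan_atLeast0[symmetric] mult_ac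
      intro!: sum.cong)
  then have "A = P * D * Q" using assoc_mult_mat[OF P D Q] by simp
  then have "similar_mat A D" unfolding similar_mat_def
    using similar_mat_witI[OF PQ QP _ A D P Q] by blast
  then have "char_poly A = char_poly D" by (rule char_poly_similar)
  also have "\<dots> = (\<Prod>x\<leftarrow>diag_mat D. [:- x, 1:])"
    by (rule char_poly_upper_triangular[OF D]) (auto simp: upper_triangular_def D_def)
  also have "diag_mat D = map e [0..<n]" by (auto simp: diag_mat_def D_def)
  finally have "proots (char_poly A) = proots (\<Prod>i\<leftarrow>[0..<n]. [:- e i, 1:])" by (simp add: o_def)
  also have "(\<Prod>i\<leftarrow>[0..<n]. [:- e i, 1:]) = (\<Prod>i<n. [:- e i, 1:])"
    by (simp add: prod.distinct_set_conv_list[symmetric] lessThan_atLeast0)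
  also have "proots \<dots> = (\<Sum>i<n. {#e i#})" by (subst proots_prod) auto
  also have "\<dots> = image_mset e (mset_set {..<n})"
    by (induction n) (auto simp: lessThan_Suc)
  finally show ?thesis by (simp add: A_def)
qed

section \<open>Traces of powers as sums over closed paths\<close>

lemma sum_PiE_insert:
  fixes g :: "('i \<Rightarrow> 'b) \<Rightarrow> 'c::comm_monoid_add"
  assumes "x \<notin> A"
  shows "(\<Sum>p\<in>insert x A \<rightarrow>\<^sub>E S. g p) = (\<Sum>p\<in>A \<rightarrow>\<^sub>E S. \<Sum>s\<in>S. g (p(x := s)))"
proof -
  have "inj_on (\<lambda>(s, p). p(x := s)) (S \<times> (A \<rightarrow>\<^sub>E S))"
    using inj_combinator[OF assms, of "\<lambda>_. S"] by simp
  then have "(\<Sum>p\<in>insert x A \<rightarrow>\<^sub>E S. g p) = (\<Sum>(s,p)\<in>S \<times> (A \<rightarrow>\<^sub>E S). g (p(x := s)))"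
    unfolding PiE_insert_eq by (subst sum.reindex) (simp_all add: o_def case_prod_unfold)
  also have "\<dots> = (\<Sum>s\<in>S. \<Sum>p\<in>A \<rightarrow>\<^sub>E S. g (p(x := s)))"
    by (simp add: sum.cartesian_product)
  also have "\<dots> = (\<Sum>p\<in>A \<rightarrow>\<^sub>E S. \<Sum>s\<in>S. g (p(x := s)))" by (rule sum.swap)
  finally show ?thesis .
qed

text \<open>Both sides are the \<open>(k, l)\<close> entry of the \<open>h\<close>-th power of the
  matrix, once by expanding the product and once by the spectral decomposition.\<close>

lemma eigen_decomp_paths:
  assumes "eigen_decomp n a u e" "k < n" "l < n"
  shows "(\<Sum>p | p \<in> {0..h} \<rightarrow>\<^sub>E {..<n} \<and> p 0 = k \<and> p h = l. \<Prod>i<h. a (p i) (p (Suc i)))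
     = (\<Sum>i<n. e i ^ h * u i k * u i l)"
  using assms(3)
proof (induction h arbitrary: l)
  case 0
  have eq: "{p. p \<in> {0..0} \<rightarrow>\<^sub>E {..<n} \<and> p 0 = k \<and> p 0 = l} = (if k = l then {(\<lambda>i\<in>{0::nat}. k)} else {})"
    using assms(2) by (auto simp: PiE_iff extensional_def restrict_def fun_eq_iff)
  show ?case using assms 0 unfolding eq by (simp add: eigen_decomp_def)
next
  case (Suc h)
  note d = assms(1)[unfolded eigen_decomp_def]
  have "(\<Sum>p | p \<in> {0..Suc h} \<rightarrow>\<^sub>E {..<n} \<and> p 0 = k \<and> p (Suc h) = l. \<Prod>i<Suc h. a (p i) (p (Suc i)))
    = (\<Sum>p\<in>{0..Suc h} \<rightarrow>\<^sub>E {..<n}. if p 0 = k \<and> p (Suc h) = l then \<Prod>i<Suc h. a (p i) (p (Suc i)) else 0)"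
    by (subst sum.inter_filter[symmetric]) (auto intro!: sum.cong finite_PiE)
  also have "\<dots> = (\<Sum>p\<in>{0..h} \<rightarrow>\<^sub>E {..<n}. \<Sum>s<n. if s = l then (if p 0
    = k then (\<Prod>i<h. a (p i) (p (Suc i))) * a (p h) l else 0) else 0)"
    unfolding atLeast0_atMost_Suc by (subst sum_PiE_insert) (auto intro!: sum.cong prod.cong)
  also have "\<dots> = (\<Sum>p\<in>{0..h} \<rightarrow>\<^sub>E {..<n}. if p 0 = k then (\<Prod>i<h. a (p i) (p (Suc i))) * a (p h) l else 0)"
    using Suc.prems by simp
  \<comment> \<open>Splitting by the penultimate vertex \<open>m\<close> makes the induction
    hypothesis available at each \<open>m\<close>.\<close>
  also have "\<dots> = (\<Sum>p\<in>{0..h} \<rightarrow>\<^sub>E {..<n}. \<Sum>m<n. if p h = m then (if p 0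
    = k then (\<Prod>i<h. a (p i) (p (Suc i))) * a m l else 0) else 0)"
  proof (intro sum.cong refl)
    fix p assume "p \<in> {0..h} \<rightarrow>\<^sub>E {..<n}"
    then have "p h < n" by (auto simp: PiE_iff)
    then show "(if p 0 = k then (\<Prod>i<h. a (p i) (p (Suc i))) * a (p h) l else 0) =
       (\<Sum>m<n. if p h = m then (if p 0 = k then (\<Prod>i<h. a (p i) (p (Suc i))) * a m l else 0) else 0)"
      by simp
  qed
  also have "\<dots> = (\<Sum>m<n. \<Sum>p\<in>{0..h} \<rightarrow>\<^sub>E {..<n}. if p 0 = k \<and> p h
    = m then (\<Prod>i<h. a (p i) (p (Suc i))) * a m l else 0)"
    by (subst sum.swap) (auto intro!: sum.cong)
  also have "\<dots> = (\<Sum>m<n. (\<Sum>p | p \<in> {0..h} \<rightarrow>\<^sub>E {..<n} \<and> p 0 = k \<and> p h = m. \<Prod>i<h. a (p i) (p (Suc i))) * a m l)"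
    by (intro sum.cong refl, subst sum_distrib_right, subst sum.inter_filter[symmetric]) (auto intro!:
      sum.cong finite_PiE)
  also have "\<dots> = (\<Sum>m<n. (\<Sum>i<n. e i ^ h * u i k * u i m) * (\<Sum>j<n. e j * u j m * u j l))"
    using Suc d by (intro sum.cong refl) auto
  also have "\<dots> = (\<Sum>m<n. \<Sum>i<n. \<Sum>j<n. e i ^ h * u i k * (e j * u j l * (u i m * u j m)))"
    unfolding sum_product by (intro sum.cong refl) (simp only: mult_ac)
  also have "\<dots> = (\<Sum>i<n. \<Sum>m<n. \<Sum>j<n. e i ^ h * u i k * (e j * u j l * (u i m * u j m)))"
    by (rule sum.swap)
  also have "\<dots> = (\<Sum>i<n. \<Sum>j<n. \<Sum>m<n. e i ^ h * u i k * (e j * u j l * (u i m * u j m)))"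
    by (rule sum.cong[OF refl], rule sum.swap)
  also have "\<dots> = (\<Sum>i<n. \<Sum>j<n. e i ^ h * u i k * (e j * u j l * (\<Sum>m<n. u i m * u j m)))"
    by (simp add: sum_distrib_left)
  also have "\<dots> = (\<Sum>i<n. \<Sum>j<n. if i = j then e i ^ h * u i k * (e j * u j l) else 0)"
    using d by (intro sum.cong refl) auto
  also have "\<dots> = (\<Sum>i<n. e i ^ Suc h * u i k * u i l)"
    by (intro sum.cong refl) (simp add: mult_ac)
  finally show ?case .
qed

lemma eigen_decomp_power_sum:
  assumes "eigen_decomp n a u e"
  shows "(\<Sum>i<n. e i ^ h) = (\<Sum>p | p \<in> {0..h} \<rightarrow>\<^sub>E {..<n} \<and> p 0 = p h. \<Prod>i<h. a (p i) (p (Suc i)))"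
proof -
  have "(\<Sum>i<n. e i ^ h) = (\<Sum>i<n. e i ^ h * (\<Sum>k<n. u i k * u i k))"
    using assms by (intro sum.cong refl) (auto simp: eigen_decomp_def)
  also have "\<dots> = (\<Sum>k<n. \<Sum>i<n. e i ^ h * u i k * u i k)"
    unfolding sum_distrib_left by (subst sum.swap) (simp add: mult_ac)
  also have "\<dots> = (\<Sum>k<n. \<Sum>p | p \<in> {0..h} \<rightarrow>\<^sub>E {..<n} \<and> p 0 = k \<and> p h = k. \<Prod>i<h. a (p i) (p (Suc i)))"
    using eigen_decomp_paths[OF assms, of _ _ h] by (intro sum.cong refl) auto
  also have "\<dots> = (\<Sum>p\<in>(\<Union>k<n. {p. p \<in> {0..h} \<rightarrow>\<^sub>E {..<n} \<and> p 0 = k \<and> p h = k}). \<Prod>i<h. a (p i) (p (Suc i)))"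
    by (rule sum.UNION_disjoint[symmetric]) (auto intro!: finite_subset[OF _ finite_PiE[of "{0..h}" "\<lambda>_.
      {..<n}"]])
  also have "(\<Union>k<n. {p. p \<in> {0..h} \<rightarrow>\<^sub>E {..<n} \<and> p 0 = k \<and> p h = k}) = {p. p \<in> {0..h} \<rightarrow>\<^sub>E {..<n} \<and> p 0 = p h}"
    by (auto simp: PiE_iff)
  finally show ?thesis .
qed

section \<open>Comparison of two spectra\<close>

lemma parseval:
  fixes u :: "nat \<Rightarrow> nat \<Rightarrow> real"
  assumes "\<And>k l. k < n \<Longrightarrow> l < n \<Longrightarrow> (\<Sum>i<n. u i k * u i l) = (if k = l then 1 else 0)"
  shows "(\<Sum>i<n. (\<Sum>k<n. c k * u i k)\<^sup>2) = (\<Sum>k<n. (c k)\<^sup>2)"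
proof -
  have "(\<Sum>i<n. (\<Sum>k<n. c k * u i k)\<^sup>2) = (\<Sum>i<n. \<Sum>k<n. \<Sum>l<n. c k * c l * (u i k * u i l))"
    unfolding power2_eq_square sum_product by (intro sum.cong refl) (simp only: mult_ac)
  also have "\<dots> = (\<Sum>k<n. \<Sum>i<n. \<Sum>l<n. c k * c l * (u i k * u i l))" by (rule sum.swap)
  also have "\<dots> = (\<Sum>k<n. \<Sum>l<n. \<Sum>i<n. c k * c l * (u i k * u i l))"
    by (rule sum.cong[OF refl], rule sum.swap)
  also have "\<dots> = (\<Sum>k<n. \<Sum>l<n. if k = l then c k * c l else 0)"
    unfolding sum_distrib_left[symmetric] using assms by (intro sum.cong refl) auto
  finally show ?thesis by (simp add: power2_eq_square)
qed

text \<open>The squared overlaps \<open>(g i j)\<^sup>2\<close> of the two eigenbases form a doubly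
  stochastic matrix, which couples the two spectra. With these weights the squared distances of the
  eigenvalues add up to exactly the squared Frobenius distance of the matrices, and Cauchy-Schwarz
  finishes.\<close>

lemma eigen_decomp_lipschitz:
  fixes f :: "real \<Rightarrow> complex"
  assumes A: "eigen_decomp n a u e" and B: "eigen_decomp n b w d"
    and f: "\<And>x y. norm (f x - f y) \<le> L * \<bar>x - y\<bar>" and L: "L \<ge> 0"
  shows "norm ((\<Sum>i<n. f (e i)) - (\<Sum>j<n. f (d j)))
    \<le> L * sqrt (real n) * sqrt (\<Sum>k<n. \<Sum>l<n. (a k l - b k l)\<^sup>2)"
proof -
  note a = A[unfolded eigen_decomp_def] and b = B[unfolded eigen_decomp_def]
  define g where "g i j = (\<Sum>k<n. u i k * w j k)" for i j
  have row: "(\<Sum>j<n. (g i j)\<^sup>2) = 1" if i: "i < n" for i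
    using parseval[of n w "u i"] a b i by (simp add: g_def power2_eq_square)
  have col: "(\<Sum>i<n. (g i j)\<^sup>2) = 1" if j: "j < n" for j
    using parseval[of n u "w j"] a b j by (simp add: g_def power2_eq_square mult.commute)
  \<comment> \<open>Between the two eigenbases the difference of the matrices has entries
    \<open>g i j * (e i - d j)\<close>, and an orthogonal change of basis on either side preserves
    the sum of squares.\<close>
  have key: "(\<Sum>i<n. \<Sum>j<n. (g i j)\<^sup>2 * (e i - d j)\<^sup>2) = (\<Sum>k<n. \<Sum>l<n. (a k l - b k l)\<^sup>2)"
  proof -
    define h where "h i l = (\<Sum>k<n. u i k * (a k l - b k l))" for i l
    have ua: "(\<Sum>k<n. u i k * a k l) = e i * u i l" if "i < n" "l < n" for i l
    proof -
      have "(\<Sum>k<n. u i k * a k l) = (\<Sum>k<n. \<Sum>m<n. e m * u m l * (u i k * u m k))"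
        using a that by (intro sum.cong refl) (simp add: sum_distrib_left mult_ac)
      also have "\<dots> = (\<Sum>m<n. e m * u m l * (\<Sum>k<n. u i k * u m k))"
        unfolding sum_distrib_left by (rule sum.swap)
      also have "\<dots> = (\<Sum>m<n. if i = m then e m * u m l else 0)"
        using a that by (intro sum.cong refl) auto
      finally show ?thesis using that by simp
    qed
    have bw: "(\<Sum>l<n. b k l * w j l) = d j * w j k" if "j < n" "k < n" for j k
    proof -
      have "(\<Sum>l<n. b k l * w j l) = (\<Sum>l<n. \<Sum>m<n. d m * w m k * (w j l * w m l))"
        using b that by (intro sum.cong refl) (simp add: sum_distrib_left mult_ac)
      also have "\<dots> = (\<Sum>m<n. d m * w m k * (\<Sum>l<n. w j l * w m l))"
        unfolding sum_distrib_left by (rule sum.swap)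
      also have "\<dots> = (\<Sum>m<n. if j = m then d m * w m k else 0)"
        using b that by (intro sum.cong refl) auto
      finally show ?thesis using that by simp
    qed
    have hw: "(\<Sum>l<n. h i l * w j l) = g i j * (e i - d j)" if ij: "i < n" "j < n" for i j
    proof -
      have "(\<Sum>l<n. h i l * w j l) = (\<Sum>l<n. (\<Sum>k<n. u i k * a k l) * w j l)
        - (\<Sum>l<n. \<Sum>k<n. u i k * (b k l * w j l))"
        unfolding sum_subtractf[symmetric] by (intro sum.cong refl)
          (simp add: h_def sum_subtractf right_diff_distrib left_diff_distrib sum_distrib_right mult.assoc)
      also have "(\<Sum>l<n. (\<Sum>k<n. u i k * a k l) * w j l) = e i * g i j"
        using ua ij by (simp add: g_def sum_distrib_left mult_ac)
      also have "(\<Sum>l<n. \<Sum>k<n. u i k * (b k l * w j l)) = (\<Sum>k<n. u i k * (\<Sum>l<n. b k l * w j l))"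
        unfolding sum_distrib_left by (rule sum.swap)
      also have "\<dots> = d j * g i j"
        using bw ij by (simp add: g_def sum_distrib_left mult_ac)
      finally show ?thesis by (simp add: algebra_simps)
    qed
    have "(\<Sum>i<n. \<Sum>j<n. (g i j)\<^sup>2 * (e i - d j)\<^sup>2) = (\<Sum>i<n. \<Sum>j<n. (\<Sum>l<n. h i l * w j l)\<^sup>2)"
      using hw by (intro sum.cong refl) (simp add: power_mult_distrib)
    also have "\<dots> = (\<Sum>i<n. \<Sum>l<n. (h i l)\<^sup>2)"
      using b by (intro sum.cong refl parseval) auto
    also have "\<dots> = (\<Sum>l<n. \<Sum>i<n. (h i l)\<^sup>2)" by (rule sum.swap)
    also have "\<dots> = (\<Sum>l<n. \<Sum>k<n. (a k l - b k l)\<^sup>2)"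
    proof (rule sum.cong[OF refl])
      fix l
      show "(\<Sum>i<n. (h i l)\<^sup>2) = (\<Sum>k<n. (a k l - b k l)\<^sup>2)"
        using parseval[of n u "\<lambda>k. a k l - b k l"] a by (simp add: h_def mult.commute)
    qed
    also have "\<dots> = (\<Sum>k<n. \<Sum>l<n. (a k l - b k l)\<^sup>2)" by (rule sum.swap)
    finally show ?thesis .
  qed
  \<comment> \<open>Rows and columns of the squared overlaps sum to 1, so both sums become double
    sums with the same weights.\<close>
  have "(\<Sum>i<n. f (e i)) = (\<Sum>i<n. \<Sum>j<n. of_real ((g i j)\<^sup>2) * f (e i))"
    using row by (intro sum.cong refl) (simp add: sum_distrib_right[symmetric] of_real_sum[symmetric] del:
      of_real_sum of_real_power)
  moreover have "(\<Sum>j<n. f (d j)) = (\<Sum>j<n. \<Sum>i<n. of_real ((g i j)\<^sup>2) * f (d j))"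
    using col by (intro sum.cong refl) (simp add: sum_distrib_right[symmetric] of_real_sum[symmetric] del:
      of_real_sum of_real_power)
  ultimately have "(\<Sum>i<n. f (e i)) - (\<Sum>j<n. f (d j)) = (\<Sum>i<n. \<Sum>j<n. of_real ((g i j)\<^sup>2) * (f (e i) - f (d j)))"
    by (simp add: right_diff_distrib sum_subtractf) (rule sum.swap)
  also have "norm \<dots> \<le> (\<Sum>i<n. \<Sum>j<n. (g i j)\<^sup>2 * (L * \<bar>e i - d j\<bar>))"
    by (intro sum_norm_le) (auto simp: norm_mult norm_power intro!: mult_left_mono f)
  also have "\<dots> = L * (\<Sum>(i,j)\<in>{..<n}\<times>{..<n}. \<bar>g i j\<bar> * (\<bar>g i j\<bar> * \<bar>e i - d j\<bar>))"
  proof -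
    have "(g i j)\<^sup>2 * (L * \<bar>e i - d j\<bar>) = L * (\<bar>g i j\<bar> * (\<bar>g i j\<bar> * \<bar>e i - d j\<bar>))" for i j
      by (simp add: power2_eq_square)
    then show ?thesis unfolding sum.cartesian_product[symmetric] sum_distrib_left by (simp only:)
  qed
  also have "\<dots> \<le> L * (sqrt (\<Sum>(i,j)\<in>{..<n}\<times>{..<n}. (g i j)\<^sup>2) * sqrt (\<Sum>(i,j)\<in>{..<n}\<times>{..<n}. (g i j)\<^sup>2 * (e
    i - d j)\<^sup>2))"
    using L2_set_mult_ineq[of "\<lambda>(i,j). g i j" "\<lambda>(i,j). g i j * (e i - d j)" "{..<n}\<times>{..<n}"]
    by (intro mult_left_mono L) (simp add: L2_set_def case_prod_unfold power_mult_distrib abs_mult)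
  also have "\<dots> = L * sqrt (real n) * sqrt (\<Sum>k<n. \<Sum>l<n. (a k l - b k l)\<^sup>2)"
    using row key by (simp add: sum.cartesian_product[symmetric])
  finally show ?thesis .
qed

section \<open>The method of moments\<close>

text \<open>The order is even, so that the Taylor remainder is bounded by an even moment, for which
  absolute values disappear.\<close>

definition char_partial :: "(nat \<Rightarrow> real) \<Rightarrow> real \<Rightarrow> nat \<Rightarrow> complex" where
  "char_partial \<beta> t K = (\<Sum>k\<le>2*K. ((\<i> * complex_of_real t) ^ k / fact k) * complex_of_real (\<beta> k))"

text \<open>The bound for the Taylor remainder vanishes at every \<open>t\<close>; under this
  condition the moments fix the characteristic function.\<close>

definition moment_growth :: "(nat \<Rightarrow> real) \<Rightarrow> bool" where
  "moment_growth \<beta> \<longleftrightarrow> (\<forall>t. (\<lambda>K. 2 * \<bar>t\<bar> ^ (2*K) / fact (2*K) * \<beta> (2*K)) \<longlonglongrightarrow> 0)"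

text \<open>Exchanges two limits: for each \<open>K\<close> the error in \<open>n\<close> is
  eventually about \<open>\<epsilon> K\<close>. Used with \<open>K\<close> as a Taylor order and
  later as a truncation level.\<close>

lemma LIMSEQ_of_approx:
  fixes a :: "nat \<Rightarrow> 'a::real_normed_vector"
  assumes ev: "\<And>K d. d > 0 \<Longrightarrow> eventually (\<lambda>n. norm (a n - P K) \<le> \<epsilon> K + d) sequentially"
    and e: "\<epsilon> \<longlonglongrightarrow> 0" and P: "P \<longlonglongrightarrow> c"
  shows "a \<longlonglongrightarrow> c"
proof (rule tendstoI)
  fix r :: real assume r: "r > 0"
  have "eventually (\<lambda>K. dist (\<epsilon> K) 0 < r/4 \<and> dist (P K) c < r/4) sequentially"
    using tendstoD[OF e, of "r/4"] tendstoD[OF P, of "r/4"] r by (auto intro: eventually_conj)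
  then obtain K where K: "dist (\<epsilon> K) 0 < r/4" "dist (P K) c < r/4"
    by (auto simp: eventually_sequentially)
  have "eventually (\<lambda>n. norm (a n - P K) \<le> \<epsilon> K + r/4) sequentially" using ev[of "r/4" K] r by simp
  then show "eventually (\<lambda>n. dist (a n) c < r) sequentially"
  proof eventually_elim
    case (elim n)
    have "dist (a n) c \<le> dist (a n) (P K) + dist (P K) c" by (rule dist_triangle)
    then show ?case using elim K r by (auto simp: dist_norm)
  qed
qed

text \<open>The limit is built from \<beta> alone and no measure with these moments is presupposed,
  so the lemma gives both convergence and, for a constant sequence, uniqueness.\<close>

lemma char_moment_limit:
  fixes \<mu> :: "nat \<Rightarrow> real measure"
  assumes \<mu>: "\<And>n. real_distribution (\<mu> n)"
    and int: "\<And>n k. integrable (\<mu> n) (\<lambda>x. x ^ k)"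
    and lim: "\<And>k. (\<lambda>n. integral\<^sup>L (\<mu> n) (\<lambda>x. x ^ k)) \<longlonglongrightarrow> \<beta> k"
    and growth: "moment_growth \<beta>"
  shows "(\<lambda>n. char (\<mu> n) t) \<longlonglongrightarrow> lim (char_partial \<beta> t)"
proof -
  define P where "P = char_partial \<beta> t"
  define \<epsilon> where "\<epsilon> K = 2 * \<bar>t\<bar> ^ (2*K) / fact (2*K) * \<beta> (2*K)" for K
  have e: "\<epsilon> \<longlonglongrightarrow> 0" using growth unfolding moment_growth_def \<epsilon>_def by blast
  have ev: "eventually (\<lambda>n. norm (char (\<mu> n) t - P K) \<le> \<epsilon> K + d) sequentially" if d: "d > 0" for K d
  proof -
    define Pn where "Pn n = (\<Sum>k\<le>2*K. ((\<i> * complex_of_real t) ^ k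
      / fact k) * complex_of_real (integral\<^sup>L (\<mu> n) (\<lambda>x. x ^ k)))" for n
    define en where "en n = 2 * \<bar>t\<bar> ^ (2*K) / fact (2*K) * integral\<^sup>L (\<mu> n) (\<lambda>x. x ^ (2*K))" for n
    have b: "norm (char (\<mu> n) t - Pn n) \<le> en n" for n
    proof -
      interpret real_distribution "\<mu> n" by (rule \<mu>)
      have "norm (char (\<mu> n) t - Pn n) \<le> (2 * \<bar>t\<bar> ^ (2*K) / fact (2*K)) * expectation (\<lambda>x. \<bar>x\<bar> ^ (2*K))"
        unfolding Pn_def using char_approx1[of "2*K" t] int by simp
      then show ?thesis by (simp add: en_def power_mult)
    qed
    have "Pn \<longlonglongrightarrow> P K" unfolding Pn_def P_def char_partial_def
      by (intro tendsto_intros lim)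
    moreover have "en \<longlonglongrightarrow> \<epsilon> K" unfolding en_def \<epsilon>_def by (intro tendsto_intros lim)
    ultimately have "eventually (\<lambda>n. dist (Pn n) (P K) < d/2 \<and> dist (en n) (\<epsilon> K) < d/2) sequentially"
      using d by (intro eventually_conj tendstoD) auto
    then show ?thesis
    proof eventually_elim
      case (elim n)
      have "norm (char (\<mu> n) t - P K) \<le> norm (char (\<mu> n) t - Pn n) + norm (Pn n - P K)"
        using norm_triangle_ineq[of "char (\<mu> n) t - Pn n" "Pn n - P K"] by simp
      then show ?case using elim b[of n] unfolding dist_norm real_norm_def by linarith
    qed
  qed
  \<comment> \<open>Two partial sums are close to the same characteristic function at one large
    \<open>n\<close>; hence the Taylor sums of \<beta> form a Cauchy sequence.\<close>
  have PP: "norm (P K - P L) \<le> \<epsilon> K + \<epsilon> L" for K L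
  proof (rule field_le_epsilon)
    fix d :: real assume "d > 0"
    then have "eventually (\<lambda>n. norm (char (\<mu> n) t - P K) \<le> \<epsilon> K + d/2 \<and> norm (char (\<mu> n) t - P L)
      \<le> \<epsilon> L + d/2) sequentially"
      using ev[of "d/2"] by (intro eventually_conj) auto
    then obtain n where n: "norm (char (\<mu> n) t - P K) \<le> \<epsilon> K + d/2" "norm (char (\<mu> n) t - P L) \<le> \<epsilon> L + d/2"
      by (auto simp: eventually_sequentially)
    have "norm (P K - P L) \<le> norm (char (\<mu> n) t - P L) + norm (char (\<mu> n) t - P K)"
      using norm_triangle_ineq4[of "char (\<mu> n) t - P L" "char (\<mu> n) t - P K"] by simp
    then show "norm (P K - P L) \<le> \<epsilon> K + \<epsilon> L + d" using n by simp
  qed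
  have "Cauchy P"
  proof (rule CauchyI)
    fix r :: real assume r: "r > 0"
    then obtain M where M: "\<And>K. K \<ge> M \<Longrightarrow> dist (\<epsilon> K) 0 < r/2"
      using tendstoD[OF e, of "r/2"] by (auto simp: eventually_sequentially)
    show "\<exists>M. \<forall>m\<ge>M. \<forall>n\<ge>M. norm (P m - P n) < r"
    proof (intro exI[of _ M] allI impI)
      fix m n assume "m \<ge> M" "n \<ge> M"
      then show "norm (P m - P n) < r" using PP[of m n] M[of m] M[of n] by (auto simp: dist_norm)
    qed
  qed
  then have "P \<longlonglongrightarrow> lim P" by (simp add: Cauchy_convergent_iff convergent_LIMSEQ_iff)
  then show ?thesis using LIMSEQ_of_approx[of "\<lambda>n. char (\<mu> n) t" P \<epsilon> "lim P"] ev e by (simp add: P_def)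
qed

lemma tight_of_second_moments:
  fixes \<mu> :: "nat \<Rightarrow> real measure"
  assumes \<mu>: "\<And>n. real_distribution (\<mu> n)"
    and int: "\<And>n. integrable (\<mu> n) (\<lambda>x. x\<^sup>2)"
    and bound: "\<And>n. integral\<^sup>L (\<mu> n) (\<lambda>x. x\<^sup>2) \<le> B"
  shows "tight \<mu>"
  unfolding tight_def
proof (intro conjI allI impI)
  show "real_distribution (\<mu> n)" for n by (rule \<mu>)
  fix \<epsilon> :: real assume e: "\<epsilon> > 0"
  \<comment> \<open>Chosen for Markov's inequality applied to squares; the summand 1 keeps
    \<open>R\<close> positive and the resulting bound strict.\<close>
  define R where "R = sqrt ((\<bar>B\<bar> + 1) / \<epsilon>)"
  have "(\<bar>B\<bar> + 1) / \<epsilon> > 0" using e by (intro divide_pos_pos) auto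
  then have R: "R > 0" "R\<^sup>2 = (\<bar>B\<bar> + 1) / \<epsilon>" by (auto simp: R_def)
  have "1 - \<epsilon> < measure (\<mu> n) {-2*R<..2*R}" for n
  proof -
    interpret real_distribution "\<mu> n" by (rule \<mu>)
    have "measure (\<mu> n) {x\<in>space (\<mu> n). x\<^sup>2 \<ge> R\<^sup>2} \<le> integral\<^sup>L (\<mu> n) (\<lambda>x. x\<^sup>2) / R\<^sup>2"
      by (rule integral_Markov_inequality_measure[where A="{}"]) (use R(1) in \<open>auto simp: int\<close>)
    also have "\<dots> \<le> \<bar>B\<bar> / R\<^sup>2" using bound[of n] by (intro divide_right_mono) auto
    also have "\<dots> < \<epsilon>" using e R by (simp add: field_simps)
    finally have 1: "measure (\<mu> n) {x\<in>space (\<mu> n). x\<^sup>2 \<ge> R\<^sup>2} < \<epsilon>" .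
    have "{x\<in>space (\<mu> n). \<not> x\<^sup>2 \<ge> R\<^sup>2} \<subseteq> {-2*R<..2*R}"
    proof
      fix x assume "x \<in> {x\<in>space (\<mu> n). \<not> x\<^sup>2 \<ge> R\<^sup>2}"
      then have "\<bar>x\<bar> < R" using R(1) abs_le_square_iff[of R x] by auto
      then show "x \<in> {-2*R<..2*R}" using R(1) by auto
    qed
    then have "prob {x\<in>space (\<mu> n). \<not> x\<^sup>2 \<ge> R\<^sup>2} \<le> prob {-2*R<..2*R}"
      by (intro finite_measure_mono) auto
    then show ?thesis using 1 prob_neg[of "\<lambda>x. x\<^sup>2 \<ge> R\<^sup>2"] by auto
  qed
  then show "\<exists>a b. a < b \<and> (\<forall>n. 1 - \<epsilon> < Sigma_Algebra.measure (\<mu> n) {a<..b})"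
    using R(1) by (intro exI[of _ "-2*R"] exI[of _ "2*R"]) auto
qed

text \<open>Weak convergence only tests bounded functions. Even powers are cut off from above and
  recovered by monotone convergence, which makes all powers integrable under the limit. A clamped
  power then differs from the power by at most \<open>x ^ (2 * k) / R ^ k\<close>, whose integral is
  small uniformly in \<open>n\<close>.\<close>

lemma weak_limit_moments:
  fixes \<mu> :: "nat \<Rightarrow> real measure"
  assumes \<mu>: "\<And>n. real_distribution (\<mu> n)" and \<nu>: "real_distribution \<nu>"
    and int: "\<And>n k. integrable (\<mu> n) (\<lambda>x. x ^ k)"
    and lim: "\<And>k. (\<lambda>n. integral\<^sup>L (\<mu> n) (\<lambda>x. x ^ k)) \<longlonglongrightarrow> \<beta> k"
    and conv: "weak_conv_m \<mu> \<nu>"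
  shows "has_bochner_integral \<nu> (\<lambda>x. x ^ k) (\<beta> k)"
proof -
  interpret N: real_distribution \<nu> by (rule \<nu>)
  have meas: "f \<in> borel_measurable \<nu>" if "continuous_on UNIV f" for f :: "real \<Rightarrow> real"
    using borel_measurable_continuous_onI[OF that] by simp
  have bc: "(\<lambda>n. integral\<^sup>L (\<mu> n) f) \<longlonglongrightarrow> integral\<^sup>L \<nu> f"
    if "continuous_on UNIV f" "\<And>x. \<bar>f x\<bar> \<le> B" for f :: "real \<Rightarrow> real" and B
    by (rule weak_conv_imp_integral_bdd_continuous_conv[OF \<mu> \<nu> conv, of f B])
       (use that in \<open>auto simp: continuous_on_eq_continuous_at\<close>)
  have even: "integrable \<nu> (\<lambda>x. x ^ (2*j)) \<and> integral\<^sup>L \<nu> (\<lambda>x. x ^ (2*j)) \<le> \<beta> (2*j)" for j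
  proof -
    have le: "integral\<^sup>L \<nu> (\<lambda>x. min (x ^ (2*j)) (real R)) \<le> \<beta> (2*j)" for R :: nat
    proof (rule LIMSEQ_le[OF bc lim])
      show "continuous_on UNIV (\<lambda>x::real. min (x ^ (2*j)) (real R))" by (intro continuous_intros)
      show "\<bar>min (x ^ (2*j)) (real R)\<bar> \<le> real R" for x :: real by (auto simp: power_mult)
      have "integral\<^sup>L (\<mu> n) (\<lambda>x. min (x ^ (2*j)) (real R)) \<le> integral\<^sup>L (\<mu> n) (\<lambda>x. x ^ (2*j))" for n
      proof (rule integral_mono)
        interpret real_distribution "\<mu> n" by (rule \<mu>)
        show "integrable (\<mu> n) (\<lambda>x. min (x ^ (2 * j)) (real R))"
          by (rule integrable_const_bound[where B="real R"]) (auto simp: power_mult)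
      qed (use int in auto)
      then show "\<exists>N. \<forall>n\<ge>N. integral\<^sup>L (\<mu> n) (\<lambda>x. min (x ^ (2*j)) (real R)) \<le> integral\<^sup>L (\<mu> n) (\<lambda>x. x ^ (2*j))"
        by blast
    qed
    have iR: "integrable \<nu> (\<lambda>x. min (x ^ (2 * j)) (real R))" for R
      by (rule N.integrable_const_bound[where B="real R"]) (auto simp: power_mult)
    have "incseq (\<lambda>R. integral\<^sup>L \<nu> (\<lambda>x. min (x ^ (2*j)) (real R)))"
      unfolding incseq_def by (intro allI impI integral_mono iR) auto
    then obtain L where L: "(\<lambda>R. integral\<^sup>L \<nu> (\<lambda>x. min (x ^ (2*j)) (real R))) \<longlonglongrightarrow> L"
      by (rule incseq_convergent[of _ "\<beta> (2*j)"]) (use le in auto)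
    have "has_bochner_integral \<nu> (\<lambda>x. x ^ (2*j)) L"
    proof (rule has_bochner_integral_monotone_convergence[OF iR _ _ L])
      show "AE x in \<nu>. mono (\<lambda>R. min (x ^ (2 * j)) (real R))" by (auto simp: mono_def)
      show "AE x in \<nu>. (\<lambda>R. min (x ^ (2 * j)) (real R)) \<longlonglongrightarrow> x ^ (2 * j)"
      proof (rule AE_I2)
        fix x
        show "(\<lambda>R. min (x ^ (2 * j)) (real R)) \<longlonglongrightarrow> x ^ (2 * j)"
        proof (rule tendsto_eventually)
          obtain R0 :: nat where "x ^ (2*j) \<le> real R0" using real_arch_simple by blast
          then show "\<forall>\<^sub>F R in sequentially. min (x ^ (2 * j)) (real R) = x ^ (2 * j)"
            by (intro eventually_sequentiallyI[of R0]) auto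
        qed
      qed
      show "(\<lambda>x. x ^ (2 * j)) \<in> borel_measurable \<nu>" by simp
    qed
    moreover have "L \<le> \<beta> (2*j)" by (rule LIMSEQ_le_const2[OF L]) (use le in auto)
    ultimately show ?thesis by (auto simp: has_bochner_integral_iff)
  qed
  have int\<nu>: "integrable \<nu> (\<lambda>x. x ^ j)" for j
  proof (rule Bochner_Integration.integrable_bound[where f="\<lambda>x. 1 + x ^ (2*j)"])
    show "integrable \<nu> (\<lambda>x. 1 + x ^ (2*j))" using even[of j] by simp
    have "\<bar>y\<bar> \<le> 1 + y\<^sup>2" for y :: real
      using zero_le_power2[of "\<bar>y\<bar> - 1"] by (simp add: power2_eq_square algebra_simps)
    from this[of "x ^ j" for x] show "AE x in \<nu>. norm (x ^ j) \<le> norm (1 + x ^ (2*j))"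
      by (auto simp: power_mult[symmetric] mult.commute intro: order_trans[OF _ abs_ge_self])
  qed auto
  show ?thesis
  proof (cases "k = 0")
    case True
    have "integral\<^sup>L (\<mu> n) (\<lambda>x. x ^ 0) = 1" for n
    proof -
      interpret real_distribution "\<mu> n" by (rule \<mu>)
      show ?thesis using prob_space by simp
    qed
    then have "\<beta> 0 = 1" using LIMSEQ_unique[OF lim[of 0]] by simp
    then show ?thesis using True int\<nu>[of 0] N.prob_space by (auto simp: has_bochner_integral_iff)
  next
    case False
    define g where "g R x = (max (-R) (min R x)) ^ k" for R x :: real
    \<comment> \<open>Beyond \<open>R\<close> the clamped power has the sign of \<open>x ^ k\<close>
      and no larger modulus, so the difference is at most \<open>\<bar>x\<bar> ^ k\<close>, and the
      extra factor \<open>\<bar>x\<bar> ^ k / R ^ k\<close> is at least 1 there.\<close>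
    have gb: "\<bar>x ^ k - g R x\<bar> \<le> x ^ (2*k) / R ^ k" if R: "R > 0" for R x
    proof (cases "\<bar>x\<bar> \<le> R")
      case True
      then show ?thesis using R by (auto simp: g_def power_mult)
    next
      case F: False
      have "\<bar>x ^ k - g R x\<bar> \<le> \<bar>x\<bar> ^ k"
      proof (cases "x > 0")
        case True
        then have "g R x = R ^ k" "R ^ k \<le> x ^ k" using F R by (auto simp: g_def intro!: power_mono)
        then show ?thesis using True R zero_le_power[of R k] by auto
      next
        case False
        then have x: "g R x = (-R) ^ k" "x = - \<bar>x\<bar>" "R ^ k \<le> \<bar>x\<bar> ^ k"
          using F R by (auto simp: g_def intro!: power_mono)
        have "x ^ k = (-1) ^ k * \<bar>x\<bar> ^ k"
          using power_minus[of "\<bar>x\<bar>" k] by (simp only: x(2)[symmetric])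
        then have "x ^ k - g R x = (-1)^k * (\<bar>x\<bar> ^ k - R ^ k)"
          using x(1) by (simp add: power_minus[of R] algebra_simps)
        then have "\<bar>x ^ k - g R x\<bar> = \<bar>\<bar>x\<bar> ^ k - R ^ k\<bar>" by (simp add: abs_mult power_abs)
        then show ?thesis using x(3) R zero_le_power[of R k] by auto
      qed
      also have "\<dots> \<le> \<bar>x\<bar> ^ k * (\<bar>x\<bar> ^ k / R ^ k)"
      proof -
        have "R ^ k \<le> \<bar>x\<bar> ^ k" using F R by (intro power_mono) auto
        then have "1 \<le> \<bar>x\<bar> ^ k / R ^ k" using R by simp
        then show ?thesis by (metis mult_left_mono mult.right_neutral abs_ge_zero zero_le_power)
      qed
      also have "\<dots> = x ^ (2*k) / R ^ k"
      proof -
        have "\<bar>x\<bar> ^ k * \<bar>x\<bar> ^ k = x ^ (2*k)"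
          by (simp add: power_mult power2_eq_square power_mult_distrib[symmetric])
        then show ?thesis by (simp only: times_divide_eq_right)
      qed
      finally show ?thesis .
    qed
    have gc: "continuous_on UNIV (g R)" for R unfolding g_def by (intro continuous_intros)
    have gB: "\<bar>g R x\<bar> \<le> R ^ k" if "R > 0" for R x
      unfolding g_def power_abs using that by (intro power_mono) auto
    have diff: "\<bar>integral\<^sup>L \<rho> (\<lambda>x. x ^ k) - integral\<^sup>L \<rho> (g R)\<bar> \<le> integral\<^sup>L \<rho> (\<lambda>x. x ^ (2*k)) / R ^ k"
      if \<rho>: "real_distribution \<rho>" and i: "\<And>j. integrable \<rho> (\<lambda>x. x ^ j)" and R: "R > 0" for \<rho> R
    proof -
      interpret real_distribution \<rho> by (rule \<rho>)
      have gi: "integrable \<rho> (g R)"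
        by (rule integrable_const_bound[where B="R^k"])
           (use gB R borel_measurable_continuous_onI[OF gc] in auto)
      have "\<bar>integral\<^sup>L \<rho> (\<lambda>x. x ^ k - g R x)\<bar> \<le> integral\<^sup>L \<rho> (\<lambda>x. x ^ (2*k) / R ^ k)"
        by (rule integral_abs_bound_integral) (use i gi gb R in auto)
      then show ?thesis using i gi by simp
    qed
    have "\<bar>integral\<^sup>L \<nu> (\<lambda>x. x ^ k) - \<beta> k\<bar> \<le> 2 * \<beta> (2*k) / R ^ k" if R: "R > 0" for R
    proof -
      have "(\<lambda>n. \<bar>integral\<^sup>L (\<mu> n) (\<lambda>x. x ^ k) - integral\<^sup>L (\<mu> n) (g R)\<bar>) \<longlonglongrightarrow> \<bar>\<beta> k - integral\<^sup>L \<nu> (g R)\<bar>"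
        by (intro tendsto_intros lim bc[OF gc gB] R)
      moreover have "(\<lambda>n. integral\<^sup>L (\<mu> n) (\<lambda>x. x ^ (2*k)) / R ^ k) \<longlonglongrightarrow> \<beta> (2*k) / R ^ k"
        by (intro tendsto_intros lim) (use R in auto)
      ultimately have "\<bar>\<beta> k - integral\<^sup>L \<nu> (g R)\<bar> \<le> \<beta> (2*k) / R ^ k"
        by (rule LIMSEQ_le) (use diff[OF \<mu> int R] in blast)
      moreover have "\<bar>integral\<^sup>L \<nu> (\<lambda>x. x ^ k) - integral\<^sup>L \<nu> (g R)\<bar> \<le> \<beta> (2*k) / R ^ k"
        by (rule order_trans[OF diff[OF \<nu> int\<nu> R] divide_right_mono]) (use even[of k] R in auto)
      ultimately show ?thesis by (simp add: abs_if split: if_splits)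
    qed
    moreover have "((\<lambda>R. 2 * \<beta> (2*k) / R ^ k) \<longlongrightarrow> 0) at_top"
      by (rule real_tendsto_divide_at_top[OF tendsto_const filterlim_pow_at_top[OF _ filterlim_ident]])
        (use False in auto)
    ultimately have "\<bar>integral\<^sup>L \<nu> (\<lambda>x. x ^ k) - \<beta> k\<bar> \<le> 0"
      by (intro tendsto_le[OF _ _ tendsto_const, of at_top "\<lambda>R. 2 * \<beta> (2*k) / R ^ k"])
         (auto intro!: eventually_mono[OF eventually_gt_at_top[of 0]])
    then show ?thesis using int\<nu>[of k] by (auto simp: has_bochner_integral_iff)
  qed
qed

text \<open>One subsequential limit is enough for existence: convergent second moments give
  tightness, and the moments converge along every subsequence, which fixes those of the
  limit.\<close>

theorem method_of_moments:
  fixes \<mu> :: "nat \<Rightarrow> real measure"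
  assumes \<mu>: "\<And>n. real_distribution (\<mu> n)"
    and int: "\<And>n k. integrable (\<mu> n) (\<lambda>x. x ^ k)"
    and lim: "\<And>k. (\<lambda>n. integral\<^sup>L (\<mu> n) (\<lambda>x. x ^ k)) \<longlonglongrightarrow> \<beta> k"
    and growth: "moment_growth \<beta>"
  shows "\<exists>\<nu>. real_distribution \<nu> \<and> (\<forall>k. has_bochner_integral \<nu> (\<lambda>x. x ^ k) (\<beta> k))"
proof -
  have "convergent (\<lambda>n. integral\<^sup>L (\<mu> n) (\<lambda>x. x\<^sup>2))" using lim by (auto simp: convergent_def)
  then have "Bseq (\<lambda>n. integral\<^sup>L (\<mu> n) (\<lambda>x. x\<^sup>2))" by (rule convergent_imp_Bseq)
  then obtain B where B: "\<And>n. norm (integral\<^sup>L (\<mu> n) (\<lambda>x. x\<^sup>2)) \<le> B" using BseqE by blast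
  have tight: "tight \<mu>"
  proof (rule tight_of_second_moments[OF \<mu>])
    show "integrable (\<mu> n) (\<lambda>x. x\<^sup>2)" for n by (rule int)
    show "integral\<^sup>L (\<mu> n) (\<lambda>x. x\<^sup>2) \<le> B" for n using B[of n] by (simp add: abs_le_iff)
  qed
  obtain r \<nu> where r: "strict_mono (r :: nat \<Rightarrow> nat)" "real_distribution \<nu>" "weak_conv_m (\<mu> \<circ> id \<circ> r) \<nu>"
    using tight_imp_convergent_subsubsequence[OF tight strict_mono_id] by blast
  have "has_bochner_integral \<nu> (\<lambda>x. x ^ k) (\<beta> k)" for k
  proof (rule weak_limit_moments[where \<mu>="\<mu> \<circ> id \<circ> r"])
    show "(\<lambda>n. integral\<^sup>L ((\<mu> \<circ> id \<circ> r) n) (\<lambda>x. x ^ k)) \<longlonglongrightarrow> \<beta> k" for k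
      using LIMSEQ_subseq_LIMSEQ[OF lim[of k] r(1)] by (simp add: o_def)
    show "real_distribution \<nu>" by (rule r)
    show "weak_conv_m (\<mu> \<circ> id \<circ> r) \<nu>" by (rule r)
    show "real_distribution ((\<mu> \<circ> id \<circ> r) n)" for n using \<mu> by simp
    show "integrable ((\<mu> \<circ> id \<circ> r) n) (\<lambda>x. x ^ k)" for n k using int by simp
  qed
  then show ?thesis using r by blast
qed

text \<open>The limit lemma at the constant sequence: the moments prescribe the characteristic
  function.\<close>

lemma char_eq_lim_partial:
  assumes \<nu>: "real_distribution \<nu>" and m: "\<And>k. has_bochner_integral \<nu> (\<lambda>x. x ^ k) (\<beta> k)"
    and growth: "moment_growth \<beta>"
  shows "char \<nu> t = lim (char_partial \<beta> t)"
proof -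
  have "(\<lambda>n. char \<nu> t) \<longlonglongrightarrow> lim (char_partial \<beta> t)"
    by (rule char_moment_limit[of "\<lambda>_. \<nu>"]) (use assms in \<open>auto simp: has_bochner_integral_iff\<close>)
  then show ?thesis by (simp add: LIMSEQ_const_iff)
qed

lemma moments_imp_weak_conv:
  fixes \<mu> :: "nat \<Rightarrow> real measure"
  assumes \<mu>: "\<And>n. real_distribution (\<mu> n)"
    and int: "\<And>n k. integrable (\<mu> n) (\<lambda>x. x ^ k)"
    and lim: "\<And>k. (\<lambda>n. integral\<^sup>L (\<mu> n) (\<lambda>x. x ^ k)) \<longlonglongrightarrow> \<beta> k"
    and growth: "moment_growth \<beta>"
    and \<nu>: "real_distribution \<nu>" and m: "\<And>k. has_bochner_integral \<nu> (\<lambda>x. x ^ k) (\<beta> k)"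
  shows "weak_conv_m \<mu> \<nu>"
proof (rule levy_continuity[OF \<mu> \<nu>])
  show "(\<lambda>n. char (\<mu> n) t) \<longlonglongrightarrow> char \<nu> t" for t
    unfolding char_eq_lim_partial[OF \<nu> m growth]
    by (rule char_moment_limit[OF \<mu> int lim growth])
qed

section \<open>Counting circuits\<close>

text \<open>Polymorphic because two instances are used: integers for congruences modulo the period,
  reals for rescaled positions.\<close>

primrec walk :: "'a::ab_group_add \<Rightarrow> (nat \<Rightarrow> 'a) \<Rightarrow> nat \<Rightarrow> 'a" where
  "walk y l 0 = y"
| "walk y l (Suc i) = l i - walk y l i"

lemma walk_eq: "walk y l i = (-1) ^ i * y + walk (0::'a::comm_ring_1) l i"
  by (induction i) auto

lemma walk_0_sum: "walk (0::'a::comm_ring_1) l h = (\<Sum>i<h. (-1) ^ (h - 1 - i) * l i)"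
proof (induction h)
  case (Suc h)
  have "(\<Sum>i<h. (-1) ^ (h - 1 - i) * l i) = - (\<Sum>i<h. (-1) ^ (Suc h - 1 - i) * l i)"
    unfolding sum_negf[symmetric]
  proof (rule sum.cong[OF refl])
    fix i assume "i \<in> {..<h}"
    then have "Suc h - 1 - i = Suc (h - 1 - i)" by auto
    then show "(-1) ^ (h - 1 - i) * l i = - ((-1) ^ (Suc h - 1 - i) * l i)" by simp
  qed
  then show ?case using Suc by simp
qed simp

definition res :: "nat \<Rightarrow> nat \<Rightarrow> int \<Rightarrow> nat" where
  "res n N z = card {p \<in> {1..n}. [int p = z] (mod int N)}"

lemma div_add_one:
  fixes a N :: int
  assumes "N > 0"
  shows "(a + 1) div N = a div N + (if N dvd a + 1 then 1 else 0)"
proof (cases "N dvd a + 1")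
  case True
  then obtain q where q: "a + 1 = N * q" by blast
  then have "a = N * (q - 1) + (N - 1)" by (simp add: algebra_simps)
  then have "a div N = q - 1" using assms by (intro int_div_pos_eq[where r="N - 1"]) auto
  then show ?thesis using q True assms by simp
next
  case False
  have "a = N * (a div N) + a mod N" by simp
  moreover have "a mod N + 1 < N"
  proof (rule ccontr)
    assume "\<not> a mod N + 1 < N"
    then have "a mod N + 1 = N" using pos_mod_bound[OF assms, of a] by simp
    then have "a + 1 = N * (a div N) + N" using calculation by linarith
    then show False using False by (metis dvd_add dvd_refl dvd_triv_left)
  qed
  ultimately have "(a + 1) div N = a div N"
    using assms by (intro int_div_pos_eq[where r="a mod N + 1"]) (auto simp: pos_mod_sign)
  then show ?thesis using False by simp
qed

text \<open>The elements counted are \<open>z + m * N\<close> with \<open>m\<close> between the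
  ceiling of \<open>(1 - z) / N\<close> and the floor of \<open>(n - z) / N\<close>; that ceiling is
  the negative of \<open>(z - 1) div N\<close>.\<close>

lemma res_formula:
  assumes "N > 0"
  shows "int (res n N z) = (int n - z) div int N + (z - 1) div int N + 1"
proof (induction n)
  case 0
  have "(z - 1 + 1) div int N = (z - 1) div int N + (if int N dvd z then 1 else 0)"
    using div_add_one[of "int N" "z - 1"] assms by simp
  then show ?case using assms zdiv_zminus1_eq_if[of "int N" z] by (auto simp: res_def dvd_eq_mod_eq_0)
next
  case (Suc n)
  have "{p \<in> {1..Suc n}. [int p = z] (mod int N)} = {p \<in> {1..n}. [int p = z] (mod int N)} \<union>
     (if [int (Suc n) = z] (mod int N) then {Suc n} else {})" by (auto simp: le_Suc_eq)
  then have 1: "res (Suc n) N z = res n N z + (if [int (Suc n) = z] (mod int N) then 1 else 0)"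
    by (simp add: res_def)
  have "[int (Suc n) = z] (mod int N) \<longleftrightarrow> int N dvd (int n - z + 1)"
    by (simp add: cong_iff_dvd_diff algebra_simps)
  then show ?case using 1 Suc div_add_one[of "int N" "int n - z"] assms by (simp add: algebra_simps)
qed

text \<open>In this form the limit is visible: with \<open>z\<close> close to \<open>t * N\<close>
  and \<open>n / N\<close> close to \<theta> the two floors become those of
  \<open>rho\<close>.\<close>

lemma res_floor:
  assumes "N > 0"
  shows "real (res n N z) = of_int \<lfloor>(real n - of_int z) / real N\<rfloor> + of_int \<lfloor>(of_int z - 1) / real N\<rfloor> + 1"
proof -
  have "\<lfloor>(real n - of_int z) / real N\<rfloor> = (int n - z) div int N"
    using floor_divide_of_int_eq[of "int n - z" "int N", where 'a=real] by simp
  moreover have "\<lfloor>(of_int z - 1) / real N\<rfloor> = (z - 1) div int N"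
    using floor_divide_of_int_eq[of "z - 1" "int N", where 'a=real] by simp
  moreover have "real (res n N z) = of_int (int (res n N z))" by simp
  ultimately show ?thesis using res_formula[OF assms, of n z] by simp
qed

lemma res_le:
  assumes "N > 0"
  shows "real (res n N z) \<le> real n / real N + 1"
proof -
  have "real (res n N z) \<le> (real n - of_int z) / real N + (of_int z - 1) / real N + 1"
    unfolding res_floor[OF assms] by (intro add_mono) auto
  also have "\<dots> \<le> real n / real N + 1" using assms by (simp add: field_simps)
  finally show ?thesis .
qed

definition circ :: "nat \<Rightarrow> nat \<Rightarrow> (nat \<Rightarrow> nat) set" where
  "circ h n = {\<pi> \<in> {0..h} \<rightarrow>\<^sub>E {1..n}. \<pi> 0 = \<pi> h}"

lemma finite_circ [simp]: "finite (circ h n)"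
  unfolding circ_def by (rule finite_subset[OF _ finite_PiE[of "{0..h}" "\<lambda>_. {1..n}"]]) auto

text \<open>Split by the residue \<open>y\<close> of the starting point. The link values then force
  the residue of every vertex, the closing congruence is the only consistency condition, and each
  vertex before \<open>h\<close> is free within its residue class, the last vertex being a copy of
  the first.\<close>

lemma card_circ_links:
  assumes N: "N > 0" and h: "h > 0" and l: "\<And>i. i < h \<Longrightarrow> l i < N"
  shows "card {\<pi> \<in> circ h n. \<forall>i<h. (\<pi> i + \<pi> (Suc i)) mod N = l i} =
    (\<Sum>y<N. if [walk (int y) (\<lambda>i. int (l i)) h = int y] (mod int N)
       then \<Prod>i<h. res n N (walk (int y) (\<lambda>i. int (l i)) i) else 0)"
proof -
  let ?w = "\<lambda>y. walk (int y) (\<lambda>i. int (l i))"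
  define Y where "Y = {y\<in>{..<N}. [?w y h = int y] (mod int N)}"
  define S where "S y = {\<pi> \<in> circ h n. \<forall>i<h. [int (\<pi> i) = ?w y i] (mod int N)}" for y
  have modl: "((a + b) mod N = l i) \<longleftrightarrow> [int a + int b = int (l i)] (mod int N)" if "i < h" for a b i
    proof -
    have "[int a + int b = int (l i)] (mod int N) \<longleftrightarrow> [a + b = l i] (mod N)"
      using cong_int_iff[of "a + b" "l i" N] by simp
    then show ?thesis using l[OF that] by (simp add: cong_def)
  qed
  have eq: "{\<pi> \<in> circ h n. \<forall>i<h. (\<pi> i + \<pi> (Suc i)) mod N = l i} = (\<Union>y\<in>Y. S y)"
  proof (intro subset_antisym subsetI)
    fix \<pi> assume "\<pi> \<in> {\<pi> \<in> circ h n. \<forall>i<h. (\<pi> i + \<pi> (Suc i)) mod N = l i}"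
    then have c: "\<pi> \<in> circ h n" and lk: "\<And>i. i < h \<Longrightarrow> [int (\<pi> i) + int (\<pi> (Suc i)) = int (l i)] (mod int N)"
      using modl by auto
    define y where "y = \<pi> 0 mod N"
    have w: "[int (\<pi> i) = ?w y i] (mod int N)" if "i \<le> h" for i
      using that
    proof (induction i)
      case 0
      then show ?case by (simp add: y_def cong_def zmod_int)
    next
      case (Suc i)
      have "[int (\<pi> i) + int (\<pi> (Suc i)) - int (\<pi> i) = int (l i) - ?w y i] (mod int N)"
        using Suc lk[of i] by (intro cong_diff) auto
      then show ?case by simp
    qed
    have "\<pi> h = \<pi> 0" using c by (simp add: circ_def)
    then have "[?w y h = int y] (mod int N)"
      using cong_trans[OF cong_sym[OF w[of h]], of "int y"] w[of 0] by simp
    then have "y \<in> Y" using N by (simp add: Y_def y_def)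
    moreover have "\<pi> \<in> S y" using c w by (simp add: S_def)
    ultimately show "\<pi> \<in> (\<Union>y\<in>Y. S y)" by blast
  next
    fix \<pi> assume "\<pi> \<in> (\<Union>y\<in>Y. S y)"
    then obtain y where y: "y \<in> Y" "\<pi> \<in> S y" by blast
    then have c: "\<pi> \<in> circ h n" and w: "\<And>i. i < h \<Longrightarrow> [int (\<pi> i) = ?w y i] (mod int N)" by (auto simp: S_def)
    have "\<pi> h = \<pi> 0" using c by (simp add: circ_def)
    then have "[int (\<pi> h) = ?w y h] (mod int N)"
      using cong_trans[of "int (\<pi> h)" "int y" "int N" "?w y h"] cong_sym[of "?w y h" "int y" "int N"] w[OF
        h] y(1)
      by (simp add: Y_def)
    \<comment> \<open>At the last vertex the congruence comes from closure; the definition of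
      \<open>S y\<close> stops before \<open>h\<close>.\<close>
    then have w': "\<And>i. i \<le> h \<Longrightarrow> [int (\<pi> i) = ?w y i] (mod int N)" using w le_neq_implies_less by blast
    have "[int (\<pi> i) + int (\<pi> (Suc i)) = int (l i)] (mod int N)" if "i < h" for i
      using cong_add[OF w'[of i] w'[of "Suc i"]] that by simp
    then show "\<pi> \<in> {\<pi> \<in> circ h n. \<forall>i<h. (\<pi> i + \<pi> (Suc i)) mod N = l i}" using c modl by auto
  qed
  have fin: "finite (S y)" for y unfolding S_def by simp
  have disj: "S y \<inter> S y' = {}" if "y \<in> Y" "y' \<in> Y" "y \<noteq> y'" for y y'
  proof (rule ccontr)
    assume "S y \<inter> S y' \<noteq> {}"
    then obtain \<pi> where "\<pi> \<in> S y" "\<pi> \<in> S y'" by blast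
    then have "[int (\<pi> 0) = int y] (mod int N)" "[int (\<pi> 0) = int y'] (mod int N)"
      using h unfolding S_def by (auto dest!: spec[of _ 0])
    then have "[int y = int y'] (mod int N)" using cong_sym cong_trans by blast
    then show False using that by (auto simp: Y_def cong_int_iff cong_def)
  qed
  have card: "card (S y) = (\<Prod>i<h. res n N (?w y i))" if "y \<in> Y" for y
  proof -
    define B where "B i = {p \<in> {1..n}. [int p = ?w y i] (mod int N)}" for i
    \<comment> \<open>A circuit is determined by its vertices before \<open>h\<close>.\<close>
    have "bij_betw (\<lambda>\<pi>. restrict \<pi> {..<h}) (S y) (PiE {..<h} B)"
    proof (rule bij_betw_byWitness[where f'="\<lambda>\<rho>. \<rho>(h := \<rho> 0)"])
      show "\<forall>\<pi>\<in>S y. (restrict \<pi> {..<h})(h := restrict \<pi> {..<h} 0) = \<pi>"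
      proof
        fix \<pi> assume "\<pi> \<in> S y"
        then have "\<pi> \<in> {0..h} \<rightarrow>\<^sub>E {1..n}" "\<pi> 0 = \<pi> h" by (auto simp: S_def circ_def)
        then show "(restrict \<pi> {..<h})(h := restrict \<pi> {..<h} 0) = \<pi>"
          using h by (auto simp: fun_eq_iff PiE_iff extensional_def)
      qed
      show "\<forall>\<rho>\<in>PiE {..<h} B. restrict (\<rho>(h := \<rho> 0)) {..<h} = \<rho>"
        by (auto simp: fun_eq_iff PiE_iff extensional_def)
      show "(\<lambda>\<pi>. restrict \<pi> {..<h}) ` S y \<subseteq> PiE {..<h} B"
        by (intro image_subsetI, unfold restrict_PiE_iff) (auto simp: S_def circ_def B_def PiE_iff)
      show "(\<lambda>\<rho>. \<rho>(h := \<rho> 0)) ` PiE {..<h} B \<subseteq> S y"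
      proof (intro image_subsetI)
        fix \<rho> assume \<rho>: "\<rho> \<in> PiE {..<h} B"
        have B: "\<rho> i \<in> {1..n}" "[int (\<rho> i) = ?w y i] (mod int N)" if "i < h" for i
          using PiE_mem[OF \<rho>, of i] that by (simp_all add: B_def)
        have "\<rho>(h := \<rho> 0) \<in> {0..h} \<rightarrow>\<^sub>E {1..n}"
        proof (rule PiE_I)
          show "(\<rho>(h := \<rho> 0)) i \<in> {1..n}" if "i \<in> {0..h}" for i
            using B(1)[of i] B(1)[OF h] that by (cases "i = h") simp_all
          show "(\<rho>(h := \<rho> 0)) i = undefined" if "i \<notin> {0..h}" for i
            using PiE_arb[OF \<rho>, of i] that by simp
        qed
        then show "\<rho>(h := \<rho> 0) \<in> S y"
          using B(2) h unfolding S_def circ_def by simp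
      qed
    qed
    then have "card (S y) = card (PiE {..<h} B)" by (rule bij_betw_same_card)
    then show ?thesis by (simp add: card_PiE B_def res_def)
  qed
  have "card (\<Union>y\<in>Y. S y) = (\<Sum>y\<in>Y. card (S y))"
    by (rule card_UN_disjoint) (use fin disj in \<open>auto simp: Y_def\<close>)
  also have "\<dots> = (\<Sum>y\<in>Y. \<Prod>i<h. res n N (?w y i))" using card by simp
  also have "\<dots> = (\<Sum>y<N. if [?w y h = int y] (mod int N) then \<Prod>i<h. res n N (?w y i) else 0)"
    unfolding Y_def by (rule sum.inter_filter) simp
  finally show ?thesis using eq by simp
qed

section \<open>Linear congruences modulo the period\<close>

lemma card_linear_cong_pos:
  fixes c d :: int
  assumes N: "N > 0" and c: "c > 0"
  shows "card {x \<in> {..<N}. int N dvd c * int x + d} \<le> nat c"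
proof -
  define S where "S = {x \<in> {..<N}. int N dvd c * int x + d}"
  \<comment> \<open>The quotient is injective in \<open>x\<close>, and its values lie in a window of
    length \<open>c\<close>, because \<open>c * x\<close> varies by less than \<open>c * N\<close>.
    Hence the bound \<open>c\<close> for any modulus.\<close>
  define q where "q x = (c * int x + d) div int N" for x
  have q: "c * int x + d = int N * q x" if "x \<in> S" for x
    using that by (auto simp: S_def q_def)
  have inj: "inj_on q S"
  proof (rule inj_onI)
    fix x x' assume "x \<in> S" "x' \<in> S" "q x = q x'"
    then have "c * int x = c * int x'" using q by (metis add_right_cancel)
    then show "x = x'" using c by simp
  qed
  show ?thesis
  proof (cases "S = {}")
    case True then show ?thesis unfolding S_def[symmetric] by simp
  next
    case False
    have fin: "finite S" by (simp add: S_def)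
    define x0 where "x0 = Min S"
    have x0: "x0 \<in> S" "\<And>x. x \<in> S \<Longrightarrow> x0 \<le> x" using False fin by (auto simp: x0_def)
    have "q x \<in> {q x0..<q x0 + c}" if "x \<in> S" for x
    proof -
      have "int N * (q x - q x0) = c * (int x - int x0)" using q[OF that] q[OF x0(1)]
        by (simp add: algebra_simps)
      moreover have "c * (int x - int x0) \<ge> 0" using c x0(2)[OF that] by simp
      moreover have "c * (int x - int x0) < c * int N" using c that by (simp add: S_def)
      ultimately have "0 \<le> int N * (q x - q x0)" "int N * (q x - q x0) < int N * c"
        by (simp_all add: mult.commute)
      then show ?thesis using N by (auto simp: zero_le_mult_iff)
    qed
    then have "q ` S \<subseteq> {q x0..<q x0 + c}" by blast
    then have "card (q ` S) \<le> card {q x0..<q x0 + c}" by (rule card_mono[rotated]) simp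
    then show ?thesis using card_image[OF inj] by (simp add: S_def)
  qed
qed

lemma card_linear_cong:
  fixes c d :: int
  assumes N: "N > 0" and c: "c \<noteq> 0"
  shows "card {x \<in> {..<N}. int N dvd c * int x + d} \<le> nat \<bar>c\<bar>"
proof (cases "c > 0")
  case True then show ?thesis using card_linear_cong_pos[OF N True, of d] by simp
next
  case False
  have "int N dvd c * int x + d \<longleftrightarrow> int N dvd (-c) * int x + (-d)" for x
    by (metis add.inverse_distrib_swap add.commute dvd_minus_iff mult_minus_left)
  then show ?thesis using card_linear_cong_pos[OF N, of "-c" "-d"] c False by simp
qed

text \<open>For fixed values of the other unknowns the congruence leaves at most
  \<open>\<bar>c r\<bar>\<close> values of \<open>v r\<close>. The set \<open>A\<close> carries what
  is already known about the others, so that the step can be iterated.\<close>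

lemma card_linear_step:
  fixes c :: "'i \<Rightarrow> int"
  assumes N: "N > 0" and R: "finite R" "r \<notin> R" and c: "c r \<noteq> 0"
    and A: "A \<subseteq> R \<rightarrow>\<^sub>E {..<N}"
  shows "card {v \<in> insert r R \<rightarrow>\<^sub>E {..<N}. restrict v R \<in> A \<and> int N dvd (\<Sum>a\<in>insert r R. c a * int (v a))}
     \<le> nat \<bar>c r\<bar> * card A"
proof -
  have finA: "finite A" using A by (rule finite_subset) (intro finite_PiE R, simp)
  define B where "B u = {x \<in> {..<N}. int N dvd c r * int x + (\<Sum>a\<in>R. c a * int (u a))}" for u
  have "{v \<in> insert r R \<rightarrow>\<^sub>E {..<N}. restrict v R \<in> A \<and> int N dvd (\<Sum>a\<in>insert r R. c a * int (v a))}
     \<subseteq> (\<lambda>(u,x). u(r := x)) ` (SIGMA u:A. B u)"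
  proof
    fix v assume v: "v \<in> {v \<in> insert r R \<rightarrow>\<^sub>E {..<N}. restrict v R \<in> A
      \<and> int N dvd (\<Sum>a\<in>insert r R. c a * int (v a))}"
    have "v = (restrict v R)(r := v r)" using v by (auto simp: fun_eq_iff PiE_iff extensional_def)
    moreover have "v r \<in> B (restrict v R)"
    proof -
      have "v r < N" using v by (auto simp: PiE_iff)
      moreover have "(\<Sum>a\<in>insert r R. c a * int (v a)) = c r * int (v r) + (\<Sum>a\<in>R. c a * int (restrict v R a))"
        using R by simp
      ultimately show ?thesis using v by (simp add: B_def)
    qed
    ultimately show "v \<in> (\<lambda>(u,x). u(r := x)) ` (SIGMA u:A. B u)" using v
      by (intro image_eqI[of _ _ "(restrict v R, v r)"]) auto
  qed
  moreover have fin: "finite (SIGMA u:A. B u)" using finA by (intro finite_SigmaI) (auto simp: B_def)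
  ultimately have "card {v \<in> insert r R \<rightarrow>\<^sub>E {..<N}. restrict v R \<in> A
    \<and> int N dvd (\<Sum>a\<in>insert r R. c a * int (v a))}
     \<le> card (SIGMA u:A. B u)"
    by (meson card_image_le card_mono finite_imageI order_trans)
  also have "\<dots> = (\<Sum>u\<in>A. card (B u))" using finA by (intro card_SigmaI) (auto simp: B_def)
  also have "\<dots> \<le> (\<Sum>u\<in>A. nat \<bar>c r\<bar>)" unfolding B_def by (intro sum_mono card_linear_cong N c)
  finally show ?thesis by (simp add: mult.commute)
qed

lemma card_linear_one:
  fixes c :: "'i \<Rightarrow> int"
  assumes N: "N > 0" and R: "finite R" "r \<in> R" and c: "c r \<noteq> 0"
  shows "card {v \<in> R \<rightarrow>\<^sub>E {..<N}. int N dvd (\<Sum>a\<in>R. c a * int (v a))} \<le> nat \<bar>c r\<bar> * N ^ (card R - 1)"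
proof -
  define R' where "R' = R - {r}"
  have R': "R = insert r R'" "r \<notin> R'" "finite R'" using R by (auto simp: R'_def)
  have "{v \<in> R \<rightarrow>\<^sub>E {..<N}. int N dvd (\<Sum>a\<in>R. c a * int (v a))} =
    {v \<in> insert r R' \<rightarrow>\<^sub>E {..<N}. restrict v R' \<in> R' \<rightarrow>\<^sub>E {..<N} \<and> int N dvd (\<Sum>a\<in>insert r R'. c a * int (v a))}"
    unfolding R'(1) by (auto simp: PiE_iff)
  also have "card \<dots> \<le> nat \<bar>c r\<bar> * card (R' \<rightarrow>\<^sub>E {..<N})"
    by (rule card_linear_step[where c=c, OF N R'(3,2) c]) simp
  finally show ?thesis using R' by (simp add: card_PiE)
qed

text \<open>A triangular system: \<open>r\<close> is absent from the second congruence, which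
  restricts the remaining unknowns by itself; the first congruence then restricts
  \<open>v r\<close>. Two factors \<open>N\<close> are saved.\<close>

lemma card_linear_two:
  fixes c :: "'i \<Rightarrow> int"
  assumes N: "N > 0" and R: "finite R" "r \<in> R" "r' \<in> R" and c: "c r \<noteq> 0" "c' r = 0" "c' r' \<noteq> 0"
  shows "card {v \<in> R \<rightarrow>\<^sub>E {..<N}. int N dvd (\<Sum>a\<in>R. c a * int (v a)) \<and> int N dvd (\<Sum>a\<in>R. c' a * int (v a))}
    \<le> nat \<bar>c r\<bar> * (nat \<bar>c' r'\<bar> * N ^ (card R - 2))"
proof -
  define R' where "R' = R - {r}"
  have R': "R = insert r R'" "r \<notin> R'" "finite R'" using R by (auto simp: R'_def)
  have r': "r' \<in> R'" using R c by (auto simp: R'_def)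
  define A where "A = {v \<in> R' \<rightarrow>\<^sub>E {..<N}. int N dvd (\<Sum>a\<in>R'. c' a * int (v a))}"
  have "{v \<in> R \<rightarrow>\<^sub>E {..<N}. int N dvd (\<Sum>a\<in>R. c a * int (v a)) \<and> int N dvd (\<Sum>a\<in>R. c' a * int (v a))} \<subseteq>
    {v \<in> insert r R' \<rightarrow>\<^sub>E {..<N}. restrict v R' \<in> A \<and> int N dvd (\<Sum>a\<in>insert r R'. c a * int (v a))}"
    unfolding R'(1) A_def using R' c by (auto simp: PiE_iff)
  then have "card {v \<in> R \<rightarrow>\<^sub>E {..<N}. int N dvd (\<Sum>a\<in>R. c a * int (v a)) \<and> int N dvd (\<Sum>a\<in>R. c' a * int (v a))}
    \<le> card {v \<in> insert r R' \<rightarrow>\<^sub>E {..<N}. restrict v R' \<in> A \<and> int N dvd (\<Sum>a\<in>insert r R'. c a * int (v a))}"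
    by (rule card_mono[rotated]) (rule finite_subset[OF _ finite_PiE[of "insert r R'" "\<lambda>_. {..<N}"]], use
      R' in auto)
  also have "\<dots> \<le> nat \<bar>c r\<bar> * card A"
    by (rule card_linear_step[where c=c, OF N R'(3,2) c(1)]) (auto simp: A_def)
  also have "card A \<le> nat \<bar>c' r'\<bar> * N ^ (card R' - 1)"
    unfolding A_def by (rule card_linear_one[where c=c', OF N R'(3) r' c(3)])
  finally show ?thesis using R' by (simp add: numeral_2_eq_2)
qed

section \<open>Words\<close>

lemma is_word_snoc: "is_word (w @ [a]) \<longleftrightarrow> is_word w \<and> (a \<in> set w \<or> a = card (set w))"
  by (auto simp: is_word_def nth_append less_Suc_eq)

lemma is_word_set: "is_word w \<Longrightarrow> set w = {..<card (set w)}"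
proof (induction w rule: rev_induct)
  case (snoc a w)
  then have w: "set w = {..<card (set w)}" "a \<in> set w \<or> a = card (set w)" by (auto simp: is_word_snoc)
  show ?case
  proof (cases "a \<in> set w")
    case True
    then have "set (w @ [a]) = set w" by auto
    then show ?thesis using w(1) by (simp only:)
  next
    case False
    then have a: "a = card (set w)" using w by simp
    have c: "card (set (w @ [a])) = Suc (card (set w))" using False by simp
    have s: "set w = {..<a}" using w(1) unfolding a[symmetric] .
    show ?thesis unfolding c a[symmetric] by (simp add: s lessThan_Suc)
  qed
qed simp

lemma count_list_card: "count_list w a = card {i. i < length w \<and> w ! i = a}"
  by (simp add: count_list_eq_length_filter length_filter_conv_card eq_commute)

lemma pair_matched_set:
  assumes "w \<in> pair_matched_words k"
  shows "set w = {..<k}"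
proof -
  have "length w = (\<Sum>a\<in>set w. count_list w a)"
    using sum_count_set[of w "set w"] by simp
  also have "\<dots> = 2 * card (set w)" using assms by (simp add: pair_matched_words_def)
  finally have "card (set w) = k" using assms by (simp add: pair_matched_words_def)
  then show ?thesis using is_word_set[of w] assms by (simp add: pair_matched_words_def)
qed

text \<open>Deleting the first letter of the alphabet and renaming keeps letters in order of
  appearance; this is the inductive step for counting words.\<close>

lemma is_word_drop_zero: "is_word w \<Longrightarrow> is_word (map (\<lambda>x. x - 1) (filter (\<lambda>x. x \<noteq> 0) w))"
proof (induction w rule: rev_induct)
  case (snoc a w)
  then have w: "is_word w" "a \<in> set w \<or> a = card (set w)" by (auto simp: is_word_snoc)
  define u where "u = map (\<lambda>x. x - 1) (filter (\<lambda>x. x \<noteq> 0) w)"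
  have u: "is_word u" unfolding u_def using snoc w by simp
  have su: "set u = (\<lambda>x. x - 1) ` (set w - {0})" by (auto simp: u_def)
  have "(\<lambda>x. x - 1) ` ({..<c} - {0}) = {..<c - 1}" for c :: nat
  proof (intro subset_antisym subsetI)
    fix x assume "x \<in> {..<c - 1}"
    then show "x \<in> (\<lambda>x. x - 1) ` ({..<c} - {0})" by (intro image_eqI[of _ _ "Suc x"]) auto
  qed auto
  then have su': "set u = {..<card (set w) - 1}" using su is_word_set[OF w(1)] by metis
  show ?case
  proof (cases "a = 0")
    case True then show ?thesis using u by (simp add: u_def)
  next
    case False
    have "a - 1 \<in> set u \<or> a - 1 = card (set u)"
    proof -
      have "card (set u) = card (set w) - 1" unfolding su' by simp
      moreover have "a - 1 \<in> set u" if "a \<in> set w" unfolding su using that False by blast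
      ultimately show ?thesis using w(2) by metis
    qed
    then show ?thesis using False u is_word_snoc[of u "a - 1"] by (simp add: u_def)
  qed
qed (simp add: is_word_def)

lemma eq_of_filter_nonzero:
  fixes w w' :: "nat list"
  assumes "length w = length w'" "\<And>i. i < length w \<Longrightarrow> (w ! i = 0) = (w' ! i = 0)"
    "filter (\<lambda>x. x \<noteq> 0) w = filter (\<lambda>x. x \<noteq> 0) w'"
  shows "w = w'"
  using assms
proof (induction w w' rule: list_induct2)
  case (Cons x xs y ys)
  have "(x = 0) = (y = 0)" using Cons.prems(1)[of 0] by simp
  moreover have "(xs ! i = 0) = (ys ! i = 0)" if "i < length xs" for i
    using Cons.prems(1)[of "Suc i"] that by simp
  ultimately show ?case using Cons.IH Cons.prems(2) by (cases "x = 0") auto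
qed simp

text \<open>The exact number is the product of the odd numbers below \<open>2 * k\<close>. The first
  position carries the letter 0, its partner has fewer than \<open>2 * Suc k\<close> places, and the
  other positions form a pair-matched word with one letter less. This factorial growth is slow
  enough for \<open>moment_growth\<close>.\<close>

lemma card_pair_matched_le: "card (pair_matched_words k) \<le> 2 ^ k * fact k"
proof (induction k)
  case 0
  have "pair_matched_words 0 \<subseteq> {[]}" by (auto simp: pair_matched_words_def)
  then have "card (pair_matched_words 0) \<le> card {[]::nat list}" by (rule card_mono[rotated]) simp
  then show ?case by simp
next
  case (Suc k)
  define Z where "Z w = {i. i < length w \<and> w ! i = 0}" for w :: "nat list"
  define U where "U w = map (\<lambda>x. x - 1) (filter (\<lambda>x. x \<noteq> 0) w)" for w :: "nat list"
  let ?J = "(\<lambda>j. {0, j}) ` {1..<2 * Suc k}"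
  have Zcard: "card (Z w) = 2" and Zin: "Z w \<in> ?J" if w: "w \<in> pair_matched_words (Suc k)" for w
  proof -
    have 0: "0 \<in> set w" using pair_matched_set[OF w] by simp
    then show c: "card (Z w) = 2" using w unfolding pair_matched_words_def Z_def
      count_list_card[symmetric] by blast
    have "w \<noteq> []" using 0 by auto
    have "is_word w" using w by (simp add: pair_matched_words_def)
    then have w0: "w ! 0 = 0" using \<open>w \<noteq> []\<close> \<open>is_word w\<close>[unfolded is_word_def, rule_format, of 0] by simp
    then have "0 \<in> Z w" using \<open>w \<noteq> []\<close> by (simp add: Z_def)
    then have "card (Z w - {0}) = 1" using c by simp
    then obtain j where j: "Z w - {0} = {j}" by (rule card_1_singletonE)
    have "j \<in> Z w - {0}" unfolding j by simp
    then have "j \<noteq> 0" by simp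
    moreover have "Z w = {0, j}" using insert_Diff[OF \<open>0 \<in> Z w\<close>] unfolding j by (rule sym)
    moreover have "j < 2 * Suc k"
    proof -
      have "j \<in> Z w" using calculation by simp
      then show ?thesis using w by (auto simp: Z_def pair_matched_words_def)
    qed
    ultimately show "Z w \<in> ?J" by (intro image_eqI[of _ _ j]) simp_all
  qed
  have U: "U w \<in> pair_matched_words k" if w: "w \<in> pair_matched_words (Suc k)" for w
  proof -
    have l: "length w = 2 * Suc k" and c: "\<And>a. a \<in> set w \<Longrightarrow> count_list w a = 2" and iw: "is_word w"
      using w by (auto simp: pair_matched_words_def)
    have "length (filter (\<lambda>x. x \<noteq> 0) w) = length w - length (filter (\<lambda>x. x = 0) w)"
      using sum_length_filter_compl[of "\<lambda>x. x = 0" w] by simp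
    also have "length (filter (\<lambda>x. x = 0) w) = 2"
      using Zcard[OF w] by (simp add: Z_def length_filter_conv_card)
    finally have "length (U w) = 2 * k" using l by (simp add: U_def)
    moreover have "is_word (U w)" unfolding U_def by (rule is_word_drop_zero[OF iw])
    moreover have "count_list (U w) a = 2" if "a \<in> set (U w)" for a
    proof -
      have "Suc a \<in> set w" using that by (auto simp: U_def)
      moreover have "count_list (U w) a = count_list w (Suc a)"
        unfolding U_def count_list_eq_length_filter filter_map filter_filter length_map o_def
        by (rule arg_cong[where f=length], rule filter_cong) auto
      ultimately show ?thesis using c by simp
    qed
    ultimately show ?thesis by (simp add: pair_matched_words_def)
  qed
  have "inj_on (\<lambda>w. (Z w, U w)) (pair_matched_words (Suc k))"
  proof (rule inj_onI)
    fix w w' assume w: "w \<in> pair_matched_words (Suc k)" "w' \<in> pair_matched_words (Suc k)"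
      and eq: "(Z w, U w) = (Z w', U w')"
    have l: "length w = length w'" using w by (simp add: pair_matched_words_def)
    have "map Suc (U v) = filter (\<lambda>x. x \<noteq> 0) v" for v :: "nat list"
      unfolding U_def map_map o_def by (rule map_idI) auto
    then have f: "filter (\<lambda>x. x \<noteq> 0) w = filter (\<lambda>x. x \<noteq> 0) w'" using eq by (metis Pair_inject)
    have z: "Z w = Z w'" using eq by simp
    have "(w ! i = 0) = (w' ! i = 0)" if "i < length w" for i
    proof -
      have "i \<in> Z w \<longleftrightarrow> i \<in> Z w'" using z by simp
      then show ?thesis using that l by (simp add: Z_def)
    qed
    then show "w = w'" using eq_of_filter_nonzero[OF l _ f] by blast
  qed
  then have "card (pair_matched_words (Suc k)) = card ((\<lambda>w. (Z w, U w)) ` pair_matched_words (Suc k))"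
    by (simp add: card_image)
  also have "\<dots> \<le> card (?J \<times> pair_matched_words k)"
    by (rule card_mono) (use Zin U in \<open>auto simp: finite_pair_matched_words\<close>)
  also have "\<dots> \<le> (2 * Suc k) * card (pair_matched_words k)"
  proof -
    have "card ?J \<le> 2 * Suc k" using card_image_le[of "{1..<2 * Suc k}" "\<lambda>j. {0::nat, j}"] by simp
    then show ?thesis unfolding card_cartesian_product by (rule mult_right_mono) simp
  qed
  also have "\<dots> \<le> (2 * Suc k) * (2 ^ k * fact k)" using Suc by (intro mult_left_mono) auto
  finally show ?case by (simp add: algebra_simps)
qed

section \<open>Words as canonical names of set partitions\<close>

lemma card_image_same_kernel:
  assumes "\<And>i j. i \<in> A \<Longrightarrow> j \<in> A \<Longrightarrow> f i = f j \<longleftrightarrow> g i = g j"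
  shows "card (f ` A) = card (g ` A)"
proof -
  define h where "h y = g (SOME x. x \<in> A \<and> f x = y)" for y
  have h: "h (f x) = g x" if "x \<in> A" for x
  proof -
    have "(SOME z. z \<in> A \<and> f z = f x) \<in> A \<and> f (SOME z. z \<in> A \<and> f z = f x) = f x"
      by (rule someI[of _ x]) (use that in simp)
    then show ?thesis using assms that unfolding h_def by blast
  qed
  have "bij_betw h (f ` A) (g ` A)"
    unfolding bij_betw_def inj_on_def using h assms by (auto simp: image_iff)
  then show ?thesis by (rule bij_betw_same_card)
qed

text \<open>From left to right, an old letter is copied from its earlier position and a new one is
  the number of letters used so far, so the partition of the positions fixes the word.\<close>

lemma word_unique:
  assumes "is_word w" "is_word w'" "length w = length w'"
    "\<And>i j. i < length w \<Longrightarrow> j < length w \<Longrightarrow> w ! i = w ! j \<longleftrightarrow> w' ! i = w' ! j"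
  shows "w = w'"
proof (rule nth_equalityI[OF assms(3)])
  fix i assume "i < length w"
  then show "w ! i = w' ! i"
  proof (induction i rule: less_induct)
    case (less i)
    have t: "take i w = take i w'" using less assms(3) by (intro nth_equalityI) auto
    have i': "i < length w'" using less assms(3) by simp
    show ?case
    proof (cases "w ! i \<in> set (take i w)")
      case True
      then obtain j where j: "j < i" "w ! j = w ! i" using less.prems by (auto simp: in_set_conv_nth)
      then have "w' ! j = w' ! i" using assms(4)[of j i] less.prems by simp
      then show ?thesis using less.IH[of j] j less.prems by simp
    next
      case False
      have "w' ! i \<notin> set (take i w')"
      proof
        assume "w' ! i \<in> set (take i w')"
        then obtain j where j: "j < i" "w' ! j = w' ! i" using i' by (auto simp: in_set_conv_nth)
        then have "w ! j = w ! i" using assms(4)[of j i] less.prems by simp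
        then show False using False j less.prems by (auto simp: in_set_conv_nth)
      qed
      then show ?thesis using False assms(1,2) less.prems i' t unfolding is_word_def by metis
    qed
  qed
qed

text \<open>The letter at \<open>i\<close> is the number of distinct values before the first
  occurrence \<open>f i\<close> of the value \<open>l i\<close>.\<close>

lemma word_of_kernel:
  fixes l :: "nat \<Rightarrow> 'b"
  shows "\<exists>w. length w = h \<and> is_word w \<and> (\<forall>i<h. \<forall>j<h. w ! i = w ! j \<longleftrightarrow> l i = l j)"
proof -
  define f where "f i = (LEAST j. l j = l i)" for i
  have f1: "l (f i) = l i" for i unfolding f_def by (rule LeastI[of "\<lambda>j. l j = l i" i]) simp
  have f2: "f i \<le> i" for i unfolding f_def by (rule Least_le[of "\<lambda>j. l j = l i" i]) simp
  have f3: "l j \<noteq> l i" if "j < f i" for i j using not_less_Least[of j "\<lambda>j. l j = l i"] that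
    unfolding f_def by simp
  have f4: "f i = f j" if "l i = l j" for i j using that by (simp add: f_def)
  define c where "c i = card (l ` {..<f i})" for i
  have c: "c i = c j \<longleftrightarrow> l i = l j" for i j
  proof
    have *: "c i < c j" if "f i < f j" for i j
    proof -
      have "l i \<notin> l ` {..<f i}"
      proof
        assume "l i \<in> l ` {..<f i}"
        then obtain x where "x < f i" "l i = l x" by blast
        then show False using f3[of x i] by simp
      qed
      moreover have "l i \<in> l ` {..<f j}" using that f1[of i] by (intro image_eqI[of _ _ "f i"]) auto
      moreover have "l ` {..<f i} \<subseteq> l ` {..<f j}" using that by (intro image_mono) auto
      ultimately show ?thesis unfolding c_def by (intro psubset_card_mono) auto
    qed
    assume "c i = c j"
    then have "f i = f j" using *[of i j] *[of j i] by (cases "f i" "f j" rule: linorder_cases) auto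
    then show "l i = l j" using f1[of i] f1[of j] by simp
  next
    assume "l i = l j"
    then have "f i = f j" by (rule f4)
    then show "c i = c j" by (simp add: c_def)
  qed
  define w where "w = map c [0..<h]"
  have w: "w ! i = c i" if "i < h" for i using that by (simp add: w_def)
  have "is_word w" unfolding is_word_def
  proof (intro allI impI)
    fix i assume "i < length w"
    then have i: "i < h" by (simp add: w_def)
    have st: "set (take i w) = c ` {..<i}" using i by (auto simp: w_def take_map lessThan_atLeast0)
    show "w ! i \<in> set (take i w) \<or> w ! i = card (set (take i w))"
    proof (cases "f i < i")
      case True
      then show ?thesis unfolding st w[OF i] using c[of i "f i"] f1[of i]
        by (intro disjI1 image_eqI[of _ _ "f i"]) auto
    next
      case False
      then have "f i = i" using f2[of i] by simp
      then have "c i = card (l ` {..<i})" by (simp add: c_def)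
      also have "\<dots> = card (c ` {..<i})" by (rule card_image_same_kernel) (simp add: c)
      finally show ?thesis unfolding st w[OF i] by simp
    qed
  qed
  then show ?thesis using w c by (intro exI[of _ w]) (auto simp: w_def)
qed

text \<open>Only an implication, as in \<open>circuits\<close>: different letters may have equal
  values, so one sequence of values may be compatible with several words.\<close>

definition compat :: "nat list \<Rightarrow> (nat \<Rightarrow> nat) \<Rightarrow> bool" where
  "compat w l \<longleftrightarrow> (\<forall>i<length w. \<forall>j<length w. w ! i = w ! j \<longrightarrow> l i = l j)"

definition mult_of :: "(nat \<Rightarrow> nat) \<Rightarrow> nat \<Rightarrow> nat \<Rightarrow> nat" where
  "mult_of l h v = card {i. i < h \<and> l i = v}"

lemma pair_matched_partner:
  assumes "w \<in> pair_matched_words k" "i < 2 * k"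
  shows "card {j. j < 2 * k \<and> w ! j = w ! i} = 2"
  using assms count_list_card[of w "w ! i"] by (auto simp: pair_matched_words_def)

text \<open>This lemma and the next one serve to show that, unless there are few distinct values,
  the number of compatible words is 0 or 1 and equals the joint moment of centred variables of
  variance 1.\<close>

lemma no_compat_of_single:
  assumes "mult_of l (2 * k) (l i) = 1" "i < 2 * k"
  shows "{w \<in> pair_matched_words k. compat w l} = {}"
proof (rule ccontr)
  assume "{w \<in> pair_matched_words k. compat w l} \<noteq> {}"
  then obtain w where w: "w \<in> pair_matched_words k" "compat w l" by blast
  have len: "length w = 2 * k" using w by (simp add: pair_matched_words_def)
  have "l j = l i" if "j < 2 * k" "w ! j = w ! i" for j
    using w(2)[unfolded compat_def len, rule_format, of j i] that assms(2) by simp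
  then have "card {j. j < 2 * k \<and> w ! j = w ! i} \<le> mult_of l (2 * k) (l i)"
    unfolding mult_of_def by (intro card_mono) auto
  then have "2 \<le> mult_of l (2 * k) (l i)" using pair_matched_partner[OF w(1) assms(2)] by simp
  then show False using assms by simp
qed

text \<open>Each class of positions with equal letters lies in a class of positions with equal
  values; both have two elements, so the two partitions coincide.\<close>

lemma unique_compat_of_pairs:
  assumes "\<And>i. i < 2 * k \<Longrightarrow> mult_of l (2 * k) (l i) = 2"
  shows "card {w \<in> pair_matched_words k. compat w l} = 1"
proof -
  obtain w where w: "length w = 2 * k" "is_word w" "\<And>i j. i < 2 * k \<Longrightarrow> j < 2 * k \<Longrightarrow> w ! i = w ! j \<longleftrightarrow> l i = l j"
    using word_of_kernel[of "2 * k" l] by blast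
  have "count_list w a = 2" if a: "a \<in> set w" for a
  proof -
    obtain i where i: "i < 2 * k" "a = w ! i" using a w(1) unfolding in_set_conv_nth by auto
    then have "{j. j < 2 * k \<and> w ! j = a} = {j. j < 2 * k \<and> l j = l i}" using w(3) by auto
    then show ?thesis using assms[OF i(1)] by (simp add: count_list_card w(1) mult_of_def)
  qed
  then have wp: "w \<in> pair_matched_words k" using w by (simp add: pair_matched_words_def)
  have uniq: "w' = w" if w': "w' \<in> pair_matched_words k" "compat w' l" for w'
  proof (rule word_unique)
    have len: "length w' = 2 * k" using w' by (simp add: pair_matched_words_def)
    show "is_word w'" "is_word w" using w' w by (simp_all add: pair_matched_words_def)
    show "length w' = length w" using len w by simp
    fix i j assume "i < length w'" "j < length w'"
    then have ij: "i < 2 * k" "j < 2 * k" using len by auto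
    have "{m. m < 2 * k \<and> w' ! m = w' ! j} = {m. m < 2 * k \<and> l m = l j}"
    proof (rule card_subset_eq)
      show "{m. m < 2 * k \<and> w' ! m = w' ! j} \<subseteq> {m. m < 2 * k \<and> l m = l j}"
      proof (intro subsetI CollectI)
        fix m assume "m \<in> {m. m < 2 * k \<and> w' ! m = w' ! j}"
        then show "m < 2 * k \<and> l m = l j"
          using w'(2)[unfolded compat_def len, rule_format, of m j] ij by simp
      qed
      show "card {m. m < 2 * k \<and> w' ! m = w' ! j} = card {m. m < 2 * k \<and> l m = l j}"
        using pair_matched_partner[OF w'(1) ij(2)] assms[OF ij(2)] by (simp add: mult_of_def)
    qed simp
    then have "i \<in> {m. m < 2 * k \<and> w' ! m = w' ! j} \<longleftrightarrow> i \<in> {m. m < 2 * k \<and> l m = l j}" by (simp only:)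
    then show "w' ! i = w' ! j \<longleftrightarrow> w ! i = w ! j" using w(3)[OF ij] ij by simp
  qed
  have cw: "compat w l" unfolding compat_def w(1) using w(3) by blast
  have "{w \<in> pair_matched_words k. compat w l} = {w}"
  proof (rule subset_antisym)
    show "{w \<in> pair_matched_words k. compat w l} \<subseteq> {w}"
    proof
      fix v assume "v \<in> {w \<in> pair_matched_words k. compat w l}"
      then have "v = w" by (intro uniq) simp_all
      then show "v \<in> {w}" by simp
    qed
  qed (use wp cw in simp)
  then show ?thesis by simp
qed

text \<open>Entry \<open>i\<close> of the list is the letter between the vertices \<open>i\<close>
  and \<open>Suc i\<close>, so the indices of \<open>circuits\<close>, which start at 1, are shifted
  by one.\<close>

lemma circuits_eq:
  assumes "length w = 2 * k"
  shows "circuits \<theta> w n = {\<pi> \<in> circ (2 * k) n. compat w (\<lambda>i. link \<theta> n (\<pi> i) (\<pi> (Suc i)))}"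
proof -
  have "(\<forall>i \<in> {1..length w}. \<forall>j \<in> {1..length w}. w ! (i - 1) = w ! (j - 1) \<longrightarrow>
           link \<theta> n (\<pi> (i - 1)) (\<pi> i) = link \<theta> n (\<pi> (j - 1)) (\<pi> j))
     \<longleftrightarrow> compat w (\<lambda>i. link \<theta> n (\<pi> i) (\<pi> (Suc i)))" (is "?L \<longleftrightarrow> ?R") for \<pi>
  proof
    assume L: ?L
    show ?R unfolding compat_def
    proof (intro allI impI)
      fix i j assume "i < length w" "j < length w" "w ! i = w ! j"
      then show "link \<theta> n (\<pi> i) (\<pi> (Suc i)) = link \<theta> n (\<pi> j) (\<pi> (Suc j))"
        using L[rule_format, of "Suc i" "Suc j"] by simp
    qed
  next
    assume R: ?R
    show ?L
    proof (intro ballI impI)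
      fix i j assume "i \<in> {1..length w}" "j \<in> {1..length w}" "w ! (i - 1) = w ! (j - 1)"
      then show "link \<theta> n (\<pi> (i - 1)) (\<pi> i) = link \<theta> n (\<pi> (j - 1)) (\<pi> j)"
        using R[unfolded compat_def, rule_format, of "i - 1" "j - 1"] by auto
    qed
  qed
  then show ?thesis using assms by (auto simp: circuits_def circ_def)
qed

section \<open>Cube integrals\<close>

text \<open>Half-open, so that the integer part of \<open>N * u\<close> stays below
  \<open>N\<close>.\<close>

definition unit_measure :: "real measure" where
  "unit_measure = restrict_space lborel {0..<1}"

text \<open>One coordinate for each of the \<open>k\<close> letters, numbered from 0, and the
  coordinate \<open>k\<close> for the starting point.\<close>

definition cube :: "nat \<Rightarrow> (nat \<Rightarrow> real) measure" where
  "cube k = PiM {..k} (\<lambda>_. unit_measure)"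

lemma space_unit_measure [simp]: "space unit_measure = {0..<1}"
  by (simp add: unit_measure_def space_restrict_space)

lemma prob_space_unit_measure: "prob_space unit_measure"
  by (rule prob_spaceI) (simp add: unit_measure_def space_restrict_space emeasure_restrict_space)

lemma prob_space_cube: "prob_space (cube k)"
  unfolding cube_def by (rule prob_space_PiM) (rule prob_space_unit_measure)

lemma space_cube: "space (cube k) = {..k} \<rightarrow>\<^sub>E {0..<1}"
  by (simp add: cube_def space_PiM)

lemma measurable_cube_component:
  assumes "a \<le> k"
  shows "(\<lambda>u. u a) \<in> borel_measurable (cube k)"
proof -
  have 1: "(\<lambda>u. u a) \<in> measurable (cube k) unit_measure"
    unfolding cube_def using assms by (intro measurable_component_singleton) simp
  have 2: "(\<lambda>x. x) \<in> measurable unit_measure borel"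
    unfolding unit_measure_def by (intro measurable_restrict_space1) simp
  show ?thesis by (rule measurable_compose[OF 1 2])
qed

text \<open>A function of the integer parts is constant on boxes of side \<open>1 / N\<close>, so
  its integral is a grid average. Sums over residues thereby become integrals over a domain that
  does not depend on \<open>N\<close>.\<close>

lemma cube_integral_grid:
  assumes N: "N > 0"
    and F: "\<And>u. u \<in> space (cube k) \<Longrightarrow> F u = (g (\<lambda>a\<in>{..k}. nat \<lfloor>real N * u a\<rfloor>) :: real)"
  shows "integral\<^sup>L (cube k) F = (\<Sum>z\<in>{..k} \<rightarrow>\<^sub>E {..<N}. g z) / real N ^ (k + 1)"
proof -
  interpret C: prob_space "cube k" by (rule prob_space_cube)
  interpret U: prob_space unit_measure by (rule prob_space_unit_measure)
  interpret P: product_sigma_finite "\<lambda>_::nat. unit_measure" by standard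
  define I where "I j = {real j / real N..<(real j + 1) / real N}" for j :: nat
  have I: "I j \<subseteq> {0..<1}" if "j < N" for j
  proof
    fix x assume "x \<in> I j"
    then have "0 \<le> x" "x < (real j + 1) / real N" using N by (auto simp: I_def intro: order_trans[rotated])
    moreover have "(real j + 1) / real N \<le> 1" using that N by simp
    ultimately show "x \<in> {0..<1}" by simp
  qed
  have Is: "I j \<in> sets unit_measure" if "j < N" for j
    using I[OF that] by (simp add: unit_measure_def sets_restrict_space_iff I_def)
  have Im: "emeasure unit_measure (I j) = ennreal (1 / real N)" if "j < N" for j
  proof -
    have "emeasure unit_measure (I j) = emeasure lborel (I j)"
      unfolding unit_measure_def using I[OF that] by (intro emeasure_restrict_space) simp_all
    also have "\<dots> = ennreal ((real j + 1) / real N - real j / real N)"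
      unfolding I_def using N by (intro emeasure_lborel_Ico) (simp add: divide_right_mono)
    also have "(real j + 1) / real N - real j / real N = 1 / real N"
      by (simp add: diff_divide_distrib[symmetric])
    finally show ?thesis .
  qed
  define box where "box z = PiE {..k} (\<lambda>a. I (z a))" for z :: "nat \<Rightarrow> nat"
  have boxs: "box z \<in> sets (cube k)" and boxm: "C.prob (box z) = 1 / real N ^ (k + 1)"
    if z: "z \<in> {..k} \<rightarrow>\<^sub>E {..<N}" for z
  proof -
    have s: "I (z a) \<in> sets unit_measure" if "a \<in> {..k}" for a using PiE_mem[OF z that] by (intro Is) simp
    show "box z \<in> sets (cube k)" unfolding box_def cube_def using s by (intro sets_PiM_I_finite) simp_all
    have "emeasure (cube k) (box z) = (\<Prod>a\<in>{..k}. emeasure unit_measure (I (z a)))"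
      unfolding box_def cube_def using s by (intro P.emeasure_PiM) simp_all
    also have "\<dots> = (\<Prod>a\<in>{..k}. ennreal (1 / real N))"
      using PiE_mem[OF z] by (intro prod.cong refl Im) simp
    also have "\<dots> = ennreal (1 / real N) ^ (k + 1)" by (simp only: prod_constant card_atMost Suc_eq_plus1)
    also have "\<dots> = ennreal ((1 / real N) ^ (k + 1))" by (rule ennreal_power) simp
    finally show "C.prob (box z) = 1 / real N ^ (k + 1)"
      by (simp add: C.emeasure_eq_measure power_divide)
  qed
  have fl: "u \<in> box z \<longleftrightarrow> z = (\<lambda>a\<in>{..k}. nat \<lfloor>real N * u a\<rfloor>)"
    if u: "u \<in> space (cube k)" and z: "z \<in> {..k} \<rightarrow>\<^sub>E {..<N}" for u z
  proof -
    have ux: "u a = undefined" if "a \<notin> {..k}" for a using u that unfolding space_cube by (rule PiE_arb)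
    have u0: "0 \<le> real N * u a" if "a \<le> k" for a using u PiE_mem[of u "{..k}" "\<lambda>_. {0..<1}" a] that
      by (simp add: space_cube)
    have "u a \<in> I j \<longleftrightarrow> j = nat \<lfloor>real N * u a\<rfloor>" if "a \<le> k" for a j
    proof -
      have "u a \<in> I j \<longleftrightarrow> real j \<le> real N * u a \<and> real N * u a < real j + 1"
        using N by (simp add: I_def field_simps)
      also have "\<dots> \<longleftrightarrow> \<lfloor>real N * u a\<rfloor> = int j" by (simp add: floor_eq_iff)
      also have "\<dots> \<longleftrightarrow> j = nat \<lfloor>real N * u a\<rfloor>" using u0[OF that] by auto
      finally show ?thesis .
    qed
    then have "u \<in> box z \<longleftrightarrow> (\<forall>a\<le>k. z a = nat \<lfloor>real N * u a\<rfloor>)"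
      unfolding box_def using ux by (simp add: PiE_iff extensional_def Ball_def)
    also have "\<dots> \<longleftrightarrow> z = (\<lambda>a\<in>{..k}. nat \<lfloor>real N * u a\<rfloor>)"
      using PiE_arb[OF z] by (auto simp: fun_eq_iff)
    finally show ?thesis .
  qed
  have flin: "(\<lambda>a\<in>{..k}. nat \<lfloor>real N * u a\<rfloor>) \<in> {..k} \<rightarrow>\<^sub>E {..<N}" if u: "u \<in> space (cube k)" for u
  proof (rule restrict_PiE_iff[THEN iffD2], rule ballI)
    fix a assume "a \<in> {..k}"
    then have "u a < 1" "0 \<le> u a" using u PiE_mem[of u "{..k}" "\<lambda>_. {0..<1}" a] by (simp_all add: space_cube)
    then have "real N * u a < real N" using N by simp
    then have "\<lfloor>real N * u a\<rfloor> < int N" by (simp add: floor_less_iff)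
    then show "nat \<lfloor>real N * u a\<rfloor> \<in> {..<N}" using N by (simp add: nat_less_iff)
  qed
  have fin: "finite ({..k} \<rightarrow>\<^sub>E {..<N})" by (intro finite_PiE) simp_all
  have "integral\<^sup>L (cube k) F = integral\<^sup>L (cube k) (\<lambda>u. \<Sum>z\<in>{..k} \<rightarrow>\<^sub>E {..<N}. g z * indicator (box z) u)"
  proof (rule Bochner_Integration.integral_cong[OF refl])
    fix u assume u: "u \<in> space (cube k)"
    define z0 where "z0 = (\<lambda>a\<in>{..k}. nat \<lfloor>real N * u a\<rfloor>)"
    have "(\<Sum>z\<in>{..k} \<rightarrow>\<^sub>E {..<N}. g z * indicator (box z) u) = (\<Sum>z\<in>{..k} \<rightarrow>\<^sub>E {..<N}. if z = z0 then g z else 0)"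
      by (rule sum.cong[OF refl]) (simp add: fl[OF u] z0_def indicator_def)
    also have "\<dots> = g z0" using fin flin[OF u] by (simp add: z0_def)
    finally show "F u = (\<Sum>z\<in>{..k} \<rightarrow>\<^sub>E {..<N}. g z * indicator (box z) u)" using F[OF u] by (simp add: z0_def)
  qed
  also have "\<dots> = (\<Sum>z\<in>{..k} \<rightarrow>\<^sub>E {..<N}. g z * C.prob (box z))"
    using boxs by (subst Bochner_Integration.integral_sum) (simp_all add: C.emeasure_eq_measure)
  also have "\<dots> = (\<Sum>z\<in>{..k} \<rightarrow>\<^sub>E {..<N}. g z / real N ^ (k + 1))"
    using boxm by (intro sum.cong refl) simp
  finally show ?thesis by (simp add: sum_divide_distrib)
qed

lemma walk_cong: "(\<And>j. j < i \<Longrightarrow> l j = l' j) \<Longrightarrow> walk y l i = walk y l' i"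
  by (induction i) simp_all

lemma measurable_walk:
  assumes "f \<in> borel_measurable M" "\<And>j. j < i \<Longrightarrow> (\<lambda>u. g u j) \<in> borel_measurable M"
  shows "(\<lambda>u. walk (f u :: real) (g u) i) \<in> borel_measurable M"
  using assms(2) by (induction i) (simp_all add: assms(1))

text \<open>The walk is affine in the coordinate \<open>k\<close> with slope 1 or -1, since all
  letters involved are below \<open>k\<close>; by Fubini the exceptional set has at most one point
  in each fibre.\<close>

lemma AE_cube_walk_neq:
  assumes w: "\<And>j. j < i \<Longrightarrow> w j < k"
  shows "AE u in cube k. walk (u k) (\<lambda>j. u (w j)) i \<noteq> c"
proof -
  interpret U: prob_space unit_measure by (rule prob_space_unit_measure)
  interpret P: product_sigma_finite "\<lambda>_::nat. unit_measure" by standard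
  define S where "S = {u \<in> space (cube k). walk (u k) (\<lambda>j. u (w j)) i = c}"
  have m: "(\<lambda>u. walk (u k) (\<lambda>j. u (w j)) i) \<in> borel_measurable (cube k)"
    using w by (intro measurable_walk measurable_cube_component) (simp_all add: less_imp_le)
  have S: "S \<in> sets (cube k)" unfolding S_def using m by measurable
  have k: "{..k} = insert k {..<k}" by auto
  have "emeasure (cube k) S = (\<integral>\<^sup>+u. indicator S u \<partial>cube k)" using S by simp
  also have "\<dots> = (\<integral>\<^sup>+x. (\<integral>\<^sup>+y. indicator S (x(k := y)) \<partial>unit_measure) \<partial>PiM {..<k} (\<lambda>_. unit_measure))"
    unfolding cube_def k
  proof (rule P.product_nn_integral_insert)
    show "indicator S \<in> borel_measurable (Pi\<^sub>M (insert k {..<k}) (\<lambda>_. unit_measure))"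
      using S unfolding cube_def k by simp
  qed simp_all
  also have "\<dots> = (\<integral>\<^sup>+x. 0 \<partial>PiM {..<k} (\<lambda>_. unit_measure))"
  proof (rule nn_integral_cong)
    fix x assume "x \<in> space (PiM {..<k} (\<lambda>_. unit_measure))"
    define d where "d = walk 0 (\<lambda>j. x (w j)) i"
    have "walk y (\<lambda>j. (x(k := y)) (w j)) i = (-1) ^ i * y + d" for y
    proof -
      have "walk 0 (\<lambda>j. (x(k := y)) (w j)) i = d"
        unfolding d_def by (rule walk_cong) (use w in force)
      then show ?thesis using walk_eq[of y "\<lambda>j. (x(k := y)) (w j)" i] by simp
    qed
    then have sub: "indicator S (x(k := y)) \<le> (indicator {(-1) ^ i * (c - d)} y :: ennreal)" for y
    proof (cases "x(k := y) \<in> S")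
      case True
      then have "(-1) ^ i * y + d = c"
        using \<open>\<And>y. walk y (\<lambda>j. (x(k := y)) (w j)) i = (-1) ^ i * y + d\<close>[of y] by (simp add: S_def)
      then have "c - d = (-1) ^ i * y" by simp
      then have "(-1) ^ i * (c - d) = ((-1) ^ i * (-1) ^ i) * y" by (simp only: mult.assoc)
      also have "(-1) ^ i * (-1) ^ i = (1::real)" by (simp flip: power_mult_distrib)
      finally show ?thesis by (simp add: indicator_def)
    qed simp
    have "(\<integral>\<^sup>+y. indicator S (x(k := y)) \<partial>unit_measure)
      \<le> (\<integral>\<^sup>+y. indicator {(-1) ^ i * (c - d)} y \<partial>unit_measure)"
      by (rule nn_integral_mono) (rule sub)
    also have "\<dots> \<le> (\<integral>\<^sup>+y. indicator {(-1) ^ i * (c - d)} y \<partial>lborel)"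
      unfolding unit_measure_def
      by (subst nn_integral_restrict_space, simp, rule nn_integral_mono) (simp add: indicator_def)
    also have "\<dots> = 0" by simp
    finally show "(\<integral>\<^sup>+y. indicator S (x(k := y)) \<partial>unit_measure) = 0" by simp
  qed
  finally have "emeasure (cube k) S = 0" by simp
  then have "S \<in> null_sets (cube k)" using S by (simp add: null_sets_def)
  then show ?thesis by (rule AE_I') (auto simp: S_def)
qed

lemma AE_cube_walk_notin_Ints:
  assumes w: "\<And>j. j < i \<Longrightarrow> w j < k"
  shows "AE u in cube k. c - walk (u k) (\<lambda>j. u (w j)) i \<notin> \<int>"
proof -
  have "AE u in cube k. \<forall>m::int. walk (u k) (\<lambda>j. u (w j)) i \<noteq> c - of_int m"
    unfolding AE_all_countable by (intro allI AE_cube_walk_neq w)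
  then show ?thesis
  proof eventually_elim
    case (elim u)
    show ?case
    proof
      assume "c - walk (u k) (\<lambda>j. u (w j)) i \<in> \<int>"
      then obtain m where "c - walk (u k) (\<lambda>j. u (w j)) i = of_int m" by (rule Ints_cases)
      then have "walk (u k) (\<lambda>j. u (w j)) i = c - of_int m" by simp
      then show False using elim by blast
    qed
  qed
qed

text \<open>The number of integers \<open>m\<close> with \<open>0 \<le> t + m \<le> \<theta>\<close>: the limit of the number of elements of
  \<open>{1..n}\<close> in a residue class near \<open>t\<close> times the period.\<close>

definition rho :: "real \<Rightarrow> real \<Rightarrow> real" where
  "rho \<theta> t = of_int \<lfloor>\<theta> - t\<rfloor> + of_int \<lfloor>t\<rfloor> + 1"

lemma rho_bounds: "\<theta> > 0 \<Longrightarrow> 0 \<le> rho \<theta> t" "rho \<theta> t \<le> \<theta> + 1"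
proof -
  have "real_of_int \<lfloor>\<theta>\<rfloor> < real_of_int (\<lfloor>\<theta> - t\<rfloor> + \<lfloor>t\<rfloor> + 2)"
    using of_int_floor_le[of \<theta>] real_of_int_floor_add_one_gt[of "\<theta> - t"] real_of_int_floor_add_one_gt[of t]
    unfolding of_int_add of_int_numeral by linarith
  then have "\<lfloor>\<theta>\<rfloor> \<le> \<lfloor>\<theta> - t\<rfloor> + \<lfloor>t\<rfloor> + 1" unfolding of_int_less_iff by linarith
  then have "real_of_int \<lfloor>\<theta>\<rfloor> \<le> real_of_int (\<lfloor>\<theta> - t\<rfloor> + \<lfloor>t\<rfloor> + 1)" by (simp only: of_int_le_iff)
  then have *: "real_of_int \<lfloor>\<theta>\<rfloor> \<le> rho \<theta> t" by (simp add: rho_def)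
  show "0 \<le> rho \<theta> t" if "\<theta> > 0"
  proof -
    have "0 \<le> real_of_int \<lfloor>\<theta>\<rfloor>" using that by simp
    then show ?thesis using * by (rule order_trans)
  qed
  show "rho \<theta> t \<le> \<theta> + 1" unfolding rho_def
    using of_int_floor_le[of "\<theta> - t"] of_int_floor_le[of t] by linarith
qed

lemma tendsto_floor_seq:
  assumes "(f \<longlongrightarrow> (l::real)) F" "l \<notin> \<int>"
  shows "((\<lambda>x. real_of_int \<lfloor>f x\<rfloor>) \<longlongrightarrow> of_int \<lfloor>l\<rfloor>) F"
  by (rule tendsto_eventually, rule eventually_mono[OF eventually_floor_eq[OF assms]]) simp

text \<open>One factor for each vertex before the last: the limiting number of elements in its
  residue class. For a word of length \<open>2 * k\<close>, \<open>length w div 2\<close> is the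
  coordinate of the starting point.\<close>

definition word_weight :: "real \<Rightarrow> nat list \<Rightarrow> (nat \<Rightarrow> real) \<Rightarrow> real" where
  "word_weight \<theta> w u = (\<Prod>i<length w. rho \<theta> (walk (u (length w div 2)) (\<lambda>j. u (w ! j)) i))"

definition word_integral :: "real \<Rightarrow> nat list \<Rightarrow> real" where
  "word_integral \<theta> w = integral\<^sup>L (cube (length w div 2)) (word_weight \<theta> w)"

lemma pair_matched_nth_less:
  assumes "w \<in> pair_matched_words k" "i < 2 * k"
  shows "w ! i < k"
proof -
  have "w ! i \<in> set w" using assms by (simp add: pair_matched_words_def)
  then show ?thesis unfolding pair_matched_set[OF assms(1)] by simp
qed

lemma measurable_word_weight:
  assumes w: "w \<in> pair_matched_words k"
  shows "word_weight \<theta> w \<in> borel_measurable (cube k)"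
proof -
  have l: "length w = 2 * k" using w by (simp add: pair_matched_words_def)
  have "(\<lambda>u. walk (u k) (\<lambda>j. u (w ! j)) i) \<in> borel_measurable (cube k)" if "i < 2 * k" for i
    using pair_matched_nth_less[OF w] that by (intro measurable_walk measurable_cube_component) (simp_all
      add: less_imp_le)
  moreover have "(\<lambda>u. rho \<theta> (f u)) \<in> borel_measurable (cube k)" if "f \<in> borel_measurable (cube k)" for f
    unfolding rho_def using that by measurable
  ultimately have "(\<lambda>u. \<Prod>i<2*k. rho \<theta> (walk (u k) (\<lambda>j. u (w ! j)) i)) \<in> borel_measurable (cube k)"
    by (intro borel_measurable_prod) simp
  then show ?thesis unfolding word_weight_def[abs_def] l by simp
qed

lemma abs_prod_le_power:
  fixes f :: "nat \<Rightarrow> real"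
  assumes "\<And>i. i < h \<Longrightarrow> 0 \<le> f i \<and> f i \<le> B"
  shows "\<bar>\<Prod>i<h. f i\<bar> \<le> B ^ h"
proof -
  have "\<bar>\<Prod>i<h. f i\<bar> = (\<Prod>i<h. f i)" using assms by (intro abs_of_nonneg prod_nonneg) simp
  also have "\<dots> \<le> (\<Prod>i<h. B)" using assms by (intro prod_mono) simp
  finally show ?thesis by simp
qed

lemma word_weight_le: "\<theta> > 0 \<Longrightarrow> \<bar>word_weight \<theta> w u\<bar> \<le> (\<theta> + 1) ^ length w"
  unfolding word_weight_def by (intro abs_prod_le_power) (simp add: rho_bounds)

lemma word_weight_nonneg: "\<theta> > 0 \<Longrightarrow> 0 \<le> word_weight \<theta> w u"
  unfolding word_weight_def by (intro prod_nonneg) (simp add: rho_bounds)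

lemma word_integral_bounds:
  assumes w: "w \<in> pair_matched_words k" and \<theta>: "\<theta> > 0"
  shows "0 \<le> word_integral \<theta> w" "word_integral \<theta> w \<le> (\<theta> + 1) ^ (2 * k)"
proof -
  have l: "length w = 2 * k" using w by (simp add: pair_matched_words_def)
  interpret C: prob_space "cube k" by (rule prob_space_cube)
  have i: "integrable (cube k) (word_weight \<theta> w)"
    using word_weight_le[OF \<theta>, of w] measurable_word_weight[OF w]
    by (intro C.integrable_const_bound[where B="(\<theta> + 1) ^ length w"]) auto
  show "0 \<le> word_integral \<theta> w" unfolding word_integral_def
    by (rule Bochner_Integration.integral_nonneg) (rule word_weight_nonneg[OF \<theta>])
  have "integral\<^sup>L (cube k) (word_weight \<theta> w) \<le> integral\<^sup>L (cube k) (\<lambda>_. (\<theta> + 1) ^ (2 * k))"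
  proof (rule Bochner_Integration.integral_mono[OF i])
    show "word_weight \<theta> w u \<le> (\<theta> + 1) ^ (2 * k)" for u
      using word_weight_le[OF \<theta>, of w u] l by (simp add: abs_le_iff)
  qed simp
  then have "word_integral \<theta> w \<le> integral\<^sup>L (cube k) (\<lambda>_. (\<theta> + 1) ^ (2 * k))"
    by (simp add: word_integral_def l)
  then show "word_integral \<theta> w \<le> (\<theta> + 1) ^ (2 * k)" by (simp add: C.prob_space)
qed

text \<open>In \<theta> the weight can jump only where \<open>\<theta> - t\<close> is an integer for
  some position \<open>t\<close> of the walk, and such points of the cube form a null set.\<close>

lemma word_integral_continuous:
  assumes w: "w \<in> pair_matched_words k" and \<theta>m: "\<And>m. \<theta>m m > 0" and \<theta>: "\<theta> > 0" and lim: "\<theta>m \<longlonglongrightarrow> \<theta>"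
  shows "(\<lambda>m. word_integral (\<theta>m m) w) \<longlonglongrightarrow> word_integral \<theta> w"
proof -
  have l: "length w = 2 * k" using w by (simp add: pair_matched_words_def)
  interpret C: prob_space "cube k" by (rule prob_space_cube)
  have "Bseq \<theta>m" using lim by (intro convergent_imp_Bseq) (auto simp: convergent_def)
  then obtain B where B: "\<And>m. norm (\<theta>m m) \<le> B" using BseqE by blast
  have Bm: "\<theta>m m \<le> B" for m using B[of m] by (simp add: abs_le_iff)
  have "(\<lambda>m. integral\<^sup>L (cube k) (word_weight (\<theta>m m) w)) \<longlonglongrightarrow> integral\<^sup>L (cube k) (word_weight \<theta> w)"
  proof (rule integral_dominated_convergence[where w="\<lambda>_. (B + 1) ^ (2 * k)"])
    show "word_weight \<theta> w \<in> borel_measurable (cube k)" by (rule measurable_word_weight[OF w])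
    show "word_weight (\<theta>m m) w \<in> borel_measurable (cube k)" for m by (rule measurable_word_weight[OF w])
    show "integrable (cube k) (\<lambda>_. (B + 1) ^ (2 * k))" by simp
    have "norm (word_weight (\<theta>m m) w u) \<le> (B + 1) ^ (2 * k)" for m u
    proof -
      have "\<bar>word_weight (\<theta>m m) w u\<bar> \<le> (\<theta>m m + 1) ^ (2 * k)" using word_weight_le[OF \<theta>m[of m], of w u] l by simp
      also have "\<dots> \<le> (B + 1) ^ (2 * k)" using Bm[of m] \<theta>m[of m] by (intro power_mono) simp_all
      finally show ?thesis by simp
    qed
    then show "AE u in cube k. norm (word_weight (\<theta>m m) w u) \<le> (B + 1) ^ (2 * k)" for m by (intro AE_I2)
    have "AE u in cube k. \<forall>i\<in>{..<2*k}. \<theta> - walk (u k) (\<lambda>j. u (w ! j)) i \<notin> \<int>"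
    proof (rule AE_finite_allI)
      fix i assume "i \<in> {..<2*k}"
      then have "w ! j < k" if "j < i" for j using pair_matched_nth_less[OF w, of j] that by simp
      then show "AE u in cube k. \<theta> - walk (u k) (\<lambda>j. u (w ! j)) i \<notin> \<int>"
        by (rule AE_cube_walk_notin_Ints)
    qed simp
    then show "AE u in cube k. (\<lambda>m. word_weight (\<theta>m m) w u) \<longlonglongrightarrow> word_weight \<theta> w u"
    proof eventually_elim
      case (elim u)
      show ?case unfolding word_weight_def l rho_def
      proof (intro tendsto_prod tendsto_add tendsto_const tendsto_floor_seq tendsto_diff lim)
        fix i assume "i \<in> {..<2 * k}"
        then show "\<theta> - walk (u (2 * k div 2)) (\<lambda>j. u (w ! j)) i \<notin> \<int>" using elim by simp
      qed
    qed
  qed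
  then show ?thesis by (simp add: word_integral_def l)
qed

section \<open>Limits of circuit counts\<close>

text \<open>The coefficient of the value of letter \<open>a\<close> in the closing congruence; as in
  \<open>walk\<close>, the signs alternate backwards from the last position. In a pair-matched word
  it is a sum of two signs, which vanishes iff the two positions have opposite parity.\<close>

definition word_coef :: "nat list \<Rightarrow> nat \<Rightarrow> int" where
  "word_coef w a = (\<Sum>i | i < length w \<and> w ! i = a. (-1) ^ (length w - 1 - i))"

definition symmetric_word :: "nat list \<Rightarrow> bool" where
  "symmetric_word w \<longleftrightarrow> (\<forall>a\<in>set w. word_coef w a = 0)"

lemma walk_word_sum:
  assumes w: "w \<in> pair_matched_words k"
  shows "walk 0 (\<lambda>i. int (v (w ! i))) (2 * k) = (\<Sum>a<k. word_coef w a * int (v a))"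
proof -
  have l: "length w = 2 * k" using w by (simp add: pair_matched_words_def)
  have "(\<Sum>a<k. word_coef w a * int (v a)) = (\<Sum>a<k. \<Sum>i | i \<in> {..<2*k} \<and> w ! i
    = a. (-1) ^ (2 * k - 1 - i) * int (v (w ! i)))"
    unfolding word_coef_def sum_distrib_right l by (intro sum.cong refl) auto
  also have "\<dots> = (\<Sum>i<2*k. (-1) ^ (2 * k - 1 - i) * int (v (w ! i)))"
    by (rule sum.group) (use pair_matched_nth_less[OF w] in auto)
  finally show ?thesis unfolding walk_0_sum by simp
qed

lemma of_int_walk: "of_int (walk y l i) = walk (of_int y :: real) (\<lambda>j. of_int (l j)) i"
  by (induction i) simp_all

text \<open>A circuit counted here has one link value per letter, so the count is organised by these
  values and by the starting residue. The length is even, so the start cancels from the closing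
  congruence, which becomes a condition on the link values alone.\<close>

lemma card_circuits:
  assumes w: "w \<in> pair_matched_words k" and k: "k > 0" and N: "N = nat \<lfloor>real n / \<theta>\<rfloor>" "N > 0"
  shows "card (circuits \<theta> w n) = (\<Sum>v\<in>{..<k} \<rightarrow>\<^sub>E {..<N}. \<Sum>y<N.
     if int N dvd (\<Sum>a<k. word_coef w a * int (v a))
     then \<Prod>i<2*k. res n N (walk (int y) (\<lambda>i. int (v (w ! i))) i) else 0)"
proof -
  have l: "length w = 2 * k" using w by (simp add: pair_matched_words_def)
  define V where "V = {..<k} \<rightarrow>\<^sub>E {..<N}"
  have finV: "finite V" unfolding V_def by (intro finite_PiE) simp_all
  define S where "S v = {\<pi> \<in> circ (2*k) n. \<forall>i<2*k. (\<pi> i + \<pi> (Suc i)) mod N = v (w ! i)}" for v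
  have link: "link \<theta> n a b = (a + b) mod N" for a b by (simp add: link_def N)
  have eq: "circuits \<theta> w n = (\<Union>v\<in>V. S v)"
  proof (rule subset_antisym)
    show "circuits \<theta> w n \<subseteq> (\<Union>v\<in>V. S v)"
    proof
      fix \<pi> assume "\<pi> \<in> circuits \<theta> w n"
      then have c: "\<pi> \<in> circ (2*k) n" and cp: "compat w (\<lambda>i. (\<pi> i + \<pi> (Suc i)) mod N)"
        unfolding circuits_eq[OF l] link by simp_all
      \<comment> \<open>Any position of the letter would do: compatibility makes the link value
        independent of the choice.\<close>
      define f where "f a = (SOME i. i < 2*k \<and> w ! i = a)" for a
      have f: "f (w ! i) < 2 * k \<and> w ! f (w ! i) = w ! i" if "i < 2*k" for i
        unfolding f_def by (rule someI[where P="\<lambda>j. j < 2*k \<and> w ! j = w ! i" and x=i]) (use that in simp)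
      define v where "v = (\<lambda>a\<in>{..<k}. (\<pi> (f a) + \<pi> (Suc (f a))) mod N)"
      have "v \<in> V" unfolding V_def v_def restrict_PiE_iff using N by simp
      moreover have "\<pi> \<in> S v" unfolding S_def
      proof (intro CollectI conjI allI impI c)
        fix i assume i: "i < 2*k"
        have "v (w ! i) = (\<pi> (f (w ! i)) + \<pi> (Suc (f (w ! i)))) mod N"
          using pair_matched_nth_less[OF w i] by (simp add: v_def)
        also have "\<dots> = (\<pi> i + \<pi> (Suc i)) mod N"
          using cp[unfolded compat_def l, rule_format, of "f (w ! i)" i] f[OF i] i by blast
        finally show "(\<pi> i + \<pi> (Suc i)) mod N = v (w ! i)" by simp
      qed
      ultimately show "\<pi> \<in> (\<Union>v\<in>V. S v)" by blast
    qed
    show "(\<Union>v\<in>V. S v) \<subseteq> circuits \<theta> w n"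
    proof
      fix \<pi> assume "\<pi> \<in> (\<Union>v\<in>V. S v)"
      then obtain v where "\<pi> \<in> S v" by blast
      then have c: "\<pi> \<in> circ (2*k) n" and e: "\<And>i. i < 2*k \<Longrightarrow> (\<pi> i + \<pi> (Suc i)) mod N = v (w ! i)"
        unfolding S_def by simp_all
      have "compat w (\<lambda>i. (\<pi> i + \<pi> (Suc i)) mod N)" unfolding compat_def l
      proof (intro allI impI)
        fix i j assume "i < 2*k" "j < 2*k" "w ! i = w ! j"
        then show "(\<pi> i + \<pi> (Suc i)) mod N = (\<pi> j + \<pi> (Suc j)) mod N" using e[of i] e[of j] by simp
      qed
      then show "\<pi> \<in> circuits \<theta> w n" unfolding circuits_eq[OF l] link using c by simp
    qed
  qed
  have disj: "S v \<inter> S v' = {}" if "v \<in> V" "v' \<in> V" "v \<noteq> v'" for v v'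
  proof (rule ccontr)
    assume "S v \<inter> S v' \<noteq> {}"
    then obtain \<pi> where p: "\<pi> \<in> S v" "\<pi> \<in> S v'" by blast
    have "v a = v' a" if "a \<in> {..<k}" for a
    proof -
      have "a \<in> set w" using that unfolding pair_matched_set[OF w] .
      then obtain i where i: "i < 2*k" "w ! i = a" using l unfolding in_set_conv_nth by auto
      have "v (w ! i) = v' (w ! i)" using p i(1) unfolding S_def by auto
      then show ?thesis using i by simp
    qed
    then have "v = v'" by (rule PiE_ext[OF that(1)[unfolded V_def] that(2)[unfolded V_def]])
    then show False using that(3) by contradiction
  qed
  have cS: "card (S v) = (\<Sum>y<N. if int N dvd (\<Sum>a<k. word_coef w a * int (v a))
     then \<Prod>i<2*k. res n N (walk (int y) (\<lambda>i. int (v (w ! i))) i) else 0)" if v: "v \<in> V" for v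
  proof -
    have vl: "v (w ! i) < N" if "i < 2*k" for i
      using PiE_mem[OF v[unfolded V_def], of "w ! i"] pair_matched_nth_less[OF w that] by simp
    have cong: "[walk (int y) (\<lambda>i. int (v (w ! i))) (2*k) = int y] (mod int N)
      \<longleftrightarrow> int N dvd (\<Sum>a<k. word_coef w a * int (v a))" for y
      unfolding cong_iff_dvd_diff walk_eq[of "int y"] walk_word_sum[OF w] by simp
    have "card (S v) = (\<Sum>y<N. if [walk (int y) (\<lambda>i. int (v (w ! i))) (2*k) = int y] (mod int N)
       then \<Prod>i<2*k. res n N (walk (int y) (\<lambda>i. int (v (w ! i))) i) else 0)"
      unfolding S_def by (rule card_circ_links[where l="\<lambda>i. v (w ! i)"]) (use N k vl in simp_all)
    then show ?thesis unfolding cong .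
  qed
  have "card (circuits \<theta> w n) = (\<Sum>v\<in>V. card (S v))"
    unfolding eq by (rule card_UN_disjoint) (use finV disj in \<open>auto simp: S_def\<close>)
  also have "\<dots> = (\<Sum>v\<in>V. \<Sum>y<N. if int N dvd (\<Sum>a<k. word_coef w a * int (v a))
     then \<Prod>i<2*k. res n N (walk (int y) (\<lambda>i. int (v (w ! i))) i) else 0)"
    by (rule sum.cong[OF refl cS])
  finally show ?thesis unfolding V_def .
qed

definition period :: "real \<Rightarrow> nat \<Rightarrow> nat" where
  "period \<theta> n = nat \<lfloor>real n / \<theta>\<rfloor>"

lemma period_limits:
  assumes \<theta>: "\<theta> > 0"
  shows "filterlim (period \<theta>) at_top sequentially"
    and "(\<lambda>n. real n / real (period \<theta> n)) \<longlonglongrightarrow> \<theta>"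
    and "(\<lambda>n. real (period \<theta> n) / real n) \<longlonglongrightarrow> 1 / \<theta>"
proof -
  have up: "real (period \<theta> n) \<le> real n / \<theta>" for n
    using \<theta> unfolding period_def by (simp add: of_nat_nat)
  have lo: "real n / \<theta> - 1 < real (period \<theta> n)" for n
    using \<theta> real_of_int_floor_add_one_gt[of "real n / \<theta>"] unfolding period_def by (simp add: of_nat_nat)
  have "filterlim (\<lambda>n. real n / \<theta> - 1) at_top sequentially"
    using \<theta> by real_asymp
  then have "filterlim (\<lambda>n. real (period \<theta> n)) at_top sequentially"
    by (rule filterlim_at_top_mono) (intro always_eventually allI less_imp_le lo)
  then show "filterlim (period \<theta>) at_top sequentially"
    unfolding filterlim_at_top
  proof (intro allI)
    fix Z
    assume "\<forall>Z. eventually (\<lambda>n. Z \<le> real (period \<theta> n)) sequentially"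
    then have "eventually (\<lambda>n. real Z \<le> real (period \<theta> n)) sequentially" ..
    then show "eventually (\<lambda>n. Z \<le> period \<theta> n) sequentially" by simp
  qed
  have 1: "(\<lambda>n. (real n / \<theta> - 1) / real n) \<longlonglongrightarrow> inverse \<theta>" using \<theta> by real_asymp
  have 2: "(\<lambda>n. (real n / \<theta>) / real n) \<longlonglongrightarrow> inverse \<theta>" using \<theta> by real_asymp
  have "(\<lambda>n. real (period \<theta> n) / real n) \<longlonglongrightarrow> inverse \<theta>"
  proof (rule tendsto_sandwich[OF _ _ 1 2])
    show "eventually (\<lambda>n. (real n / \<theta> - 1) / real n \<le> real (period \<theta> n) / real n) sequentially"
      by (intro always_eventually allI divide_right_mono less_imp_le[OF lo]) simp
    show "eventually (\<lambda>n. real (period \<theta> n) / real n \<le> real n / \<theta> / real n) sequentially"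
      by (intro always_eventually allI divide_right_mono up) simp
  qed
  then show lim: "(\<lambda>n. real (period \<theta> n) / real n) \<longlonglongrightarrow> 1 / \<theta>" by (simp add: inverse_eq_divide)
  show "(\<lambda>n. real n / real (period \<theta> n)) \<longlonglongrightarrow> \<theta>"
    using tendsto_inverse[OF lim] \<theta> by (simp add: inverse_eq_divide)
qed


lemma period_pos:
  assumes \<theta>: "\<theta> > 0"
  shows "eventually (\<lambda>n. period \<theta> n > 0) sequentially"
proof -
  have "eventually (\<lambda>n. 1 \<le> period \<theta> n) sequentially"
    using period_limits(1)[OF \<theta>] unfolding filterlim_at_top by (rule spec)
  then show ?thesis by (simp add: Suc_le_eq)
qed

text \<open>A nonzero coefficient lets the closing congruence cut the \<open>N ^ k\<close> choices
  of link values to order \<open>N ^ (k - 1)\<close>. With \<open>N\<close> starts and boundedly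
  many vertices per residue, the count is of order \<open>n ^ k\<close>.\<close>

lemma circuits_limit_asymmetric:
  assumes w: "w \<in> pair_matched_words k" and k: "k > 0" and \<theta>: "\<theta> > 0" and ns: "\<not> symmetric_word w"
  shows "(\<lambda>n. real (card (circuits \<theta> w n)) / real n ^ (k + 1)) \<longlonglongrightarrow> 0"
proof -
  obtain a where a: "a < k" "word_coef w a \<noteq> 0" using ns
    unfolding symmetric_word_def pair_matched_set[OF w] by auto
  define C where "C = real (nat \<bar>word_coef w a\<bar>)"
  have bound: "real (card (circuits \<theta> w n)) / real n ^ (k + 1) \<le>
      C * (real (period \<theta> n) / real n) ^ k * (real n / real (period \<theta> n) + 1) ^ (2 * k) * (1 / real n)"
    if N: "period \<theta> n > 0" and n: "n > 0" for n
  proof -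
    define N where "N = period \<theta> n"
    define V where "V = {v \<in> {..<k} \<rightarrow>\<^sub>E {..<N}. int N dvd (\<Sum>a<k. word_coef w a * int (v a))}"
    have finV: "finite ({..<k} \<rightarrow>\<^sub>E {..<N})" by (intro finite_PiE) simp_all
    define B where "B = (real n / real N + 1) ^ (2 * k)"
    have B: "real (\<Prod>i<2*k. res n N (z i)) \<le> B" for z
      unfolding B_def of_nat_prod
      by (rule order_trans[OF prod_mono[where g="\<lambda>_. real n / real N + 1"]])
         (use N res_le[of N n] in \<open>simp_all add: N_def\<close>)
    have "card (circuits \<theta> w n) = (\<Sum>v\<in>{..<k} \<rightarrow>\<^sub>E {..<N}. \<Sum>y<N.
       if int N dvd (\<Sum>a<k. word_coef w a * int (v a))
       then \<Prod>i<2*k. res n N (walk (int y) (\<lambda>i. int (v (w ! i))) i) else 0)"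
      using card_circuits[OF w k, of N n \<theta>] N by (simp add: N_def period_def)
    also have "\<dots> = (\<Sum>v\<in>{..<k} \<rightarrow>\<^sub>E {..<N}. if int N dvd (\<Sum>a<k. word_coef w a * int (v a))
       then (\<Sum>y<N. \<Prod>i<2*k. res n N (walk (int y) (\<lambda>i. int (v (w ! i))) i)) else 0)"
      by (intro sum.cong refl) simp
    also have "\<dots> = (\<Sum>v\<in>V. \<Sum>y<N. \<Prod>i<2*k. res n N (walk (int y) (\<lambda>i. int (v (w ! i))) i))"
      unfolding V_def using finV by (rule sum.inter_filter[symmetric])
    finally have "real (card (circuits \<theta> w n)) = (\<Sum>v\<in>V. \<Sum>y<N. real (\<Prod>i<2*k. res n N (walk (int y) (\<lambda>i. int
      (v (w ! i))) i)))"
      by (simp only: of_nat_sum)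
    also have "\<dots> \<le> (\<Sum>v\<in>V. \<Sum>y<N. B)" by (intro sum_mono B)
    also have "\<dots> = real (card V) * (real N * B)" by simp
    also have "\<dots> \<le> real (nat \<bar>word_coef w a\<bar> * N ^ (k - 1)) * (real N * B)"
    proof (rule mult_right_mono)
      have "card V \<le> nat \<bar>word_coef w a\<bar> * N ^ (card {..<k} - 1)"
        unfolding V_def by (rule card_linear_one[where c="word_coef w"]) (use a N in \<open>simp_all add: N_def\<close>)
      then show "real (card V) \<le> real (nat \<bar>word_coef w a\<bar> * N ^ (k - 1))" unfolding of_nat_le_iff by simp
      show "0 \<le> real N * B" by (simp add: B_def)
    qed
    also have "\<dots> = C * real N ^ k * B" using k by (cases k) (simp_all add: C_def)
    finally have "real (card (circuits \<theta> w n)) / real n ^ (k + 1) \<le> C * real N ^ k * B / real n ^ (k + 1)"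
      by (intro divide_right_mono) simp_all
    also have "\<dots> = C * (real N / real n) ^ k * B * (1 / real n)" by (simp add: power_divide)
    finally show ?thesis by (simp add: B_def N_def)
  qed
  show ?thesis
  proof (rule tendsto_sandwich[OF _ _ tendsto_const])
    show "eventually (\<lambda>n. 0 \<le> real (card (circuits \<theta> w n)) / real n ^ (k + 1)) sequentially" by simp
    have "eventually (\<lambda>n. period \<theta> n > 0) sequentially"
      by (rule period_pos[OF \<theta>])
    then show "eventually (\<lambda>n. real (card (circuits \<theta> w n)) / real n ^ (k + 1) \<le>
      C * (real (period \<theta> n) / real n) ^ k * (real n / real (period \<theta> n) + 1) ^ (2 * k) * (1
        / real n)) sequentially"
      using eventually_gt_at_top[of 0] by eventually_elim (rule bound)
    have "(\<lambda>n. C * (real (period \<theta> n) / real n) ^ k * (real n / real (period \<theta> n) + 1) ^ (2 * k) * (1 / real n))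
      \<longlonglongrightarrow> C * (1 / \<theta>) ^ k * (\<theta> + 1) ^ (2 * k) * 0"
      by (intro tendsto_intros period_limits[OF \<theta>] lim_1_over_n)
    then show "(\<lambda>n. C * (real (period \<theta> n) / real n) ^ k * (real n / real (period \<theta> n) + 1) ^ (2 * k) * (1
      / real n)) \<longlonglongrightarrow> 0"
      by simp
  qed
qed

text \<open>The start becomes coordinate \<open>k\<close> of the grid point; all letters are below
  \<open>k\<close>, so the update there leaves the link values alone.\<close>

lemma circuits_symmetric_grid:
  assumes w: "w \<in> pair_matched_words k" and k: "k > 0" and s: "symmetric_word w"
    and N: "N = nat \<lfloor>real n / \<theta>\<rfloor>" "N > 0"
  shows "real (card (circuits \<theta> w n)) = (\<Sum>z\<in>{..k} \<rightarrow>\<^sub>E {..<N}.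
    \<Prod>i<2*k. real (res n N (walk (int (z k)) (\<lambda>i. int (z (w ! i))) i)))"
proof -
  have c0: "(\<Sum>a<k. word_coef w a * int (v a)) = 0" for v
    using s unfolding symmetric_word_def pair_matched_set[OF w] by (intro sum.neutral) simp
  have k1: "{..k} = insert k {..<k}" by auto
  have "card (circuits \<theta> w n) = (\<Sum>v\<in>{..<k} \<rightarrow>\<^sub>E {..<N}. \<Sum>y<N.
      \<Prod>i<2*k. res n N (walk (int y) (\<lambda>i. int (v (w ! i))) i))"
    using card_circuits[OF w k N] unfolding c0 by simp
  also have "\<dots> = (\<Sum>v\<in>{..<k} \<rightarrow>\<^sub>E {..<N}. \<Sum>y\<in>{..<N}.
      \<Prod>i<2*k. res n N (walk (int ((v(k := y)) k)) (\<lambda>i. int ((v(k := y)) (w ! i))) i))"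
  proof (intro sum.cong refl prod.cong)
    fix v y i assume "i \<in> {..<2*k}"
    then have i: "i < 2 * k" by simp
    have "walk (int y) (\<lambda>i. int (v (w ! i))) i = walk (int y) (\<lambda>i. int ((v(k := y)) (w ! i))) i"
    proof (rule walk_cong)
      fix j assume "j < i"
      then have "w ! j < k" using pair_matched_nth_less[OF w, of j] i by simp
      then show "int (v (w ! j)) = int ((v(k := y)) (w ! j))" by simp
    qed
    then show "res n N (walk (int y) (\<lambda>i. int (v (w ! i))) i)
      = res n N (walk (int ((v(k := y)) k)) (\<lambda>i. int ((v(k := y)) (w ! i))) i)" by (simp only: fun_upd_same)
  qed
  also have "\<dots> = (\<Sum>z\<in>insert k {..<k} \<rightarrow>\<^sub>E {..<N}. \<Prod>i<2*k. res n N (walk (int (z k)) (\<lambda>i. int (z (w ! i))) i))"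
    by (rule sum_PiE_insert[symmetric]) simp
  finally show ?thesis unfolding k1 by (simp only: of_nat_sum of_nat_prod)
qed

text \<open>For each \<open>n\<close> the count is, up to a power of the period, the integral of a
  step function \<open>F n\<close>, by \<open>cube_integral_grid\<close>. Almost everywhere no floor
  in the limit is taken at an integer, so \<open>F n\<close> tends to the weight, and dominated
  convergence applies.\<close>

lemma circuits_limit_symmetric:
  assumes w: "w \<in> pair_matched_words k" and k: "k > 0" and \<theta>: "\<theta> > 0" and s: "symmetric_word w"
  shows "(\<lambda>n. real (card (circuits \<theta> w n)) / real n ^ (k + 1)) \<longlonglongrightarrow> word_integral \<theta> w / \<theta> ^ (k + 1)"
proof -
  have l: "length w = 2 * k" using w by (simp add: pair_matched_words_def)
  interpret C: prob_space "cube k" by (rule prob_space_cube)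
  \<comment> \<open>\<open>T\<close> walks along the integer parts of the rescaled coordinates, and
    \<open>R\<close> extends the count \<open>res\<close> to real arguments, so that limits can be
    taken.\<close>
  define T where "T n u i = walk (real_of_int \<lfloor>real (period \<theta> n) * u k\<rfloor>) (\<lambda>j. real_of_int \<lfloor>real (period \<theta>
    n) * u (w ! j)\<rfloor>) i" for n u i
  define R where "R n t = real_of_int \<lfloor>(real n - t) / real (period \<theta> n)\<rfloor> + real_of_int \<lfloor>(t - 1)
    / real (period \<theta> n)\<rfloor> + 1" for n t
  define F where "F n u = (\<Prod>i<2*k. R n (T n u i))" for n u
  have wk: "w ! j < k" if "j < 2*k" for j by (rule pair_matched_nth_less[OF w that])
  define g where "g n z = (\<Prod>i<2*k. real (res n (period \<theta> n) (walk (int (z k)) (\<lambda>i. int (z (w ! i))) i)))"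
    for n and z :: "nat \<Rightarrow> nat"
  have Rres: "R n (real_of_int z) = real (res n (period \<theta> n) z)" if "period \<theta> n > 0" for n z
    unfolding R_def res_floor[OF that] by simp
  have Fg: "F n u = g n (\<lambda>a\<in>{..k}. nat \<lfloor>real (period \<theta> n) * u a\<rfloor>)"
    if N: "period \<theta> n > 0" and u: "u \<in> space (cube k)" for n u
  proof -
    have u0: "0 \<le> \<lfloor>real (period \<theta> n) * u a\<rfloor>" if "a \<le> k" for a
      using u PiE_mem[of u "{..k}" "\<lambda>_. {0..<1}" a] that by (simp add: space_cube)
    have "T n u i = real_of_int (walk (int (nat \<lfloor>real (period \<theta> n) * u k\<rfloor>))
       (\<lambda>j. int ((\<lambda>a\<in>{..k}. nat \<lfloor>real (period \<theta> n) * u a\<rfloor>) (w ! j))) i)" if i: "i < 2*k" for i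
    proof -
      have "real_of_int \<lfloor>real (period \<theta> n) * u (w ! j)\<rfloor>
        = real_of_int (int ((\<lambda>a\<in>{..k}. nat \<lfloor>real (period \<theta> n) * u a\<rfloor>) (w ! j)))"
        if "j < i" for j using wk[of j] that i u0[of "w ! j"] by simp
      moreover have "real_of_int (int (nat \<lfloor>real (period \<theta> n) * u k\<rfloor>)) = real_of_int \<lfloor>real (period \<theta> n) * u k\<rfloor>"
        using u0[of k] by simp
      ultimately show ?thesis unfolding T_def of_int_walk by (simp only:) (rule walk_cong, simp only:)
    qed
    then show ?thesis unfolding F_def g_def by (intro prod.cong refl) (simp add: Rres[OF N])
  qed
  have int: "integral\<^sup>L (cube k) (F n) * real (period \<theta> n) ^ (k + 1) = real (card (circuits \<theta> w n))"
    if N: "period \<theta> n > 0" for n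
  proof -
    have "integral\<^sup>L (cube k) (F n) = (\<Sum>z\<in>{..k} \<rightarrow>\<^sub>E {..<period \<theta> n}. g n z) / real (period \<theta> n) ^ (k + 1)"
      by (rule cube_integral_grid[where F="F n" and g="g n", OF N Fg[OF N]])
    also have "(\<Sum>z\<in>{..k} \<rightarrow>\<^sub>E {..<period \<theta> n}. g n z) = real (card (circuits \<theta> w n))"
      unfolding g_def using circuits_symmetric_grid[OF w k s period_def N] by simp
    finally show ?thesis using N by simp
  qed
  have ev: "eventually (\<lambda>n. period \<theta> n > 0) sequentially"
    by (rule period_pos[OF \<theta>])
  have "eventually (\<lambda>n. real n / real (period \<theta> n) < \<theta> + 1) sequentially"
    using order_tendstoD(2)[OF period_limits(2)[OF \<theta>], of "\<theta> + 1"] by simp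
  then have "eventually (\<lambda>n. period \<theta> n > 0 \<and> real n / real (period \<theta> n) < \<theta> + 1) sequentially"
    using ev by eventually_elim simp
  \<comment> \<open>From \<open>n0\<close> on one constant dominates: \<open>n / N\<close> is below
    \<open>\<theta> + 1\<close>, and a residue class has at most \<open>n / N + 1\<close>
    elements.\<close>
  then obtain n0 where n0: "\<And>n. n \<ge> n0 \<Longrightarrow> period \<theta> n > 0 \<and> real n / real (period \<theta> n) < \<theta> + 1"
    unfolding eventually_sequentially by blast
  have measT: "(\<lambda>u. T n u i) \<in> borel_measurable (cube k)" if "i < 2*k" for n i
    unfolding T_def
  proof (rule measurable_walk)
    have "(\<lambda>u. real_of_int \<lfloor>c * u a\<rfloor>) \<in> borel_measurable (cube k)" if "a \<le> k" for a c
    proof -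
      have "(\<lambda>u. c * u a) \<in> borel_measurable (cube k)"
        by (intro borel_measurable_times borel_measurable_const measurable_cube_component that)
      moreover have "(\<lambda>u. real_of_int \<lfloor>f u\<rfloor>) \<in> borel_measurable (cube k)"
        if "f \<in> borel_measurable (cube k)" for f :: "(nat \<Rightarrow> real) \<Rightarrow> real"
        using that by measurable
      ultimately show ?thesis by blast
    qed
    then show "(\<lambda>u. real_of_int \<lfloor>real (period \<theta> n) * u k\<rfloor>) \<in> borel_measurable (cube k)"
      "\<And>j. j < i \<Longrightarrow> (\<lambda>u. real_of_int \<lfloor>real (period \<theta> n) * u (w ! j)\<rfloor>) \<in> borel_measurable (cube k)"
      using wk that by (simp_all add: less_imp_le)
  qed
  have measF: "F n \<in> borel_measurable (cube k)" for n
  proof -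
    have "(\<lambda>u. R n (T n u i)) \<in> borel_measurable (cube k)" if "i < 2*k" for i
      unfolding R_def using measT[OF that, of n] by measurable
    then have "(\<lambda>u. \<Prod>i<2*k. R n (T n u i)) \<in> borel_measurable (cube k)" by (intro borel_measurable_prod) simp
    then show ?thesis unfolding F_def[abs_def] .
  qed
  have "(\<lambda>n. integral\<^sup>L (cube k) (F (n + n0))) \<longlonglongrightarrow> integral\<^sup>L (cube k) (word_weight \<theta> w)"
  proof (rule integral_dominated_convergence[where w="\<lambda>_. (\<theta> + 2) ^ (2 * k)"])
    show "word_weight \<theta> w \<in> borel_measurable (cube k)" by (rule measurable_word_weight[OF w])
    show "F (n + n0) \<in> borel_measurable (cube k)" for n by (rule measF)
    show "integrable (cube k) (\<lambda>_. (\<theta> + 2) ^ (2 * k))" by simp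
    show "AE u in cube k. norm (F (n + n0) u) \<le> (\<theta> + 2) ^ (2 * k)" for n
    proof (rule AE_I2)
      fix u assume u: "u \<in> space (cube k)"
      have N: "period \<theta> (n + n0) > 0" "real (n + n0) / real (period \<theta> (n + n0)) < \<theta> + 1"
        using n0[of "n + n0"] by simp_all
      have "real (res (n + n0) (period \<theta> (n + n0)) z) \<le> \<theta> + 2" for z
        using res_le[OF N(1), of "n + n0" z] N(2) by linarith
      then show "norm (F (n + n0) u) \<le> (\<theta> + 2) ^ (2 * k)"
        unfolding Fg[OF N(1) u] g_def real_norm_def by (intro abs_prod_le_power) simp
    qed
    \<comment> \<open>The second condition, with 0 in place of \<theta>, is for the floor of the
      position itself.\<close>
    have "AE u in cube k. \<forall>i\<in>{..<2*k}. \<theta> - walk (u k) (\<lambda>j. u (w ! j)) i \<notin> \<int> \<and> 0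
      - walk (u k) (\<lambda>j. u (w ! j)) i \<notin> \<int>"
    proof (rule AE_finite_allI)
      fix i assume "i \<in> {..<2*k}"
      then have "w ! j < k" if "j < i" for j using wk[of j] that by simp
      then show "AE u in cube k. \<theta> - walk (u k) (\<lambda>j. u (w ! j)) i \<notin> \<int> \<and> 0 - walk (u k) (\<lambda>j. u (w ! j)) i \<notin> \<int>"
        by (intro AE_conjI AE_cube_walk_notin_Ints)
    qed simp
    then show "AE u in cube k. (\<lambda>n. F (n + n0) u) \<longlonglongrightarrow> word_weight \<theta> w u"
    proof eventually_elim
      case (elim u)
      have Ninf: "filterlim (\<lambda>n. real (period \<theta> n)) at_top sequentially"
        using period_limits(1)[OF \<theta>] by (rule filterlim_compose[OF filterlim_real_sequentially])
      have fl: "(\<lambda>n. real_of_int \<lfloor>real (period \<theta> n) * x\<rfloor> / real (period \<theta> n)) \<longlonglongrightarrow> x" for x :: real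
      proof -
        have "((\<lambda>y::real. real_of_int \<lfloor>y * x\<rfloor> / y) \<longlongrightarrow> x) at_top"
        proof (rule tendsto_sandwich[where f="\<lambda>y. x - 1 / y" and h="\<lambda>_. x"])
          show "eventually (\<lambda>y. x - 1 / y \<le> real_of_int \<lfloor>y * x\<rfloor> / y) at_top"
            using eventually_gt_at_top[of 0]
          proof eventually_elim
            case (elim y)
            have "(y * x - 1) / y \<le> real_of_int \<lfloor>y * x\<rfloor> / y"
              using elim real_of_int_floor_add_one_gt[of "y * x"] by (intro divide_right_mono) linarith+
            then show ?case using elim by (simp add: diff_divide_distrib)
          qed
          show "eventually (\<lambda>y. real_of_int \<lfloor>y * x\<rfloor> / y \<le> x) at_top"
            using eventually_gt_at_top[of 0]
          proof eventually_elim
            case (elim y)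
            have "real_of_int \<lfloor>y * x\<rfloor> / y \<le> (y * x) / y"
              using elim by (intro divide_right_mono of_int_floor_le) simp
            then show ?case using elim by simp
          qed
          show "((\<lambda>y. x - 1 / y) \<longlongrightarrow> x) at_top" by real_asymp
        qed simp
        then show ?thesis using Ninf by (rule filterlim_compose)
      qed
      have T: "(\<lambda>n. T n u i / real (period \<theta> n)) \<longlonglongrightarrow> walk (u k) (\<lambda>j. u (w ! j)) i" for i
        unfolding T_def
      proof (induction i)
        case 0 then show ?case using fl by simp
      next
        case (Suc i)
        then show ?case using tendsto_diff[OF fl[of "u (w ! i)"] Suc] by (simp add: diff_divide_distrib)
      qed
      have inv: "(\<lambda>n. 1 / real (period \<theta> n)) \<longlonglongrightarrow> 0"
        by (rule real_tendsto_divide_at_top[OF tendsto_const Ninf])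
      have "(\<lambda>n. F n u) \<longlonglongrightarrow> word_weight \<theta> w u"
        unfolding F_def word_weight_def l
      proof (rule tendsto_prod)
        fix i assume i: "i \<in> {..<2*k}"
        define t where "t = walk (u k) (\<lambda>j. u (w ! j)) i"
        have t: "\<theta> - t \<notin> \<int>" "t \<notin> \<int>" using elim i unfolding t_def by auto
        have "(\<lambda>n. real n / real (period \<theta> n) - T n u i / real (period \<theta> n)) \<longlonglongrightarrow> \<theta> - t"
          unfolding t_def by (intro tendsto_diff T period_limits(2)[OF \<theta>])
        then have 1: "(\<lambda>n. (real n - T n u i) / real (period \<theta> n)) \<longlonglongrightarrow> \<theta> - t" by (simp only: diff_divide_distrib)
        have "(\<lambda>n. T n u i / real (period \<theta> n) - 1 / real (period \<theta> n)) \<longlonglongrightarrow> t - 0"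
          unfolding t_def by (intro tendsto_diff T inv)
        then have 2: "(\<lambda>n. (T n u i - 1) / real (period \<theta> n)) \<longlonglongrightarrow> t" by (simp only: diff_divide_distrib diff_zero)
        have "(\<lambda>n. R n (T n u i)) \<longlonglongrightarrow> rho \<theta> t"
          unfolding R_def rho_def
          by (intro tendsto_add tendsto_const tendsto_floor_seq[OF 1 t(1)] tendsto_floor_seq[OF 2 t(2)])
        then show "(\<lambda>n. R n (T n u i)) \<longlonglongrightarrow> rho \<theta> (walk (u (2 * k div 2)) (\<lambda>j. u (w ! j)) i)"
          by (simp add: t_def)
      qed
      then show ?case by (rule LIMSEQ_ignore_initial_segment)
    qed
  qed
  then have "(\<lambda>n. integral\<^sup>L (cube k) (F n)) \<longlonglongrightarrow> word_integral \<theta> w"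
    unfolding word_integral_def l by (simp add: LIMSEQ_offset)
  then have "(\<lambda>n. integral\<^sup>L (cube k) (F n) * (real (period \<theta> n) / real n) ^ (k + 1))
    \<longlonglongrightarrow> word_integral \<theta> w * (1 / \<theta>) ^ (k + 1)"
    by (intro tendsto_mult tendsto_power period_limits[OF \<theta>])
  moreover have "eventually (\<lambda>n. integral\<^sup>L (cube k) (F n) * (real (period \<theta> n) / real n) ^ (k + 1)
     = real (card (circuits \<theta> w n)) / real n ^ (k + 1)) sequentially"
    using ev
  proof eventually_elim
    case (elim n)
    show ?case unfolding int[OF elim, symmetric] power_divide by simp
  qed
  ultimately have "(\<lambda>n. real (card (circuits \<theta> w n)) / real n ^ (k + 1))
    \<longlonglongrightarrow> word_integral \<theta> w * (1 / \<theta>) ^ (k + 1)"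
    by (rule Lim_transform_eventually)
  then show ?thesis by (simp add: power_divide)
qed

text \<open>The limit with its dependence on \<theta> made explicit. Symmetry is a property of the
  word alone, so continuity in \<theta> reduces to that of the integral.\<close>

definition word_value :: "real \<Rightarrow> nat list \<Rightarrow> real" where
  "word_value \<theta> w = (if symmetric_word w then word_integral \<theta> w / \<theta> ^ (length w div 2 + 1) else 0)"

lemma circuits_limit:
  assumes w: "w \<in> pair_matched_words k" and k: "k > 0" and \<theta>: "\<theta> > 0"
  shows "(\<lambda>n. real (card (circuits \<theta> w n)) / real n ^ (k + 1)) \<longlonglongrightarrow> word_limit \<theta> w"
    and "word_limit \<theta> w = word_value \<theta> w"
proof -
  have l: "length w div 2 = k" using w by (simp add: pair_matched_words_def)
  have lim: "(\<lambda>n. real (card (circuits \<theta> w n)) / real n ^ (k + 1)) \<longlonglongrightarrow> word_value \<theta> w"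
    unfolding word_value_def l
    using circuits_limit_symmetric[OF w k \<theta>] circuits_limit_asymmetric[OF w k \<theta>]
      by (cases "symmetric_word w") simp_all
  show "word_limit \<theta> w = word_value \<theta> w" unfolding word_limit_def l by (rule limI[OF lim])
  then show "(\<lambda>n. real (card (circuits \<theta> w n)) / real n ^ (k + 1)) \<longlonglongrightarrow> word_limit \<theta> w" using lim by simp
qed

lemma word_value_continuous:
  assumes w: "w \<in> pair_matched_words k" and \<theta>m: "\<And>m. \<theta>m m > 0" and \<theta>: "\<theta> > 0" and lim: "\<theta>m \<longlonglongrightarrow> \<theta>"
  shows "(\<lambda>m. word_value (\<theta>m m) w) \<longlonglongrightarrow> word_value \<theta> w"
proof (cases "symmetric_word w")
  case True
  have "(\<lambda>m. word_integral (\<theta>m m) w / \<theta>m m ^ (length w div 2 + 1))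
    \<longlonglongrightarrow> word_integral \<theta> w / \<theta> ^ (length w div 2 + 1)"
    using \<theta> by (intro tendsto_divide tendsto_power lim word_integral_continuous[OF w \<theta>m \<theta> lim]) simp
  then show ?thesis using True by (simp add: word_value_def)
qed (simp add: word_value_def)

lemma word_value_bounds:
  assumes w: "w \<in> pair_matched_words k" and \<theta>: "\<theta> > 0"
  shows "0 \<le> word_value \<theta> w" "word_value \<theta> w \<le> ((\<theta> + 1)\<^sup>2 / \<theta>) ^ k / \<theta>"
proof -
  have l: "length w div 2 = k" using w by (simp add: pair_matched_words_def)
  show "0 \<le> word_value \<theta> w" using word_integral_bounds[OF w \<theta>] \<theta> by (simp add: word_value_def)
  have "word_integral \<theta> w / \<theta> ^ (k + 1) \<le> (\<theta> + 1) ^ (2 * k) / \<theta> ^ (k + 1)"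
    using word_integral_bounds[OF w \<theta>] \<theta> by (intro divide_right_mono) simp_all
  also have "\<dots> = ((\<theta> + 1)\<^sup>2 / \<theta>) ^ k / \<theta>" by (simp add: power_mult power_divide)
  finally show "word_value \<theta> w \<le> ((\<theta> + 1)\<^sup>2 / \<theta>) ^ k / \<theta>"
    using \<theta> by (simp add: word_value_def l)
qed

section \<open>Counting quadruples of circuits\<close>

text \<open>The partition into level sets is encoded by an idempotent map that sends each index to a
  representative of its class.\<close>

lemma kernel_rep:
  fixes f :: "'i \<Rightarrow> 'v"
  shows "\<exists>g\<in>I \<rightarrow>\<^sub>E I. (\<forall>i\<in>I. g (g i) = g i) \<and> (\<forall>i\<in>I. \<forall>j\<in>I. f i = f j \<longleftrightarrow> g i = g j)"
proof -
  define s where "s v = (SOME j. j \<in> I \<and> f j = v)" for v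
  have s: "s (f i) \<in> I \<and> f (s (f i)) = f i" if "i \<in> I" for i
    unfolding s_def by (rule someI[where P="\<lambda>j. j \<in> I \<and> f j = f i" and x=i]) (use that in simp)
  define g where "g = (\<lambda>i\<in>I. s (f i))"
  have g: "g i = s (f i)" if "i \<in> I" for i using that by (simp add: g_def)
  have "g \<in> I \<rightarrow>\<^sub>E I" unfolding g_def restrict_PiE_iff using s by simp
  moreover have "g (g i) = g i" if "i \<in> I" for i
    using g[OF that] g[of "s (f i)"] s[OF that] by simp
  moreover have "f i = f j \<longleftrightarrow> g i = g j" if "i \<in> I" "j \<in> I" for i j
  proof
    assume "f i = f j" then show "g i = g j" using g that by simp
  next
    assume "g i = g j"
    then have "f (s (f i)) = f (s (f j))" using g that by simp
    then show "f i = f j" using s[OF that(1)] s[OF that(2)] by simp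
  qed
  ultimately show ?thesis by blast
qed

text \<open>Functions are sorted by their partition into level sets; there are at most
  \<open>card I ^ card I\<close> representative maps, a constant with respect to
  \<open>N\<close>.\<close>

lemma card_by_kernel:
  fixes P :: "('i \<Rightarrow> nat) \<Rightarrow> bool"
  assumes I: "finite I"
    and K: "\<And>g. g \<in> I \<rightarrow>\<^sub>E I \<Longrightarrow> (\<And>i. i \<in> I \<Longrightarrow> g (g i) = g i) \<Longrightarrow>
      card {f \<in> I \<rightarrow>\<^sub>E {..<N}. P f \<and> (\<forall>i\<in>I. \<forall>j\<in>I. f i = f j \<longleftrightarrow> g i = g j)} \<le> C"
  shows "card {f \<in> I \<rightarrow>\<^sub>E {..<N}. P f} \<le> card I ^ card I * C"
proof -
  define G where "G = {g \<in> I \<rightarrow>\<^sub>E I. \<forall>i\<in>I. g (g i) = g i}"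
  define S where "S g = {f \<in> I \<rightarrow>\<^sub>E {..<N}. P f \<and> (\<forall>i\<in>I. \<forall>j\<in>I. f i = f j \<longleftrightarrow> g i = g j)}" for g :: "'i \<Rightarrow> 'i"
  have finI: "finite (I \<rightarrow>\<^sub>E I)" using I by (intro finite_PiE) simp_all
  then have finG: "finite G" by (simp add: G_def)
  have finS: "finite (S g)" for g
    by (rule finite_subset[OF _ finite_PiE[of I "\<lambda>_. {..<N}"]]) (use I in \<open>auto simp: S_def\<close>)
  have "{f \<in> I \<rightarrow>\<^sub>E {..<N}. P f} \<subseteq> (\<Union>g\<in>G. S g)"
  proof
    fix f assume f: "f \<in> {f \<in> I \<rightarrow>\<^sub>E {..<N}. P f}"
    obtain g where "g \<in> I \<rightarrow>\<^sub>E I" "\<forall>i\<in>I. g (g i) = g i" "\<forall>i\<in>I. \<forall>j\<in>I. f i = f j \<longleftrightarrow> g i = g j"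
      using kernel_rep[of I f] by blast
    then have "g \<in> G" "f \<in> S g" using f by (simp_all add: G_def S_def)
    then show "f \<in> (\<Union>g\<in>G. S g)" by blast
  qed
  then have a: "card {f \<in> I \<rightarrow>\<^sub>E {..<N}. P f} \<le> card (\<Union>g\<in>G. S g)"
    by (rule card_mono[rotated]) (use finG finS in simp)
  have b: "card (\<Union>g\<in>G. S g) \<le> (\<Sum>g\<in>G. card (S g))" by (rule card_UN_le[OF finG])
  have "card (S g) \<le> C" if "g \<in> G" for g
    unfolding S_def by (rule K) (use that in \<open>simp_all add: G_def\<close>)
  then have "(\<Sum>g\<in>G. card (S g)) \<le> (\<Sum>g\<in>G. C)" by (rule sum_mono)
  then have c: "(\<Sum>g\<in>G. card (S g)) \<le> card G * C" by simp
  have "card G \<le> card (I \<rightarrow>\<^sub>E I)" by (intro card_mono finI) (simp add: G_def)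
  then have "card G \<le> card I ^ card I" using I by (simp add: card_PiE)
  then have "card G * C \<le> card I ^ card I * C" by (rule mult_right_mono) simp
  then show ?thesis using a b c by linarith
qed

text \<open>Once the partition is prescribed, a function is known from its values at the
  representatives.\<close>

lemma card_kernel_le:
  fixes K :: "('i \<Rightarrow> nat) set"
  assumes g: "\<And>i. i \<in> I \<Longrightarrow> g i \<in> I \<and> g (g i) = g i"
    and K: "\<And>f. f \<in> K \<Longrightarrow> f \<in> I \<rightarrow>\<^sub>E {..<N} \<and> (\<forall>i\<in>I. \<forall>j\<in>I. f i = f j \<longleftrightarrow> g i = g j)"
    and Q: "\<And>f. f \<in> K \<Longrightarrow> restrict f (g ` I) \<in> Q" "finite Q"
  shows "card K \<le> card Q"
proof (rule card_inj_on_le)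
  show "inj_on (\<lambda>f. restrict f (g ` I)) K"
  proof (rule inj_onI)
    fix f f' assume f: "f \<in> K" "f' \<in> K" and eq: "restrict f (g ` I) = restrict f' (g ` I)"
    have "f i = f' i" if i: "i \<in> I" for i
    proof -
      have gi: "g i \<in> I" "g (g i) = g i" using g[OF i] by simp_all
      have "f i = f (g i)" using K[OF f(1)] i gi by simp
      moreover have "f' i = f' (g i)" using K[OF f(2)] i gi by simp
      moreover have "restrict f (g ` I) (g i) = restrict f' (g ` I) (g i)" using eq by simp
      ultimately show ?thesis using i by simp
    qed
    then show "f = f'" using K[OF f(1)] K[OF f(2)] by (intro PiE_ext) auto
  qed
  show "(\<lambda>f. restrict f (g ` I)) ` K \<subseteq> Q" using Q(1) by blast
qed (rule Q(2))

lemma card_image_le_power: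
  fixes I :: "'i set"
  assumes I: "finite I" and N: "N > 0"
  shows "card {f \<in> I \<rightarrow>\<^sub>E {..<N}. card (f ` I) \<le> b} \<le> card I ^ card I * N ^ b"
proof (rule card_by_kernel[OF I])
  fix g :: "'i \<Rightarrow> 'i" assume g: "g \<in> I \<rightarrow>\<^sub>E I" "\<And>i. i \<in> I \<Longrightarrow> g (g i) = g i"
  let ?K = "{f \<in> I \<rightarrow>\<^sub>E {..<N}. card (f ` I) \<le> b \<and> (\<forall>i\<in>I. \<forall>j\<in>I. f i = f j \<longleftrightarrow> g i = g j)}"
  show "card ?K \<le> N ^ b"
  proof (cases "?K = {}")
    case False
    then obtain f where f: "f \<in> ?K" by blast
    have "card (g ` I) = card (f ` I)" by (rule card_image_same_kernel) (use f in simp)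
    then have b: "card (g ` I) \<le> b" using f by simp
    have "card ?K \<le> card (g ` I \<rightarrow>\<^sub>E {..<N})"
    proof (rule card_kernel_le[where g=g and I=I and N=N])
      show "g i \<in> I \<and> g (g i) = g i" if "i \<in> I" for i using g that PiE_mem[OF g(1) that] by simp
      show "restrict f (g ` I) \<in> g ` I \<rightarrow>\<^sub>E {..<N}" if "f \<in> ?K" for f
        unfolding restrict_PiE_iff using that PiE_mem[OF g(1)] by (auto simp: PiE_iff)
      show "finite (g ` I \<rightarrow>\<^sub>E {..<N})" using I by (intro finite_PiE) simp_all
    qed simp
    also have "\<dots> = N ^ card (g ` I)" using I by (simp add: card_PiE)
    also have "\<dots> \<le> N ^ b" using b N by (intro power_increasing) simp_all
    finally show ?thesis .
  next
    case True
    then show ?thesis by (simp only: card.empty zero_le)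
  qed
qed

lemma matched_image_card:
  assumes I: "finite I" and m: "\<And>i. i \<in> I \<Longrightarrow> \<exists>j\<in>I. j \<noteq> i \<and> f j = f i"
  shows "2 * card (f ` I) \<le> card I"
proof -
  have "card I = (\<Sum>v\<in>f ` I. card {i \<in> I. f i = v})"
    using sum.image_gen[OF I, of "\<lambda>_. 1::nat" f] by simp
  moreover have "(\<Sum>v\<in>f ` I. 2) \<le> (\<Sum>v\<in>f ` I. card {i \<in> I. f i = v})"
  proof (rule sum_mono)
    fix v assume "v \<in> f ` I"
    then obtain i where i: "i \<in> I" "v = f i" by blast
    obtain j where j: "j \<in> I" "j \<noteq> i" "f j = f i" using m[OF i(1)] by blast
    have "card {i, j} \<le> card {i \<in> I. f i = v}" using I i j by (intro card_mono) auto
    then show "2 \<le> card {i \<in> I. f i = v}" using j by simp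
  qed
  ultimately show ?thesis by simp
qed

text \<open>Signs can cancel, parity cannot: an odd number of occurrences certifies a nonzero
  coefficient.\<close>

lemma odd_signed_sum:
  fixes e :: "'i \<Rightarrow> int"
  assumes "finite S" "\<And>i. i \<in> S \<Longrightarrow> odd (e i)"
  shows "odd (\<Sum>i\<in>S. e i) \<longleftrightarrow> odd (card S)"
  using assms by (induction S rule: finite_induct) auto

lemma signed_sum_bound:
  fixes e :: "'i \<Rightarrow> int"
  assumes "\<And>i. i \<in> S \<Longrightarrow> \<bar>e i\<bar> = 1"
  shows "\<bar>\<Sum>i\<in>S. e i\<bar> \<le> int (card S)"
  using sum_abs[of e S] assms by simp

text \<open>The index \<open>(j, i)\<close> stands for the \<open>i\<close>-th link of the \<open>j\<close>-th of four circuits of length \<open>h\<close>.\<close>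

definition quad_index :: "nat \<Rightarrow> (nat \<times> nat) set" where
  "quad_index h = {..<4} \<times> {..<h}"

definition matched_fun :: "('i \<Rightarrow> 'v) \<Rightarrow> 'i set \<Rightarrow> bool" where
  "matched_fun f I \<longleftrightarrow> (\<forall>i\<in>I. \<exists>j\<in>I. j \<noteq> i \<and> f j = f i)"

definition crossing_fun :: "(nat \<times> nat \<Rightarrow> 'v) \<Rightarrow> nat \<Rightarrow> bool" where
  "crossing_fun f h \<longleftrightarrow> (\<forall>j<4. \<exists>i<h. \<exists>j'<4. \<exists>i'<h. j' \<noteq> j \<and> f (j, i) = f (j', i'))"

text \<open>Necessary for the values to be link values of four circuits of even length; each circuit
  thereby loses one degree of freedom.\<close>

definition closing_fun :: "(nat \<times> nat \<Rightarrow> nat) \<Rightarrow> nat \<Rightarrow> nat \<Rightarrow> bool" where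
  "closing_fun f h N \<longleftrightarrow> (\<forall>j<4. int N dvd (\<Sum>i<h. (-1) ^ (h - 1 - i) * int (f (j, i))))"

lemma card_matched_le:
  assumes N: "N > 0"
  shows "card {f \<in> quad_index h \<rightarrow>\<^sub>E {..<N}. matched_fun f (quad_index h)} \<le> (4 * h) ^ (4 * h) * N ^ (2 * h)"
proof -
  have fin: "finite (quad_index h)" and c: "card (quad_index h) = 4 * h"
    by (simp_all add: quad_index_def card_cartesian_product)
  have "card {f \<in> quad_index h \<rightarrow>\<^sub>E {..<N}. matched_fun f (quad_index h)}
    \<le> card {f \<in> quad_index h \<rightarrow>\<^sub>E {..<N}. card (f ` quad_index h) \<le> 2 * h}"
  proof (rule card_mono)
    show "finite {f \<in> quad_index h \<rightarrow>\<^sub>E {..<N}. card (f ` quad_index h) \<le> 2 * h}"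
      by (rule finite_subset[OF _ finite_PiE[of "quad_index h" "\<lambda>_. {..<N}"]]) (use fin in auto)
    show "{f \<in> quad_index h \<rightarrow>\<^sub>E {..<N}. matched_fun f (quad_index h)}
      \<subseteq> {f \<in> quad_index h \<rightarrow>\<^sub>E {..<N}. card (f ` quad_index h) \<le> 2 * h}"
    proof (intro subsetI CollectI)
      fix f assume f: "f \<in> {f \<in> quad_index h \<rightarrow>\<^sub>E {..<N}. matched_fun f (quad_index h)}"
      then have "2 * card (f ` quad_index h) \<le> card (quad_index h)"
        by (intro matched_image_card fin) (simp add: matched_fun_def)
      then show "f \<in> quad_index h \<rightarrow>\<^sub>E {..<N} \<and> card (f ` quad_index h) \<le> 2 * h" using f c by simp
    qed
  qed
  also have "\<dots> \<le> (4 * h) ^ (4 * h) * N ^ (2 * h)" using card_image_le_power[OF fin N, of "2 * h"] c by simp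
  finally show ?thesis .
qed

text \<open>Matching alone allows \<open>2 * h\<close> distinct values, and two factors
  \<open>N\<close> have to be saved. With at most \<open>2 * h - 2\<close> values this is automatic;
  with \<open>2 * h - 1\<close> one closing congruence has to be nontrivial; with
  \<open>2 * h\<close> two of them, in triangular form.\<close>

lemma card_quadruples_le:
  assumes N: "N > 0" and h: "h > 0"
  shows "card {f \<in> quad_index h \<rightarrow>\<^sub>E {..<N}. matched_fun f (quad_index h) \<and> crossing_fun f h \<and> closing_fun f h N}
    \<le> (4 * h) ^ (4 * h) * (h\<^sup>2 * N ^ (2 * h - 2))"
proof -
  let ?I = "quad_index h"
  have fin: "finite ?I" and cI: "card ?I = 4 * h"
    by (simp_all add: quad_index_def card_cartesian_product)
  define P where "P f \<longleftrightarrow> matched_fun f ?I \<and> crossing_fun f h \<and> closing_fun f h N" for f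
  have "card {f \<in> ?I \<rightarrow>\<^sub>E {..<N}. P f} \<le> card ?I ^ card ?I * (h\<^sup>2 * N ^ (2 * h - 2))"
  proof (rule card_by_kernel[OF fin])
    fix g :: "nat \<times> nat \<Rightarrow> nat \<times> nat" assume g: "g \<in> ?I \<rightarrow>\<^sub>E ?I" "\<And>i. i \<in> ?I \<Longrightarrow> g (g i) = g i"
    let ?K = "{f \<in> ?I \<rightarrow>\<^sub>E {..<N}. P f \<and> (\<forall>i\<in>?I. \<forall>j\<in>?I. f i = f j \<longleftrightarrow> g i = g j)}"
    \<comment> \<open>\<open>R\<close> holds one representative per value, \<open>B r j\<close> the
      positions of that value in circuit \<open>j\<close>, and \<open>c j r\<close> its coefficient
      in the closing congruence of circuit \<open>j\<close>.\<close>
    define R where "R = g ` ?I"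
    define B where "B r j = {i. i < h \<and> g (j, i) = r}" for r j
    define c where "c j r = (\<Sum>i\<in>B r j. (-1) ^ (h - 1 - i) :: int)" for j r
    have finB: "finite (B r j)" for r j by (simp add: B_def)
    have finR: "finite R" using fin by (simp add: R_def)
    have RI: "r \<in> ?I" if "r \<in> R" for r using that PiE_mem[OF g(1)] unfolding R_def by auto
    have c_odd: "c j r \<noteq> 0" if "odd (card (B r j))" for j r
    proof -
      have "odd (c j r)" unfolding c_def using that by (subst odd_signed_sum[OF finB]) simp_all
      then show ?thesis by auto
    qed
    have c_le: "nat \<bar>c j r\<bar> \<le> h" for j r
    proof -
      have "\<bar>c j r\<bar> \<le> int (card (B r j))" unfolding c_def by (rule signed_sum_bound) (simp add: power_abs)
      moreover have "card (B r j) \<le> card {..<h}" by (rule card_mono) (auto simp: B_def)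
      ultimately show ?thesis by simp
    qed
    have total: "(\<Sum>r\<in>R. \<Sum>j<4. card (B r j)) = 4 * h"
    proof -
      have "(\<Sum>r\<in>R. card (B r j)) = h" if "j < 4" for j
      proof -
        have "g (j, i) \<in> R" if "i < h" for i using that \<open>j < 4\<close> by (simp add: R_def quad_index_def)
        then have "(\<Sum>r\<in>R. \<Sum>i | i \<in> {..<h} \<and> g (j, i) = r. 1::nat) = (\<Sum>i<h. 1)"
          using finR by (intro sum.group) auto
        then show ?thesis by (simp add: B_def)
      qed
      then show ?thesis by (subst sum.swap) simp
    qed
    have sumR: "(\<Sum>i<h. (-1) ^ (h - 1 - i) * int (f (j, i))) = (\<Sum>r\<in>R. c j r * int (restrict f R r))"
      if f: "f \<in> ?K" and j: "j < 4" for f j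
    proof -
      have gR: "g (j, i) \<in> R" if "i < h" for i using that j by (simp add: R_def quad_index_def)
      have fg: "f (j, i) = f (g (j, i))" if "i < h" for i
      proof -
        have ji: "(j, i) \<in> ?I" using that j by (simp add: quad_index_def)
        have "f (j, i) = f (g (j, i)) \<longleftrightarrow> g (j, i) = g (g (j, i))"
          using f ji PiE_mem[OF g(1) ji] by blast
        then show ?thesis using g(2)[OF ji] by simp
      qed
      have "(\<Sum>r\<in>R. c j r * int (restrict f R r)) = (\<Sum>r\<in>R. \<Sum>i | i \<in> {..<h} \<and> g (j, i)
        = r. (-1) ^ (h - 1 - i) * int (f (j, i)))"
        unfolding c_def sum_distrib_right
        by (intro sum.cong refl) (auto simp: B_def fg)
      also have "\<dots> = (\<Sum>i<h. (-1) ^ (h - 1 - i) * int (f (j, i)))"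
        using finR gR by (intro sum.group) auto
      finally show ?thesis by simp
    qed
    have constr: "int N dvd (\<Sum>r\<in>R. c j r * int (restrict f R r))" if f: "f \<in> ?K" and j: "j < 4" for f j
    proof -
      have "int N dvd (\<Sum>i<h. (-1) ^ (h - 1 - i) * int (f (j, i)))"
        using f j by (simp add: P_def closing_fun_def)
      then show ?thesis unfolding sumR[OF f j] .
    qed
    have restrR: "restrict f R \<in> R \<rightarrow>\<^sub>E {..<N}" if f: "f \<in> ?K" for f
      unfolding restrict_PiE_iff
    proof
      fix r assume "r \<in> R"
      then have "r \<in> ?I" by (rule RI)
      moreover have "f \<in> ?I \<rightarrow>\<^sub>E {..<N}" using f by simp
      ultimately show "f r \<in> {..<N}" by (rule PiE_mem[rotated])
    qed
    have le: "card ?K \<le> card Q" if Q: "\<And>f. f \<in> ?K \<Longrightarrow> restrict f R \<in> Q" "Q \<subseteq> R \<rightarrow>\<^sub>E {..<N}" for Q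
    proof (rule card_kernel_le[where g=g and I="?I" and N=N])
      show "g i \<in> ?I \<and> g (g i) = g i" if "i \<in> ?I" for i using g(2)[OF that] PiE_mem[OF g(1) that] by simp
      show "restrict f (g ` ?I) \<in> Q" if "f \<in> ?K" for f using Q(1)[OF that] by (simp add: R_def)
      show "finite Q" by (rule finite_subset[OF Q(2)]) (use finR in \<open>simp add: finite_PiE\<close>)
    qed simp
    have h2: "1 \<le> h\<^sup>2" using h by simp
    show "card ?K \<le> h\<^sup>2 * N ^ (2 * h - 2)"
    proof (cases "?K = {}")
      case True
      then show ?thesis by (simp only: card.empty zero_le)
    next
      case False
      then obtain f0 where f0: "f0 \<in> ?K" by blast
      have ker: "f0 i = f0 j \<longleftrightarrow> g i = g j" if "i \<in> ?I" "j \<in> ?I" for i j using f0 that by simp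
      have two: "2 \<le> (\<Sum>j<4. card (B r j))" if r: "r \<in> R" for r
      proof -
        obtain i where i: "i \<in> ?I" "r = g i" using r unfolding R_def by blast
        obtain j where j: "j \<in> ?I" "j \<noteq> i" "f0 j = f0 i" using f0 i(1) unfolding P_def matched_fun_def by blast
        have gj: "g j = r" using ker[OF j(1) i(1)] j(3) i(2) by simp
        have "(\<Sum>j<4. card (B r j)) = card (SIGMA j:{..<4}. B r j)" using finB by (subst card_SigmaI) simp_all
        also have "card {i, j} \<le> card (SIGMA j:{..<4}. B r j)"
        proof (rule card_mono)
          show "finite (SIGMA j:{..<4}. B r j)" using finB by simp
          have "q \<in> (SIGMA j:{..<4}. B r j)" if "q \<in> ?I" "g q = r" for q
            using that by (cases q) (simp add: B_def quad_index_def)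
          then show "{i, j} \<subseteq> (SIGMA j:{..<4}. B r j)" using i j gj by simp
        qed
        finally show ?thesis using j(2) by simp
      qed
      have cross: "\<exists>r\<in>R. \<exists>j'<4. j' \<noteq> j \<and> 1 \<le> card (B r j) \<and> 1 \<le> card (B r j')" if j: "j < 4" for j
      proof -
        have "crossing_fun f0 h" using f0 by (simp add: P_def)
        then obtain i j' i' where i: "i < h" "j' < 4" "i' < h" "j' \<noteq> j" "f0 (j, i) = f0 (j', i')"
          using j unfolding crossing_fun_def by blast
        have m: "(j, i) \<in> ?I" "(j', i') \<in> ?I" using i j by (simp_all add: quad_index_def)
        have "g (j, i) = g (j', i')" using ker[OF m] i(5) by simp
        then have "i \<in> B (g (j, i)) j" "i' \<in> B (g (j, i)) j'" using i by (simp_all add: B_def)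
        then have "1 \<le> card (B (g (j, i)) j)" "1 \<le> card (B (g (j, i)) j')"
          using finB by (auto simp: Suc_le_eq card_gt_0_iff)
        moreover have "g (j, i) \<in> R" using m by (simp add: R_def)
        ultimately show ?thesis using i by blast
      qed
      have bnd: "2 * card R \<le> 4 * h"
      proof -
        have "(\<Sum>r\<in>R. 2) \<le> (\<Sum>r\<in>R. \<Sum>j<4. card (B r j))" by (rule sum_mono) (rule two)
        then show ?thesis using total by simp
      qed
      have pair_le: "card (B r j) + card (B r j') \<le> (\<Sum>j<4. card (B r j))" if "j < 4" "j' < 4" "j \<noteq> j'"
        for r j j'
        using sum_mono2[of "{..<4}" "{j, j'}" "\<lambda>j. card (B r j)"] that by simp
      have triple_le: "card (B r j) + card (B r j') + card (B r s) \<le> (\<Sum>j<4. card (B r j))"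
        if "j < 4" "j' < 4" "s < 4" "j \<noteq> j'" "s \<noteq> j" "s \<noteq> j'" for r j j' s
      proof -
        have "sum (\<lambda>j. card (B r j)) {j, j', s} \<le> (\<Sum>j<4. card (B r j))"
          using that by (intro sum_mono2) auto
        then show ?thesis using that by simp
      qed
      obtain r j1 where r: "r \<in> R" "j1 < 4" "j1 \<noteq> 0" "1 \<le> card (B r 0)" "1 \<le> card (B r j1)"
        using cross[of 0] by auto
      \<comment> \<open>Circuit 0 crosses circuit \<open>j1\<close> in the value \<open>r\<close>.
        The circuit \<open>s\<close> is neither of these two, and its own crossing value is
        \<open>r'\<close>.\<close>
      define s where "s = (if j1 = 1 then 2 else 1 :: nat)"
      have s: "s < 4" "s \<noteq> 0" "s \<noteq> j1" by (auto simp: s_def)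
      obtain r' t where r': "r' \<in> R" "t < 4" "t \<noteq> s" "1 \<le> card (B r' s)" "1 \<le> card (B r' t)"
        using cross[OF s(1)] by auto
      consider (small) "card R \<le> 2 * h - 2" | (mid) "card R = 2 * h - 1" | (full) "card R = 2 * h"
        using bnd h by linarith
      then show ?thesis
      proof cases
        case small
        have "card ?K \<le> card (R \<rightarrow>\<^sub>E {..<N})" by (rule le) (use restrR in simp_all)
        also have "\<dots> = N ^ card R" using finR by (simp add: card_PiE)
        also have "\<dots> \<le> 1 * N ^ (2 * h - 2)" using small N by (simp add: power_increasing)
        also have "\<dots> \<le> h\<^sup>2 * N ^ (2 * h - 2)" using h2 by (rule mult_right_mono) simp
        finally show ?thesis .
      next
        case mid
        \<comment> \<open>If all multiplicities within circuits were even, a crossing value would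
          occur at least twice in each circuit involved. This adds 4 to the lower bound
          \<open>2 * card R\<close> for the number of links and exceeds
          \<open>4 * h\<close>.\<close>
        have "\<exists>q\<in>R. \<exists>j<4. odd (card (B q j))"
        proof (rule ccontr)
          assume "\<not> (\<exists>q\<in>R. \<exists>j<4. odd (card (B q j)))"
          then have ev: "even (card (B q j))" if "q \<in> R" "j < 4" for q j using that by blast
          have e2: "2 \<le> card (B q j)" if "q \<in> R" "j < 4" "1 \<le> card (B q j)" for q j
            using ev[OF that(1,2)] that(3) by (metis One_nat_def Suc_1 Suc_leI even_Suc le_eq_less_or_eq
              even_zero odd_one)
          have a: "2 \<le> card (B r 0)" "2 \<le> card (B r j1)" using e2[of r 0] e2[of r j1] r by simp_all
          have b: "2 \<le> card (B r' s)" "2 \<le> card (B r' t)" using e2[of r' s] e2[of r' t] r' s by simp_all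
          have "2 * card R + 4 \<le> (\<Sum>q\<in>R. \<Sum>j<4. card (B q j))"
          proof (cases "r = r'")
            case True
            have "6 \<le> (\<Sum>j<4. card (B r j))" using triple_le[of 0 j1 s r] a b(1) r s True by simp
            moreover have "(\<Sum>q\<in>R. \<Sum>j<4. card (B q j)) = (\<Sum>j<4. card (B r j)) + (\<Sum>q\<in>R - {r}. \<Sum>j<4. card (B q j))"
              using finR r(1) by (rule sum.remove)
            moreover have "(\<Sum>q\<in>R - {r}. 2) \<le> (\<Sum>q\<in>R - {r}. \<Sum>j<4. card (B q j))"
              by (rule sum_mono) (use two in simp)
            ultimately show ?thesis using finR r(1) card_Diff_singleton[of r R] by simp
          next
            case False
            have 1: "4 \<le> (\<Sum>j<4. card (B r j))" using pair_le[of 0 j1 r] a r by simp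
            have 2: "4 \<le> (\<Sum>j<4. card (B r' j))" using pair_le[of s t r'] b r' s by simp
            have 3: "(\<Sum>q\<in>R. \<Sum>j<4. card (B q j)) = (\<Sum>j<4. card (B r j)) + (\<Sum>q\<in>R - {r}. \<Sum>j<4. card (B q j))"
              using finR r(1) by (rule sum.remove)
            have 4: "(\<Sum>q\<in>R - {r}. \<Sum>j<4. card (B q j))
              = (\<Sum>j<4. card (B r' j)) + (\<Sum>q\<in>R - {r} - {r'}. \<Sum>j<4. card (B q j))"
              by (rule sum.remove) (use finR r'(1) False in simp_all)
            have 5: "(\<Sum>q\<in>R - {r} - {r'}. 2) \<le> (\<Sum>q\<in>R - {r} - {r'}. \<Sum>j<4. card (B q j))"
              by (rule sum_mono) (use two in simp)
            have "card (R - {r} - {r'}) = card R - 2"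
              using finR r(1) r'(1) False by simp
            moreover have "card {r, r'} \<le> card R" using finR r(1) r'(1) by (intro card_mono) simp_all
            ultimately show ?thesis using 1 2 3 4 5 False by simp
          qed
          then show False using total mid h by simp
        qed
        then obtain q j where q: "q \<in> R" "j < 4" "odd (card (B q j))" by blast
        define Q where "Q = {v \<in> R \<rightarrow>\<^sub>E {..<N}. int N dvd (\<Sum>a\<in>R. c j a * int (v a))}"
        have "card ?K \<le> card Q"
        proof (rule le)
          show "restrict f R \<in> Q" if "f \<in> ?K" for f
            unfolding Q_def using restrR[OF that] constr[OF that q(2)] by simp
        qed (simp add: Q_def)
        also have "\<dots> \<le> nat \<bar>c j q\<bar> * N ^ (card R - 1)"
          unfolding Q_def by (rule card_linear_one[where c="c j", OF N finR q(1) c_odd[OF q(3)]])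
        also have "\<dots> \<le> h\<^sup>2 * N ^ (2 * h - 2)"
        proof (rule mult_mono)
          show "nat \<bar>c j q\<bar> \<le> h\<^sup>2" using order_trans[OF c_le[of j q] le_square[of h]]
            by (simp add: power2_eq_square)
          show "N ^ (card R - 1) \<le> N ^ (2 * h - 2)" using mid by (simp add: numeral_2_eq_2)
        qed simp_all
        finally show ?thesis .
      next
        case full
        have b2: "(\<Sum>j<4. card (B q j)) = 2" if q: "q \<in> R" for q
        proof (rule ccontr)
          assume "(\<Sum>j<4. card (B q j)) \<noteq> 2"
          then have "3 \<le> (\<Sum>j<4. card (B q j))" using two[OF q] by simp
          moreover have "(\<Sum>q\<in>R. \<Sum>j<4. card (B q j)) = (\<Sum>j<4. card (B q j)) + (\<Sum>q\<in>R - {q}. \<Sum>j<4. card (B q j))"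
            using finR q by (rule sum.remove)
          moreover have "(\<Sum>q\<in>R - {q}. 2) \<le> (\<Sum>q\<in>R - {q}. \<Sum>j<4. card (B q j))"
            by (rule sum_mono) (use two in simp)
          ultimately have "2 * card R < (\<Sum>q\<in>R. \<Sum>j<4. card (B q j))"
            using finR q card_Diff_singleton[of q R] card_gt_0_iff[of R] by auto
          then show False using total full by simp
        qed
        \<comment> \<open>Every value occurs exactly twice, so \<open>r\<close> occurs once in
          circuit 0, once in \<open>j1\<close> and not in \<open>s\<close>, while \<open>r'\<close>
          occurs once in \<open>s\<close>: the closing congruences of 0 and \<open>s\<close> are
          triangular.\<close>
        have 1: "card (B r 0) = 1" using pair_le[of 0 j1 r] b2[OF r(1)] r by simp
        have 2: "card (B r s) = 0" using triple_le[of 0 j1 s r] b2[OF r(1)] r s by simp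
        have 3: "card (B r' s) = 1" using pair_le[of s t r'] b2[OF r'(1)] r' s by simp
        have c1: "c 0 r \<noteq> 0" by (rule c_odd) (simp add: 1)
        have c2: "c s r = 0" using 2 finB by (simp add: c_def)
        have c3: "c s r' \<noteq> 0" by (rule c_odd) (simp add: 3)
        define Q where "Q = {v \<in> R \<rightarrow>\<^sub>E {..<N}. int N dvd (\<Sum>a\<in>R. c 0 a * int (v a))
          \<and> int N dvd (\<Sum>a\<in>R. c s a * int (v a))}"
        have "card ?K \<le> card Q"
        proof (rule le)
          show "restrict f R \<in> Q" if "f \<in> ?K" for f
            unfolding Q_def using restrR[OF that] constr[OF that, of 0] constr[OF that s(1)] by simp
        qed (auto simp: Q_def)
        also have "\<dots> \<le> nat \<bar>c 0 r\<bar> * (nat \<bar>c s r'\<bar> * N ^ (card R - 2))"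
          unfolding Q_def by (rule card_linear_two[where c="c 0" and c'="c s", OF N finR r(1) r'(1) c1 c2 c3])
        also have "\<dots> \<le> h * (h * N ^ (2 * h - 2))"
          using c_le full by (intro mult_mono) simp_all
        also have "\<dots> = h\<^sup>2 * N ^ (2 * h - 2)" by (simp add: power2_eq_square)
        finally show ?thesis .
      qed
    qed
  qed
  then show ?thesis unfolding P_def cI .
qed

section \<open>Fourth moments\<close>

text \<open>The sum over \<open>n\<close> of the fourth powers has finite expectation, so the series
  converges almost surely and its terms tend to 0.\<close>

lemma (in prob_space) AE_tendsto_0_of_fourth_moments:
  fixes Z :: "nat \<Rightarrow> 'a \<Rightarrow> real"
  assumes int: "\<And>n. integrable M (\<lambda>\<omega>. (Z n \<omega>) ^ 4)"
    and sum: "summable b" and b: "\<And>n. expectation (\<lambda>\<omega>. (Z n \<omega>) ^ 4) \<le> b n"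
  shows "AE \<omega> in M. (\<lambda>n. Z n \<omega>) \<longlonglongrightarrow> 0"
proof -
  define f where "f n \<omega> = (Z n \<omega>) ^ 4" for n \<omega>
  have f0: "0 \<le> f n \<omega>" for n \<omega> unfolding f_def by simp
  have fm: "f n \<in> borel_measurable M" for n using int[of n] unfolding f_def[abs_def] by simp
  have E: "(\<integral>\<^sup>+\<omega>. ennreal (f n \<omega>) \<partial>M) = ennreal (expectation (f n))" for n
    by (rule nn_integral_eq_integral) (use int[of n] f0 in \<open>simp_all add: f_def[abs_def]\<close>)
  have E0: "0 \<le> expectation (f n)" for n using f0 by (intro Bochner_Integration.integral_nonneg)
  have "summable (\<lambda>n. expectation (f n))"
  proof (rule summable_comparison_test'[OF sum, of 0])
    fix n show "norm (expectation (f n)) \<le> b n" using b[of n] E0[of n] unfolding f_def by simp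
  qed
  then have fin: "(\<Sum>n. ennreal (expectation (f n))) \<noteq> \<infinity>"
    unfolding infinity_ennreal_def by (rule ennreal_suminf_neq_top) (rule E0)
  have "(\<integral>\<^sup>+\<omega>. (\<Sum>n. ennreal (f n \<omega>)) \<partial>M) = (\<Sum>n. ennreal (expectation (f n)))"
    using fm by (subst nn_integral_suminf) (simp_all add: E)
  then have "(\<integral>\<^sup>+\<omega>. (\<Sum>n. ennreal (f n \<omega>)) \<partial>M) \<noteq> \<infinity>" using fin by simp
  then have "AE \<omega> in M. (\<Sum>n. ennreal (f n \<omega>)) \<noteq> \<infinity>"
    using fm by (intro nn_integral_PInf_AE) simp_all
  then show ?thesis
  proof eventually_elim
    case (elim \<omega>)
    have "summable (\<lambda>n. f n \<omega>)" by (rule summable_suminf_not_top) (use elim f0 in simp_all)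
    then have "(\<lambda>n. f n \<omega>) \<longlonglongrightarrow> 0" by (rule summable_LIMSEQ_zero)
    then have "(\<lambda>n. root 4 (f n \<omega>)) \<longlonglongrightarrow> root 4 0" by (rule tendsto_real_root)
    moreover have "root 4 (f n \<omega>) = \<bar>Z n \<omega>\<bar>" for n
      using real_root_power_cancel[of 4 "\<bar>Z n \<omega>\<bar>"] by (simp add: f_def)
    ultimately have "(\<lambda>n. \<bar>Z n \<omega>\<bar>) \<longlonglongrightarrow> 0" by simp
    then show ?case by (rule tendsto_rabs_zero_cancel)
  qed
qed

text \<open>Common ground of Assumptions 1 and 3, and of the truncated inputs under Assumption
  2.\<close>

locale moment_sequence = prob_space M for M :: "'a measure" +
  fixes x :: "nat \<Rightarrow> 'a \<Rightarrow> real"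
  assumes indep: "indep_vars (\<lambda>_. borel) x UNIV"
    and mean: "\<And>i. expectation (x i) = 0"
    and second: "\<And>i. expectation (\<lambda>\<omega>. (x i \<omega>)\<^sup>2) = 1"
    and bounded_moments: "\<And>h::nat. \<exists>C. \<forall>i. integrable M (\<lambda>\<omega>. \<bar>x i \<omega>\<bar> ^ h) \<and> expectation (\<lambda>\<omega>. \<bar>x i \<omega>\<bar> ^ h) \<le> C"
begin

lemma x_measurable [measurable]: "x i \<in> borel_measurable M"
  using indep unfolding indep_vars_def by simp

definition abs_bound :: "nat \<Rightarrow> real" where
  "abs_bound h = (SOME C. \<forall>i. integrable M (\<lambda>\<omega>. \<bar>x i \<omega>\<bar> ^ h) \<and> expectation (\<lambda>\<omega>. \<bar>x i \<omega>\<bar> ^ h) \<le> C)"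

lemma abs_bound: "integrable M (\<lambda>\<omega>. \<bar>x i \<omega>\<bar> ^ h)" "expectation (\<lambda>\<omega>. \<bar>x i \<omega>\<bar> ^ h) \<le> abs_bound h"
proof -
  have "\<forall>i. integrable M (\<lambda>\<omega>. \<bar>x i \<omega>\<bar> ^ h) \<and> expectation (\<lambda>\<omega>. \<bar>x i \<omega>\<bar> ^ h) \<le> abs_bound h"
    unfolding abs_bound_def by (rule someI_ex) (rule bounded_moments)
  then show "integrable M (\<lambda>\<omega>. \<bar>x i \<omega>\<bar> ^ h)" "expectation (\<lambda>\<omega>. \<bar>x i \<omega>\<bar> ^ h) \<le> abs_bound h" by simp_all
qed

lemma abs_bound_nonneg: "0 \<le> abs_bound h"
  using abs_bound(2)[of 0 h] by (rule order_trans[rotated]) (intro Bochner_Integration.integral_nonneg, simp)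

lemma power_integrable: "integrable M (\<lambda>\<omega>. x i \<omega> ^ h)"
  by (rule Bochner_Integration.integrable_bound[OF abs_bound(1)[of i h]]) (simp_all add: power_abs)

definition cprod :: "('i \<Rightarrow> nat) \<Rightarrow> 'i set \<Rightarrow> 'a \<Rightarrow> real" where
  "cprod f I \<omega> = (\<Prod>i\<in>I. x (f i) \<omega>)"

definition mom :: "('i \<Rightarrow> nat) \<Rightarrow> 'i set \<Rightarrow> real" where
  "mom f I = expectation (cprod f I)"

text \<open>The largest factor dominates the product, and its power is one of the summands; the 1 is
  for the empty product.\<close>

lemma abs_prod_le_sum_power:
  fixes y :: "'i \<Rightarrow> real"
  assumes "finite I"
  shows "\<bar>\<Prod>i\<in>I. y i\<bar> \<le> 1 + (\<Sum>i\<in>I. \<bar>y i\<bar> ^ card I)"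
proof (cases "I = {}")
  case False
  define m where "m = Max ((\<lambda>i. \<bar>y i\<bar>) ` I)"
  have "m \<in> (\<lambda>i. \<bar>y i\<bar>) ` I" unfolding m_def using assms False by (intro Max_in) simp_all
  then obtain j where j: "j \<in> I" "m = \<bar>y j\<bar>" by blast
  have le: "\<bar>y i\<bar> \<le> m" if "i \<in> I" for i unfolding m_def using assms that by (intro Max_ge) simp_all
  have "\<bar>\<Prod>i\<in>I. y i\<bar> = (\<Prod>i\<in>I. \<bar>y i\<bar>)" by (rule abs_prod)
  also have "\<dots> \<le> (\<Prod>i\<in>I. m)" using le by (intro prod_mono) simp
  also have "\<dots> = \<bar>y j\<bar> ^ card I" using j by simp
  also have "\<dots> \<le> (\<Sum>i\<in>I. \<bar>y i\<bar> ^ card I)" using j assms by (intro member_le_sum) simp_all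
  finally show ?thesis by simp
qed simp

lemma cprod_measurable: "cprod f I \<in> borel_measurable M"
  unfolding cprod_def[abs_def] by (intro borel_measurable_prod) simp

lemma cprod_integrable:
  assumes I: "finite I"
  shows "integrable M (cprod f I)"
proof (rule Bochner_Integration.integrable_bound)
  show "integrable M (\<lambda>\<omega>. 1 + (\<Sum>i\<in>I. \<bar>x (f i) \<omega>\<bar> ^ card I))"
    by (intro Bochner_Integration.integrable_add Bochner_Integration.integrable_sum abs_bound) simp
  show "cprod f I \<in> borel_measurable M" by (rule cprod_measurable)
  show "AE \<omega> in M. norm (cprod f I \<omega>) \<le> norm (1 + (\<Sum>i\<in>I. \<bar>x (f i) \<omega>\<bar> ^ card I))"
  proof (rule AE_I2)
    fix \<omega>
    have "\<bar>cprod f I \<omega>\<bar> \<le> 1 + (\<Sum>i\<in>I. \<bar>x (f i) \<omega>\<bar> ^ card I)" unfolding cprod_def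
      by (rule abs_prod_le_sum_power[OF I])
    then show "norm (cprod f I \<omega>) \<le> norm (1 + (\<Sum>i\<in>I. \<bar>x (f i) \<omega>\<bar> ^ card I))" by simp
  qed
qed

text \<open>Summed over all orders up to \<open>H\<close>, so that one constant serves every index
  set with at most \<open>H\<close> elements.\<close>

definition mom_bound :: "nat \<Rightarrow> real" where
  "mom_bound H = 1 + (\<Sum>h\<le>H. real h * abs_bound h)"

lemma mom_bound_ge_1: "1 \<le> mom_bound H"
  unfolding mom_bound_def using abs_bound_nonneg by (simp add: sum_nonneg)

lemma mom_le:
  assumes I: "finite I" and H: "card I \<le> H"
  shows "\<bar>mom f I\<bar> \<le> mom_bound H"
proof -
  have "\<bar>mom f I\<bar> \<le> expectation (\<lambda>\<omega>. \<bar>cprod f I \<omega>\<bar>)"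
    unfolding mom_def by (rule integral_abs_bound)
  also have "\<dots> \<le> expectation (\<lambda>\<omega>. 1 + (\<Sum>i\<in>I. \<bar>x (f i) \<omega>\<bar> ^ card I))"
  proof (rule Bochner_Integration.integral_mono)
    show "integrable M (\<lambda>\<omega>. \<bar>cprod f I \<omega>\<bar>)" by (intro Bochner_Integration.integrable_abs cprod_integrable I)
    show "integrable M (\<lambda>\<omega>. 1 + (\<Sum>i\<in>I. \<bar>x (f i) \<omega>\<bar> ^ card I))"
      by (intro Bochner_Integration.integrable_add Bochner_Integration.integrable_sum abs_bound) simp
    show "\<bar>cprod f I \<omega>\<bar> \<le> 1 + (\<Sum>i\<in>I. \<bar>x (f i) \<omega>\<bar> ^ card I)" for \<omega>
      unfolding cprod_def by (rule abs_prod_le_sum_power[OF I])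
  qed
  also have "\<dots> = 1 + (\<Sum>i\<in>I. expectation (\<lambda>\<omega>. \<bar>x (f i) \<omega>\<bar> ^ card I))"
    using abs_bound(1) by (subst Bochner_Integration.integral_add) (simp_all add: prob_space)
  also have "\<dots> \<le> 1 + (\<Sum>i\<in>I. abs_bound (card I))" by (intro add_left_mono sum_mono abs_bound)
  also have "\<dots> = 1 + real (card I) * abs_bound (card I)" by simp
  also have "\<dots> \<le> mom_bound H"
    unfolding mom_bound_def using H abs_bound_nonneg
    by (intro add_left_mono member_le_sum[of "card I" "{..H}" "\<lambda>h. real h * abs_bound h"]) simp_all
  finally show ?thesis .
qed

text \<open>Equal values are collected into powers of one variable, and powers of different
  variables are independent. A value of multiplicity 1 then contributes the factor 0, one of
  multiplicity 2 the factor 1.\<close>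

lemma mom_eq_prod:
  assumes I: "finite I"
  shows "mom f I = (\<Prod>v\<in>f ` I. expectation (\<lambda>\<omega>. x v \<omega> ^ card {i \<in> I. f i = v}))"
proof -
  have "cprod f I \<omega> = (\<Prod>v\<in>f ` I. x v \<omega> ^ card {i \<in> I. f i = v})" for \<omega>
  proof -
    have "cprod f I \<omega> = (\<Prod>v\<in>f ` I. \<Prod>i\<in>{i \<in> I. f i = v}. x (f i) \<omega>)"
      unfolding cprod_def by (rule prod.image_gen[OF I])
    also have "\<dots> = (\<Prod>v\<in>f ` I. \<Prod>i\<in>{i \<in> I. f i = v}. x v \<omega>)" by (intro prod.cong refl) simp
    finally show ?thesis by simp
  qed
  then have "cprod f I = (\<lambda>\<omega>. \<Prod>v\<in>f ` I. x v \<omega> ^ card {i \<in> I. f i = v})" by (rule ext)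
  then have "mom f I = expectation (\<lambda>\<omega>. \<Prod>v\<in>f ` I. x v \<omega> ^ card {i \<in> I. f i = v})"
    unfolding mom_def by (simp only:)
  also have "\<dots> = (\<Prod>v\<in>f ` I. expectation (\<lambda>\<omega>. x v \<omega> ^ card {i \<in> I. f i = v}))"
  proof (rule indep_vars_lebesgue_integral)
    show "finite (f ` I)" using I by simp
    have "indep_vars (\<lambda>_. borel) x (f ` I)" by (rule indep_vars_subset[OF indep]) simp
    then show "indep_vars (\<lambda>_. borel) (\<lambda>v \<omega>. x v \<omega> ^ card {i \<in> I. f i = v}) (f ` I)"
      by (rule indep_vars_compose2[where Y="\<lambda>v y. y ^ card {i \<in> I. f i = v}"]) simp
    show "integrable M (\<lambda>\<omega>. x v \<omega> ^ card {i \<in> I. f i = v})" for v by (rule power_integrable)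
  qed
  finally show ?thesis .
qed

lemma mom_disjoint:
  assumes A: "finite A" and B: "finite B" and AB: "A \<inter> B = {}" and f: "f ` A \<inter> f ` B = {}"
  shows "mom f (A \<union> B) = mom f A * mom f B"
proof -
  have a: "{i \<in> A \<union> B. f i = v} = {i \<in> A. f i = v}" if "v \<in> f ` A" for v
    using that f by auto
  have b: "{i \<in> A \<union> B. f i = v} = {i \<in> B. f i = v}" if "v \<in> f ` B" for v
    using that f by auto
  have "mom f (A \<union> B) = (\<Prod>v\<in>f ` A \<union> f ` B. expectation (\<lambda>\<omega>. x v \<omega> ^ card {i \<in> A \<union> B. f i = v}))"
    using A B by (subst mom_eq_prod) (simp_all add: image_Un)
  also have "\<dots> = (\<Prod>v\<in>f ` A. expectation (\<lambda>\<omega>. x v \<omega> ^ card {i \<in> A \<union> B. f i = v})) *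
      (\<Prod>v\<in>f ` B. expectation (\<lambda>\<omega>. x v \<omega> ^ card {i \<in> A \<union> B. f i = v}))"
    using A B f by (intro prod.union_disjoint) simp_all
  also have "(\<Prod>v\<in>f ` A. expectation (\<lambda>\<omega>. x v \<omega> ^ card {i \<in> A \<union> B. f i = v})) = mom f A"
    unfolding mom_eq_prod[OF A] by (intro prod.cong refl) (simp only: a)
  also have "(\<Prod>v\<in>f ` B. expectation (\<lambda>\<omega>. x v \<omega> ^ card {i \<in> A \<union> B. f i = v})) = mom f B"
    unfolding mom_eq_prod[OF B] by (intro prod.cong refl) (simp only: b)
  finally show ?thesis .
qed

lemma mom_single:
  assumes I: "finite I" and i: "i \<in> I" and u: "\<And>j. j \<in> I \<Longrightarrow> j \<noteq> i \<Longrightarrow> f j \<noteq> f i"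
  shows "mom f I = 0"
proof -
  have "{j \<in> I. f j = f i} = {i}" using i u by blast
  then have "expectation (\<lambda>\<omega>. x (f i) \<omega> ^ card {j \<in> I. f j = f i}) = 0" using mean[of "f i"] by simp
  then show ?thesis unfolding mom_eq_prod[OF I] using I i by (intro prod_zero) auto
qed

lemma mom_pairs:
  assumes I: "finite I" and c: "\<And>i. i \<in> I \<Longrightarrow> card {j \<in> I. f j = f i} = 2"
  shows "mom f I = 1"
  unfolding mom_eq_prod[OF I]
proof (rule prod.neutral, rule ballI)
  fix v assume "v \<in> f ` I"
  then obtain i where "i \<in> I" "v = f i" by blast
  then have "card {j \<in> I. f j = v} = 2" using c by simp
  then show "expectation (\<lambda>\<omega>. x v \<omega> ^ card {i \<in> I. f i = v}) = 1" using second by simp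
qed

section \<open>Products over four circuits\<close>

definition block :: "nat \<Rightarrow> nat \<Rightarrow> (nat \<times> nat) set" where
  "block h j = {j} \<times> {..<h}"

text \<open>With \<open>c = 1\<close> each circuit is centred at its mean, for even lengths; with
  \<open>c = 0\<close> it is left as it is, for odd lengths.\<close>

definition quad :: "real \<Rightarrow> (nat \<times> nat \<Rightarrow> nat) \<Rightarrow> nat \<Rightarrow> 'a \<Rightarrow> real" where
  "quad c f h \<omega> = (\<Prod>j<4. cprod f (block h j) \<omega> - c * mom f (block h j))"

lemma prod_cprod_blocks:
  assumes "finite S"
  shows "(\<Prod>j\<in>S. cprod f (block h j) \<omega>) = cprod f (S \<times> {..<h}) \<omega>"
proof -
  have "cprod f (block h j) \<omega> = (\<Prod>i<h. x (f (j, i)) \<omega>)" for j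
    unfolding cprod_def block_def using prod.cartesian_product[of "\<lambda>a b. x (f (a, b)) \<omega>" "{..<h}" "{j}"] by simp
  then show ?thesis using prod.cartesian_product[of "\<lambda>a b. x (f (a, b)) \<omega>" "{..<h}" S]
    by (simp add: cprod_def case_prod_unfold)
qed

text \<open>Centring multiplies out into products over subfamilies of circuits with constant
  coefficients, so that the expectation of each term involves a single joint moment.\<close>

lemma prod_blocks_expand:
  assumes J: "finite J"
  shows "(\<Prod>j\<in>J. cprod f (block h j) \<omega> - c * mom f (block h j)) =
    (\<Sum>S\<in>Pow J. cprod f (S \<times> {..<h}) \<omega> * (\<Prod>j\<in>J - S. - (c * mom f (block h j))))"
proof -
  have "(\<Prod>j\<in>J. cprod f (block h j) \<omega> - c * mom f (block h j)) =
     (\<Prod>j\<in>J. cprod f (block h j) \<omega> + - (c * mom f (block h j)))" by simp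
  also have "\<dots> = (\<Sum>S\<in>Pow J. (\<Prod>j\<in>S. cprod f (block h j) \<omega>) * (\<Prod>j\<in>J - S. - (c * mom f (block h j))))"
    by (rule prod_add[OF J])
  also have "\<dots> = (\<Sum>S\<in>Pow J. cprod f (S \<times> {..<h}) \<omega> * (\<Prod>j\<in>J - S. - (c * mom f (block h j))))"
  proof (rule sum.cong[OF refl])
    fix S assume "S \<in> Pow J"
    then have "finite S" using J finite_subset by auto
    then show "(\<Prod>j\<in>S. cprod f (block h j) \<omega>) * (\<Prod>j\<in>J - S. - (c * mom f (block h j)))
       = cprod f (S \<times> {..<h}) \<omega> * (\<Prod>j\<in>J - S. - (c * mom f (block h j)))"
      by (simp only: prod_cprod_blocks)
  qed
  finally show ?thesis .
qed

lemma quad_integrable: "integrable M (quad c f h)"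
proof -
  have "integrable M (\<lambda>\<omega>. \<Sum>S\<in>Pow {..<4}. cprod f (S \<times> {..<h}) \<omega> * (\<Prod>j\<in>{..<4} - S. - (c * mom f (block h j))))"
  proof (rule Bochner_Integration.integrable_sum)
    fix S assume "S \<in> Pow {..<4::nat}"
    then have "finite (S \<times> {..<h})" by (auto intro: finite_subset)
    then show "integrable M (\<lambda>\<omega>. cprod f (S \<times> {..<h}) \<omega> * (\<Prod>j\<in>{..<4} - S. - (c * mom f (block h j))))"
      by (intro integrable_mult_left cprod_integrable)
  qed
  then show ?thesis unfolding quad_def[abs_def] by (simp only: prod_blocks_expand[OF finite_lessThan])
qed

lemma quad_expectation:
  "expectation (quad c f h) = (\<Sum>S\<in>Pow {..<4}. mom f (S \<times> {..<h}) * (\<Prod>j\<in>{..<4} - S. - (c * mom f (block h j))))"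
proof -
  have i: "integrable M (cprod f (S \<times> {..<h}))" if "S \<in> Pow {..<4::nat}" for S
    by (rule cprod_integrable) (use that in \<open>auto intro: finite_subset\<close>)
  have "expectation (quad c f h) = expectation (\<lambda>\<omega>. \<Sum>S\<in>Pow {..<4}. cprod f (S \<times> {..<h}) \<omega> * (\<Prod>j\<in>{..<4}
    - S. - (c * mom f (block h j))))"
    unfolding quad_def[abs_def] by (simp only: prod_blocks_expand[OF finite_lessThan])
  also have "\<dots> = (\<Sum>S\<in>Pow {..<4}. expectation (\<lambda>\<omega>. cprod f (S \<times> {..<h}) \<omega> * (\<Prod>j\<in>{..<4} - S.
    - (c * mom f (block h j)))))"
    by (rule Bochner_Integration.integral_sum) (intro integrable_mult_left i)
  also have "\<dots> = (\<Sum>S\<in>Pow {..<4}. mom f (S \<times> {..<h}) * (\<Prod>j\<in>{..<4} - S. - (c * mom f (block h j))))"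
    unfolding mom_def by (rule sum.cong[OF refl]) (use i in simp)
  finally show ?thesis .
qed

text \<open>There are 16 subsets of the four circuits; each term has one joint moment and at most
  four further factors, whence the exponent 5.\<close>

lemma quad_bound:
  assumes c: "\<bar>c\<bar> \<le> 1"
  shows "\<bar>expectation (quad c f h)\<bar> \<le> 16 * mom_bound (4 * h) ^ 5"
proof -
  define K where "K = mom_bound (4 * h)"
  have K: "1 \<le> K" unfolding K_def by (rule mom_bound_ge_1)
  have "\<bar>expectation (quad c f h)\<bar> \<le> (\<Sum>S\<in>Pow {..<4::nat}. \<bar>mom f (S \<times> {..<h}) * (\<Prod>j\<in>{..<4} - S.
    - (c * mom f (block h j)))\<bar>)"
    unfolding quad_expectation by (rule sum_abs)
  also have "\<dots> \<le> (\<Sum>S\<in>Pow {..<4::nat}. K ^ 5)"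
  proof (rule sum_mono)
    fix S assume S: "S \<in> Pow {..<4::nat}"
    then have finS: "finite S" by (auto intro: finite_subset)
    have cS: "card S \<le> 4" using S card_mono[of "{..<4::nat}" S] by simp
    have 1: "\<bar>mom f (S \<times> {..<h})\<bar> \<le> K" unfolding K_def
      by (rule mom_le) (use finS cS in \<open>simp_all add: card_cartesian_product\<close>)
    have "\<bar>c * mom f (block h j)\<bar> \<le> 1 * K" for j unfolding abs_mult
    proof (rule mult_mono[OF c])
      show "\<bar>mom f (block h j)\<bar> \<le> K" unfolding K_def
        by (rule mom_le) (simp_all add: block_def card_cartesian_product)
    qed simp_all
    then have "\<bar>\<Prod>j\<in>{..<4} - S. - (c * mom f (block h j))\<bar> \<le> (\<Prod>j\<in>{..<4::nat} - S. K)"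
      unfolding abs_prod by (intro prod_mono) simp
    also have "\<dots> = K ^ card ({..<4} - S)" by simp
    also have "\<dots> \<le> K ^ 4"
    proof (rule power_increasing[OF _ K])
      show "card ({..<4} - S) \<le> 4" using card_mono[of "{..<4::nat}" "{..<4} - S"] by simp
    qed
    finally have "\<bar>mom f (S \<times> {..<h}) * (\<Prod>j\<in>{..<4} - S. - (c * mom f (block h j)))\<bar> \<le> K * K ^ 4"
      unfolding abs_mult using 1 K by (intro mult_mono) simp_all
    then show "\<bar>mom f (S \<times> {..<h}) * (\<Prod>j\<in>{..<4} - S. - (c * mom f (block h j)))\<bar> \<le> K ^ 5"
      by (simp add: numeral_eq_Suc)
  qed
  also have "\<dots> = 16 * K ^ 5" by (simp add: card_Pow)
  finally show ?thesis unfolding K_def .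
qed

text \<open>A link value that occurs only once kills every term of the expansion: through the joint
  moment if its circuit lies in \<open>S\<close>, through the mean of that circuit
  otherwise.\<close>

lemma quad_unmatched:
  assumes nm: "\<not> matched_fun f (quad_index h)"
  shows "expectation (quad c f h) = 0"
proof -
  obtain q where q: "q \<in> quad_index h" "\<And>p. p \<in> quad_index h \<Longrightarrow> p \<noteq> q \<Longrightarrow> f p \<noteq> f q"
    using nm unfolding matched_fun_def by blast
  obtain j0 i0 where ji: "q = (j0, i0)" "j0 < 4" "i0 < h" using q(1) by (auto simp: quad_index_def)
  have "mom f (S \<times> {..<h}) * (\<Prod>j\<in>{..<4} - S. - (c * mom f (block h j))) = 0" if S: "S \<in> Pow {..<4::nat}" for S
  proof (cases "j0 \<in> S")
    case True
    have finS: "finite S" using S by (auto intro: finite_subset)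
    have "mom f (S \<times> {..<h}) = 0"
    proof (rule mom_single[of _ q])
      show "q \<in> S \<times> {..<h}" using True ji by simp
      show "f p \<noteq> f q" if "p \<in> S \<times> {..<h}" "p \<noteq> q" for p
        by (rule q(2)) (use that S in \<open>auto simp: quad_index_def\<close>)
    qed (use finS in simp)
    then show ?thesis by simp
  next
    case False
    have "mom f (block h j0) = 0"
    proof (rule mom_single[of _ q])
      show "q \<in> block h j0" using ji by (simp add: block_def)
      show "f p \<noteq> f q" if "p \<in> block h j0" "p \<noteq> q" for p
        by (rule q(2)) (use that ji in \<open>auto simp: quad_index_def block_def\<close>)
    qed (simp add: block_def)
    then have "(\<Prod>j\<in>{..<4} - S. - (c * mom f (block h j))) = 0"
      using False ji(2) by (intro prod_zero) auto
    then show ?thesis by simp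
  qed
  then show ?thesis unfolding quad_expectation by (rule sum.neutral[OF ballI])
qed

text \<open>An isolated circuit is independent of the others, so centring kills the expectation.\<close>

lemma quad_isolated:
  assumes nc: "\<not> crossing_fun f h"
  shows "expectation (quad 1 f h) = 0"
proof -
  obtain j0 where j0: "j0 < 4" and iso: "\<And>i j' i'. i < h \<Longrightarrow> j' < 4 \<Longrightarrow> i' < h \<Longrightarrow> j' \<noteq> j0 \<Longrightarrow> f (j0, i) \<noteq> f (j', i')"
    using nc unfolding crossing_fun_def by blast
  define J where "J = {..<4::nat} - {j0}"
  define m where "m = mom f (block h j0)"
  define d where "d S = (\<Prod>j\<in>J - S. - (1 * mom f (block h j)))" for S
  have finJ: "finite J" by (simp add: J_def)
  have Jeq: "{..<4} = insert j0 J" "j0 \<notin> J" using j0 by (auto simp: J_def)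
  have finb: "finite (block h j0)" by (simp add: block_def)
  \<comment> \<open>The isolated circuit is kept apart and only the other three factors are
    expanded; each term is then a difference with expectation zero by independence.\<close>
  have q: "quad 1 f h \<omega> = (\<Sum>S\<in>Pow J. (cprod f (block h j0 \<union> S \<times> {..<h}) \<omega>
    - m * cprod f (S \<times> {..<h}) \<omega>) * d S)" for \<omega>
  proof -
    have "quad 1 f h \<omega> = (cprod f (block h j0) \<omega> - m) * (\<Prod>j\<in>J. cprod f (block h j) \<omega> - 1 * mom f (block h j))"
      unfolding quad_def Jeq(1) m_def using finJ Jeq(2) by simp
    also have "\<dots> = (\<Sum>S\<in>Pow J. (cprod f (block h j0) \<omega> - m) * (cprod f (S \<times> {..<h}) \<omega> * d S))"
      unfolding prod_blocks_expand[OF finJ] d_def by (rule sum_distrib_left)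
    also have "\<dots> = (\<Sum>S\<in>Pow J. (cprod f (block h j0 \<union> S \<times> {..<h}) \<omega> - m * cprod f (S \<times> {..<h}) \<omega>) * d S)"
    proof (rule sum.cong[OF refl])
      fix S assume S: "S \<in> Pow J"
      have "finite S" using S finJ by (auto intro: finite_subset)
      then have "cprod f (block h j0 \<union> S \<times> {..<h}) \<omega> = cprod f (block h j0) \<omega> * cprod f (S \<times> {..<h}) \<omega>"
        unfolding cprod_def using S Jeq(2) finb by (intro prod.union_disjoint) (auto simp: block_def)
      then show "(cprod f (block h j0) \<omega> - m) * (cprod f (S \<times> {..<h}) \<omega> * d S) =
         (cprod f (block h j0 \<union> S \<times> {..<h}) \<omega> - m * cprod f (S \<times> {..<h}) \<omega>) * d S"
        by (simp add: algebra_simps)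
    qed
    finally show ?thesis .
  qed
  have finS: "finite S" if "S \<in> Pow J" for S using that finJ by (auto intro: finite_subset)
  have i1: "integrable M (cprod f (S \<times> {..<h}))" "integrable M (cprod f (block h j0 \<union> S \<times> {..<h}))"
    if "S \<in> Pow J" for S
    using finS[OF that] finb by (simp_all add: cprod_integrable)
  have "expectation (quad 1 f h) = (\<Sum>S\<in>Pow J. expectation (\<lambda>\<omega>. (cprod f (block h j0 \<union> S \<times> {..<h}) \<omega>
    - m * cprod f (S \<times> {..<h}) \<omega>) * d S))"
    unfolding q[abs_def] q using i1 by (intro Bochner_Integration.integral_sum) simp
  also have "\<dots> = (\<Sum>S\<in>Pow J. (mom f (block h j0 \<union> S \<times> {..<h}) - m * mom f (S \<times> {..<h})) * d S)"
    unfolding mom_def using i1 by (intro sum.cong refl) simp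
  also have "\<dots> = (\<Sum>S\<in>Pow J. 0)"
  proof (rule sum.cong[OF refl])
    fix S assume S: "S \<in> Pow J"
    have "mom f (block h j0 \<union> S \<times> {..<h}) = m * mom f (S \<times> {..<h})"
      unfolding m_def
    proof (rule mom_disjoint[OF finb])
      show "finite (S \<times> {..<h})" using finS[OF S] by simp
      show "block h j0 \<inter> S \<times> {..<h} = {}" using S Jeq(2) by (auto simp: block_def)
      show "f ` block h j0 \<inter> f ` (S \<times> {..<h}) = {}"
      proof (rule ccontr)
        assume "f ` block h j0 \<inter> f ` (S \<times> {..<h}) \<noteq> {}"
        then obtain i j' i' where "i < h" "j' \<in> S" "i' < h" "f (j0, i) = f (j', i')" by (auto simp: block_def)
        then show False using iso[of i j' i'] S by (auto simp: J_def)
      qed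
    qed
    then show "(mom f (block h j0 \<union> S \<times> {..<h}) - m * mom f (S \<times> {..<h})) * d S = 0" by simp
  qed
  finally show ?thesis by simp
qed

end

section \<open>Moments of traces\<close>

definition links :: "real \<Rightarrow> nat \<Rightarrow> (nat \<Rightarrow> nat) \<Rightarrow> nat \<Rightarrow> nat" where
  "links \<theta> n \<pi> i = link \<theta> n (\<pi> i) (\<pi> (Suc i))"

lemma links_eq: "links \<theta> n \<pi> i = (\<pi> i + \<pi> (Suc i)) mod period \<theta> n"
  by (simp add: links_def link_def period_def)

definition max_res :: "real \<Rightarrow> nat \<Rightarrow> nat" where
  "max_res \<theta> n = n div period \<theta> n + 1"

lemma res_le_max_res:
  assumes "period \<theta> n > 0"
  shows "res n (period \<theta> n) z \<le> max_res \<theta> n"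
proof -
  have "real (res n (period \<theta> n) z) \<le> real n / real (period \<theta> n) + 1" by (rule res_le[OF assms])
  also have "\<dots> < real (n div period \<theta> n) + 2"
  proof -
    have "n < (n div period \<theta> n + 1) * period \<theta> n" using dividend_less_div_times[OF assms, of n] by simp
    then have "real n < real (n div period \<theta> n + 1) * real (period \<theta> n)"
      by (simp only: of_nat_less_iff flip: of_nat_mult)
    then have "real n / real (period \<theta> n) < real (n div period \<theta> n + 1)" using assms
      by (simp add: pos_divide_less_eq)
    then show ?thesis by simp
  qed
  finally show ?thesis unfolding max_res_def by linarith
qed

lemma prod_res_le:
  assumes "period \<theta> n > 0"
  shows "(\<Prod>i<h. res n (period \<theta> n) (z i)) \<le> max_res \<theta> n ^ h"
proof -
  have "(\<Prod>i<h. res n (period \<theta> n) (z i)) \<le> (\<Prod>i<h. max_res \<theta> n)"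
    by (intro prod_mono conjI zero_le res_le_max_res[OF assms])
  then show ?thesis by simp
qed

lemma card_links_le_even:
  assumes N: "period \<theta> n > 0" and h: "h > 0" and l: "\<And>i. i < h \<Longrightarrow> l i < period \<theta> n"
  shows "card {\<pi> \<in> circ h n. \<forall>i<h. links \<theta> n \<pi> i = l i} \<le> period \<theta> n * max_res \<theta> n ^ h"
proof -
  have "card {\<pi> \<in> circ h n. \<forall>i<h. links \<theta> n \<pi> i = l i} =
     (\<Sum>y<period \<theta> n. if [walk (int y) (\<lambda>i. int (l i)) h = int y] (mod int (period \<theta> n))
       then \<Prod>i<h. res n (period \<theta> n) (walk (int y) (\<lambda>i. int (l i)) i) else 0)"
    unfolding links_eq by (rule card_circ_links[where l=l]) (use N h l in simp_all)
  also have "\<dots> \<le> (\<Sum>y<period \<theta> n. max_res \<theta> n ^ h)"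
    by (intro sum_mono) (use prod_res_le[OF N] in simp)
  finally have "card {\<pi> \<in> circ h n. \<forall>i<h. links \<theta> n \<pi> i = l i} \<le> (\<Sum>y<period \<theta> n. max_res \<theta> n ^ h)" .
  then show ?thesis by simp
qed

text \<open>For odd length the start enters the closing congruence with coefficient -2, so at most
  two starting residues survive. A factor of the period is gained for each circuit.\<close>

lemma card_links_le_odd:
  assumes N: "period \<theta> n > 0" and h: "odd h" and l: "\<And>i. i < h \<Longrightarrow> l i < period \<theta> n"
  shows "card {\<pi> \<in> circ h n. \<forall>i<h. links \<theta> n \<pi> i = l i} \<le> 2 * max_res \<theta> n ^ h"
proof -
  have h0: "h > 0" using h by (rule odd_pos)
  define d where "d = walk 0 (\<lambda>i. int (l i)) h"
  define Y where "Y = {y\<in>{..<period \<theta> n}. int (period \<theta> n) dvd (-2) * int y + d}"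
  have cong: "[walk (int y) (\<lambda>i. int (l i)) h = int y] (mod int (period \<theta> n))
    \<longleftrightarrow> int (period \<theta> n) dvd (-2) * int y + d" for y
    unfolding cong_iff_dvd_diff walk_eq[of "int y"] d_def[symmetric] using h by (simp add: algebra_simps)
  have "card {\<pi> \<in> circ h n. \<forall>i<h. links \<theta> n \<pi> i = l i} =
     (\<Sum>y<period \<theta> n. if int (period \<theta> n) dvd (-2) * int y
       + d then \<Prod>i<h. res n (period \<theta> n) (walk (int y) (\<lambda>i. int (l i)) i) else 0)"
    unfolding links_eq cong[symmetric] by (rule card_circ_links[where l=l]) (use N h0 l in simp_all)
  also have "\<dots> = (\<Sum>y\<in>Y. \<Prod>i<h. res n (period \<theta> n) (walk (int y) (\<lambda>i. int (l i)) i))"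
    unfolding Y_def by (rule sum.inter_filter[symmetric]) simp
  also have "\<dots> \<le> (\<Sum>y\<in>Y. max_res \<theta> n ^ h)" by (intro sum_mono prod_res_le[OF N])
  also have "\<dots> = card Y * max_res \<theta> n ^ h" by simp
  also have "\<dots> \<le> 2 * max_res \<theta> n ^ h"
  proof (rule mult_right_mono)
    show "card Y \<le> 2" unfolding Y_def using card_linear_cong[OF N, of "-2" d] by simp
  qed simp
  finally show ?thesis .
qed

text \<open>If it failed, the exact count of circuits with these link values would be 0, although
  \<pi> is one of them.\<close>

lemma links_closing:
  assumes N: "period \<theta> n > 0" and h: "even h" "h > 0" and \<pi>: "\<pi> \<in> circ h n"
  shows "int (period \<theta> n) dvd (\<Sum>i<h. (-1) ^ (h - 1 - i) * int (links \<theta> n \<pi> i))"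
proof (rule ccontr)
  assume nd: "\<not> ?thesis"
  have "walk (int y) (\<lambda>i. int (links \<theta> n \<pi> i)) h - int y
    = (\<Sum>i<h. (-1) ^ (h - 1 - i) * int (links \<theta> n \<pi> i))" for y
    unfolding walk_eq[of "int y"] walk_0_sum using h by simp
  then have nc: "\<not> [walk (int y) (\<lambda>i. int (links \<theta> n \<pi> i)) h = int y] (mod int (period \<theta> n))" for y
    unfolding cong_iff_dvd_diff using nd by simp
  have "card {\<rho> \<in> circ h n. \<forall>i<h. (\<rho> i + \<rho> (Suc i)) mod period \<theta> n = links \<theta> n \<pi> i} = 0"
    by (subst card_circ_links[OF N h(2)]) (use N nc in \<open>simp_all add: links_eq\<close>)
  moreover have "finite {\<rho> \<in> circ h n. \<forall>i<h. (\<rho> i + \<rho> (Suc i)) mod period \<theta> n = links \<theta> n \<pi> i}" by simp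
  ultimately have "{\<rho> \<in> circ h n. \<forall>i<h. (\<rho> i + \<rho> (Suc i)) mod period \<theta> n = links \<theta> n \<pi> i} = {}" by simp
  moreover have "\<pi> \<in> {\<rho> \<in> circ h n. \<forall>i<h. (\<rho> i + \<rho> (Suc i)) mod period \<theta> n = links \<theta> n \<pi> i}"
    using \<pi> by (simp add: links_eq)
  ultimately show False by blast
qed

definition quad_links :: "real \<Rightarrow> nat \<Rightarrow> nat \<Rightarrow> (nat \<Rightarrow> nat \<Rightarrow> nat) \<Rightarrow> nat \<times> nat \<Rightarrow> nat" where
  "quad_links \<theta> n h p = (\<lambda>q\<in>quad_index h. links \<theta> n (p (fst q)) (snd q))"

lemma quad_links_apply: "j < 4 \<Longrightarrow> i < h \<Longrightarrow> quad_links \<theta> n h p (j, i) = links \<theta> n (p j) i"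
  by (simp add: quad_links_def quad_index_def)

lemma card_quad_links_le:
  assumes E: "\<And>l. (\<And>i. i < h \<Longrightarrow> l i < N) \<Longrightarrow> card {\<pi> \<in> circ h n. \<forall>i<h. links \<theta> n \<pi> i = l i} \<le> E"
    and F: "F \<subseteq> quad_index h \<rightarrow>\<^sub>E {..<N}"
  shows "card {p \<in> {..<4} \<rightarrow>\<^sub>E circ h n. quad_links \<theta> n h p \<in> F} \<le> card F * E ^ 4"
proof -
  have finF: "finite F" by (rule finite_subset[OF F]) (simp add: finite_PiE quad_index_def)
  define S where "S f = {p \<in> {..<4::nat} \<rightarrow>\<^sub>E circ h n. quad_links \<theta> n h p = f}" for f
  have fin: "finite ({..<4::nat} \<rightarrow>\<^sub>E circ h n)" by (intro finite_PiE) simp_all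
  have cS: "card (S f) \<le> E ^ 4" if f: "f \<in> F" for f
  proof -
    define P where "P j = {\<pi> \<in> circ h n. \<forall>i<h. links \<theta> n \<pi> i = f (j, i)}" for j
    have "S f \<subseteq> PiE {..<4} P"
    proof
      fix p assume p: "p \<in> S f"
      then have pp: "p \<in> {..<4} \<rightarrow>\<^sub>E circ h n" and pf: "quad_links \<theta> n h p = f" by (simp_all add: S_def)
      show "p \<in> PiE {..<4} P"
      proof (rule PiE_I)
        fix j :: nat assume j: "j \<in> {..<4}"
        have "links \<theta> n (p j) i = f (j, i)" if "i < h" for i
          using quad_links_apply[of j i h \<theta> n p] j that unfolding pf by simp
        then show "p j \<in> P j" unfolding P_def using PiE_mem[OF pp j] by simp
      qed (use PiE_arb[OF pp] in blast)
    qed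
    then have "card (S f) \<le> card (PiE {..<4::nat} P)"
      by (rule card_mono[rotated]) (simp add: finite_PiE P_def)
    also have "\<dots> = (\<Prod>j<4. card (P j))" by (simp add: card_PiE)
    also have "\<dots> \<le> (\<Prod>j<4::nat. E)"
    proof (intro prod_mono conjI zero_le)
      fix j :: nat assume j: "j \<in> {..<4}"
      have "f (j, i) < N" if "i < h" for i
        using PiE_mem[OF subsetD[OF F f], of "(j, i)"] j that by (simp add: quad_index_def)
      then show "card (P j) \<le> E" unfolding P_def by (rule E)
    qed
    finally show ?thesis by simp
  qed
  have "{p \<in> {..<4} \<rightarrow>\<^sub>E circ h n. quad_links \<theta> n h p \<in> F} = (\<Union>f\<in>F. S f)" by (auto simp: S_def)
  then have "card {p \<in> {..<4} \<rightarrow>\<^sub>E circ h n. quad_links \<theta> n h p \<in> F} \<le> (\<Sum>f\<in>F. card (S f))"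
    using card_UN_le[OF finF, of S] by simp
  also have "\<dots> \<le> (\<Sum>f\<in>F. E ^ 4)" by (rule sum_mono) (rule cS)
  finally show ?thesis by simp
qed

section \<open>Expectation and concentration of traces\<close>

context moment_sequence
begin

text \<open>The trace of the \<open>h\<close>-th power before scaling by the square root of
  \<open>n\<close>; the scaling enters with \<open>emom\<close>.\<close>

definition tr :: "real \<Rightarrow> nat \<Rightarrow> nat \<Rightarrow> 'a \<Rightarrow> real" where
  "tr \<theta> h n \<omega> = (\<Sum>\<pi>\<in>circ h n. cprod (links \<theta> n \<pi>) {..<h} \<omega>)"

definition tr_mean :: "real \<Rightarrow> nat \<Rightarrow> nat \<Rightarrow> real" where
  "tr_mean \<theta> h n = (\<Sum>\<pi>\<in>circ h n. mom (links \<theta> n \<pi>) {..<h})"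

lemma block_links:
  assumes j: "j < 4"
  shows "cprod (quad_links \<theta> n h p) (block h j) \<omega> = cprod (links \<theta> n (p j)) {..<h} \<omega>"
    and "mom (quad_links \<theta> n h p) (block h j) = mom (links \<theta> n (p j)) {..<h}"
proof -
  have b: "block h j = Pair j ` {..<h}" by (auto simp: block_def)
  have inj: "inj_on (Pair j) {..<h}" by (rule inj_onI) simp
  have e: "cprod (quad_links \<theta> n h p) (block h j) \<omega> = cprod (links \<theta> n (p j)) {..<h} \<omega>" for \<omega>
    unfolding cprod_def b prod.reindex[OF inj] o_def
    by (rule prod.cong[OF refl]) (simp add: quad_links_apply[OF j])
  then show "cprod (quad_links \<theta> n h p) (block h j) \<omega> = cprod (links \<theta> n (p j)) {..<h} \<omega>" .
  have "cprod (quad_links \<theta> n h p) (block h j) = cprod (links \<theta> n (p j)) {..<h}" using e by (rule ext)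
  then show "mom (quad_links \<theta> n h p) (block h j) = mom (links \<theta> n (p j)) {..<h}" unfolding mom_def by simp
qed

lemma fourth_power_expand:
  "(tr \<theta> h n \<omega> - c * tr_mean \<theta> h n) ^ 4 = (\<Sum>p\<in>{..<4} \<rightarrow>\<^sub>E circ h n. quad c (quad_links \<theta> n h p) h \<omega>)"
proof -
  define y where "y \<pi> = cprod (links \<theta> n \<pi>) {..<h} \<omega> - c * mom (links \<theta> n \<pi>) {..<h}" for \<pi>
  have "tr \<theta> h n \<omega> - c * tr_mean \<theta> h n = (\<Sum>\<pi>\<in>circ h n. y \<pi>)"
    unfolding tr_def tr_mean_def y_def by (simp add: sum_subtractf sum_distrib_left)
  then have "(tr \<theta> h n \<omega> - c * tr_mean \<theta> h n) ^ 4 = (\<Prod>j<4::nat. \<Sum>\<pi>\<in>circ h n. y \<pi>)" by simp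
  also have "\<dots> = (\<Sum>p\<in>{..<4::nat} \<rightarrow>\<^sub>E circ h n. \<Prod>j<4. y (p j))" by (rule prod_sum_PiE[where f="\<lambda>_. y"
    and B="\<lambda>_. circ h n"]) simp_all
  also have "\<dots> = (\<Sum>p\<in>{..<4} \<rightarrow>\<^sub>E circ h n. quad c (quad_links \<theta> n h p) h \<omega>)"
    unfolding quad_def y_def by (intro sum.cong prod.cong refl) (simp add: block_links)
  finally show ?thesis .
qed

lemma fourth_power_integrable: "integrable M (\<lambda>\<omega>. (tr \<theta> h n \<omega> - c * tr_mean \<theta> h n) ^ 4)"
  unfolding fourth_power_expand by (intro Bochner_Integration.integrable_sum quad_integrable)

text \<open>\<open>F\<close> collects the link patterns that may contribute, and \<open>E\<close>
  bounds the number of circuits with given links, so that the two counts separate.\<close>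

lemma fourth_moment_le:
  assumes c: "\<bar>c\<bar> \<le> 1"
    and F: "F \<subseteq> quad_index h \<rightarrow>\<^sub>E {..<N}"
    and E: "\<And>l. (\<And>i. i < h \<Longrightarrow> l i < N) \<Longrightarrow> card {\<pi> \<in> circ h n. \<forall>i<h. links \<theta> n \<pi> i = l i} \<le> E"
    and nz: "\<And>p. p \<in> {..<4} \<rightarrow>\<^sub>E circ h n \<Longrightarrow> expectation (quad c (quad_links \<theta> n h p) h) \<noteq> 0
      \<Longrightarrow> quad_links \<theta> n h p \<in> F"
  shows "expectation (\<lambda>\<omega>. (tr \<theta> h n \<omega> - c * tr_mean \<theta> h n) ^ 4)
    \<le> 16 * mom_bound (4 * h) ^ 5 * (real (card F) * real E ^ 4)"
proof -
  let ?K = "16 * mom_bound (4 * h) ^ 5"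
  let ?P = "{..<4::nat} \<rightarrow>\<^sub>E circ h n"
  have fin: "finite ?P" by (intro finite_PiE) simp_all
  have K0: "0 \<le> ?K" using mom_bound_ge_1[of "4*h"] by simp
  have "expectation (\<lambda>\<omega>. (tr \<theta> h n \<omega> - c * tr_mean \<theta> h n) ^ 4)
    = (\<Sum>p\<in>?P. expectation (quad c (quad_links \<theta> n h p) h))"
    unfolding fourth_power_expand by (rule Bochner_Integration.integral_sum) (rule quad_integrable)
  also have "\<dots> \<le> (\<Sum>p\<in>?P. if quad_links \<theta> n h p \<in> F then ?K else 0)"
  proof (rule sum_mono)
    fix p assume p: "p \<in> ?P"
    show "expectation (quad c (quad_links \<theta> n h p) h) \<le> (if quad_links \<theta> n h p \<in> F then ?K else 0)"
    proof (cases "quad_links \<theta> n h p \<in> F")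
      case True
      then show ?thesis using quad_bound[OF c, of "quad_links \<theta> n h p" h] by simp
    next
      case False
      then have "expectation (quad c (quad_links \<theta> n h p) h) = 0" using nz[OF p] by blast
      then show ?thesis using False by simp
    qed
  qed
  also have "\<dots> = (\<Sum>p\<in>{p\<in>?P. quad_links \<theta> n h p \<in> F}. ?K)"
    by (rule sum.inter_filter[OF fin, symmetric])
  also have "\<dots> = ?K * real (card {p\<in>?P. quad_links \<theta> n h p \<in> F})" by simp
  also have "\<dots> \<le> ?K * real (card F * E ^ 4)"
    using card_quad_links_le[OF E F] by (intro mult_left_mono K0) (simp only: of_nat_le_iff)
  finally show ?thesis by simp
qed

lemma quad_links_in:
  assumes N: "period \<theta> n > 0"
  shows "quad_links \<theta> n h p \<in> quad_index h \<rightarrow>\<^sub>E {..<period \<theta> n}"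
  unfolding quad_links_def restrict_PiE_iff using N by (simp add: links_eq)

lemma quad_nonzero_matched:
  assumes "expectation (quad c f h) \<noteq> 0"
  shows "matched_fun f (quad_index h)"
  using assms quad_unmatched[of f h c] by blast

text \<open>The links contribute order \<open>N ^ (2 * h - 2)\<close> and the four starts
  \<open>N ^ 4\<close>; against the normalisation \<open>n ^ (2 * h + 4)\<close> this leaves order
  \<open>1 / n\<^sup>2\<close>.\<close>

lemma fourth_moment_even:
  assumes N: "period \<theta> n > 0" and h: "even h" "h > 0"
  shows "expectation (\<lambda>\<omega>. (tr \<theta> h n \<omega> - tr_mean \<theta> h n) ^ 4) \<le>
    16 * mom_bound (4 * h) ^ 5 * (real ((4 * h) ^ (4 * h) * (h\<^sup>2 * period \<theta> n ^ (2 * h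
      - 2))) * real (period \<theta> n * max_res \<theta> n ^ h) ^ 4)"
proof -
  define F where "F = {f \<in> quad_index h \<rightarrow>\<^sub>E {..<period \<theta> n}. matched_fun f (quad_index h)
    \<and> crossing_fun f h \<and> closing_fun f h (period \<theta> n)}"
  have "expectation (\<lambda>\<omega>. (tr \<theta> h n \<omega> - 1 * tr_mean \<theta> h n) ^ 4) \<le>
    16 * mom_bound (4 * h) ^ 5 * (real (card F) * real (period \<theta> n * max_res \<theta> n ^ h) ^ 4)"
  proof (rule fourth_moment_le)
    show "F \<subseteq> quad_index h \<rightarrow>\<^sub>E {..<period \<theta> n}" by (simp add: F_def)
    show "card {\<pi> \<in> circ h n. \<forall>i<h. links \<theta> n \<pi> i = l i} \<le> period \<theta> n * max_res \<theta> n ^ h"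
      if "\<And>i. i < h \<Longrightarrow> l i < period \<theta> n" for l by (rule card_links_le_even[OF N h(2) that])
    fix p assume p: "p \<in> {..<4} \<rightarrow>\<^sub>E circ h n" and nz: "expectation (quad 1 (quad_links \<theta> n h p) h) \<noteq> 0"
    have "crossing_fun (quad_links \<theta> n h p) h" using nz quad_isolated by blast
    moreover have "closing_fun (quad_links \<theta> n h p) h (period \<theta> n)"
      unfolding closing_fun_def
    proof (intro allI impI)
      fix j :: nat assume j: "j < 4"
      have "p j \<in> circ h n" by (rule PiE_mem[OF p]) (use j in simp)
      then have "int (period \<theta> n) dvd (\<Sum>i<h. (-1) ^ (h - 1 - i) * int (links \<theta> n (p j) i))"
        by (rule links_closing[OF N h])
      also have "(\<Sum>i<h. (-1) ^ (h - 1 - i) * int (links \<theta> n (p j) i))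
        = (\<Sum>i<h. (-1) ^ (h - 1 - i) * int (quad_links \<theta> n h p (j, i)))"
        by (rule sum.cong[OF refl]) (simp add: quad_links_apply[OF j])
      finally show "int (period \<theta> n) dvd (\<Sum>i<h. (-1) ^ (h - 1 - i) * int (quad_links \<theta> n h p (j, i)))" .
    qed
    ultimately show "quad_links \<theta> n h p \<in> F"
      unfolding F_def using quad_links_in[OF N] quad_nonzero_matched[OF nz] by simp
  qed simp
  also have "\<dots> \<le> 16 * mom_bound (4 * h) ^ 5 * (real ((4 * h) ^ (4 * h) * (h\<^sup>2 * period \<theta> n ^ (2 * h
    - 2))) * real (period \<theta> n * max_res \<theta> n ^ h) ^ 4)"
  proof (intro mult_left_mono mult_right_mono)
    show "real (card F) \<le> real ((4 * h) ^ (4 * h) * (h\<^sup>2 * period \<theta> n ^ (2 * h - 2)))"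
      unfolding F_def of_nat_le_iff by (rule card_quadruples_le[OF N h(2)])
    show "0 \<le> 16 * mom_bound (4 * h) ^ 5" using mom_bound_ge_1[of "4*h"] by simp
  qed simp
  finally show ?thesis by simp
qed

text \<open>Without centring only matching is available, which gives \<open>N ^ (2 * h)\<close> link
  patterns; but the starts are bounded in number, so no further power of \<open>N\<close>
  appears.\<close>

lemma fourth_moment_odd:
  assumes N: "period \<theta> n > 0" and h: "odd h"
  shows "expectation (\<lambda>\<omega>. (tr \<theta> h n \<omega>) ^ 4) \<le>
    16 * mom_bound (4 * h) ^ 5 * (real ((4 * h) ^ (4 * h) * period \<theta> n ^ (2 * h)) * real (2 * max_res \<theta> n
      ^ h) ^ 4)"
proof -
  define F where "F = {f \<in> quad_index h \<rightarrow>\<^sub>E {..<period \<theta> n}. matched_fun f (quad_index h)}"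
  have "expectation (\<lambda>\<omega>. (tr \<theta> h n \<omega> - 0 * tr_mean \<theta> h n) ^ 4) \<le>
    16 * mom_bound (4 * h) ^ 5 * (real (card F) * real (2 * max_res \<theta> n ^ h) ^ 4)"
  proof (rule fourth_moment_le)
    show "F \<subseteq> quad_index h \<rightarrow>\<^sub>E {..<period \<theta> n}" by (simp add: F_def)
    show "card {\<pi> \<in> circ h n. \<forall>i<h. links \<theta> n \<pi> i = l i} \<le> 2 * max_res \<theta> n ^ h"
      if "\<And>i. i < h \<Longrightarrow> l i < period \<theta> n" for l by (rule card_links_le_odd[OF N h that])
    fix p assume nz: "expectation (quad 0 (quad_links \<theta> n h p) h) \<noteq> 0"
    then show "quad_links \<theta> n h p \<in> F"
      unfolding F_def using quad_links_in[OF N] quad_nonzero_matched[OF nz] by simp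
  qed simp
  also have "\<dots> \<le> 16 * mom_bound (4 * h) ^ 5 * (real ((4 * h) ^ (4 * h) * period \<theta> n ^ (2 * h)) * real (2 *
    max_res \<theta> n ^ h) ^ 4)"
  proof (intro mult_left_mono mult_right_mono)
    show "real (card F) \<le> real ((4 * h) ^ (4 * h) * period \<theta> n ^ (2 * h))"
      unfolding F_def of_nat_le_iff by (rule card_matched_le[OF N])
    show "0 \<le> 16 * mom_bound (4 * h) ^ 5" using mom_bound_ge_1[of "4*h"] by simp
  qed simp
  finally show ?thesis by simp
qed

text \<open>Pairings contribute exactly one word; the other matched sequences have fewer than \<open>k\<close> values.\<close>

lemma mom_eq_compat:
  assumes many: "\<not> card (l ` {..<2 * k}) \<le> k - 1"
  shows "mom l {..<2 * k} = real (card {w \<in> pair_matched_words k. compat w l})"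
proof (cases "\<exists>i<2 * k. mult_of l (2 * k) (l i) = 1")
  case True
  then obtain i where i: "i < 2 * k" "mult_of l (2 * k) (l i) = 1" by blast
  have "mom l {..<2 * k} = 0"
  proof (rule mom_single[of _ i])
    fix j assume j: "j \<in> {..<2 * k}" "j \<noteq> i"
    show "l j \<noteq> l i"
    proof
      assume "l j = l i"
      then have "card {i, j} \<le> mult_of l (2 * k) (l i)" unfolding mult_of_def using i j
        by (intro card_mono) auto
      then show False using i(2) j(2) by simp
    qed
  qed (use i in simp_all)
  then show ?thesis unfolding no_compat_of_single[OF i(2,1)] by simp
next
  case False
  have pos: "mult_of l (2 * k) (l i) > 0" if "i < 2 * k" for i
  proof -
    have "i \<in> {j. j < 2 * k \<and> l j = l i}" using that by simp
    then show ?thesis unfolding mult_of_def by (subst card_gt_0_iff) auto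
  qed
  have ge2: "2 \<le> mult_of l (2 * k) (l i)" if "i < 2 * k" for i
  proof -
    have "mult_of l (2 * k) (l i) \<noteq> 1" using False that by blast
    then show ?thesis using pos[OF that] by linarith
  qed
  have fin: "finite (l ` {..<2 * k})" by simp
  have total: "(\<Sum>v\<in>l ` {..<2 * k}. mult_of l (2 * k) v) = 2 * k"
    using sum.image_gen[of "{..<2 * k}" "\<lambda>_. 1::nat" l] by (simp add: mult_of_def)
  have eq2: "mult_of l (2 * k) (l i) = 2" if i: "i < 2 * k" for i
  proof (rule ccontr)
    assume "mult_of l (2 * k) (l i) \<noteq> 2"
    then have 3: "3 \<le> mult_of l (2 * k) (l i)" using ge2[OF i] by simp
    have li: "l i \<in> l ` {..<2 * k}" using i by simp
    have "(\<Sum>v\<in>l ` {..<2 * k} - {l i}. 2) \<le> (\<Sum>v\<in>l ` {..<2 * k} - {l i}. mult_of l (2 * k) v)"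
      by (rule sum_mono) (use ge2 in auto)
    \<comment> \<open>A value of multiplicity at least 3 takes an extra position, which forces at
      most \<open>k - 1\<close> distinct values.\<close>
    then have "2 * (card (l ` {..<2 * k}) - 1) + 3 \<le> 2 * k"
      using total sum.remove[OF fin li, of "mult_of l (2 * k)"] 3 card_Diff_singleton[OF li] by simp
    then show False using many by simp
  qed
  have "mom l {..<2 * k} = 1"
  proof (rule mom_pairs)
    fix i assume "i \<in> {..<2 * k}"
    then have "mult_of l (2 * k) (l i) = 2" using eq2 by simp
    then show "card {j \<in> {..<2 * k}. l j = l i} = 2" by (simp add: mult_of_def)
  qed simp
  then show ?thesis using unique_compat_of_pairs[OF eq2] by simp
qed

text \<open>Order \<open>N ^ (k - 1)\<close> for the links and \<open>N\<close> for the start: one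
  power below the normalisation \<open>n ^ (k + 1)\<close>.\<close>

lemma card_few_values:
  assumes N: "period \<theta> n > 0" and k: "k > 0"
  shows "card {\<pi> \<in> circ (2 * k) n. card (links \<theta> n \<pi> ` {..<2 * k}) \<le> k - 1}
    \<le> (2 * k) ^ (2 * k) * period \<theta> n ^ (k - 1) * (period \<theta> n * max_res \<theta> n ^ (2 * k))"
proof -
  let ?N = "period \<theta> n"
  define L where "L = {l \<in> {..<2 * k} \<rightarrow>\<^sub>E {..<?N}. card (l ` {..<2 * k}) \<le> k - 1}"
  define S where "S l = {\<pi> \<in> circ (2 * k) n. \<forall>i<2 * k. links \<theta> n \<pi> i = l i}" for l
  have finL: "finite L" unfolding L_def by (rule finite_subset[OF _ finite_PiE[of "{..<2 * k}" "\<lambda>_.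
    {..<?N}"]]) auto
  have "{\<pi> \<in> circ (2 * k) n. card (links \<theta> n \<pi> ` {..<2 * k}) \<le> k - 1} \<subseteq> (\<Union>l\<in>L. S l)"
  proof
    fix \<pi> assume \<pi>: "\<pi> \<in> {\<pi> \<in> circ (2 * k) n. card (links \<theta> n \<pi> ` {..<2 * k}) \<le> k - 1}"
    define l where "l = restrict (links \<theta> n \<pi>) {..<2 * k}"
    have "l ` {..<2 * k} = links \<theta> n \<pi> ` {..<2 * k}" unfolding l_def by (rule image_restrict_eq)
    moreover have "l \<in> {..<2 * k} \<rightarrow>\<^sub>E {..<?N}" unfolding l_def restrict_PiE_iff using N by (simp add: links_eq)
    ultimately have "l \<in> L" using \<pi> by (simp add: L_def)
    moreover have "\<pi> \<in> S l" using \<pi> by (simp add: S_def l_def)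
    ultimately show "\<pi> \<in> (\<Union>l\<in>L. S l)" by blast
  qed
  then have "card {\<pi> \<in> circ (2 * k) n. card (links \<theta> n \<pi> ` {..<2 * k}) \<le> k - 1} \<le> card (\<Union>l\<in>L. S l)"
    by (rule card_mono[rotated]) (use finL in \<open>simp add: S_def\<close>)
  also have "\<dots> \<le> (\<Sum>l\<in>L. card (S l))" by (rule card_UN_le[OF finL])
  also have "\<dots> \<le> (\<Sum>l\<in>L. ?N * max_res \<theta> n ^ (2 * k))"
  proof (rule sum_mono)
    fix l assume l: "l \<in> L"
    have "l i < ?N" if "i < 2 * k" for i using PiE_mem[of l "{..<2 * k}" "\<lambda>_. {..<?N}" i] l that
      by (simp add: L_def)
    then show "card (S l) \<le> ?N * max_res \<theta> n ^ (2 * k)" unfolding S_def using k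
      by (intro card_links_le_even N) simp_all
  qed
  also have "\<dots> = card L * (?N * max_res \<theta> n ^ (2 * k))" by simp
  also have "\<dots> \<le> (2 * k) ^ (2 * k) * ?N ^ (k - 1) * (?N * max_res \<theta> n ^ (2 * k))"
  proof (rule mult_right_mono)
    show "card L \<le> (2 * k) ^ (2 * k) * ?N ^ (k - 1)"
      unfolding L_def using card_image_le_power[of "{..<2 * k}" ?N "k - 1"] N by simp
  qed simp
  finally show ?thesis .
qed

text \<open>After exchanging sums, the circuit counts add up the number of compatible words over all
  circuits. This number agrees with the moment unless there are fewer than \<open>k\<close> distinct
  link values, and such circuits are of smaller order.\<close>

lemma tr_mean_approx:
  assumes N: "period \<theta> n > 0" and k: "k > 0"
  shows "\<bar>tr_mean \<theta> (2 * k) n - (\<Sum>w\<in>pair_matched_words k. real (card (circuits \<theta> w n)))\<bar>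
    \<le> (mom_bound (2 * k) + real (card (pair_matched_words k))) *
      real ((2 * k) ^ (2 * k) * period \<theta> n ^ (k - 1) * (period \<theta> n * max_res \<theta> n ^ (2 * k)))"
proof -
  define W where "W \<pi> = real (card {w \<in> pair_matched_words k. compat w (links \<theta> n \<pi>)})" for \<pi>
  define C where "C = mom_bound (2 * k) + real (card (pair_matched_words k))"
  have C0: "0 \<le> C" unfolding C_def using mom_bound_ge_1[of "2 * k"] by simp
  define B where "B = {\<pi> \<in> circ (2 * k) n. card (links \<theta> n \<pi> ` {..<2 * k}) \<le> k - 1}"
  have "(\<Sum>w\<in>pair_matched_words k. real (card (circuits \<theta> w n)))
    = (\<Sum>w\<in>pair_matched_words k. \<Sum>\<pi>\<in>circ (2 * k) n. if compat w (links \<theta> n \<pi>) then 1 else 0)"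
  proof (rule sum.cong[OF refl])
    fix w assume w: "w \<in> pair_matched_words k"
    have "circuits \<theta> w n = {\<pi> \<in> circ (2 * k) n. compat w (links \<theta> n \<pi>)}"
      unfolding links_def[abs_def] by (rule circuits_eq) (use w in \<open>simp add: pair_matched_words_def\<close>)
    then have "real (card (circuits \<theta> w n)) = (\<Sum>\<pi>\<in>{\<pi> \<in> circ (2 * k) n. compat w (links \<theta> n \<pi>)}. 1)" by simp
    also have "\<dots> = (\<Sum>\<pi>\<in>circ (2 * k) n. if compat w (links \<theta> n \<pi>) then 1 else 0)" by (rule sum.inter_filter) simp
    finally show "real (card (circuits \<theta> w n)) = (\<Sum>\<pi>\<in>circ (2 * k) n. if compat w (links \<theta> n \<pi>) then 1 else 0)" .
  qed
  also have "\<dots> = (\<Sum>\<pi>\<in>circ (2 * k) n. \<Sum>w\<in>pair_matched_words k. if compat w (links \<theta> n \<pi>) then 1 else 0)"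
    by (rule sum.swap)
  also have "\<dots> = (\<Sum>\<pi>\<in>circ (2 * k) n. W \<pi>)"
  proof (rule sum.cong[OF refl])
    fix \<pi>
    have "(\<Sum>w\<in>pair_matched_words k. if compat w (links \<theta> n \<pi>) then 1 else 0)
      = (\<Sum>w\<in>{w \<in> pair_matched_words k. compat w (links \<theta> n \<pi>)}. 1::real)"
      by (rule sum.inter_filter[symmetric]) (rule finite_pair_matched_words)
    then show "(\<Sum>w\<in>pair_matched_words k. if compat w (links \<theta> n \<pi>) then 1 else 0) = W \<pi>" by (simp add: W_def)
  qed
  finally have "tr_mean \<theta> (2 * k) n - (\<Sum>w\<in>pair_matched_words k. real (card (circuits \<theta> w n)))
    = (\<Sum>\<pi>\<in>circ (2 * k) n. mom (links \<theta> n \<pi>) {..<2 * k} - W \<pi>)"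
    unfolding tr_mean_def by (simp add: sum_subtractf)
  also have "\<bar>\<dots>\<bar> \<le> (\<Sum>\<pi>\<in>circ (2 * k) n. \<bar>mom (links \<theta> n \<pi>) {..<2 * k} - W \<pi>\<bar>)" by (rule sum_abs)
  also have "\<dots> \<le> (\<Sum>\<pi>\<in>circ (2 * k) n. if card (links \<theta> n \<pi> ` {..<2 * k}) \<le> k - 1 then C else 0)"
  proof (rule sum_mono)
    fix \<pi> assume "\<pi> \<in> circ (2 * k) n"
    show "\<bar>mom (links \<theta> n \<pi>) {..<2 * k} - W \<pi>\<bar> \<le> (if card (links \<theta> n \<pi> ` {..<2 * k}) \<le> k - 1 then C else 0)"
    proof (cases "card (links \<theta> n \<pi> ` {..<2 * k}) \<le> k - 1")
      case True
      have "\<bar>mom (links \<theta> n \<pi>) {..<2 * k}\<bar> \<le> mom_bound (2 * k)" by (rule mom_le) simp_all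
      moreover have "\<bar>W \<pi>\<bar> \<le> real (card (pair_matched_words k))"
        unfolding W_def using card_mono[OF finite_pair_matched_words[of k], of "{w \<in> pair_matched_words k.
          compat w (links \<theta> n \<pi>)}"] by simp
      ultimately show ?thesis using True unfolding C_def by simp
    next
      case False
      then show ?thesis using mom_eq_compat[OF False] by (simp add: W_def)
    qed
  qed
  also have "\<dots> = (\<Sum>\<pi>\<in>B. C)" unfolding B_def by (rule sum.inter_filter[symmetric]) simp
  also have "\<dots> = C * real (card B)" by simp
  also have "\<dots> \<le> C * real ((2 * k) ^ (2 * k) * period \<theta> n ^ (k - 1) * (period \<theta> n * max_res \<theta> n ^ (2 * k)))"
    using card_few_values[OF N k] unfolding B_def by (intro mult_left_mono C0) (simp only: of_nat_le_iff)
  finally show ?thesis unfolding C_def .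
qed

end

text \<open>Order 0 is set apart: the empty word would contribute \<open>1 / \<theta>\<close>
  instead of the total mass 1.\<close>

definition limit_moment :: "real \<Rightarrow> nat \<Rightarrow> real" where
  "limit_moment \<theta> h = (if h = 0 then 1 else if even h then \<Sum>w\<in>pair_matched_words (h div 2). word_value \<theta> w
    else 0)"

lemma eventually_period_regular:
  assumes \<theta>: "\<theta> > 0"
  shows "\<exists>n0>0. \<forall>n\<ge>n0. period \<theta> n > 0 \<and> real (max_res \<theta> n) \<le> \<theta> + 2 \<and> real (period \<theta> n) \<le> (1 / \<theta>) * real n"
proof -
  have "eventually (\<lambda>n. real n / real (period \<theta> n) < \<theta> + 1) sequentially"
    using order_tendstoD(2)[OF period_limits(2)[OF \<theta>], of "\<theta> + 1"] by simp
  then have "eventually (\<lambda>n. period \<theta> n > 0 \<and> real n / real (period \<theta> n) < \<theta> + 1) sequentially"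
    using period_pos[OF \<theta>] by eventually_elim simp
  then obtain n0 where n0: "\<And>n. n \<ge> n0 \<Longrightarrow> period \<theta> n > 0 \<and> real n / real (period \<theta> n) < \<theta> + 1"
    unfolding eventually_sequentially by blast
  show ?thesis
  proof (intro exI[of _ "Suc n0"] conjI allI impI)
    fix n assume n: "Suc n0 \<le> n"
    show "period \<theta> n > 0" using n0[of n] n by simp
    have "real (n div period \<theta> n) \<le> real n / real (period \<theta> n)" by (rule of_nat_div_le_of_nat)
    then show "real (max_res \<theta> n) \<le> \<theta> + 2" unfolding max_res_def using n0[of n] n by simp
    show "real (period \<theta> n) \<le> (1 / \<theta>) * real n"
      using \<theta> of_int_floor_le[of "real n / \<theta>"] unfolding period_def by simp
  qed simp
qed

context moment_sequence
begin

text \<open>For \<open>n > 0\<close> this is the \<open>h\<close>-th moment of the spectral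
  distribution, by \<open>emp_moments\<close>.\<close>

definition emom :: "real \<Rightarrow> nat \<Rightarrow> nat \<Rightarrow> 'a \<Rightarrow> real" where
  "emom \<theta> h n \<omega> = tr \<theta> h n \<omega> / (real n * sqrt (real n) ^ h)"

lemma tr_mean_limit:
  assumes \<theta>: "\<theta> > 0" and k: "k > 0"
  shows "(\<lambda>n. tr_mean \<theta> (2 * k) n / real n ^ (k + 1)) \<longlonglongrightarrow> limit_moment \<theta> (2 * k)"
proof -
  obtain n0 where n0: "n0 > 0" "\<And>n. n \<ge> n0 \<Longrightarrow> period \<theta> n > 0 \<and> real (max_res \<theta> n)
    \<le> \<theta> + 2 \<and> real (period \<theta> n) \<le> (1 / \<theta>) * real n"
    using eventually_period_regular[OF \<theta>] by blast
  define W where "W n = (\<Sum>w\<in>pair_matched_words k. real (card (circuits \<theta> w n)))" for n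
  define C where "C = mom_bound (2 * k) + real (card (pair_matched_words k))"
  have C0: "0 \<le> C" unfolding C_def using mom_bound_ge_1[of "2 * k"] by simp
  define D where "D = C * (real ((2 * k) ^ (2 * k)) * ((1 / \<theta>) ^ k * (\<theta> + 2) ^ (2 * k)))"
  have "(\<lambda>n. \<Sum>w\<in>pair_matched_words k. real (card (circuits \<theta> w n)) / real n ^ (k + 1))
    \<longlonglongrightarrow> (\<Sum>w\<in>pair_matched_words k. word_value \<theta> w)"
  proof (rule tendsto_sum)
    fix w assume w: "w \<in> pair_matched_words k"
    show "(\<lambda>n. real (card (circuits \<theta> w n)) / real n ^ (k + 1)) \<longlonglongrightarrow> word_value \<theta> w"
      using circuits_limit(1)[OF w k \<theta>] unfolding circuits_limit(2)[OF w k \<theta>] .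
  qed
  then have lim: "(\<lambda>n. W n / real n ^ (k + 1)) \<longlonglongrightarrow> limit_moment \<theta> (2 * k)"
    unfolding W_def sum_divide_distrib limit_moment_def using k by simp
  have "(\<lambda>n. tr_mean \<theta> (2 * k) n / real n ^ (k + 1) - W n / real n ^ (k + 1)) \<longlonglongrightarrow> 0"
  proof (rule Lim_null_comparison)
    show "(\<lambda>n. D * (1 / real n)) \<longlonglongrightarrow> 0" using tendsto_mult[OF tendsto_const lim_1_over_n, of D] by simp
    show "eventually (\<lambda>n. norm (tr_mean \<theta> (2 * k) n / real n ^ (k + 1) - W n / real n ^ (k + 1))
      \<le> D * (1 / real n)) sequentially"
    proof (rule eventually_sequentiallyI[of n0])
      fix n assume n: "n \<ge> n0"
      have N: "period \<theta> n > 0" and m: "real (max_res \<theta> n) \<le> \<theta> + 2"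
        and p: "real (period \<theta> n) \<le> (1 / \<theta>) * real n" using n0(2)[OF n] by simp_all
      have np: "0 < real n" using n n0(1) by simp
      have "\<bar>tr_mean \<theta> (2 * k) n - W n\<bar> \<le> C * real ((2 * k) ^ (2 * k) * period \<theta> n ^ (k
        - 1) * (period \<theta> n * max_res \<theta> n ^ (2 * k)))"
        unfolding W_def C_def by (rule tr_mean_approx[OF N k])
      also have "real ((2 * k) ^ (2 * k) * period \<theta> n ^ (k - 1) * (period \<theta> n * max_res \<theta> n ^ (2 * k)))
        = real ((2 * k) ^ (2 * k)) * (real (period \<theta> n) ^ k * real (max_res \<theta> n) ^ (2 * k))"
        using k by (cases k) simp_all
      also have "C * \<dots> \<le> C * (real ((2 * k) ^ (2 * k)) * (((1 / \<theta>) * real n) ^ k * (\<theta> + 2) ^ (2 * k)))"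
        by (intro mult_left_mono mult_mono power_mono m p C0) (use \<theta> in simp_all)
      also have "\<dots> = D * real n ^ k" unfolding D_def by (simp add: power_mult_distrib power_divide)
      finally have "\<bar>tr_mean \<theta> (2 * k) n - W n\<bar> / real n ^ (k + 1) \<le> D * real n ^ k / real n ^ (k + 1)"
        by (intro divide_right_mono) simp_all
      also have "\<dots> = D * (1 / real n)" using np by simp
      finally show "norm (tr_mean \<theta> (2 * k) n / real n ^ (k + 1) - W n / real n ^ (k + 1)) \<le> D * (1 / real n)"
        by (simp add: diff_divide_distrib[symmetric])
    qed
  qed
  from tendsto_add[OF this lim] show ?thesis by simp
qed

lemma sqrt_power_4: "(real n * sqrt (real n) ^ h) ^ 4 = real n ^ (2 * h + 4)"
proof -
  have "(sqrt (real n) ^ h) ^ 4 = ((sqrt (real n))\<^sup>2) ^ (2 * h)"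
    unfolding power_mult[symmetric] by (rule arg_cong[where f="\<lambda>m. sqrt (real n) ^ m"]) simp
  then have "(sqrt (real n) ^ h) ^ 4 = real n ^ (2 * h)" by simp
  then show ?thesis by (simp add: power_mult_distrib power_add)
qed

text \<open>The exponent \<open>2 * h + 2\<close> is two below that of the normalisation, so the
  bounds are summable. As in \<open>quad\<close>, \<open>c\<close> switches the centring on or
  off.\<close>

lemma emom_centered_AE:
  assumes \<theta>: "\<theta> > 0" and n0: "n0 > 0"
    and K: "\<And>n. n \<ge> n0 \<Longrightarrow> expectation (\<lambda>\<omega>. (tr \<theta> h n \<omega> - c * tr_mean \<theta> h n) ^ 4) \<le> K * real n ^ (2 * h + 2)"
  shows "AE \<omega> in M. (\<lambda>n. emom \<theta> h n \<omega> - c * tr_mean \<theta> h n / (real n * sqrt (real n) ^ h)) \<longlonglongrightarrow> 0"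
proof -
  define d where "d n = real n * sqrt (real n) ^ h" for n
  \<comment> \<open>Shifted by \<open>n0\<close>, because the moment bound starts there; the limit
    does not see the shift.\<close>
  define Z where "Z n \<omega> = (tr \<theta> h (n + n0) \<omega> - c * tr_mean \<theta> h (n + n0)) / d (n + n0)" for n \<omega>
  have Z4: "(Z n \<omega>) ^ 4 = (tr \<theta> h (n + n0) \<omega> - c * tr_mean \<theta> h (n + n0)) ^ 4 / real (n + n0) ^ (2 * h
    + 4)" for n \<omega>
    unfolding Z_def power_divide d_def sqrt_power_4 ..
  have "AE \<omega> in M. (\<lambda>n. Z n \<omega>) \<longlonglongrightarrow> 0"
  proof (rule AE_tendsto_0_of_fourth_moments)
    show "integrable M (\<lambda>\<omega>. (Z n \<omega>) ^ 4)" for n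
      unfolding Z4 by (intro integrable_divide fourth_power_integrable)
    have "summable (\<lambda>n. inverse (real n ^ 2))" by (rule inverse_power_summable) simp
    then have "summable (\<lambda>n. inverse (real (n + n0) ^ 2))" by (rule summable_ignore_initial_segment)
    then show "summable (\<lambda>n. K * inverse (real (n + n0) ^ 2))" by (rule summable_mult)
    show "expectation (\<lambda>\<omega>. (Z n \<omega>) ^ 4) \<le> K * inverse (real (n + n0) ^ 2)" for n
    proof -
      have p: "0 < real (n + n0)" using n0 by simp
      have "expectation (\<lambda>\<omega>. (Z n \<omega>) ^ 4) = expectation (\<lambda>\<omega>. (tr \<theta> h (n + n0) \<omega> - c * tr_mean \<theta> h (n
        + n0)) ^ 4) / real (n + n0) ^ (2 * h + 4)"
        unfolding Z4 by (rule integral_divide_zero)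
      also have "\<dots> \<le> K * real (n + n0) ^ (2 * h + 2) / real (n + n0) ^ (2 * h + 4)"
        by (intro divide_right_mono K) simp_all
      also have "real (n + n0) ^ (2 * h + 4) = real (n + n0) ^ (2 * h + 2) * real (n + n0) ^ 2"
        unfolding power_add[symmetric] by (rule arg_cong[where f="\<lambda>m. real (n + n0) ^ m"]) simp
      also have "K * real (n + n0) ^ (2 * h + 2) / (real (n + n0) ^ (2 * h + 2) * real (n + n0) ^ 2)
        = K * inverse (real (n + n0) ^ 2)"
      proof -
        have "K * a / (a * b) = K * inverse b" if "a \<noteq> 0" for a b :: real using that
          by (simp add: divide_inverse)
        then show ?thesis using p by (metis less_irrefl zero_less_power)
      qed
      finally show ?thesis .
    qed
  qed
  then show ?thesis
  proof eventually_elim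
    case (elim \<omega>)
    have "Z n \<omega> = emom \<theta> h (n + n0) \<omega> - c * tr_mean \<theta> h (n + n0) / (real (n + n0) * sqrt (real (n
      + n0)) ^ h)" for n
      unfolding Z_def emom_def d_def by (rule diff_divide_distrib)
    then have "(\<lambda>n. emom \<theta> h (n + n0) \<omega> - c * tr_mean \<theta> h (n + n0) / (real (n + n0) * sqrt (real (n
      + n0)) ^ h)) \<longlonglongrightarrow> 0"
      using elim by simp
    then show ?case by (rule LIMSEQ_offset)
  qed
qed

lemma emom_odd_AE:
  assumes \<theta>: "\<theta> > 0" and h: "odd h"
  shows "AE \<omega> in M. (\<lambda>n. emom \<theta> h n \<omega>) \<longlonglongrightarrow> 0"
proof -
  obtain n0 where n0: "n0 > 0" "\<And>n. n \<ge> n0 \<Longrightarrow> period \<theta> n > 0 \<and> real (max_res \<theta> n)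
    \<le> \<theta> + 2 \<and> real (period \<theta> n) \<le> (1 / \<theta>) * real n"
    using eventually_period_regular[OF \<theta>] by blast
  define A where "A = 16 * mom_bound (4 * h) ^ 5"
  have A0: "0 \<le> A" unfolding A_def using mom_bound_ge_1[of "4 * h"] by simp
  define K where "K = A * (real ((4 * h) ^ (4 * h)) * (1 / \<theta>) ^ (2 * h) * (2 * (\<theta> + 2) ^ h) ^ 4)"
  have K0: "0 \<le> K" unfolding K_def using A0 \<theta> by (intro mult_nonneg_nonneg) simp_all
  have "expectation (\<lambda>\<omega>. (tr \<theta> h n \<omega> - 0 * tr_mean \<theta> h n) ^ 4) \<le> K * real n ^ (2 * h + 2)" if n: "n \<ge> n0" for n
  proof -
    have N: "period \<theta> n > 0" and m: "real (max_res \<theta> n) \<le> \<theta> + 2"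
      and p: "real (period \<theta> n) \<le> (1 / \<theta>) * real n" using n0(2)[OF n] by simp_all
    have n1: "1 \<le> real n" using n n0(1) by simp
    have "expectation (\<lambda>\<omega>. (tr \<theta> h n \<omega>) ^ 4) \<le> A * (real ((4 * h) ^ (4 * h) * period \<theta> n ^ (2 * h)) * real
      (2 * max_res \<theta> n ^ h) ^ 4)"
      unfolding A_def by (rule fourth_moment_odd[OF N h])
    also have "\<dots> = A * (real ((4 * h) ^ (4 * h)) * real (period \<theta> n) ^ (2 * h) * (2 * real (max_res \<theta> n) ^
      h) ^ 4)"
      by simp
    also have "\<dots> \<le> A * (real ((4 * h) ^ (4 * h)) * ((1 / \<theta>) * real n) ^ (2 * h) * (2 * (\<theta> + 2) ^ h) ^ 4)"
      by (intro mult_left_mono mult_mono power_mono m p A0) (use \<theta> in simp_all)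
    also have "\<dots> = K * real n ^ (2 * h)" unfolding K_def power_mult_distrib[of "1 / \<theta>"] by (simp only: mult_ac)
    also have "\<dots> \<le> K * real n ^ (2 * h + 2)" by (intro mult_left_mono power_increasing K0 n1) simp
    finally show ?thesis by simp
  qed
  from emom_centered_AE[OF \<theta> n0(1) this] show ?thesis by simp
qed

lemma emom_even_AE:
  assumes \<theta>: "\<theta> > 0" and k: "k > 0"
  shows "AE \<omega> in M. (\<lambda>n. emom \<theta> (2 * k) n \<omega>) \<longlonglongrightarrow> limit_moment \<theta> (2 * k)"
proof -
  define h where "h = 2 * k"
  have h: "even h" "h > 0" using k by (simp_all add: h_def)
  obtain n0 where n0: "n0 > 0" "\<And>n. n \<ge> n0 \<Longrightarrow> period \<theta> n > 0 \<and> real (max_res \<theta> n)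
    \<le> \<theta> + 2 \<and> real (period \<theta> n) \<le> (1 / \<theta>) * real n"
    using eventually_period_regular[OF \<theta>] by blast
  define A where "A = 16 * mom_bound (4 * h) ^ 5"
  have A0: "0 \<le> A" unfolding A_def using mom_bound_ge_1[of "4 * h"] by simp
  define K where "K = A * (real ((4 * h) ^ (4 * h) * h\<^sup>2) * (1 / \<theta>) ^ (2 * h + 2) * ((\<theta> + 2) ^ h) ^ 4)"
  have "expectation (\<lambda>\<omega>. (tr \<theta> h n \<omega> - 1 * tr_mean \<theta> h n) ^ 4) \<le> K * real n ^ (2 * h + 2)" if n: "n \<ge> n0" for n
  proof -
    have N: "period \<theta> n > 0" and m: "real (max_res \<theta> n) \<le> \<theta> + 2"
      and p: "real (period \<theta> n) \<le> (1 / \<theta>) * real n" using n0(2)[OF n] by simp_all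
    have "expectation (\<lambda>\<omega>. (tr \<theta> h n \<omega> - tr_mean \<theta> h n) ^ 4) \<le>
       A * (real ((4 * h) ^ (4 * h) * (h\<^sup>2 * period \<theta> n ^ (2 * h
         - 2))) * real (period \<theta> n * max_res \<theta> n ^ h) ^ 4)"
      unfolding A_def by (rule fourth_moment_even[OF N h])
    also have "\<dots> = A * (real ((4 * h) ^ (4 * h) * h\<^sup>2) * (real (period \<theta> n) ^ (2 * h
      - 2) * real (period \<theta> n) ^ 4) * (real (max_res \<theta> n) ^ h) ^ 4)"
      by (simp add: power_mult_distrib)
    also have "real (period \<theta> n) ^ (2 * h - 2) * real (period \<theta> n) ^ 4 = real (period \<theta> n) ^ (2 * h + 2)"
      unfolding power_add[symmetric] using h(2) by (intro arg_cong[where f="\<lambda>m. real (period \<theta> n) ^ m"]) simp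
    also have "A * (real ((4 * h) ^ (4 * h) * h\<^sup>2) * real (period \<theta> n) ^ (2 * h
      + 2) * (real (max_res \<theta> n) ^ h) ^ 4)
      \<le> A * (real ((4 * h) ^ (4 * h) * h\<^sup>2) * ((1 / \<theta>) * real n) ^ (2 * h + 2) * ((\<theta> + 2) ^ h) ^ 4)"
      by (intro mult_left_mono mult_mono power_mono m p A0) (use \<theta> in simp_all)
    also have "\<dots> = K * real n ^ (2 * h + 2)" unfolding K_def power_mult_distrib[of "1 / \<theta>"]
      by (simp only: mult_ac)
    finally show ?thesis by simp
  qed
  then have A1: "AE \<omega> in M. (\<lambda>n. emom \<theta> h n \<omega> - 1 * tr_mean \<theta> h n / (real n * sqrt (real n) ^ h)) \<longlonglongrightarrow> 0"
    by (rule emom_centered_AE[OF \<theta> n0(1)])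
  have A2: "(\<lambda>n. tr_mean \<theta> h n / (real n * sqrt (real n) ^ h)) \<longlonglongrightarrow> limit_moment \<theta> h"
    using tr_mean_limit[OF \<theta> k] by (simp add: h_def power_mult)
  show ?thesis unfolding h_def[symmetric] using A1
  proof eventually_elim
    case (elim \<omega>)
    from tendsto_add[OF elim A2] show ?case by simp
  qed
qed

lemma emom_AE:
  assumes \<theta>: "\<theta> > 0"
  shows "AE \<omega> in M. \<forall>h>0. (\<lambda>n. emom \<theta> h n \<omega>) \<longlonglongrightarrow> limit_moment \<theta> h"
proof -
  have "AE \<omega> in M. h > 0 \<longrightarrow> (\<lambda>n. emom \<theta> h n \<omega>) \<longlonglongrightarrow> limit_moment \<theta> h" for h
  proof (cases "even h")
    case True
    then obtain k where k: "h = 2 * k" by blast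
    show ?thesis
    proof (cases "k > 0")
      case True
      show ?thesis using emom_even_AE[OF \<theta> True] unfolding k by eventually_elim simp
    qed (simp add: k)
  next
    case False
    then have "limit_moment \<theta> h = 0" using odd_pos[OF False] by (auto simp: limit_moment_def)
    then show ?thesis using emom_odd_AE[OF \<theta> False] by simp
  qed
  then show ?thesis by (simp add: AE_all_countable)
qed

end

section \<open>The limiting measures\<close>

text \<open>The empirical measure of the first \<open>n\<close> values. For \<open>n = 0\<close> it
  is still a probability measure, though an unspecified one.\<close>

definition emp :: "nat \<Rightarrow> (nat \<Rightarrow> real) \<Rightarrow> real measure" where
  "emp n e = distr (measure_pmf (pmf_of_set {..<n})) borel e"

lemma emp_real_distribution: "real_distribution (emp n e)"
  unfolding emp_def by (rule prob_space.real_distribution_distr) (simp_all add: measure_pmf.prob_space_axioms)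

lemma emp_integral:
  fixes f :: "real \<Rightarrow> 'b::{banach, second_countable_topology}"
  assumes n: "n > 0" and f: "f \<in> borel_measurable borel"
  shows "integral\<^sup>L (emp n e) f = (\<Sum>i<n. f (e i)) /\<^sub>R real n" and "integrable (emp n e) f"
proof -
  have sp: "set_pmf (pmf_of_set {..<n}) = {..<n}" using n by (intro set_pmf_of_set) auto
  then have fin: "finite (set_pmf (pmf_of_set {..<n}))" by simp
  have "integral\<^sup>L (emp n e) f = integral\<^sup>L (measure_pmf (pmf_of_set {..<n})) (\<lambda>i. f (e i))"
    unfolding emp_def using f by (intro integral_distr) simp_all
  also have "\<dots> = (\<Sum>i\<in>{..<n}. pmf (pmf_of_set {..<n}) i *\<^sub>R f (e i))"
    by (rule integral_measure_pmf) (use sp in auto)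
  also have "\<dots> = (\<Sum>i<n. f (e i) /\<^sub>R real n)"
    using n by (intro sum.cong refl) (simp add: inverse_eq_divide indicator_def lessThan_empty_iff)
  finally show "integral\<^sup>L (emp n e) f = (\<Sum>i<n. f (e i)) /\<^sub>R real n" by (simp add: scaleR_sum_right)
  have "integrable (measure_pmf (pmf_of_set {..<n})) (\<lambda>i. f (e i))"
    by (rule integrable_measure_pmf_finite[OF fin])
  then show "integrable (emp n e) f" unfolding emp_def using f by (subst integrable_distr_eq) simp_all
qed

lemma emp_cdf:
  assumes n: "n > 0"
  shows "cdf (emp n e) t = real (card {i. i < n \<and> e i \<le> t}) / real n"
proof -
  have "cdf (emp n e) t = measure (measure_pmf (pmf_of_set {..<n})) (e -` {..t} \<inter> space (measure_pmf
    (pmf_of_set {..<n})))"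
    unfolding cdf_def emp_def by (rule measure_distr) simp_all
  also have "\<dots> = real (card ({..<n} \<inter> (e -` {..t}))) / real (card {..<n})"
    using n by (simp add: measure_pmf_of_set lessThan_empty_iff)
  also have "{..<n} \<inter> (e -` {..t}) = {i. i < n \<and> e i \<le> t}" by auto
  finally show ?thesis by simp
qed

definition entries :: "real \<Rightarrow> (nat \<Rightarrow> 'a \<Rightarrow> real) \<Rightarrow> nat \<Rightarrow> 'a \<Rightarrow> nat \<Rightarrow> nat \<Rightarrow> real" where
  "entries \<theta> x n \<omega> i j = x (link \<theta> n (Suc i) (Suc j)) \<omega> / sqrt (real n)"

text \<open>Chosen at each sample point separately; almost sure statements are proved for traces and
  for sums of squares and reach the eigenvalues through relations that hold at every sample
  point.\<close>

definition eigs :: "real \<Rightarrow> (nat \<Rightarrow> 'a \<Rightarrow> real) \<Rightarrow> nat \<Rightarrow> 'a \<Rightarrow> nat \<Rightarrow> real" where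
  "eigs \<theta> x n \<omega> = (SOME e. \<exists>u. eigen_decomp n (entries \<theta> x n \<omega>) u e)"

lemma eigs: "\<exists>u. eigen_decomp n (entries \<theta> x n \<omega>) u (eigs \<theta> x n \<omega>)"
proof -
  have "\<exists>u e. eigen_decomp n (entries \<theta> x n \<omega>) u e"
    by (rule eigen_decomp_exists) (simp add: entries_def link_def add.commute)
  then have "\<exists>e u. eigen_decomp n (entries \<theta> x n \<omega>) u e" by blast
  then show ?thesis unfolding eigs_def by (rule someI_ex)
qed

lemma ESD_eq_cdf:
  assumes n: "n > 0"
  shows "ESD (link_matrix \<theta> x n \<omega>) = cdf (emp n (eigs \<theta> x n \<omega>))"
proof
  fix t
  obtain u where u: "eigen_decomp n (entries \<theta> x n \<omega>) u (eigs \<theta> x n \<omega>)" using eigs[where \<theta>=\<theta> and x=x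
    and n=n and \<omega>=\<omega>] by blast
  have lm: "link_matrix \<theta> x n \<omega> = Matrix.mat n n (\<lambda>(i, j). entries \<theta> x n \<omega> i j)"
    by (simp add: link_matrix_def entries_def)
  have "proots (char_poly (link_matrix \<theta> x n \<omega>)) = image_mset (eigs \<theta> x n \<omega>) (mset_set {..<n})"
    unfolding lm by (rule eigen_decomp_char_poly[OF u])
  then have "size {#l \<in># proots (char_poly (link_matrix \<theta> x n \<omega>)). l \<le> t#}
    = card {i \<in> {..<n}. eigs \<theta> x n \<omega> i \<le> t}"
    by (simp add: filter_mset_image_mset)
  moreover have "dim_row (link_matrix \<theta> x n \<omega>) = n" by (simp add: link_matrix_def)
  ultimately show "ESD (link_matrix \<theta> x n \<omega>) t = cdf (emp n (eigs \<theta> x n \<omega>)) t"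
    unfolding ESD_def emp_cdf[OF n] by simp
qed

lemma sum_circ_shift:
  fixes g :: "(nat \<Rightarrow> nat) \<Rightarrow> real"
  shows "(\<Sum>p | p \<in> {0..h} \<rightarrow>\<^sub>E {..<n} \<and> p 0 = p h. g (\<lambda>i\<in>{0..h}. Suc (p i))) = (\<Sum>\<pi>\<in>circ h n. g \<pi>)"
proof (rule sum.reindex_bij_betw)
  show "bij_betw (\<lambda>p. \<lambda>i\<in>{0..h}. Suc (p i)) {p. p \<in> {0..h} \<rightarrow>\<^sub>E {..<n} \<and> p 0 = p h} (circ h n)"
  proof (rule bij_betw_byWitness[where f'="\<lambda>\<pi>. \<lambda>i\<in>{0..h}. \<pi> i - 1"])
    show "\<forall>p\<in>{p. p \<in> {0..h} \<rightarrow>\<^sub>E {..<n} \<and> p 0 = p h}. (\<lambda>i\<in>{0..h}. (\<lambda>i\<in>{0..h}. Suc (p i)) i - 1) = p"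
    proof
      fix p assume "p \<in> {p. p \<in> {0..h} \<rightarrow>\<^sub>E {..<n} \<and> p 0 = p h}"
      then have p: "p \<in> {0..h} \<rightarrow>\<^sub>E {..<n}" by simp
      show "(\<lambda>i\<in>{0..h}. (\<lambda>i\<in>{0..h}. Suc (p i)) i - 1) = p"
        using PiE_arb[OF p] by (auto simp: fun_eq_iff restrict_def)
    qed
    show "\<forall>\<pi>\<in>circ h n. (\<lambda>i\<in>{0..h}. Suc ((\<lambda>i\<in>{0..h}. \<pi> i - 1) i)) = \<pi>"
    proof
      fix \<pi> assume "\<pi> \<in> circ h n"
      then have p: "\<pi> \<in> {0..h} \<rightarrow>\<^sub>E {1..n}" by (simp add: circ_def)
      have "Suc (\<pi> i - 1) = \<pi> i" if "i \<in> {0..h}" for i using PiE_mem[OF p that] by simp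
      then show "(\<lambda>i\<in>{0..h}. Suc ((\<lambda>i\<in>{0..h}. \<pi> i - 1) i)) = \<pi>"
        using PiE_arb[OF p] by (auto simp: fun_eq_iff restrict_def)
    qed
    show "(\<lambda>p. \<lambda>i\<in>{0..h}. Suc (p i)) ` {p. p \<in> {0..h} \<rightarrow>\<^sub>E {..<n} \<and> p 0 = p h} \<subseteq> circ h n"
    proof (rule image_subsetI)
      fix p assume p: "p \<in> {p. p \<in> {0..h} \<rightarrow>\<^sub>E {..<n} \<and> p 0 = p h}"
      have "Suc (p i) \<in> {1..n}" if "i \<in> {0..h}" for i
        using p PiE_mem[of p "{0..h}" "\<lambda>_. {..<n}" i] that by (simp add: Suc_le_eq)
      then show "(\<lambda>i\<in>{0..h}. Suc (p i)) \<in> circ h n" unfolding circ_def using p by (simp add: restrict_PiE_iff)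
    qed
    show "(\<lambda>\<pi>. \<lambda>i\<in>{0..h}. \<pi> i - 1) ` circ h n \<subseteq> {p. p \<in> {0..h} \<rightarrow>\<^sub>E {..<n} \<and> p 0 = p h}"
    proof (rule image_subsetI)
      fix \<pi> assume "\<pi> \<in> circ h n"
      then have p: "\<pi> \<in> {0..h} \<rightarrow>\<^sub>E {1..n}" "\<pi> 0 = \<pi> h" by (simp_all add: circ_def)
      have "\<pi> i - 1 \<in> {..<n}" if "i \<in> {0..h}" for i using PiE_mem[OF p(1) that] by auto
      then show "(\<lambda>i\<in>{0..h}. \<pi> i - 1) \<in> {p. p \<in> {0..h} \<rightarrow>\<^sub>E {..<n} \<and> p 0 = p h}" using p(2)
        by (simp add: restrict_PiE_iff)
    qed
  qed
qed

text \<open>The summand 1 in \<open>1 + 1 / \<theta>\<close> covers \<open>k = 0\<close>.\<close>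

lemma card_pair_matched_moment_bound:
  assumes \<theta>: "\<theta> > 0"
  shows "0 \<le> limit_moment \<theta> (2 * k)" "limit_moment \<theta> (2 * k)
    \<le> (1 + 1 / \<theta>) * ((2 * ((\<theta> + 1)\<^sup>2 / \<theta>)) ^ k * fact k)"
proof -
  define a where "a = (\<theta> + 1)\<^sup>2 / \<theta>"
  have a: "0 \<le> a" using \<theta> by (simp add: a_def)
  show "0 \<le> limit_moment \<theta> (2 * k)"
    unfolding limit_moment_def using word_value_bounds(1)[OF _ \<theta>] by (auto intro!: sum_nonneg)
  show "limit_moment \<theta> (2 * k) \<le> (1 + 1 / \<theta>) * ((2 * ((\<theta> + 1)\<^sup>2 / \<theta>)) ^ k * fact k)"
  proof (cases "k = 0")
    case True
    then show ?thesis using \<theta> by (simp add: limit_moment_def)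
  next
    case False
    have "limit_moment \<theta> (2 * k) = (\<Sum>w\<in>pair_matched_words k. word_value \<theta> w)"
      using False by (simp add: limit_moment_def)
    also have "\<dots> \<le> (\<Sum>w\<in>pair_matched_words k. a ^ k / \<theta>)"
      unfolding a_def by (rule sum_mono) (rule word_value_bounds(2)[OF _ \<theta>])
    also have "\<dots> = real (card (pair_matched_words k)) * (a ^ k / \<theta>)" by simp
    also have "\<dots> \<le> real (2 ^ k * fact k) * (a ^ k / \<theta>)"
    proof (rule mult_right_mono)
      show "real (card (pair_matched_words k)) \<le> real (2 ^ k * fact k)"
        unfolding of_nat_le_iff by (rule card_pair_matched_le)
      show "0 \<le> a ^ k / \<theta>" using a \<theta> by simp
    qed
    also have "\<dots> = (1 / \<theta>) * ((2 * a) ^ k * fact k)" by (simp add: power_mult_distrib)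
    also have "\<dots> \<le> (1 + 1 / \<theta>) * ((2 * a) ^ k * fact k)"
      using a by (intro mult_right_mono) simp_all
    finally show ?thesis by (simp only: a_def)
  qed
qed

text \<open>The moment of order \<open>2 * K\<close> is at most geometric times
  \<open>fact K\<close>, and \<open>fact (2 * K)\<close> is at least \<open>fact K * fact K\<close>;
  what remains is a term of an exponential series.\<close>

lemma limit_moment_growth:
  assumes \<theta>: "\<theta> > 0"
  shows "moment_growth (limit_moment \<theta>)"
  unfolding moment_growth_def
proof
  fix t :: real
  define a where "a = 2 * ((\<theta> + 1)\<^sup>2 / \<theta>)"
  have a: "0 \<le> a" using \<theta> by (simp add: a_def)
  define y where "y = t\<^sup>2 * a"
  have "summable (\<lambda>K. inverse (fact K) * y ^ K)" by (rule summable_exp)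
  then have "(\<lambda>K. inverse (fact K) * y ^ K) \<longlonglongrightarrow> 0" by (rule summable_LIMSEQ_zero)
  then have lim: "(\<lambda>K. 2 * (1 + 1 / \<theta>) * (inverse (fact K) * y ^ K)) \<longlonglongrightarrow> 0" by (rule tendsto_mult_right_zero)
  show "(\<lambda>K. 2 * \<bar>t\<bar> ^ (2 * K) / fact (2 * K) * limit_moment \<theta> (2 * K)) \<longlonglongrightarrow> 0"
  proof (rule tendsto_sandwich[OF _ _ tendsto_const lim])
    show "eventually (\<lambda>K. 0 \<le> 2 * \<bar>t\<bar> ^ (2 * K) / fact (2 * K) * limit_moment \<theta> (2 * K)) sequentially"
      using card_pair_matched_moment_bound(1)[OF \<theta>]
        by (intro always_eventually allI mult_nonneg_nonneg) simp_all
    show "eventually (\<lambda>K. 2 * \<bar>t\<bar> ^ (2 * K) / fact (2 * K) * limit_moment \<theta> (2 * K)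
      \<le> 2 * (1 + 1 / \<theta>) * (inverse (fact K) * y ^ K)) sequentially"
    proof (intro always_eventually allI)
      fix K :: nat
      have "(fact K * fact K :: nat) dvd fact (K + K)" by (rule fact_fact_dvd_fact)
      then have "(fact K * fact K :: nat) \<le> fact (2 * K)" by (intro dvd_imp_le) (simp_all add: mult_2)
      then have "real (fact K * fact K) \<le> real (fact (2 * K))" by (simp only: of_nat_le_iff)
      then have f: "(fact K * fact K :: real) \<le> fact (2 * K)" by (simp only: of_nat_mult of_nat_fact)
      have "2 * \<bar>t\<bar> ^ (2 * K) / fact (2 * K) * limit_moment \<theta> (2 * K)
        \<le> 2 * \<bar>t\<bar> ^ (2 * K) / (fact K * fact K) * ((1 + 1 / \<theta>) * (a ^ K * fact K))"
      proof (rule mult_mono)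
        show "2 * \<bar>t\<bar> ^ (2 * K) / fact (2 * K) \<le> 2 * \<bar>t\<bar> ^ (2 * K) / (fact K * fact K)"
          using f by (intro divide_left_mono) simp_all
        show "limit_moment \<theta> (2 * K) \<le> (1 + 1 / \<theta>) * (a ^ K * fact K)"
          unfolding a_def by (rule card_pair_matched_moment_bound(2)[OF \<theta>])
      qed (use card_pair_matched_moment_bound(1)[OF \<theta>] in simp_all)
      also have "\<dots> = 2 * (1 + 1 / \<theta>) * (inverse (fact K) * y ^ K)"
      proof -
        have t2: "\<bar>t\<bar> ^ (2 * K) = (t\<^sup>2) ^ K" by (simp add: power_mult)
        have alg: "2 * A / (F * F) * (c * (B * F)) = 2 * c * (inverse F * (A * B))" if "F \<noteq> 0"
          for A B c F :: real
          using that by (simp add: field_simps)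
        show ?thesis unfolding t2 y_def power_mult_distrib by (rule alg) simp
      qed
      finally show "2 * \<bar>t\<bar> ^ (2 * K) / fact (2 * K) * limit_moment \<theta> (2 * K)
        \<le> 2 * (1 + 1 / \<theta>) * (inverse (fact K) * y ^ K)" .
    qed
  qed
qed

lemma limit_moment_continuous:
  assumes "\<And>m. \<theta>m m > 0" "\<theta> > 0" "\<theta>m \<longlonglongrightarrow> \<theta>"
  shows "(\<lambda>m. limit_moment (\<theta>m m) h) \<longlonglongrightarrow> limit_moment \<theta> h"
proof (cases "h \<noteq> 0 \<and> even h")
  case True
  have "(\<lambda>m. \<Sum>w\<in>pair_matched_words (h div 2). word_value (\<theta>m m) w)
    \<longlonglongrightarrow> (\<Sum>w\<in>pair_matched_words (h div 2). word_value \<theta> w)"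
    by (rule tendsto_sum) (rule word_value_continuous[OF _ assms])
  then show ?thesis using True by (simp add: limit_moment_def)
qed (auto simp: limit_moment_def)

context moment_sequence
begin

lemma emp_moments:
  assumes n: "n > 0"
  shows "integral\<^sup>L (emp n (eigs \<theta> x n \<omega>)) (\<lambda>t. t ^ h) = emom \<theta> h n \<omega>"
proof -
  obtain u where u: "eigen_decomp n (entries \<theta> x n \<omega>) u (eigs \<theta> x n \<omega>)" using eigs[where \<theta>=\<theta> and x=x
    and n=n and \<omega>=\<omega>] by blast
  define g where "g \<pi> = (\<Prod>i<h. x (link \<theta> n (\<pi> i) (\<pi> (Suc i))) \<omega>) / sqrt (real n) ^ h" for \<pi> :: "nat \<Rightarrow> nat"
  have "(\<Sum>i<n. eigs \<theta> x n \<omega> i ^ h) = (\<Sum>p | p \<in> {0..h} \<rightarrow>\<^sub>E {..<n} \<and> p 0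
    = p h. \<Prod>i<h. entries \<theta> x n \<omega> (p i) (p (Suc i)))"
    by (rule eigen_decomp_power_sum[OF u])
  also have "\<dots> = (\<Sum>p | p \<in> {0..h} \<rightarrow>\<^sub>E {..<n} \<and> p 0 = p h. g (\<lambda>i\<in>{0..h}. Suc (p i)))"
  proof (rule sum.cong[OF refl])
    fix p
    have "(\<Prod>i<h. entries \<theta> x n \<omega> (p i) (p (Suc i)))
      = (\<Prod>i<h. x (link \<theta> n (Suc (p i)) (Suc (p (Suc i)))) \<omega>) / sqrt (real n) ^ h"
      unfolding entries_def by (simp add: prod_dividef)
    also have "(\<Prod>i<h. x (link \<theta> n (Suc (p i)) (Suc (p (Suc i)))) \<omega>) =
       (\<Prod>i<h. x (link \<theta> n ((\<lambda>i\<in>{0..h}. Suc (p i)) i) ((\<lambda>i\<in>{0..h}. Suc (p i)) (Suc i))) \<omega>)"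
      by (rule prod.cong[OF refl]) simp
    finally show "(\<Prod>i<h. entries \<theta> x n \<omega> (p i) (p (Suc i))) = g (\<lambda>i\<in>{0..h}. Suc (p i))" unfolding g_def .
  qed
  also have "\<dots> = (\<Sum>\<pi>\<in>circ h n. g \<pi>)" by (rule sum_circ_shift)
  also have "\<dots> = tr \<theta> h n \<omega> / sqrt (real n) ^ h"
    unfolding g_def tr_def cprod_def links_def by (simp add: sum_divide_distrib)
  finally have "(\<Sum>i<n. eigs \<theta> x n \<omega> i ^ h) = tr \<theta> h n \<omega> / sqrt (real n) ^ h" .
  then show ?thesis by (subst emp_integral(1)[OF n]) (simp_all add: emom_def divide_inverse mult_ac)
qed

text \<open>Indexing by \<open>Suc n\<close> keeps clear of the empty matrix; the countably many
  orders share one null set.\<close>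

lemma emp_moments_AE:
  assumes \<theta>: "\<theta> > 0"
  shows "AE \<omega> in M. \<forall>h. (\<lambda>n. integral\<^sup>L (emp (Suc n) (eigs \<theta> x (Suc n) \<omega>)) (\<lambda>t. t ^ h)) \<longlonglongrightarrow> limit_moment \<theta> h"
  using emom_AE[OF \<theta>]
proof eventually_elim
  case (elim \<omega>)
  show ?case
  proof
    fix h
    show "(\<lambda>n. integral\<^sup>L (emp (Suc n) (eigs \<theta> x (Suc n) \<omega>)) (\<lambda>t. t ^ h)) \<longlonglongrightarrow> limit_moment \<theta> h"
    proof (cases "h = 0")
      case True
      have "integral\<^sup>L (emp (Suc n) (eigs \<theta> x (Suc n) \<omega>)) (\<lambda>t. t ^ 0) = 1" for n
        by (subst emp_integral(1)) simp_all
      then show ?thesis using True by (simp add: limit_moment_def)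
    next
      case False
      then have "(\<lambda>n. emom \<theta> h n \<omega>) \<longlonglongrightarrow> limit_moment \<theta> h" using elim by simp
      then have "(\<lambda>n. emom \<theta> h (Suc n) \<omega>) \<longlonglongrightarrow> limit_moment \<theta> h" by (rule LIMSEQ_Suc)
      then show ?thesis by (simp only: emp_moments[OF zero_less_Suc])
    qed
  qed
qed

lemma emp_power_integrable: "integrable (emp (Suc n) e) (\<lambda>t. t ^ h)"
  by (rule emp_integral(2)) simp_all

text \<open>One sample point of the almost sure event suffices: the spectral distributions along it
  are a deterministic sequence to which the method of moments applies.\<close>

lemma limit_measure_exists:
  assumes \<theta>: "\<theta> > 0"
  shows "\<exists>\<nu>. real_distribution \<nu> \<and> (\<forall>h. has_bochner_integral \<nu> (\<lambda>t. t ^ h) (limit_moment \<theta> h))"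
proof -
  have "ae_filter M \<noteq> bot" by (simp add: ae_filter_eq_bot_iff emeasure_space_1)
  then have "\<exists>\<omega>. \<forall>h. (\<lambda>n. integral\<^sup>L (emp (Suc n) (eigs \<theta> x (Suc n) \<omega>)) (\<lambda>t. t ^ h)) \<longlonglongrightarrow> limit_moment \<theta> h"
    by (rule eventually_happens'[OF _ emp_moments_AE[OF \<theta>]])
  then obtain \<omega> where w: "\<And>h. (\<lambda>n. integral\<^sup>L (emp (Suc n) (eigs \<theta> x (Suc n) \<omega>)) (\<lambda>t. t ^ h))
    \<longlonglongrightarrow> limit_moment \<theta> h" by blast
  show ?thesis
    by (rule method_of_moments[where \<mu>="\<lambda>n. emp (Suc n) (eigs \<theta> x (Suc n) \<omega>)"])
       (rule emp_real_distribution emp_power_integrable w limit_moment_growth[OF \<theta>])+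
qed

end

section \<open>From characteristic functions to the limiting distribution\<close>

lemma is_LSD_of_char:
  assumes \<nu>: "real_distribution \<nu>"
    and ch: "AE \<omega> in M. \<forall>t. (\<lambda>n. char (emp (Suc n) (eigs \<theta> x (Suc n) \<omega>)) t) \<longlonglongrightarrow> char \<nu> t"
  shows "is_LSD M (link_matrix \<theta> x) \<nu>"
  unfolding is_LSD_def
proof (intro conjI \<nu>)
  show "AE \<omega> in M. weak_conv (\<lambda>n. ESD (link_matrix \<theta> x n \<omega>)) (cdf \<nu>)"
    using ch
  proof eventually_elim
    case (elim \<omega>)
    have "weak_conv_m (\<lambda>n. emp (Suc n) (eigs \<theta> x (Suc n) \<omega>)) \<nu>"
      by (rule levy_continuity[OF emp_real_distribution \<nu>]) (use elim in blast)
    then have wc: "(\<lambda>n. cdf (emp (Suc n) (eigs \<theta> x (Suc n) \<omega>)) t) \<longlonglongrightarrow> cdf \<nu> t" if "isCont (cdf \<nu>) t" for t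
      using that unfolding weak_conv_m_def weak_conv_def by blast
    show ?case unfolding weak_conv_def
    proof (intro allI impI)
      fix t assume "isCont (cdf \<nu>) t"
      then have "(\<lambda>n. ESD (link_matrix \<theta> x (Suc n) \<omega>) t) \<longlonglongrightarrow> cdf \<nu> t"
        using wc by (simp only: ESD_eq_cdf[OF zero_less_Suc])
      then show "(\<lambda>n. ESD (link_matrix \<theta> x n \<omega>) t) \<longlonglongrightarrow> cdf \<nu> t" by (rule LIMSEQ_imp_Suc)
    qed
  qed
qed

context moment_sequence
begin

text \<open>Stated with characteristic functions, since these are what the comparison with truncated
  inputs controls. The null set does not depend on \<open>t\<close>, because it comes from the
  moments.\<close>

lemma emp_char_AE:
  assumes \<theta>: "\<theta> > 0" and \<nu>: "real_distribution \<nu>"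
    and m: "\<And>h. has_bochner_integral \<nu> (\<lambda>t. t ^ h) (limit_moment \<theta> h)"
  shows "AE \<omega> in M. \<forall>t. (\<lambda>n. char (emp (Suc n) (eigs \<theta> x (Suc n) \<omega>)) t) \<longlonglongrightarrow> char \<nu> t"
  using emp_moments_AE[OF \<theta>]
proof eventually_elim
  case (elim \<omega>)
  show ?case
  proof
    fix t
    show "(\<lambda>n. char (emp (Suc n) (eigs \<theta> x (Suc n) \<omega>)) t) \<longlonglongrightarrow> char \<nu> t"
      unfolding char_eq_lim_partial[OF \<nu> m limit_moment_growth[OF \<theta>]]
      by (rule char_moment_limit) (rule emp_real_distribution emp_power_integrable elim[rule_format]
        limit_moment_growth[OF \<theta>])+
  qed
qed

end

lemma moment_sequence_of_assumption3:
  assumes M: "prob_space M" and a: "assumption3 M x"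
  shows "moment_sequence M x"
proof -
  interpret prob_space M by (rule M)
  have i: "indep_vars (\<lambda>_. borel) x UNIV" and mv: "\<And>i. mean0_var1 M (x i)"
    and b: "\<And>h::nat. \<exists>C. \<forall>i. integrable M (\<lambda>\<omega>. \<bar>x i \<omega>\<bar> ^ h) \<and> expectation (\<lambda>\<omega>. \<bar>x i \<omega>\<bar> ^ h) \<le> C"
    using a unfolding assumption3_def indep_mean0_var1_def by blast+
  show ?thesis
  proof (unfold_locales)
    show "indep_vars (\<lambda>_. borel) x UNIV" by (rule i)
    show m: "expectation (x i) = 0" for i using mv[of i] by (simp add: mean0_var1_def)
    show "expectation (\<lambda>\<omega>. (x i \<omega>)\<^sup>2) = 1" for i using mv[of i] m[of i] by (simp add: mean0_var1_def)
    show "\<exists>C. \<forall>i. integrable M (\<lambda>\<omega>. \<bar>x i \<omega>\<bar> ^ h) \<and> expectation (\<lambda>\<omega>. \<bar>x i \<omega>\<bar> ^ h) \<le> C" for h by (rule b)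
  qed
qed

lemma moment_sequence_of_assumption1:
  assumes M: "prob_space M" and a: "assumption1 M x"
  shows "moment_sequence M x"
proof (rule moment_sequence_of_assumption3[OF M])
  interpret prob_space M by (rule M)
  obtain C where C: "\<And>i. AE \<omega> in M. \<bar>x i \<omega>\<bar> \<le> C" using a unfolding assumption1_def by blast
  have ind: "indep_mean0_var1 M x" using a by (simp add: assumption1_def)
  have xm: "x i \<in> borel_measurable M" for i using ind unfolding indep_mean0_var1_def indep_vars_def by simp
  have "integrable M (\<lambda>\<omega>. \<bar>x i \<omega>\<bar> ^ h) \<and> expectation (\<lambda>\<omega>. \<bar>x i \<omega>\<bar> ^ h) \<le> \<bar>C\<bar> ^ h" for i h
  proof -
    have ae: "AE \<omega> in M. \<bar>x i \<omega>\<bar> ^ h \<le> \<bar>C\<bar> ^ h"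
      using C[of i] by eventually_elim (intro power_mono, simp_all)
    have int: "integrable M (\<lambda>\<omega>. \<bar>x i \<omega>\<bar> ^ h)"
      by (rule integrable_const_bound[where B="\<bar>C\<bar> ^ h"]) (use ae xm[of i] in simp_all)
    moreover have "expectation (\<lambda>\<omega>. \<bar>x i \<omega>\<bar> ^ h) \<le> \<bar>C\<bar> ^ h"
      by (rule integral_le_const[OF int ae])
    ultimately show ?thesis by simp
  qed
  then show "assumption3 M x" unfolding assumption3_def using ind by blast
qed

section \<open>A one-sided law of large numbers\<close>

lemma (in prob_space) indep_second_moment_sum:
  fixes Y :: "nat \<Rightarrow> 'a \<Rightarrow> real"
  assumes ind: "indep_vars (\<lambda>_. borel) Y UNIV" and J: "finite J"
    and B: "\<And>i \<omega>. \<bar>Y i \<omega>\<bar> \<le> B" and mean: "\<And>i. expectation (Y i) = 0"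
  shows "expectation (\<lambda>\<omega>. (\<Sum>i\<in>J. Y i \<omega>)\<^sup>2) = (\<Sum>i\<in>J. expectation (\<lambda>\<omega>. (Y i \<omega>)\<^sup>2))"
proof -
  have Ym: "Y i \<in> borel_measurable M" for i using ind unfolding indep_vars_def by simp
  have Yi: "integrable M (Y i)" for i
    by (rule integrable_const_bound[where B=B]) (use B Ym in auto)
  have YY: "integrable M (\<lambda>\<omega>. Y i \<omega> * Y j \<omega>)" for i j
  proof (rule integrable_const_bound[where B="B * B"])
    show "AE \<omega> in M. norm (Y i \<omega> * Y j \<omega>) \<le> B * B"
    proof (rule AE_I2)
      fix \<omega>
      have "0 \<le> B" using B[of i \<omega>] by (rule order_trans[OF abs_ge_zero])
      then show "norm (Y i \<omega> * Y j \<omega>) \<le> B * B"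
        unfolding real_norm_def abs_mult by (intro mult_mono B) simp_all
    qed
    show "(\<lambda>\<omega>. Y i \<omega> * Y j \<omega>) \<in> borel_measurable M" using Ym[of i] Ym[of j] by simp
  qed
  have cross: "expectation (\<lambda>\<omega>. Y i \<omega> * Y j \<omega>) = (if i = j then expectation (\<lambda>\<omega>. (Y i \<omega>)\<^sup>2) else 0)" for i j
  proof (cases "i = j")
    case True then show ?thesis by (simp add: power2_eq_square)
  next
    case False
    have "indep_vars (\<lambda>_. borel) Y {i, j}" by (rule indep_vars_subset[OF ind]) simp
    then have "expectation (\<lambda>\<omega>. \<Prod>a\<in>{i, j}. Y a \<omega>) = (\<Prod>a\<in>{i, j}. expectation (Y a))"
      by (intro indep_vars_lebesgue_integral Yi) simp_all
    then show ?thesis using False mean by simp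
  qed
  have "expectation (\<lambda>\<omega>. (\<Sum>i\<in>J. Y i \<omega>)\<^sup>2) = expectation (\<lambda>\<omega>. \<Sum>i\<in>J. \<Sum>j\<in>J. Y i \<omega> * Y j \<omega>)"
    by (simp only: power2_eq_square sum_product)
  also have "\<dots> = (\<Sum>i\<in>J. expectation (\<lambda>\<omega>. \<Sum>j\<in>J. Y i \<omega> * Y j \<omega>))"
    by (rule Bochner_Integration.integral_sum) (intro Bochner_Integration.integrable_sum YY)
  also have "\<dots> = (\<Sum>i\<in>J. \<Sum>j\<in>J. expectation (\<lambda>\<omega>. Y i \<omega> * Y j \<omega>))"
    by (intro sum.cong refl Bochner_Integration.integral_sum YY)
  also have "\<dots> = (\<Sum>i\<in>J. expectation (\<lambda>\<omega>. (Y i \<omega>)\<^sup>2))"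
    unfolding cross using J by (intro sum.cong refl) simp
  finally show ?thesis .
qed

text \<open>A geometric sum is at most twice its last term, which is below \<open>t\<close>. The
  bound by \<open>2 ^ K\<close> strengthens the induction.\<close>

lemma sum_dyadic_below:
  fixes t :: real
  assumes "t \<ge> 0"
  shows "(\<Sum>m<K. if 2 ^ m < t then 2 ^ m else 0) \<le> min (2 ^ K) (2 * t)"
proof (induction K)
  case (Suc K)
  define s :: real where "s = (\<Sum>m<K. if 2 ^ m < t then 2 ^ m else 0)"
  define p :: real where "p = 2 ^ K"
  have s: "s \<le> p" "s \<le> 2 * t" using Suc unfolding s_def p_def by simp_all
  have p: "2 ^ Suc K = 2 * p" "0 < p" by (simp_all add: p_def)
  have e: "(\<Sum>m<Suc K. if 2 ^ m < t then 2 ^ m else 0) = s + (if p < t then p else 0)" by (simp add: s_def p_def)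
  show ?case
  proof (cases "p < t")
    case True
    then have "s + p \<le> 2 * p" "s + p \<le> 2 * t" using s by linarith+
    then show ?thesis unfolding e p(1) using True by simp
  next
    case False
    have "s \<le> 2 * p" using s p by linarith
    then show ?thesis unfolding e p(1) using False s(2) by simp
  qed
qed (use assms in simp)

text \<open>A geometric tail that starts where \<open>2 ^ m\<close> first reaches \<open>t\<close>,
  with a first term of at most \<open>t\<close>.\<close>

lemma sum_dyadic_above:
  fixes t :: real
  assumes t: "t \<ge> 0"
  shows "(\<Sum>m<K. (if t \<le> 2 ^ m then t\<^sup>2 else 0) / 2 ^ m) \<le> 2 * t"
proof -
  \<comment> \<open>Before the first admissible \<open>m\<close> the sum is zero; afterwards
    \<open>2 * (t\<^sup>2 / 2 ^ K)\<close> is the part of the tail still to come.\<close>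
  have "(\<Sum>m<K. (if t \<le> 2 ^ m then t\<^sup>2 else 0) / 2 ^ m) \<le> 0 \<or>
      (\<Sum>m<K. (if t \<le> 2 ^ m then t\<^sup>2 else 0) / 2 ^ m) \<le> 2 * t - 2 * (t\<^sup>2 / 2 ^ K)"
  proof (induction K)
    case (Suc K)
    define s where "s = (\<Sum>m<K. (if t \<le> 2 ^ m then t\<^sup>2 else 0) / 2 ^ m)"
    define p where "p = t\<^sup>2 / 2 ^ K"
    have p2: "t\<^sup>2 / 2 ^ Suc K = p / 2" by (simp add: p_def)
    have p0: "0 \<le> p" by (simp add: p_def)
    show ?case
    proof (cases "t \<le> 2 ^ K")
      case True
      have "t * t \<le> t * 2 ^ K" using t True by (rule mult_left_mono[rotated])
      then have "p \<le> t" unfolding p_def by (simp add: power2_eq_square pos_divide_le_eq)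
      moreover have "(\<Sum>m<Suc K. (if t \<le> 2 ^ m then t\<^sup>2 else 0) / 2 ^ m) = s + p" using True
        by (simp add: s_def p_def)
      moreover have "s \<le> 0 \<or> s \<le> 2 * t - 2 * p" using Suc unfolding s_def p_def .
      ultimately show ?thesis unfolding p2 by linarith
    next
      case False
      have "(\<Sum>m<Suc K. (if t \<le> 2 ^ m then t\<^sup>2 else 0) / 2 ^ m) = s" using False by (simp add: s_def)
      moreover have "s \<le> 0 \<or> s \<le> 2 * t - 2 * p" using Suc unfolding s_def p_def .
      ultimately show ?thesis unfolding p2 using p0 by linarith
    qed
  qed simp
  moreover have "0 \<le> t\<^sup>2 / 2 ^ K" by simp
  ultimately show ?thesis using t by linarith
qed

text \<open>The constant 5 is 4 + 1. With \<open>2 ^ M \<le> N < 2 ^ (M + 1)\<close> the sum is at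
  most \<open>C + 4 * \<epsilon> * 2 ^ M\<close>, and the finitely many early terms, collected in
  \<open>C\<close>, are eventually at most \<open>\<epsilon> * N\<close>.\<close>

lemma dyadic_blocks_imp_linear:
  fixes a :: "nat \<Rightarrow> real"
  assumes a: "\<And>i. a i \<ge> 0" and \<epsilon>: "\<epsilon> > 0"
    and ev: "eventually (\<lambda>m. (\<Sum>i\<in>{2 ^ m..<2 ^ Suc m}. a i) \<le> 2 * \<epsilon> * 2 ^ m) sequentially"
  shows "eventually (\<lambda>N. (\<Sum>i<N. a i) \<le> 5 * \<epsilon> * real N) sequentially"
proof -
  obtain m0 where m0: "\<And>m. m \<ge> m0 \<Longrightarrow> (\<Sum>i\<in>{2 ^ m..<2 ^ Suc m}. a i) \<le> 2 * \<epsilon> * 2 ^ m"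
    using ev unfolding eventually_sequentially by blast
  define C where "C = (\<Sum>i<2 ^ m0. a i)"
  have pow: "(\<Sum>i<2 ^ M. a i) \<le> C + 2 * \<epsilon> * 2 ^ M" if "M \<ge> m0" for M
    using that
  proof (induction M rule: dec_induct)
    case base
    show ?case using \<epsilon> by (simp add: C_def)
  next
    case (step M)
    have "{..<2 ^ Suc M} = {..<2 ^ M} \<union> {2 ^ M..<2 ^ Suc M :: nat}" by auto
    then have "(\<Sum>i<2 ^ Suc M. a i) = (\<Sum>i<2 ^ M. a i) + (\<Sum>i\<in>{2 ^ M..<2 ^ Suc M}. a i)"
      by (simp only:) (rule sum.union_disjoint, simp_all add: ivl_disj_int)
    also have "\<dots> \<le> C + 2 * \<epsilon> * 2 ^ M + 2 * \<epsilon> * 2 ^ M" using step.IH m0[OF step.hyps(1)] by (rule add_mono)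
    finally show ?case by simp
  qed
  obtain N0 :: nat where N0: "C / \<epsilon> \<le> real N0" using real_arch_simple by blast
  show ?thesis
  proof (rule eventually_sequentiallyI[of "max (2 ^ m0) N0"])
    fix N assume N: "max (2 ^ m0) N0 \<le> N"
    then have N1: "2 ^ m0 \<le> N" "N0 \<le> N" by simp_all
    have "(1::nat) \<le> 2 ^ m0" by simp
    then have "1 \<le> N" using N1(1) by (rule order_trans)
    then obtain M where M: "2 ^ M \<le> N" "N < 2 ^ (M + 1)" using ex_power_ivl1[of 2 N] by auto
    have "(2::nat) ^ m0 < 2 ^ (M + 1)" using N1(1) M(2) by (rule le_less_trans)
    then have Mm: "m0 \<le> M + 1" using power_less_imp_less_exp[of "2::nat" m0 "M + 1"] by simp
    have "(\<Sum>i<N. a i) \<le> (\<Sum>i<2 ^ (M + 1). a i)" using M(2) a by (intro sum_mono2) auto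
    also have "\<dots> \<le> C + 2 * \<epsilon> * 2 ^ (M + 1)" by (rule pow[OF Mm])
    also have "\<dots> = C + 4 * \<epsilon> * 2 ^ M" by simp
    also have "\<dots> \<le> \<epsilon> * real N + 4 * \<epsilon> * real N"
    proof (rule add_mono)
      have "C \<le> \<epsilon> * real N0" using N0 \<epsilon> by (simp add: pos_divide_le_eq mult.commute)
      also have "\<dots> \<le> \<epsilon> * real N" using N1(2) \<epsilon> by simp
      finally show "C \<le> \<epsilon> * real N" .
      have "real (2 ^ M) \<le> real N" using M(1) by (simp only: of_nat_le_iff)
      then show "4 * \<epsilon> * 2 ^ M \<le> 4 * \<epsilon> * real N" using \<epsilon> by simp
    qed
    finally show "(\<Sum>i<N. a i) \<le> 5 * \<epsilon> * real N" by simp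
  qed
qed

text \<open>A one-sided strong law with a non-optimal constant, by truncation on dyadic blocks.\<close>

lemma (in prob_space) iid_sum_eventually_le:
  fixes z :: "nat \<Rightarrow> 'a \<Rightarrow> real"
  assumes ind: "indep_vars (\<lambda>_. borel) z UNIV" and z0: "\<And>i \<omega>. 0 \<le> z i \<omega>"
    and dist: "\<And>i. distr M borel (z i) = distr M borel (z 0)"
    and int: "integrable M (z 0)" and mean: "expectation (z 0) \<le> \<epsilon>" and \<epsilon>: "\<epsilon> > 0"
  shows "AE \<omega> in M. eventually (\<lambda>N. (\<Sum>i<N. z i \<omega>) \<le> 5 * \<epsilon> * real N) sequentially"
proof -
  have zm: "z i \<in> borel_measurable M" for i using ind unfolding indep_vars_def by simp
  have same: "expectation (\<lambda>\<omega>. f (z i \<omega>)) = expectation (\<lambda>\<omega>. f (z 0 \<omega>))"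
    if f: "f \<in> borel_measurable borel" for f :: "real \<Rightarrow> real" and i
  proof -
    have "expectation (\<lambda>\<omega>. f (z i \<omega>)) = integral\<^sup>L (distr M borel (z i)) f"
      by (rule integral_distr[symmetric]) (use zm f in simp_all)
    also have "\<dots> = integral\<^sup>L (distr M borel (z 0)) f" unfolding dist[of i] ..
    also have "\<dots> = expectation (\<lambda>\<omega>. f (z 0 \<omega>))" by (rule integral_distr) (use zm f in simp_all)
    finally show ?thesis .
  qed
  define J where "J m = {2 ^ m..<2 ^ Suc m :: nat}" for m
  have cJ: "card (J m) = 2 ^ m" and fJ: "finite (J m)" for m by (simp_all add: J_def)
  define A where "A m = {\<omega> \<in> space M. 2 * \<epsilon> * 2 ^ m < (\<Sum>i\<in>J m. z i \<omega>)}" for m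
  have As: "A m \<in> sets M" for m unfolding A_def using zm by measurable
  \<comment> \<open>On the block of \<open>2 ^ m\<close> indices the variables are truncated at the
    same level \<open>2 ^ m\<close>.\<close>
  define tr where "tr m t = (if t \<le> 2 ^ m then t else 0)" for m and t :: real
  have trm: "tr m \<in> borel_measurable borel" for m unfolding tr_def[abs_def] by measurable
  define b where "b m t = (if 2 ^ m < t then 1 else (0::real))" for m and t :: real
  have bm: "b m \<in> borel_measurable borel" for m unfolding b_def[abs_def] by measurable
  have trb: "0 \<le> tr m (z i \<omega>)" "tr m (z i \<omega>) \<le> 2 ^ m" "tr m (z i \<omega>) \<le> z i \<omega>" for m i \<omega>
    using z0[of i \<omega>] by (simp_all add: tr_def)
  have tri: "integrable M (\<lambda>\<omega>. tr m (z i \<omega>))" for m i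
  proof (rule integrable_const_bound[where B="2 ^ m"])
    show "(\<lambda>\<omega>. tr m (z i \<omega>)) \<in> borel_measurable M" by (rule measurable_compose[OF zm trm])
  qed (use trb in auto)
  have tri2: "integrable M (\<lambda>\<omega>. (tr m (z i \<omega>))\<^sup>2)" for m i
  proof (rule integrable_const_bound[where B="(2 ^ m)\<^sup>2"])
    show "(\<lambda>\<omega>. (tr m (z i \<omega>))\<^sup>2) \<in> borel_measurable M" using measurable_compose[OF zm[of i] trm[of m]] by simp
    show "AE \<omega> in M. norm ((tr m (z i \<omega>))\<^sup>2) \<le> (2 ^ m)\<^sup>2"
    proof (rule AE_I2)
      fix \<omega>
      show "norm ((tr m (z i \<omega>))\<^sup>2) \<le> (2 ^ m)\<^sup>2"
        using power_mono[OF trb(2)[of m i \<omega>] trb(1)[of m i \<omega>], of 2] by simp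
    qed
  qed
  have bi: "integrable M (\<lambda>\<omega>. b m (z i \<omega>))" for m i
  proof (rule integrable_const_bound[where B=1])
    show "(\<lambda>\<omega>. b m (z i \<omega>)) \<in> borel_measurable M" by (rule measurable_compose[OF zm bm])
  qed (simp add: b_def)
  define \<mu> where "\<mu> m = expectation (\<lambda>\<omega>. tr m (z 0 \<omega>))" for m
  have \<mu>: "0 \<le> \<mu> m" "\<mu> m \<le> \<epsilon>" "\<mu> m \<le> 2 ^ m" for m
  proof -
    show "0 \<le> \<mu> m" unfolding \<mu>_def by (rule Bochner_Integration.integral_nonneg) (rule trb)
    have "\<mu> m \<le> expectation (z 0)" unfolding \<mu>_def
      by (rule Bochner_Integration.integral_mono[OF tri int]) (rule trb)
    then show "\<mu> m \<le> \<epsilon>" using mean by simp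
    show "\<mu> m \<le> 2 ^ m" unfolding \<mu>_def by (rule integral_le_const[OF tri]) (rule AE_I2, rule trb)
  qed
  \<comment> \<open>First summand: union bound for exceeding the truncation level. Second: Chebyshev
    for the centred truncated block sum.\<close>
  define q where "q m = 2 ^ m * expectation (\<lambda>\<omega>. b m (z 0 \<omega>)) + expectation (\<lambda>\<omega>. (tr m (z 0 \<omega>))\<^sup>2)
    / (2 ^ m * \<epsilon>\<^sup>2)" for m
  have PA: "prob (A m) \<le> q m" for m
  proof -
    define Y where "Y i \<omega> = tr m (z i \<omega>) - \<mu> m" for i \<omega>
    have Yind: "indep_vars (\<lambda>_. borel) Y UNIV"
      unfolding Y_def[abs_def]
      by (rule indep_vars_compose2[where Y="\<lambda>_ t. tr m t - \<mu> m", OF ind]) (use trm in simp)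
    have Yb: "\<bar>Y i \<omega>\<bar> \<le> 2 ^ m" for i \<omega>
      using trb[of m i \<omega>] \<mu>[of m] unfolding Y_def by linarith
    have Ymean: "expectation (Y i) = 0" for i
      unfolding Y_def[abs_def] using tri[of m i] same[OF trm, of m i] by (simp add: prob_space \<mu>_def)
    have Y2: "expectation (\<lambda>\<omega>. (Y i \<omega>)\<^sup>2) \<le> expectation (\<lambda>\<omega>. (tr m (z 0 \<omega>))\<^sup>2)" for i
    proof -
      have e: "(Y i \<omega>)\<^sup>2 = (tr m (z i \<omega>))\<^sup>2 - 2 * \<mu> m * tr m (z i \<omega>) + (\<mu> m)\<^sup>2" for \<omega>
        unfolding Y_def by (simp add: power2_diff)
      have "expectation (\<lambda>\<omega>. (Y i \<omega>)\<^sup>2) = expectation (\<lambda>\<omega>. (tr m (z i \<omega>))\<^sup>2)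
        - 2 * \<mu> m * expectation (\<lambda>\<omega>. tr m (z i \<omega>)) + (\<mu> m)\<^sup>2"
        unfolding e using tri[of m i] tri2[of m i] by (simp add: prob_space)
      also have "expectation (\<lambda>\<omega>. tr m (z i \<omega>)) = \<mu> m" unfolding \<mu>_def by (rule same[OF trm])
      also have "expectation (\<lambda>\<omega>. (tr m (z i \<omega>))\<^sup>2) = expectation (\<lambda>\<omega>. (tr m (z 0 \<omega>))\<^sup>2)"
        by (rule same) (use trm in simp)
      finally show ?thesis by (simp add: power2_eq_square)
    qed
    define S where "S \<omega> = (\<Sum>i\<in>J m. Y i \<omega>)" for \<omega>
    have Sm: "S \<in> borel_measurable M"
      unfolding S_def[abs_def] Y_def using measurable_compose[OF zm trm] by simp
    have S2i: "integrable M (\<lambda>\<omega>. (S \<omega>)\<^sup>2)"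
    proof (rule integrable_const_bound[where B="(2 ^ m * 2 ^ m)\<^sup>2"])
      show "AE \<omega> in M. norm ((S \<omega>)\<^sup>2) \<le> (2 ^ m * 2 ^ m)\<^sup>2"
      proof (rule AE_I2)
        fix \<omega>
        have "\<bar>S \<omega>\<bar> \<le> (\<Sum>i\<in>J m. \<bar>Y i \<omega>\<bar>)" unfolding S_def by (rule sum_abs)
        also have "\<dots> \<le> (\<Sum>i\<in>J m. 2 ^ m)" by (rule sum_mono) (rule Yb)
        also have "\<dots> = 2 ^ m * 2 ^ m" by (simp add: cJ)
        finally show "norm ((S \<omega>)\<^sup>2) \<le> (2 ^ m * 2 ^ m)\<^sup>2"
          by (simp add: abs_le_square_iff[symmetric])
      qed
    qed (use Sm in simp)
    have "expectation (\<lambda>\<omega>. (S \<omega>)\<^sup>2) = (\<Sum>i\<in>J m. expectation (\<lambda>\<omega>. (Y i \<omega>)\<^sup>2))"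
      unfolding S_def by (rule indep_second_moment_sum[OF Yind fJ Yb Ymean])
    also have "\<dots> \<le> (\<Sum>i\<in>J m. expectation (\<lambda>\<omega>. (tr m (z 0 \<omega>))\<^sup>2))" by (rule sum_mono) (rule Y2)
    also have "\<dots> = 2 ^ m * expectation (\<lambda>\<omega>. (tr m (z 0 \<omega>))\<^sup>2)" by (simp add: cJ)
    finally have ES: "expectation (\<lambda>\<omega>. (S \<omega>)\<^sup>2) \<le> 2 ^ m * expectation (\<lambda>\<omega>. (tr m (z 0 \<omega>))\<^sup>2)" .
    define E1 where "E1 = {\<omega> \<in> space M. (2 ^ m * \<epsilon>)\<^sup>2 \<le> (S \<omega>)\<^sup>2}"
    define E2 where "E2 i = {\<omega> \<in> space M. 1 \<le> b m (z i \<omega>)}" for i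
    have E1s: "E1 \<in> sets M" unfolding E1_def using Sm by measurable
    have E2s: "E2 i \<in> sets M" for i unfolding E2_def using measurable_compose[OF zm[of i] bm[of m]]
      by measurable
    \<comment> \<open>Without an exceedance the truncated block sum equals the original one, which
      is above \<open>2 * \<epsilon> * 2 ^ m\<close>, while its mean is at most
      \<open>\<epsilon> * 2 ^ m\<close>.\<close>
    have sub: "A m \<subseteq> E1 \<union> (\<Union>i\<in>J m. E2 i)"
    proof
      fix \<omega> assume w: "\<omega> \<in> A m"
      show "\<omega> \<in> E1 \<union> (\<Union>i\<in>J m. E2 i)"
      proof (cases "\<exists>i\<in>J m. 2 ^ m < z i \<omega>")
        case True
        then show ?thesis using w by (auto simp: A_def E2_def b_def)
      next
        case False
        then have "tr m (z i \<omega>) = z i \<omega>" if "i \<in> J m" for i using that by (auto simp: tr_def not_less)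
        then have "S \<omega> = (\<Sum>i\<in>J m. z i \<omega>) - 2 ^ m * \<mu> m"
          unfolding S_def Y_def by (simp add: sum_subtractf cJ)
        moreover have "2 * (2 ^ m * \<epsilon>) < (\<Sum>i\<in>J m. z i \<omega>)" using w by (simp add: A_def mult_ac)
        moreover have "2 ^ m * \<mu> m \<le> 2 ^ m * \<epsilon>" using \<mu>(2)[of m] by simp
        ultimately have "2 ^ m * \<epsilon> \<le> S \<omega>" by linarith
        then have "(2 ^ m * \<epsilon>)\<^sup>2 \<le> (S \<omega>)\<^sup>2" using \<epsilon> by (intro power_mono) simp_all
        then show ?thesis using w by (simp add: E1_def A_def)
      qed
    qed
    have P1: "prob E1 \<le> expectation (\<lambda>\<omega>. (S \<omega>)\<^sup>2) / (2 ^ m * \<epsilon>)\<^sup>2"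
      unfolding E1_def by (rule integral_Markov_inequality_measure[OF S2i, where A="{}"]) (use \<epsilon> in simp_all)
    have P2: "prob (E2 i) \<le> expectation (\<lambda>\<omega>. b m (z 0 \<omega>))" for i
    proof -
      have "prob (E2 i) \<le> expectation (\<lambda>\<omega>. b m (z i \<omega>)) / 1"
        unfolding E2_def by (rule integral_Markov_inequality_measure[OF bi, where A="{}"]) (simp_all add: b_def)
      then show ?thesis using same[OF bm, of m i] by simp
    qed
    have "prob (A m) \<le> prob (E1 \<union> (\<Union>i\<in>J m. E2 i))"
      by (rule finite_measure_mono[OF sub]) (use E1s E2s fJ in auto)
    also have "\<dots> \<le> prob E1 + prob (\<Union>i\<in>J m. E2 i)"
      by (rule measure_Un_le) (use E1s E2s fJ in auto)
    also have "prob (\<Union>i\<in>J m. E2 i) \<le> (\<Sum>i\<in>J m. prob (E2 i))"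
      by (rule finite_measure_subadditive_finite[OF fJ]) (use E2s in auto)
    also have "(\<Sum>i\<in>J m. prob (E2 i)) \<le> (\<Sum>i\<in>J m. expectation (\<lambda>\<omega>. b m (z 0 \<omega>)))" by (rule sum_mono) (rule P2)
    also have "\<dots> = 2 ^ m * expectation (\<lambda>\<omega>. b m (z 0 \<omega>))" by (simp add: cJ)
    finally have "prob (A m) \<le> prob E1 + 2 ^ m * expectation (\<lambda>\<omega>. b m (z 0 \<omega>))" by simp
    moreover have "prob E1 \<le> expectation (\<lambda>\<omega>. (tr m (z 0 \<omega>))\<^sup>2) / (2 ^ m * \<epsilon>\<^sup>2)"
    proof -
      have "expectation (\<lambda>\<omega>. (S \<omega>)\<^sup>2) / (2 ^ m * \<epsilon>)\<^sup>2
        \<le> 2 ^ m * expectation (\<lambda>\<omega>. (tr m (z 0 \<omega>))\<^sup>2) / (2 ^ m * \<epsilon>)\<^sup>2"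
        by (rule divide_right_mono[OF ES]) simp
      also have "\<dots> = expectation (\<lambda>\<omega>. (tr m (z 0 \<omega>))\<^sup>2) / (2 ^ m * \<epsilon>\<^sup>2)"
      proof -
        have "p * X / (p * e)\<^sup>2 = X / (p * e\<^sup>2)" if "p \<noteq> 0" for p X e :: real
          using that by (simp add: power2_eq_square)
        then show ?thesis by simp
      qed
      finally show ?thesis using P1 by simp
    qed
    ultimately show ?thesis unfolding q_def by simp
  qed
  \<comment> \<open>The sum over \<open>m\<close> is taken inside the expectation, where the two
    dyadic lemmas bound it by a multiple of \<open>z 0\<close>; a finite first moment is therefore
    enough.\<close>
  have qsum: "(\<Sum>m<K. q m) \<le> (2 + 2 / \<epsilon>\<^sup>2) * expectation (z 0)" for K
  proof -
    define g where "g m \<omega> = 2 ^ m * b m (z 0 \<omega>) + (tr m (z 0 \<omega>))\<^sup>2 / (2 ^ m * \<epsilon>\<^sup>2)" for m \<omega>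
    have gi: "integrable M (g m)" for m
      unfolding g_def[abs_def] by (intro Bochner_Integration.integrable_add integrable_mult_right
        integrable_divide bi tri2)
    have "q m = expectation (g m)" for m
      unfolding q_def g_def[abs_def] using bi[of m 0] tri2[of m 0] by simp
    then have "(\<Sum>m<K. q m) = expectation (\<lambda>\<omega>. \<Sum>m<K. g m \<omega>)" using gi by simp
    also have "\<dots> \<le> expectation (\<lambda>\<omega>. (2 + 2 / \<epsilon>\<^sup>2) * z 0 \<omega>)"
    proof (rule Bochner_Integration.integral_mono)
      show "integrable M (\<lambda>\<omega>. \<Sum>m<K. g m \<omega>)" by (intro Bochner_Integration.integrable_sum gi)
      show "integrable M (\<lambda>\<omega>. (2 + 2 / \<epsilon>\<^sup>2) * z 0 \<omega>)" by (intro integrable_mult_right int)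
      fix \<omega>
      define t where "t = z 0 \<omega>"
      have t: "t \<ge> 0" unfolding t_def by (rule z0)
      have "(\<Sum>m<K. g m \<omega>) = (\<Sum>m<K. if 2 ^ m < t then 2 ^ m else 0) + (\<Sum>m<K. (if t
        \<le> 2 ^ m then t\<^sup>2 else 0) / 2 ^ m) / \<epsilon>\<^sup>2"
        unfolding g_def t_def[symmetric] sum.distrib sum_divide_distrib
        by (intro arg_cong2[where f="(+)"] sum.cong refl) (simp_all add: b_def tr_def)
      also have "\<dots> \<le> 2 * t + 2 * t / \<epsilon>\<^sup>2"
      proof (intro add_mono divide_right_mono)
        show "(\<Sum>m<K. if 2 ^ m < t then 2 ^ m else 0) \<le> 2 * t" using sum_dyadic_below[OF t, of K] by simp
        show "(\<Sum>m<K. (if t \<le> 2 ^ m then t\<^sup>2 else 0) / 2 ^ m) \<le> 2 * t" by (rule sum_dyadic_above[OF t])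
      qed simp
      finally show "(\<Sum>m<K. g m \<omega>) \<le> (2 + 2 / \<epsilon>\<^sup>2) * z 0 \<omega>" unfolding t_def by (simp add: distrib_right)
    qed
    also have "\<dots> = (2 + 2 / \<epsilon>\<^sup>2) * expectation (z 0)" by simp
    finally show ?thesis .
  qed
  have "summable (\<lambda>m. prob (A m))"
  proof (rule summableI_nonneg_bounded)
    show "(\<Sum>m<K. prob (A m)) \<le> (2 + 2 / \<epsilon>\<^sup>2) * expectation (z 0)" for K
      by (rule order_trans[OF sum_mono qsum]) (rule PA)
  qed simp
  then have "AE \<omega> in M. eventually (\<lambda>m. \<omega> \<in> space M - A m) sequentially"
    by (intro borel_cantelli_AE1 As) (simp_all add: emeasure_eq_measure)
  then show ?thesis
  proof eventually_elim
    case (elim \<omega>)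
    have "eventually (\<lambda>m. (\<Sum>i\<in>{2 ^ m..<2 ^ Suc m}. z i \<omega>) \<le> 2 * \<epsilon> * 2 ^ m) sequentially"
      using elim by eventually_elim (simp add: A_def J_def not_less)
    then show ?case by (rule dyadic_blocks_imp_linear[OF z0 \<epsilon>])
  qed
qed

section \<open>Truncation\<close>

lemma cmod_iexp_diff_le: "cmod (iexp a - iexp b) \<le> \<bar>a - b\<bar>"
proof -
  have "iexp a = iexp b * iexp (a - b)" by (simp add: exp_add[symmetric] algebra_simps)
  then have "iexp a - iexp b = iexp b * (iexp (a - b) - 1)" by (simp add: algebra_simps)
  then have "cmod (iexp a - iexp b) = cmod (iexp (a - b) - 1)" by (simp add: norm_mult)
  also have "\<dots> \<le> \<bar>a - b\<bar>" using iexp_approx1[of "a - b" 0] by simp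
  finally show ?thesis .
qed

lemma emp_char:
  assumes n: "n > 0"
  shows "char (emp n e) t = (\<Sum>i<n. iexp (t * e i)) /\<^sub>R real n"
  unfolding char_def by (rule emp_integral(1)[OF n]) simp

lemma row_link_sum_le:
  assumes N: "period \<theta> n > 0" and d: "\<And>v. d v \<ge> (0::real)"
  shows "(\<Sum>l<n. d (link \<theta> n k (Suc l))) \<le> real (max_res \<theta> n) * (\<Sum>v<period \<theta> n. d v)"
proof -
  let ?N = "period \<theta> n"
  have lk: "link \<theta> n k (Suc l) = (k + Suc l) mod ?N" for l by (simp add: link_def period_def)
  have "(\<Sum>l<n. d (link \<theta> n k (Suc l))) = (\<Sum>v<?N. \<Sum>l | l \<in> {..<n} \<and> (k + Suc l) mod ?N
    = v. d ((k + Suc l) mod ?N))"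
    unfolding lk by (rule sum.group[symmetric]) (use N in auto)
  also have "\<dots> = (\<Sum>v<?N. real (card {l \<in> {..<n}. (k + Suc l) mod ?N = v}) * d v)"
    by (intro sum.cong refl) simp
  also have "\<dots> \<le> (\<Sum>v<?N. real (max_res \<theta> n) * d v)"
  proof (intro sum_mono mult_right_mono d)
    fix v assume v: "v \<in> {..<?N}"
    have "card {l \<in> {..<n}. (k + Suc l) mod ?N = v} \<le> card {p \<in> {1..n}. [int p = int v - int k] (mod int ?N)}"
    proof (rule card_inj_on_le[where f=Suc])
      show "Suc ` {l \<in> {..<n}. (k + Suc l) mod ?N = v} \<subseteq> {p \<in> {1..n}. [int p = int v - int k] (mod int ?N)}"
      proof (rule image_subsetI)
        fix l assume l: "l \<in> {l \<in> {..<n}. (k + Suc l) mod ?N = v}"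
        have "[k + Suc l = v] (mod ?N)" using l v by (simp add: cong_def)
        then have "[int (k + Suc l) = int v] (mod int ?N)" by (simp only: cong_int_iff)
        then have "[int (k + Suc l) - int k = int v - int k] (mod int ?N)" by (rule cong_diff) (rule cong_refl)
        then show "Suc l \<in> {p \<in> {1..n}. [int p = int v - int k] (mod int ?N)}" using l by simp
      qed
    qed simp_all
    also have "\<dots> \<le> max_res \<theta> n" using res_le_max_res[OF N, of "int v - int k"] by (simp only: res_def)
    finally show "real (card {l \<in> {..<n}. (k + Suc l) mod ?N = v}) \<le> real (max_res \<theta> n)" by simp
  qed
  finally show ?thesis by (simp add: sum_distrib_left)
qed

text \<open>Each of the \<open>n\<close> rows contributes at most
  \<open>max_res \<theta> n / n\<close> times the sum of squared differences to the squared
  Frobenius distance; the test function has Lipschitz constant \<open>\<bar>t\<bar>\<close>.\<close>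

lemma char_compare:
  assumes N: "period \<theta> n > 0" and n: "n > 0"
  shows "cmod (char (emp n (eigs \<theta> x n \<omega>)) t - char (emp n (eigs \<theta> y n \<omega>)) t)
    \<le> \<bar>t\<bar> * sqrt (real (max_res \<theta> n) * (\<Sum>v<period \<theta> n. (x v \<omega> - y v \<omega>)\<^sup>2) / real n)"
proof -
  define D where "D = (\<Sum>v<period \<theta> n. (x v \<omega> - y v \<omega>)\<^sup>2)"
  obtain u where u: "eigen_decomp n (entries \<theta> x n \<omega>) u (eigs \<theta> x n \<omega>)" using eigs[where \<theta>=\<theta> and x=x
    and n=n and \<omega>=\<omega>] by blast
  obtain w where w: "eigen_decomp n (entries \<theta> y n \<omega>) w (eigs \<theta> y n \<omega>)" using eigs[where \<theta>=\<theta> and x=y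
    and n=n and \<omega>=\<omega>] by blast
  have F: "(\<Sum>k<n. \<Sum>l<n. (entries \<theta> x n \<omega> k l - entries \<theta> y n \<omega> k l)\<^sup>2) \<le> real (max_res \<theta> n) * D"
  proof -
    have "(\<Sum>k<n. \<Sum>l<n. (entries \<theta> x n \<omega> k l - entries \<theta> y n \<omega> k l)\<^sup>2)
      = (\<Sum>k<n. (\<Sum>l<n. (x (link \<theta> n (Suc k) (Suc l)) \<omega> - y (link \<theta> n (Suc k) (Suc l)) \<omega>)\<^sup>2) / real n)"
      unfolding sum_divide_distrib entries_def diff_divide_distrib[symmetric] power_divide by simp
    also have "\<dots> \<le> (\<Sum>k<n. real (max_res \<theta> n) * D / real n)"
    proof (intro sum_mono divide_right_mono)
      fix k
      show "(\<Sum>l<n. (x (link \<theta> n (Suc k) (Suc l)) \<omega> - y (link \<theta> n (Suc k) (Suc l)) \<omega>)\<^sup>2)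
        \<le> real (max_res \<theta> n) * D"
        unfolding D_def using row_link_sum_le[OF N, of "\<lambda>v. (x v \<omega> - y v \<omega>)\<^sup>2" "Suc k"] by simp
    qed simp
    also have "\<dots> = real (max_res \<theta> n) * D" using n by simp
    finally show ?thesis .
  qed
  have "cmod ((\<Sum>i<n. iexp (t * eigs \<theta> x n \<omega> i)) - (\<Sum>i<n. iexp (t * eigs \<theta> y n \<omega> i)))
    \<le> \<bar>t\<bar> * sqrt (real n) * sqrt (\<Sum>k<n. \<Sum>l<n. (entries \<theta> x n \<omega> k l - entries \<theta> y n \<omega> k l)\<^sup>2)"
  proof (rule eigen_decomp_lipschitz[OF u w, where f="\<lambda>s. iexp (t * s)"])
    fix a b :: real
    have "cmod (iexp (t * a) - iexp (t * b)) \<le> \<bar>t * a - t * b\<bar>" by (rule cmod_iexp_diff_le)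
    then show "cmod (iexp (t * a) - iexp (t * b)) \<le> \<bar>t\<bar> * \<bar>a - b\<bar>"
      by (simp only: right_diff_distrib[symmetric] abs_mult)
  qed simp
  also have "\<dots> \<le> \<bar>t\<bar> * sqrt (real n) * sqrt (real (max_res \<theta> n) * D)"
    by (intro mult_left_mono real_sqrt_le_mono F) simp
  finally have b: "cmod ((\<Sum>i<n. iexp (t * eigs \<theta> x n \<omega> i)) - (\<Sum>i<n. iexp (t * eigs \<theta> y n \<omega> i)))
    \<le> \<bar>t\<bar> * sqrt (real n) * sqrt (real (max_res \<theta> n) * D)" .
  have "cmod (char (emp n (eigs \<theta> x n \<omega>)) t - char (emp n (eigs \<theta> y n \<omega>)) t)
     = cmod ((\<Sum>i<n. iexp (t * eigs \<theta> x n \<omega> i)) - (\<Sum>i<n. iexp (t * eigs \<theta> y n \<omega> i))) / real n"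
    unfolding emp_char[OF n] scaleR_diff_right[symmetric] by (simp add: divide_inverse mult.commute)
  also have "\<dots> \<le> \<bar>t\<bar> * sqrt (real n) * sqrt (real (max_res \<theta> n) * D) / real n"
    by (rule divide_right_mono[OF b]) simp
  also have "\<dots> = \<bar>t\<bar> * sqrt (real (max_res \<theta> n) * D / real n)"
  proof -
    have "sqrt (real n) * sqrt (real n) = real n" by simp
    moreover have "sqrt (real n) \<noteq> 0" using n by simp
    moreover have "a * s * b / r = a * (b / s)" if "s * s = r" "s \<noteq> 0" for a b r s :: real
      using that by (auto simp: field_simps)
    ultimately show ?thesis unfolding real_sqrt_divide by blast
  qed
  finally show ?thesis unfolding D_def .
qed

definition cut :: "nat \<Rightarrow> real \<Rightarrow> real" where
  "cut c s = (if \<bar>s\<bar> \<le> real c then s else 0)"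

lemma cut_measurable [measurable]: "cut c \<in> borel_measurable borel"
  unfolding cut_def[abs_def] by measurable

lemma cut_le: "\<bar>cut c s\<bar> \<le> \<bar>s\<bar>" "\<bar>cut c s\<bar> \<le> real c"
  by (simp_all add: cut_def)

lemma cut_tendsto: "(\<lambda>c. cut c s) \<longlonglongrightarrow> s"
proof (rule tendsto_eventually)
  obtain c0 :: nat where "\<bar>s\<bar> \<le> real c0" using real_arch_simple by blast
  then show "eventually (\<lambda>c. cut c s = s) sequentially"
    by (intro eventually_sequentiallyI[of c0]) (simp add: cut_def)
qed

locale iid_sequence = prob_space M for M :: "'a measure" +
  fixes x :: "nat \<Rightarrow> 'a \<Rightarrow> real"
  assumes indep: "indep_vars (\<lambda>_. borel) x UNIV"
    and mean: "\<And>i. expectation (x i) = 0"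
    and int1: "\<And>i. integrable M (x i)"
    and second: "\<And>i. expectation (\<lambda>\<omega>. (x i \<omega>)\<^sup>2) = 1"
    and int2: "\<And>i. integrable M (\<lambda>\<omega>. (x i \<omega>)\<^sup>2)"
    and dist: "\<And>i. distr M borel (x i) = distr M borel (x 0)"
begin

lemma x_measurable [measurable]: "x i \<in> borel_measurable M"
  using indep unfolding indep_vars_def by simp

lemma same_expectation:
  assumes f: "f \<in> borel_measurable borel"
  shows "expectation (\<lambda>\<omega>. f (x i \<omega>)) = (expectation (\<lambda>\<omega>. f (x 0 \<omega>)) :: real)"
proof -
  have "expectation (\<lambda>\<omega>. f (x i \<omega>)) = integral\<^sup>L (distr M borel (x i)) f"
    by (rule integral_distr[symmetric]) (use f in simp_all)
  also have "\<dots> = integral\<^sup>L (distr M borel (x 0)) f" unfolding dist[of i] ..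
  also have "\<dots> = expectation (\<lambda>\<omega>. f (x 0 \<omega>))" by (rule integral_distr) (use f in simp_all)
  finally show ?thesis .
qed

definition cut_mean :: "nat \<Rightarrow> real" where "cut_mean c = expectation (\<lambda>\<omega>. cut c (x 0 \<omega>))"
definition cut_second :: "nat \<Rightarrow> real" where "cut_second c = expectation (\<lambda>\<omega>. (cut c (x 0 \<omega>))\<^sup>2)"
definition cut_var :: "nat \<Rightarrow> real" where "cut_var c = cut_second c - (cut_mean c)\<^sup>2"

lemma cut_integrable: "integrable M (\<lambda>\<omega>. cut c (x i \<omega>))" "integrable M (\<lambda>\<omega>. (cut c (x i \<omega>))\<^sup>2)"
proof -
  show "integrable M (\<lambda>\<omega>. cut c (x i \<omega>))"
    by (rule Bochner_Integration.integrable_bound[OF int1[of i]]) (simp_all add: cut_le)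
  show "integrable M (\<lambda>\<omega>. (cut c (x i \<omega>))\<^sup>2)"
    by (rule Bochner_Integration.integrable_bound[OF int2[of i]]) (simp_all add: cut_le
      abs_le_square_iff[symmetric])
qed

lemma cut_limits: "cut_mean \<longlonglongrightarrow> 0" "cut_second \<longlonglongrightarrow> 1" "cut_var \<longlonglongrightarrow> 1"
proof -
  have "(\<lambda>c. expectation (\<lambda>\<omega>. cut c (x 0 \<omega>))) \<longlonglongrightarrow> expectation (\<lambda>\<omega>. x 0 \<omega>)"
  proof (rule integral_dominated_convergence[where w="\<lambda>\<omega>. \<bar>x 0 \<omega>\<bar>"])
    show "AE \<omega> in M. (\<lambda>c. cut c (x 0 \<omega>)) \<longlonglongrightarrow> x 0 \<omega>" by (intro AE_I2 cut_tendsto)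
    show "integrable M (\<lambda>\<omega>. \<bar>x 0 \<omega>\<bar>)" by (intro Bochner_Integration.integrable_abs int1)
    show "AE \<omega> in M. norm (cut c (x 0 \<omega>)) \<le> \<bar>x 0 \<omega>\<bar>" for c by (intro AE_I2) (simp add: cut_le)
  qed simp_all
  then show m: "cut_mean \<longlonglongrightarrow> 0" unfolding cut_mean_def[abs_def] mean .
  have "(\<lambda>c. expectation (\<lambda>\<omega>. (cut c (x 0 \<omega>))\<^sup>2)) \<longlonglongrightarrow> expectation (\<lambda>\<omega>. (x 0 \<omega>)\<^sup>2)"
  proof (rule integral_dominated_convergence[where w="\<lambda>\<omega>. (x 0 \<omega>)\<^sup>2"])
    show "AE \<omega> in M. (\<lambda>c. (cut c (x 0 \<omega>))\<^sup>2) \<longlonglongrightarrow> (x 0 \<omega>)\<^sup>2" by (intro AE_I2 tendsto_power cut_tendsto)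
    show "integrable M (\<lambda>\<omega>. (x 0 \<omega>)\<^sup>2)" by (rule int2)
    show "AE \<omega> in M. norm ((cut c (x 0 \<omega>))\<^sup>2) \<le> (x 0 \<omega>)\<^sup>2" for c
      by (intro AE_I2) (simp add: cut_le abs_le_square_iff[symmetric])
  qed simp_all
  then show s: "cut_second \<longlonglongrightarrow> 1" unfolding cut_second_def[abs_def] second .
  have "(\<lambda>c. cut_second c - (cut_mean c)\<^sup>2) \<longlonglongrightarrow> 1 - 0\<^sup>2" by (intro tendsto_intros m s)
  then show "cut_var \<longlonglongrightarrow> 1" unfolding cut_var_def[abs_def] by simp
qed

definition trunc :: "nat \<Rightarrow> nat \<Rightarrow> 'a \<Rightarrow> real" where
  "trunc c i \<omega> = (cut c (x i \<omega>) - cut_mean c) / sqrt (cut_var c)"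

lemma trunc_moment_sequence:
  assumes v: "cut_var c > 0"
  shows "moment_sequence M (trunc c)"
proof (rule moment_sequence_of_assumption1)
  show "prob_space M" by (rule prob_space_axioms)
  have ind: "indep_vars (\<lambda>_. borel) (trunc c) UNIV"
    unfolding trunc_def[abs_def]
    by (rule indep_vars_compose2[where Y="\<lambda>_ s. (cut c s - cut_mean c) / sqrt (cut_var c)", OF indep]) simp
  have E1: "expectation (\<lambda>\<omega>. cut c (x i \<omega>)) = cut_mean c" for i
    unfolding cut_mean_def by (rule same_expectation) simp
  have E2: "expectation (\<lambda>\<omega>. (cut c (x i \<omega>))\<^sup>2) = cut_second c" for i
    unfolding cut_second_def by (rule same_expectation) simp
  have sq: "(trunc c i \<omega>)\<^sup>2 = ((cut c (x i \<omega>))\<^sup>2 - 2 * cut_mean c * cut c (x i \<omega>) + (cut_mean c)\<^sup>2)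
    / cut_var c" for i \<omega>
    unfolding trunc_def power_divide using v by (simp add: power2_diff)
  have yi: "integrable M (trunc c i)" for i
    unfolding trunc_def[abs_def] using cut_integrable(1)[of c i] by simp
  have y2i: "integrable M (\<lambda>\<omega>. (trunc c i \<omega>)\<^sup>2)" for i
    unfolding sq using cut_integrable[of c i] by simp
  have ym: "expectation (trunc c i) = 0" for i
    unfolding trunc_def[abs_def] using cut_integrable(1)[of c i] by (simp add: E1 prob_space)
  have y2: "expectation (\<lambda>\<omega>. (trunc c i \<omega>)\<^sup>2) = 1" for i
  proof -
    have "expectation (\<lambda>\<omega>. (trunc c i \<omega>)\<^sup>2) = (cut_second c - 2 * cut_mean c * cut_mean c
      + (cut_mean c)\<^sup>2) / cut_var c"
      unfolding sq using cut_integrable[of c i] by (simp add: E1 E2 prob_space)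
    also have "cut_second c - 2 * cut_mean c * cut_mean c + (cut_mean c)\<^sup>2 = cut_var c"
      by (simp add: cut_var_def power2_eq_square)
    finally show ?thesis using v by simp
  qed
  have "\<bar>trunc c i \<omega>\<bar> \<le> (real c + \<bar>cut_mean c\<bar>) / sqrt (cut_var c)" for i \<omega>
  proof -
    have "\<bar>cut c (x i \<omega>) - cut_mean c\<bar> \<le> real c + \<bar>cut_mean c\<bar>" using cut_le(2)[of c "x i \<omega>"] by linarith
    then have "\<bar>cut c (x i \<omega>) - cut_mean c\<bar> / sqrt (cut_var c) \<le> (real c + \<bar>cut_mean c\<bar>) / sqrt (cut_var c)"
      by (rule divide_right_mono) (use v in simp)
    then show ?thesis unfolding trunc_def abs_divide using v by simp
  qed
  then have "\<forall>i. AE \<omega> in M. \<bar>trunc c i \<omega>\<bar> \<le> (real c + \<bar>cut_mean c\<bar>) / sqrt (cut_var c)" by (intro allI AE_I2)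
  then show "assumption1 M (trunc c)"
    unfolding assumption1_def indep_mean0_var1_def mean0_var1_def
    by (intro conjI allI exI[where x="(real c + \<bar>cut_mean c\<bar>) / sqrt (cut_var c)"])
      (simp_all add: ind yi y2i ym y2)
qed

text \<open>The mean square distance of \<open>x 0\<close> from its standardised truncation: both
  have second moment 1, and their product has mean
  \<open>cut_second c / sqrt (cut_var c)\<close>.\<close>

definition cut_error :: "nat \<Rightarrow> real" where
  "cut_error c = 2 - 2 * cut_second c / sqrt (cut_var c)"

lemma cut_error_limit: "cut_error \<longlonglongrightarrow> 0"
proof -
  have "(\<lambda>c. 2 - 2 * cut_second c / sqrt (cut_var c)) \<longlonglongrightarrow> 2 - 2 * 1 / sqrt 1"
    by (intro tendsto_intros cut_limits) simp
  then show ?thesis unfolding cut_error_def[abs_def] by simp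
qed

lemma cut_error:
  assumes v: "cut_var c > 0"
  shows "integrable M (\<lambda>\<omega>. (x 0 \<omega> - trunc c 0 \<omega>)\<^sup>2)" "expectation (\<lambda>\<omega>. (x 0 \<omega> - trunc c 0 \<omega>)\<^sup>2) = cut_error c"
proof -
  interpret Y: moment_sequence M "trunc c" by (rule trunc_moment_sequence[OF v])
  have y2: "integrable M (\<lambda>\<omega>. (trunc c 0 \<omega>)\<^sup>2)" by (rule Y.power_integrable)
  \<comment> \<open>\<open>cut c s\<close> is \<open>s\<close> or 0, so \<open>s * cut c s\<close>
    is the square of \<open>cut c s\<close>.\<close>
  have xc: "x 0 \<omega> * trunc c 0 \<omega> = ((cut c (x 0 \<omega>))\<^sup>2 - cut_mean c * x 0 \<omega>) / sqrt (cut_var c)" for \<omega>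
    unfolding trunc_def by (simp add: cut_def power2_eq_square right_diff_distrib)
  have xyi: "integrable M (\<lambda>\<omega>. x 0 \<omega> * trunc c 0 \<omega>)"
    unfolding xc using cut_integrable(2)[of c 0] int1[of 0] by simp
  have xy: "expectation (\<lambda>\<omega>. x 0 \<omega> * trunc c 0 \<omega>) = cut_second c / sqrt (cut_var c)"
    unfolding xc using cut_integrable(2)[of c 0] int1[of 0] mean[of 0] by (simp add: cut_second_def)
  have e: "(x 0 \<omega> - trunc c 0 \<omega>)\<^sup>2 = (x 0 \<omega>)\<^sup>2 - 2 * (x 0 \<omega> * trunc c 0 \<omega>) + (trunc c 0 \<omega>)\<^sup>2" for \<omega>
    by (simp add: power2_diff)
  show "integrable M (\<lambda>\<omega>. (x 0 \<omega> - trunc c 0 \<omega>)\<^sup>2)"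
    unfolding e using int2[of 0] xyi y2 by simp
  have "expectation (\<lambda>\<omega>. (x 0 \<omega> - trunc c 0 \<omega>)\<^sup>2) = 1 - 2 * (cut_second c / sqrt (cut_var c)) + 1"
    unfolding e using int2[of 0] xyi y2 by (simp add: xy second Y.second)
  then show "expectation (\<lambda>\<omega>. (x 0 \<omega> - trunc c 0 \<omega>)\<^sup>2) = cut_error c" by (simp add: cut_error_def)
qed

lemma cut_average_AE:
  assumes v: "cut_var c > 0" and \<epsilon>: "cut_error c \<le> \<epsilon>" "\<epsilon> > 0"
  shows "AE \<omega> in M. eventually (\<lambda>N. (\<Sum>i<N. (x i \<omega> - trunc c i \<omega>)\<^sup>2) \<le> 5 * \<epsilon> * real N) sequentially"
proof (rule iid_sum_eventually_le)
  define f where "f s = (s - (cut c s - cut_mean c) / sqrt (cut_var c))\<^sup>2" for s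
  have fm: "f \<in> borel_measurable borel" unfolding f_def[abs_def] by measurable
  have e: "(\<lambda>\<omega>. (x i \<omega> - trunc c i \<omega>)\<^sup>2) = (\<lambda>\<omega>. f (x i \<omega>))" for i by (simp add: f_def trunc_def)
  show "indep_vars (\<lambda>_. borel) (\<lambda>i \<omega>. (x i \<omega> - trunc c i \<omega>)\<^sup>2) UNIV"
    unfolding e by (rule indep_vars_compose2[where Y="\<lambda>_. f", OF indep]) (rule fm)
  show "distr M borel (\<lambda>\<omega>. (x i \<omega> - trunc c i \<omega>)\<^sup>2) = distr M borel (\<lambda>\<omega>. (x 0 \<omega> - trunc c 0 \<omega>)\<^sup>2)" for i
  proof -
    have "distr M borel (\<lambda>\<omega>. f (x j \<omega>)) = distr (distr M borel (x j)) borel f" for j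
      using distr_distr[OF fm, of "x j" M] by (simp add: o_def)
    then show ?thesis unfolding e using dist[of i] by simp
  qed
  show "integrable M (\<lambda>\<omega>. (x 0 \<omega> - trunc c 0 \<omega>)\<^sup>2)" by (rule cut_error(1)[OF v])
  show "expectation (\<lambda>\<omega>. (x 0 \<omega> - trunc c 0 \<omega>)\<^sup>2) \<le> \<epsilon>" unfolding cut_error(2)[OF v] by (rule \<epsilon>)
qed (use \<epsilon> in simp_all)

lemma eventually_cut_var_pos: "\<exists>c0. \<forall>c\<ge>c0. cut_var c > 0"
  using order_tendstoD(1)[OF cut_limits(3), of 0] by (simp add: eventually_sequentially)

text \<open>The limiting moments do not involve the input, so all truncation levels share the limit
  \<nu>; the comparison error is small at high levels, uniformly in large \<open>n\<close>.\<close>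

lemma emp_char_AE:
  assumes \<theta>: "\<theta> > 0" and \<nu>: "real_distribution \<nu>"
    and m: "\<And>h. has_bochner_integral \<nu> (\<lambda>t. t ^ h) (limit_moment \<theta> h)"
  shows "AE \<omega> in M. \<forall>t. (\<lambda>n. char (emp (Suc n) (eigs \<theta> x (Suc n) \<omega>)) t) \<longlonglongrightarrow> char \<nu> t"
proof -
  obtain c0 where c0: "\<And>c. c \<ge> c0 \<Longrightarrow> cut_var c > 0" using eventually_cut_var_pos by blast
  \<comment> \<open>The added \<open>1 / real (Suc c)\<close> makes the bound positive, as the law
    of large numbers requires, and vanishes in the limit.\<close>
  define e where "e c = \<bar>cut_error c\<bar> + 1 / real (Suc c)" for c
  have e0: "e c > 0" and ee: "cut_error c \<le> e c" for c
  proof -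
    have "0 < 1 / real (Suc c)" by simp
    then show "e c > 0" "cut_error c \<le> e c" unfolding e_def by linarith+
  qed
  have "(\<lambda>c. \<bar>cut_error c\<bar> + 1 / real (Suc c)) \<longlonglongrightarrow> \<bar>0\<bar> + 0"
    by (intro tendsto_add tendsto_rabs cut_error_limit LIMSEQ_Suc lim_1_over_n)
  then have elim0: "e \<longlonglongrightarrow> 0" unfolding e_def[abs_def] by simp
  \<comment> \<open>\<open>\<theta> + 2\<close> bounds \<open>max_res\<close>, 5 comes from the law
    of large numbers, and \<open>1 / \<theta>\<close> from the ratio of the period to
    \<open>n\<close>.\<close>
  define C where "C = (\<theta> + 2) * (5 * (1 / \<theta>))"
  have A1: "AE \<omega> in M. \<forall>t. (\<lambda>n. char (emp (Suc n) (eigs \<theta> (trunc (c + c0)) (Suc n) \<omega>)) t) \<longlonglongrightarrow> char \<nu> t" for c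
  proof -
    interpret Y: moment_sequence M "trunc (c + c0)" by (rule trunc_moment_sequence) (rule c0, simp)
    show ?thesis by (rule Y.emp_char_AE[OF \<theta> \<nu> m])
  qed
  have A2: "AE \<omega> in M. eventually (\<lambda>N. (\<Sum>i<N. (x i \<omega> - trunc (c + c0) i \<omega>)\<^sup>2)
    \<le> 5 * e (c + c0) * real N) sequentially" for c
    by (rule cut_average_AE[OF _ ee e0]) (rule c0, simp)
  obtain n0 where n0: "n0 > 0" "\<And>n. n \<ge> n0 \<Longrightarrow> period \<theta> n > 0 \<and> real (max_res \<theta> n)
    \<le> \<theta> + 2 \<and> real (period \<theta> n) \<le> (1 / \<theta>) * real n"
    using eventually_period_regular[OF \<theta>] by blast
  have "AE \<omega> in M. \<forall>c. (\<forall>t. (\<lambda>n. char (emp (Suc n) (eigs \<theta> (trunc (c + c0)) (Suc n) \<omega>)) t) \<longlonglongrightarrow> char \<nu> t) \<and>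
      eventually (\<lambda>N. (\<Sum>i<N. (x i \<omega> - trunc (c + c0) i \<omega>)\<^sup>2) \<le> 5 * e (c + c0) * real N) sequentially"
    unfolding AE_all_countable by (intro allI AE_conjI A1 A2)
  then show ?thesis
  proof eventually_elim
    case (elim \<omega>)
    show ?case
    proof
      fix t
      define \<eta> where "\<eta> K = \<bar>t\<bar> * sqrt (C * e (K + c0))" for K
      have ev: "eventually (\<lambda>n. norm (char (emp (Suc n) (eigs \<theta> x (Suc n) \<omega>)) t - char \<nu> t)
        \<le> \<eta> K + d) sequentially"
        if d: "d > 0" for K d
      proof -
        have "eventually (\<lambda>n. dist (char (emp (Suc n) (eigs \<theta> (trunc (K + c0)) (Suc n) \<omega>)) t) (char \<nu> t)
          < d) sequentially"
          using elim d by (intro tendstoD) simp_all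
        moreover have "eventually (\<lambda>N. (\<Sum>i<N. (x i \<omega> - trunc (K + c0) i \<omega>)\<^sup>2)
          \<le> 5 * e (K + c0) * real N) sequentially"
          using elim by blast
        \<comment> \<open>The matrix of size \<open>n\<close> uses only inputs with index below its
          period, so the law of large numbers is read along the periods.\<close>
        then have "eventually (\<lambda>n. (\<Sum>i<period \<theta> n. (x i \<omega> - trunc (K + c0) i \<omega>)\<^sup>2)
          \<le> 5 * e (K + c0) * real (period \<theta> n)) sequentially"
          by (rule eventually_compose_filterlim[OF _ period_limits(1)[OF \<theta>]])
        then have "eventually (\<lambda>n. (\<Sum>i<period \<theta> (Suc n). (x i \<omega> - trunc (K + c0) i \<omega>)\<^sup>2)
          \<le> 5 * e (K + c0) * real (period \<theta> (Suc n))) sequentially"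
          by (rule eventually_compose_filterlim[OF _ filterlim_Suc])
        ultimately show ?thesis using eventually_ge_at_top[of n0]
        proof eventually_elim
          case (elim n)
          have N: "period \<theta> (Suc n) > 0" and mr: "real (max_res \<theta> (Suc n)) \<le> \<theta> + 2"
            and p: "real (period \<theta> (Suc n)) \<le> (1 / \<theta>) * real (Suc n)" using n0(2)[of "Suc n"] elim(3)
              by simp_all
          define D where "D = (\<Sum>i<period \<theta> (Suc n). (x i \<omega> - trunc (K + c0) i \<omega>)\<^sup>2)"
          have D0: "0 \<le> D" unfolding D_def by (intro sum_nonneg) simp
          have "D \<le> 5 * e (K + c0) * real (period \<theta> (Suc n))" unfolding D_def by (rule elim(2))
          also have "\<dots> \<le> 5 * e (K + c0) * ((1 / \<theta>) * real (Suc n))"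
            using p e0[of "K + c0"] by (intro mult_left_mono) simp_all
          finally have "real (max_res \<theta> (Suc n)) * D \<le> (\<theta> + 2) * (5 * e (K + c0) * ((1 / \<theta>) * real (Suc n)))"
            using mr D0 \<theta> by (intro mult_mono) simp_all
          then have "real (max_res \<theta> (Suc n)) * D / real (Suc n)
            \<le> (\<theta> + 2) * (5 * e (K + c0) * ((1 / \<theta>) * real (Suc n))) / real (Suc n)"
            by (rule divide_right_mono) simp
          also have "\<dots> = C * e (K + c0)" unfolding C_def by (simp add: mult_ac del: of_nat_Suc)
          finally have b: "real (max_res \<theta> (Suc n)) * D / real (Suc n) \<le> C * e (K + c0)" .
          have "cmod (char (emp (Suc n) (eigs \<theta> x (Suc n) \<omega>)) t - char (emp (Suc n) (eigs \<theta> (trunc (K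
            + c0)) (Suc n) \<omega>)) t)
             \<le> \<bar>t\<bar> * sqrt (real (max_res \<theta> (Suc n)) * D / real (Suc n))"
            unfolding D_def by (rule char_compare[OF N zero_less_Suc])
          also have "\<dots> \<le> \<eta> K" unfolding \<eta>_def by (intro mult_left_mono real_sqrt_le_mono b) simp
          finally have "cmod (char (emp (Suc n) (eigs \<theta> x (Suc n) \<omega>)) t
            - char (emp (Suc n) (eigs \<theta> (trunc (K + c0)) (Suc n) \<omega>)) t) \<le> \<eta> K" .
          moreover have "cmod (char (emp (Suc n) (eigs \<theta> (trunc (K + c0)) (Suc n) \<omega>)) t - char \<nu> t) < d"
            using elim(1) by (simp only: dist_norm)
          ultimately show ?case
            using norm_triangle_ineq[of "char (emp (Suc n) (eigs \<theta> x (Suc n) \<omega>)) t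
              - char (emp (Suc n) (eigs \<theta> (trunc (K + c0)) (Suc n) \<omega>)) t"
              "char (emp (Suc n) (eigs \<theta> (trunc (K + c0)) (Suc n) \<omega>)) t - char \<nu> t"] by simp
        qed
      qed
      have "(\<lambda>K. \<bar>t\<bar> * sqrt (C * e (K + c0))) \<longlonglongrightarrow> \<bar>t\<bar> * sqrt (C * 0)"
        by (intro tendsto_intros LIMSEQ_ignore_initial_segment elim0)
      then have \<eta>0: "\<eta> \<longlonglongrightarrow> 0" unfolding \<eta>_def[abs_def] by simp
      show "(\<lambda>n. char (emp (Suc n) (eigs \<theta> x (Suc n) \<omega>)) t) \<longlonglongrightarrow> char \<nu> t"
        by (rule LIMSEQ_of_approx[where P="\<lambda>_. char \<nu> t" and \<epsilon>=\<eta>, OF ev \<eta>0 tendsto_const])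
    qed
  qed
qed

lemma limit_measure_exists:
  assumes \<theta>: "\<theta> > 0"
  shows "\<exists>\<nu>. real_distribution \<nu> \<and> (\<forall>h. has_bochner_integral \<nu> (\<lambda>t. t ^ h) (limit_moment \<theta> h))"
proof -
  obtain c0 where c0: "\<And>c. c \<ge> c0 \<Longrightarrow> cut_var c > 0" using eventually_cut_var_pos by blast
  interpret Y: moment_sequence M "trunc c0" by (rule trunc_moment_sequence) (rule c0, simp)
  show ?thesis by (rule Y.limit_measure_exists[OF \<theta>])
qed

end

lemma iid_sequence_of_assumption2:
  assumes M: "prob_space M" and a: "assumption2 M x"
  shows "iid_sequence M x"
proof -
  interpret prob_space M by (rule M)
  have i: "indep_vars (\<lambda>_. borel) x UNIV" and mv: "\<And>i. mean0_var1 M (x i)"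
    and d: "\<And>i j. distr M borel (x i) = distr M borel (x j)"
    using a unfolding assumption2_def indep_mean0_var1_def by blast+
  show ?thesis
  proof (unfold_locales)
    show "indep_vars (\<lambda>_. borel) x UNIV" by (rule i)
    show m: "expectation (x i) = 0" for i using mv[of i] by (simp add: mean0_var1_def)
    show "integrable M (x i)" "integrable M (\<lambda>\<omega>. (x i \<omega>)\<^sup>2)" for i using mv[of i]
      by (simp_all add: mean0_var1_def)
    show "expectation (\<lambda>\<omega>. (x i \<omega>)\<^sup>2) = 1" for i using mv[of i] m[of i] by (simp add: mean0_var1_def)
    show "distr M borel (x i) = distr M borel (x 0)" for i by (rule d)
  qed
qed

theorem theorem2p2:
  fixes M :: "'a measure" and x :: "nat \<Rightarrow> 'a \<Rightarrow> real"
  assumes "prob_space M"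
    and "assumption1 M x \<or> assumption2 M x \<or> assumption3 M x"
  shows "\<exists>F :: real \<Rightarrow> real measure.
    (\<forall>\<theta>>0. is_LSD M (link_matrix \<theta> x) (F \<theta>) \<and>
       (\<forall>k::nat. k \<ge> 1 \<longrightarrow>
          has_bochner_integral (F \<theta>) (\<lambda>t. t ^ (2 * k - 1)) 0 \<and>
          has_bochner_integral (F \<theta>) (\<lambda>t. t ^ (2 * k))
            (\<Sum>w \<in> pair_matched_words k. word_limit \<theta> w))) \<and>
    (\<forall>(\<theta>\<^sub>m :: nat \<Rightarrow> real) \<theta>. (\<forall>m. \<theta>\<^sub>m m > 0) \<and> \<theta> > 0 \<and> \<theta>\<^sub>m \<longlonglongrightarrow> \<theta> \<longrightarrow>
       weak_conv_m (\<lambda>m. F (\<theta>\<^sub>m m)) (F \<theta>))"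
proof -
  \<comment> \<open>Existence and identification are separated: every distribution with the limiting
    moments is an LSD, so a choice made from \<theta> alone will serve.\<close>
  have main: "(\<exists>\<nu>. real_distribution \<nu> \<and> (\<forall>h. has_bochner_integral \<nu> (\<lambda>t. t ^ h) (limit_moment \<theta> h))) \<and>
      (\<forall>\<nu>. real_distribution \<nu> \<longrightarrow> (\<forall>h. has_bochner_integral \<nu> (\<lambda>t. t ^ h) (limit_moment \<theta> h)) \<longrightarrow>
        is_LSD M (link_matrix \<theta> x) \<nu>)" if \<theta>: "\<theta> > 0" for \<theta>
  proof (cases "assumption2 M x")
    case True
    interpret I: iid_sequence M x by (rule iid_sequence_of_assumption2[OF assms(1) True])
    show ?thesis
    proof (intro conjI allI impI)
      show "\<exists>\<nu>. real_distribution \<nu> \<and> (\<forall>h. has_bochner_integral \<nu> (\<lambda>t. t ^ h) (limit_moment \<theta> h))"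
        by (rule I.limit_measure_exists[OF \<theta>])
      fix \<nu> assume \<nu>: "real_distribution \<nu>" and m: "\<forall>h. has_bochner_integral \<nu> (\<lambda>t. t ^ h) (limit_moment \<theta> h)"
      show "is_LSD M (link_matrix \<theta> x) \<nu>" by (rule is_LSD_of_char[OF \<nu> I.emp_char_AE[OF \<theta> \<nu> m[rule_format]]])
    qed
  next
    case False
    then have "moment_sequence M x"
      using assms moment_sequence_of_assumption1 moment_sequence_of_assumption3 by blast
    then interpret S: moment_sequence M x .
    show ?thesis
    proof (intro conjI allI impI)
      show "\<exists>\<nu>. real_distribution \<nu> \<and> (\<forall>h. has_bochner_integral \<nu> (\<lambda>t. t ^ h) (limit_moment \<theta> h))"
        by (rule S.limit_measure_exists[OF \<theta>])
      fix \<nu> assume \<nu>: "real_distribution \<nu>" and m: "\<forall>h. has_bochner_integral \<nu> (\<lambda>t. t ^ h) (limit_moment \<theta> h)"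
      show "is_LSD M (link_matrix \<theta> x) \<nu>" by (rule is_LSD_of_char[OF \<nu> S.emp_char_AE[OF \<theta> \<nu> m[rule_format]]])
    qed
  qed
  \<comment> \<open>Chosen through the moments, without reference to the input or the
    matrices.\<close>
  define F where "F \<theta> = (SOME \<nu>. real_distribution \<nu>
    \<and> (\<forall>h. has_bochner_integral \<nu> (\<lambda>t. t ^ h) (limit_moment \<theta> h)))" for \<theta>
  have F: "real_distribution (F \<theta>)" "\<And>h. has_bochner_integral (F \<theta>) (\<lambda>t. t ^ h) (limit_moment \<theta> h)"
    if \<theta>: "\<theta> > 0" for \<theta>
  proof -
    have "real_distribution (F \<theta>) \<and> (\<forall>h. has_bochner_integral (F \<theta>) (\<lambda>t. t ^ h) (limit_moment \<theta> h))"
      unfolding F_def by (rule someI_ex) (rule conjunct1[OF main[OF \<theta>]])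
    then show "real_distribution (F \<theta>)" "\<And>h. has_bochner_integral (F \<theta>) (\<lambda>t. t ^ h) (limit_moment \<theta> h)"
      by simp_all
  qed
  show ?thesis
  proof (intro exI[of _ F] conjI allI impI)
    fix \<theta> :: real assume \<theta>: "0 < \<theta>"
    show "is_LSD M (link_matrix \<theta> x) (F \<theta>)" using main[OF \<theta>] F[OF \<theta>] by blast
    fix k :: nat assume k: "1 \<le> k"
    have "odd (2 * k - 1)" using k by simp
    then have "limit_moment \<theta> (2 * k - 1) = 0" using odd_pos by (auto simp: limit_moment_def)
    then show "has_bochner_integral (F \<theta>) (\<lambda>t. t ^ (2 * k - 1)) 0" using F(2)[OF \<theta>, of "2 * k - 1"] by simp
    have "limit_moment \<theta> (2 * k) = (\<Sum>w\<in>pair_matched_words k. word_value \<theta> w)" using k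
      by (simp add: limit_moment_def)
    also have "\<dots> = (\<Sum>w\<in>pair_matched_words k. word_limit \<theta> w)"
      by (rule sum.cong[OF refl]) (use circuits_limit(2)[OF _ _ \<theta>] k in simp)
    finally show "has_bochner_integral (F \<theta>) (\<lambda>t. t ^ (2 * k)) (\<Sum>w\<in>pair_matched_words k. word_limit \<theta> w)"
      using F(2)[OF \<theta>, of "2 * k"] by simp
  next
    fix \<theta>\<^sub>m :: "nat \<Rightarrow> real" and \<theta> :: real
    assume a: "(\<forall>m. 0 < \<theta>\<^sub>m m) \<and> 0 < \<theta> \<and> \<theta>\<^sub>m \<longlonglongrightarrow> \<theta>"
    then have pos: "0 < \<theta>\<^sub>m m" and \<theta>: "0 < \<theta>" and lim: "\<theta>\<^sub>m \<longlonglongrightarrow> \<theta>" for m by simp_all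
    \<comment> \<open>Part (ii) compares the limiting measures through their moments, which are
      continuous in \<theta>.\<close>
    show "weak_conv_m (\<lambda>m. F (\<theta>\<^sub>m m)) (F \<theta>)"
    proof (rule moments_imp_weak_conv)
      show "real_distribution (F (\<theta>\<^sub>m m))" for m by (rule F(1)[OF pos])
      show "integrable (F (\<theta>\<^sub>m m)) (\<lambda>t. t ^ h)" for m h using F(2)[OF pos, of m h]
        by (rule has_bochner_integral_iff[THEN iffD1, THEN conjunct1])
      have "integral\<^sup>L (F (\<theta>\<^sub>m m)) (\<lambda>t. t ^ h) = limit_moment (\<theta>\<^sub>m m) h" for m h
        using F(2)[OF pos, of m h] by (rule has_bochner_integral_iff[THEN iffD1, THEN conjunct2])
      then show "(\<lambda>m. integral\<^sup>L (F (\<theta>\<^sub>m m)) (\<lambda>t. t ^ h)) \<longlonglongrightarrow> limit_moment \<theta> h" for h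
        using limit_moment_continuous[OF pos \<theta> lim, of h] by simp
      show "moment_growth (limit_moment \<theta>)" by (rule limit_moment_growth[OF \<theta>])
      show "real_distribution (F \<theta>)" by (rule F(1)[OF \<theta>])
      show "has_bochner_integral (F \<theta>) (\<lambda>t. t ^ h) (limit_moment \<theta> h)" for h by (rule F(2)[OF \<theta>])
    qed
  qed
qed

end
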